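(* Let $d\in\{2,3\}$, let $\Omega\subset\mathbb{R}^d$ be a bounded polygonal/polyhedral domain and let $\mathcal{T}_h$ be a mesh of $\Omega$ as described in the context. Then $$\|\boldsymbol{w}\|_{\mathrm{sym}} = \left(\left\| \nabla_h\boldsymbol{w}+\nabla_h\boldsymbol{w}^{T}-\tfrac{2}{3}(\nabla_h\cdot\boldsymbol{w})\,\mathbb{I}\right\|_{L^2(\Omega)}^2+\sum_{F\in\mathcal{F}_h}\frac{1}{h_F}\int_F [\![\boldsymbol{w}]\!]\cdot[\![\boldsymbol{w}]\!]\,dA\right)^{1/2}$$ defines a norm on the space $\boldsymbol{H}^1(\mathcal{T}_h)$ of piecewise $H^1$ vector fields.
   Context: $\mathcal{T}_h$ is a finite mesh of $\Omega$ into non-overlapping simplices $K$ (triangles if $d=2$, tetrahedra if $d=3$) that conforms to $\Omega$ and has no hanging nodes. $\mathcal{F}_h$ is the set of all faces (edges if $d=2$) of the mesh; $\mathcal{F}_h^i$ is the set of interior faces, each shared by exactly two elements, and $\mathcal{F}_h^{\partial}$ is the set of faces contained in $\partial\Omega$. For each face $F$, $h_F>0$ is its diameter. $\boldsymbol{H}^1(\mathcal{T}_h)=\{\boldsymbol{w}\in L^2(\Omega)^d:\ \boldsymbol{w}|_K\in H^1(K)^d\ \ \forall K\in\mathcal{T}_h\}$. The operators $\nabla_h$ and $\nabla_h\cdot$ are the gradient and divergence taken element by element; $\mathbb{I}$ is the $d\times d$ identity; the $L^2(\Omega)$ norm of a tensor field is taken with the Frobenius inner product. The jump on $F\in\mathcal{F}_h^i$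 is $[\![\boldsymbol{w}]\!]=\boldsymbol{w}_+-\boldsymbol{w}_-$, the difference of the traces from the two elements sharing $F$ (with a fixed choice of $+$ and $-$ sides); on $F\in\mathcal{F}_h^{\partial}$, $[\![\boldsymbol{w}]\!]=\boldsymbol{w}$. *)

theory Defs
  imports "HOL-Analysis.Analysis"
begin

section \<open>Norms on spaces of functions modulo almost everywhere equality\<close>

text \<open>
  The elements of a Lebesgue or Sobolev space are classes of functions modulo almost everywhere
  equality. Such a space is represented here by the set \<open>V\<close> of all representatives, and \<open>N\<close> is
  a norm on the quotient: \<open>V\<close> is saturated and a linear space, \<open>N\<close> does not depend on the
  representative, and the norm axioms hold, the zero class being the functions that vanish
  almost everywhere.
\<close>

definition norm_on_ae_classes ::
  "'a measure \<Rightarrow> ('a \<Rightarrow> 'b::real_normed_vector) set \<Rightarrow> (('a \<Rightarrow> 'b) \<Rightarrow> real) \<Rightarrow> bool"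
where
  "norm_on_ae_classes M V N \<longleftrightarrow>
     (\<lambda>x. 0) \<in> V \<and>
     (\<forall>v\<in>V. \<forall>w\<in>V. (\<lambda>x. v x + w x) \<in> V) \<and>
     (\<forall>c. \<forall>v\<in>V. (\<lambda>x. c *\<^sub>R v x) \<in> V) \<and>
     (\<forall>v\<in>V. \<forall>w. (AE x in M. v x = w x) \<longrightarrow> w \<in> V \<and> N w = N v) \<and>
     (\<forall>v\<in>V. 0 \<le> N v) \<and>
     (\<forall>v\<in>V. N v = 0 \<longleftrightarrow> (AE x in M. v x = 0)) \<and>
     (\<forall>c. \<forall>v\<in>V. N (\<lambda>x. c *\<^sub>R v x) = \<bar>c\<bar> * N v) \<and>
     (\<forall>v\<in>V. \<forall>w\<in>V. N (\<lambda>x. v x + w x) \<le> N v + N w)"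

text \<open>For matrices, the norm of the type \<open>real ^ 'n ^ 'n\<close> is the Frobenius norm.\<close>

definition L2_fun :: "'a measure \<Rightarrow> ('a \<Rightarrow> 'b::euclidean_space) \<Rightarrow> bool" where
  "L2_fun M f \<longleftrightarrow> f \<in> borel_measurable M \<and> integrable M (\<lambda>x. (norm (f x))\<^sup>2)"

definition L2_norm :: "'a measure \<Rightarrow> ('a \<Rightarrow> 'b::euclidean_space) \<Rightarrow> real" where
  "L2_norm M f = sqrt (\<integral>x. (norm (f x))\<^sup>2 \<partial>M)"


section \<open>Polyhedral domains and simplicial meshes\<close>

text \<open>
  The condition \<open>interior (closure \<Omega>) = \<Omega>\<close> says that the domain lies locally on one side of
  the codimension-one part of its boundary (no slits or cracks). It is weaker than being a
  Lipschitz domain.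
\<close>

definition polyhedral_domain :: "'a::euclidean_space set \<Rightarrow> bool" where
  "polyhedral_domain \<Omega> \<longleftrightarrow>
     \<Omega> \<noteq> {} \<and> open \<Omega> \<and> connected \<Omega> \<and> bounded \<Omega> \<and> interior (closure \<Omega>) = \<Omega> \<and>
     (\<exists>\<P>. finite \<P> \<and> (\<forall>P\<in>\<P>. polytope P) \<and> closure \<Omega> = \<Union>\<P>)"

text \<open>
  Elements are closed simplices. By \<^const>\<open>triangulation\<close> there are finitely many and any two
  meet in a common (possibly empty) face, so they do not overlap and there are no hanging nodes.
\<close>

definition simplicial_mesh :: "'a::euclidean_space set \<Rightarrow> 'a set set \<Rightarrow> bool" where
  "simplicial_mesh \<Omega> \<T> \<longleftrightarrow>
     triangulation \<T> \<and> (\<forall>K\<in>\<T>. int DIM('a) simplex K) \<and> \<Union>\<T> = closure \<Omega>"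

definition mesh_faces :: "'a::euclidean_space set set \<Rightarrow> 'a set set" where
  "mesh_faces \<T> = {F. \<exists>K\<in>\<T>. F facet_of K}"

definition boundary_faces :: "'a::euclidean_space set \<Rightarrow> 'a set set \<Rightarrow> 'a set set" where
  "boundary_faces \<Omega> \<T> = {F \<in> mesh_faces \<T>. F \<subseteq> frontier \<Omega>}"

definition interior_faces :: "'a::euclidean_space set \<Rightarrow> 'a set set \<Rightarrow> 'a set set" where
  "interior_faces \<Omega> \<T> = mesh_faces \<T> - boundary_faces \<Omega> \<T>"

text \<open>
  A fixed choice of sides: \<open>Kp F\<close> and \<open>Km F\<close> are the elements on the \<open>+\<close> and \<open>-\<close> side of \<open>F\<close>.
\<close>

definition face_sides ::
  "'a::euclidean_space set \<Rightarrow> 'a set set \<Rightarrow> ('a set \<Rightarrow> 'a set) \<Rightarrow> ('a set \<Rightarrow> 'a set) \<Rightarrow> bool"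
where
  "face_sides \<Omega> \<T> Kp Km \<longleftrightarrow>
     (\<forall>F \<in> interior_faces \<Omega> \<T>. Kp F \<noteq> Km F \<and> {K \<in> \<T>. F facet_of K} = {Kp F, Km F})"


section \<open>Surface measure on a flat face\<close>

text \<open>
  The Lebesgue measure of the affine hull of \<open>F\<close>, transported from Cartesian coordinates with
  respect to an orthonormal basis \<open>B\<close> of the direction space of \<open>F\<close> and an origin \<open>p \<in> F\<close>
  (it does not depend on \<open>p\<close> and \<open>B\<close>), restricted to \<open>F\<close>.
\<close>

definition orthonormal_directions :: "'a::euclidean_space set \<Rightarrow> 'a set \<Rightarrow> bool" where
  "orthonormal_directions F B \<longleftrightarrow>
     pairwise orthogonal B \<and> (\<forall>b\<in>B. norm b = 1) \<and> span B = span {x - y |x y. x \<in> F \<and> y \<in> F}"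

definition surface_measure :: "'a::euclidean_space set \<Rightarrow> 'a measure" where
  "surface_measure F =
     (let p = (SOME p. p \<in> F); B = (SOME B. orthonormal_directions F B)
      in restrict_space
           (distr (\<Pi>\<^sub>M b\<in>B. lborel) borel (\<lambda>c. p + (\<Sum>b\<in>B. c b *\<^sub>R b))) F)"


section \<open>Smooth functions and weak derivatives\<close>

primrec C_k :: "nat \<Rightarrow> ('a::real_normed_vector \<Rightarrow> 'b::real_normed_vector) \<Rightarrow> bool" where
  "C_k 0 f \<longleftrightarrow> continuous_on UNIV f"
| "C_k (Suc k) f \<longleftrightarrow>
     (\<forall>x. f differentiable (at x)) \<and> (\<forall>v. C_k k (\<lambda>x. frechet_derivative f (at x) v))"

definition smooth :: "('a::real_normed_vector \<Rightarrow> 'b::real_normed_vector) \<Rightarrow> bool" where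
  "smooth f \<longleftrightarrow> (\<forall>k. C_k k f)"

definition test_function :: "(real ^ 'n) set \<Rightarrow> (real ^ 'n \<Rightarrow> real) \<Rightarrow> bool" where
  "test_function U \<phi> \<longleftrightarrow>
     smooth \<phi> \<and> compact (closure {x. \<phi> x \<noteq> 0}) \<and> closure {x. \<phi> x \<noteq> 0} \<subseteq> U"

text \<open>
  \<open>G x $ i $ j\<close> is the derivative of the \<open>i\<close>-th component in the direction of the \<open>j\<close>-th
  coordinate, the convention of \<^const>\<open>jacobian\<close>.
\<close>

definition has_L2_weak_gradient ::
  "(real ^ 'n) set \<Rightarrow> (real ^ 'n \<Rightarrow> real ^ 'n) \<Rightarrow> (real ^ 'n \<Rightarrow> real ^ 'n ^ 'n) \<Rightarrow> bool"
where
  "has_L2_weak_gradient U w G \<longleftrightarrow>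
     L2_fun (lebesgue_on U) G \<and>
     (\<forall>\<phi> i j. test_function U \<phi> \<longrightarrow>
        (\<integral>x. w x $ i * frechet_derivative \<phi> (at x) (axis j 1) \<partial>lebesgue_on U) =
        - (\<integral>x. G x $ i $ j * \<phi> x \<partial>lebesgue_on U))"

definition H1 :: "(real ^ 'n) set \<Rightarrow> (real ^ 'n \<Rightarrow> real ^ 'n) set" where
  "H1 U = {w. L2_fun (lebesgue_on U) w \<and> (\<exists>G. has_L2_weak_gradient U w G)}"

text \<open>A representative; it is determined up to almost everywhere equality on \<open>U\<close>.\<close>

definition weak_gradient ::
  "(real ^ 'n) set \<Rightarrow> (real ^ 'n \<Rightarrow> real ^ 'n) \<Rightarrow> real ^ 'n \<Rightarrow> real ^ 'n ^ 'n"
where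
  "weak_gradient U w = (SOME G. has_L2_weak_gradient U w G)"


section \<open>Traces on faces\<close>

text \<open>
  The trace operator from an element \<open>K\<close> to its face \<open>F\<close> is the continuous extension to \<open>H1\<close> of
  the restriction \<open>\<phi> \<mapsto> \<phi>|\<^sub>F\<close> of functions that are smooth up to the boundary of \<open>K\<close>: \<open>g\<close> is the
  trace of \<open>w\<close> if smooth functions \<open>\<phi> m\<close> converge to \<open>w\<close> in \<open>H1\<close> and to \<open>g\<close> in \<open>L2\<close> of the face.
\<close>

definition is_face_trace ::
  "(real ^ 'n) set \<Rightarrow> (real ^ 'n) set \<Rightarrow> (real ^ 'n \<Rightarrow> real ^ 'n) \<Rightarrow> (real ^ 'n \<Rightarrow> real ^ 'n) \<Rightarrow> bool"
where
  "is_face_trace K F w g \<longleftrightarrow>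
     L2_fun (surface_measure F) g \<and>
     (\<exists>\<phi> :: nat \<Rightarrow> real ^ 'n \<Rightarrow> real ^ 'n.
        (\<forall>m. smooth (\<phi> m)) \<and>
        (\<lambda>m. L2_norm (lebesgue_on (interior K)) (\<lambda>x. \<phi> m x - w x)) \<longlonglongrightarrow> 0 \<and>
        (\<lambda>m. L2_norm (lebesgue_on (interior K))
                (\<lambda>x. jacobian (\<phi> m) (at x) - weak_gradient (interior K) w x)) \<longlonglongrightarrow> 0 \<and>
        (\<lambda>m. L2_norm (surface_measure F) (\<lambda>x. \<phi> m x - g x)) \<longlonglongrightarrow> 0)"

definition face_trace ::
  "(real ^ 'n) set \<Rightarrow> (real ^ 'n) set \<Rightarrow> (real ^ 'n \<Rightarrow> real ^ 'n) \<Rightarrow> real ^ 'n \<Rightarrow> real ^ 'n"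
where
  "face_trace K F w = (SOME g. is_face_trace K F w g)"

definition jump ::
  "(real ^ 'n) set \<Rightarrow> (real ^ 'n) set set \<Rightarrow>
   ((real ^ 'n) set \<Rightarrow> (real ^ 'n) set) \<Rightarrow> ((real ^ 'n) set \<Rightarrow> (real ^ 'n) set) \<Rightarrow>
   (real ^ 'n \<Rightarrow> real ^ 'n) \<Rightarrow> (real ^ 'n) set \<Rightarrow> real ^ 'n \<Rightarrow> real ^ 'n"
where
  "jump \<Omega> \<T> Kp Km w F =
     (if F \<in> boundary_faces \<Omega> \<T>
      then face_trace (THE K. K \<in> \<T> \<and> F facet_of K) F w
      else (\<lambda>x. face_trace (Kp F) F w x - face_trace (Km F) F w x))"


section \<open>The broken Sobolev space and the norm\<close>

definition broken_H1 ::
  "(real ^ 'n) set \<Rightarrow> (real ^ 'n) set set \<Rightarrow> (real ^ 'n \<Rightarrow> real ^ 'n) set"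
where
  "broken_H1 \<Omega> \<T> = {w. L2_fun (lebesgue_on \<Omega>) w \<and> (\<forall>K\<in>\<T>. w \<in> H1 (interior K))}"

text \<open>Set to zero on the mesh skeleton, which is a null set.\<close>

definition broken_grad ::
  "(real ^ 'n) set set \<Rightarrow> (real ^ 'n \<Rightarrow> real ^ 'n) \<Rightarrow> real ^ 'n \<Rightarrow> real ^ 'n ^ 'n"
where
  "broken_grad \<T> w x =
     (\<Sum>K\<in>\<T>. indicat_real (interior K) x *\<^sub>R weak_gradient (interior K) w x)"

definition broken_div ::
  "(real ^ 'n) set set \<Rightarrow> (real ^ 'n \<Rightarrow> real ^ 'n) \<Rightarrow> real ^ 'n \<Rightarrow> real"
where
  "broken_div \<T> w x = (\<Sum>i\<in>UNIV. broken_grad \<T> w x $ i $ i)"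

definition sym_strain ::
  "(real ^ 'n) set set \<Rightarrow> (real ^ 'n \<Rightarrow> real ^ 'n) \<Rightarrow> real ^ 'n \<Rightarrow> real ^ 'n ^ 'n"
where
  "sym_strain \<T> w x =
     broken_grad \<T> w x + transpose (broken_grad \<T> w x) - ((2/3) * broken_div \<T> w x) *\<^sub>R mat 1"

definition sym_norm ::
  "(real ^ 'n) set \<Rightarrow> (real ^ 'n) set set \<Rightarrow>
   ((real ^ 'n) set \<Rightarrow> (real ^ 'n) set) \<Rightarrow> ((real ^ 'n) set \<Rightarrow> (real ^ 'n) set) \<Rightarrow>
   (real ^ 'n \<Rightarrow> real ^ 'n) \<Rightarrow> real"
where
  "sym_norm \<Omega> \<T> Kp Km w =
     sqrt ((L2_norm (lebesgue_on \<Omega>) (sym_strain \<T> w))\<^sup>2 +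
           (\<Sum>F\<in>mesh_faces \<T>. (1 / diameter F) *
              (\<integral>x. jump \<Omega> \<T> Kp Km w F x \<bullet> jump \<Omega> \<T> Kp Km w F x \<partial>surface_measure F)))"

end

theory Submission
  imports Defs
begin

text \<open>
  On an element, dilation towards an interior point followed by mollification shows that smooth
  functions are dense in \<open>H1\<close> and that weak gradients are unique. Integrating
  \<open>\<partial>\<^sub>s (s\<^sup>d f(a + s (y - a)))\<close> from the vertex \<open>a\<close> opposite to a face over the simplex gives the trace
  inequality, hence existence, uniqueness and linearity of traces; combining these identities over all
  faces by barycentric coordinates gives the divergence theorem and Green's formula. So the
  seminorm is well defined and satisfies the triangle inequality.

  If it vanishes at \<open>w\<close>, all jumps and boundary traces are zero, so the extension of \<open>w\<close> by zero has a
  square integrable weak gradient on the whole space whose deviatoric symmetric part vanishes. For a mollification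
  \<open>V\<close> with gradient \<open>A\<close> this reads \<open>A + A\<^sup>T = (2/3) (tr A) I\<close>; contracting with \<open>A\<close> and using
  \<open>\<integral> A : A\<^sup>T = \<integral> (tr A)\<^sup>2\<close> for compactly supported fields yields
  \<open>\<integral> |A|\<^sup>2 + (1/3) \<integral> (tr A)\<^sup>2 = 0\<close>. Hence \<open>V\<close> is constant and compactly supported, that is, zero.
\<close>

section \<open>Square integrable functions\<close>

text \<open>On a single element the strain has a nontrivial kernel: the infinitesimal rigid motions,
  and for d = 3 also the dilations and the other conformal fields. Definiteness is therefore a
  global matter and has to come from the faces, in particular from those on the boundary, where the
  jump is the trace itself. This is why the elements are glued together before the strain is used.
  The constant 2/3 is harmless in the energy identity because it is below 1 and so leaves the
  positive coefficient 1 - 2/3 in front of the squared trace of the gradient. Density exploits that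
  elements are convex: for x in the element and z in the support of the kernel the point (1 -
  \<epsilon>) x + \<epsilon> z is again in the element, so averages make sense up to the boundary
  and their kernels are admissible test functions. Since \<open>weak_gradient\<close> and
  \<open>face_trace\<close> are chosen by \<open>SOME\<close>, sums and multiples of them are
  identified through uniqueness, hence only almost everywhere.\<close>

lemma L2_funD:
  assumes "L2_fun M f"
  shows "f \<in> borel_measurable M" "integrable M (\<lambda>x. (norm (f x))\<^sup>2)"
  using assms by (auto simp: L2_fun_def)

lemma integrable_inner_L2:
  fixes f g :: "'a \<Rightarrow> 'b::euclidean_space"
  assumes "L2_fun M f" "L2_fun M g"
  shows "integrable M (\<lambda>x. f x \<bullet> g x)"
proof (rule Bochner_Integration.integrable_bound)
  show "integrable M (\<lambda>x. (norm (f x))\<^sup>2 + (norm (g x))\<^sup>2)"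
    using assms by (auto simp: L2_fun_def)
  show "(\<lambda>x. f x \<bullet> g x) \<in> borel_measurable M"
    using assms by (auto simp: L2_fun_def)
  show "AE x in M. norm (f x \<bullet> g x) \<le> norm ((norm (f x))\<^sup>2 + (norm (g x))\<^sup>2)"
  proof (rule AE_I2)
    fix x
    have "\<bar>f x \<bullet> g x\<bar> \<le> norm (f x) * norm (g x)"
      by (rule Cauchy_Schwarz_ineq2)
    also have "\<dots> \<le> (norm (f x))\<^sup>2 + (norm (g x))\<^sup>2"
      using sum_squares_bound[of "norm (f x)" "norm (g x)"]
        mult_nonneg_nonneg[OF norm_ge_zero[of "f x"] norm_ge_zero[of "g x"]] by linarith
    finally show "norm (f x \<bullet> g x) \<le> norm ((norm (f x))\<^sup>2 + (norm (g x))\<^sup>2)" by simp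
  qed
qed

lemma L2_fun_scaleR: "L2_fun M f \<Longrightarrow> L2_fun M (\<lambda>x. c *\<^sub>R f x)"
  by (auto simp: L2_fun_def power_mult_distrib)

lemma L2_fun_zero [simp]: "L2_fun M (\<lambda>x. 0)"
  by (auto simp: L2_fun_def)

lemma L2_fun_add:
  assumes "L2_fun M f" "L2_fun M g"
  shows "L2_fun M (\<lambda>x. f x + g x)"
proof -
  have eq: "(norm (f x + g x))\<^sup>2 = (norm (f x))\<^sup>2 + 2 * (f x \<bullet> g x) + (norm (g x))\<^sup>2" for x
    by (simp add: power2_norm_eq_inner inner_add_left inner_add_right inner_commute)
  show ?thesis
    using assms integrable_inner_L2[OF assms] unfolding L2_fun_def eq by auto
qed

lemma L2_fun_uminus: "L2_fun M f \<Longrightarrow> L2_fun M (\<lambda>x. - f x)"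
  using L2_fun_scaleR[of M f "-1"] by simp

lemma L2_fun_diff: "L2_fun M f \<Longrightarrow> L2_fun M g \<Longrightarrow> L2_fun M (\<lambda>x. f x - g x)"
  using L2_fun_add[OF _ L2_fun_uminus, of M f g] by simp

lemma L2_fun_sum:
  assumes "\<And>i. i \<in> I \<Longrightarrow> L2_fun M (f i)"
  shows "L2_fun M (\<lambda>x. \<Sum>i\<in>I. f i x)"
  using assms by (induction I rule: infinite_finite_induct) (auto intro: L2_fun_add)

lemma L2_norm_nonneg [simp]: "0 \<le> L2_norm M f"
  by (auto simp: L2_norm_def)

lemma L2_norm_power2: "(L2_norm M f)\<^sup>2 = (\<integral>x. (norm (f x))\<^sup>2 \<partial>M)"
  by (auto simp: L2_norm_def)

lemma L2_norm_scaleR: "L2_norm M (\<lambda>x. c *\<^sub>R f x) = \<bar>c\<bar> * L2_norm M f"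
  by (simp add: L2_norm_def power_mult_distrib real_sqrt_mult)

lemma L2_norm_eq_0_iff:
  assumes "L2_fun M f"
  shows "L2_norm M f = 0 \<longleftrightarrow> (AE x in M. f x = 0)"
  using integral_nonneg_eq_0_iff_AE[OF L2_funD(2)[OF assms]]
  by (auto simp: L2_norm_def)

lemma L2_norm_cong_AE:
  assumes "f \<in> borel_measurable M" "g \<in> borel_measurable M" "AE x in M. f x = g x"
  shows "L2_norm M f = L2_norm M g"
proof -
  have "(\<integral>x. (norm (f x))\<^sup>2 \<partial>M) = (\<integral>x. (norm (g x))\<^sup>2 \<partial>M)"
    using assms by (intro integral_cong_AE) auto
  then show ?thesis by (simp add: L2_norm_def)
qed

text \<open>The sign of c is left open, so the norm bound carries its absolute value.\<close>

lemma L2_fun_bound: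
  fixes f :: "'a \<Rightarrow> 'b::euclidean_space" and g :: "'a \<Rightarrow> 'c::euclidean_space"
  assumes f: "L2_fun M f" and g: "g \<in> borel_measurable M"
    and le: "AE x in M. norm (g x) \<le> c * norm (f x)"
  shows "L2_fun M g" "L2_norm M g \<le> \<bar>c\<bar> * L2_norm M f"
proof -
  have le': "AE x in M. (norm (g x))\<^sup>2 \<le> c\<^sup>2 * (norm (f x))\<^sup>2"
    using le by eventually_elim (metis norm_ge_zero power_mono power_mult_distrib)
  have i: "integrable M (\<lambda>x. c\<^sup>2 * (norm (f x))\<^sup>2)"
    using f by (auto simp: L2_fun_def)
  have i2: "integrable M (\<lambda>x. (norm (g x))\<^sup>2)"
    by (rule Bochner_Integration.integrable_bound[OF i]) (use g le' in auto)
  show "L2_fun M g" using i2 g by (simp add: L2_fun_def)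
  have "(\<integral>x. (norm (g x))\<^sup>2 \<partial>M) \<le> (\<integral>x. c\<^sup>2 * (norm (f x))\<^sup>2 \<partial>M)"
    by (rule integral_mono_AE[OF i2 i le'])
  also have "\<dots> = (\<bar>c\<bar> * L2_norm M f)\<^sup>2"
    by (simp add: L2_norm_power2 power_mult_distrib)
  finally show "L2_norm M g \<le> \<bar>c\<bar> * L2_norm M f"
    unfolding L2_norm_def[of M g] by (simp add: real_le_lsqrt)
qed

lemma (in finite_measure) L2_fun_bounded:
  fixes f :: "'a \<Rightarrow> 'b::euclidean_space"
  assumes "f \<in> borel_measurable M" "AE x in M. norm (f x) \<le> B"
  shows "L2_fun M f"
proof (rule L2_fun_bound(1)[where f="\<lambda>_. 1::real"])
  show "L2_fun M (\<lambda>_. 1::real)" by (simp add: L2_fun_def)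
  show "AE x in M. norm (f x) \<le> B * norm (1::real)" using assms by auto
qed (use assms in auto)

text \<open>Young's inequality with the weights b / (2a) and a / (2b), tuned so that each of the two
  terms integrates to ab / 2. If a or b is zero, the product vanishes almost everywhere.\<close>

lemma Cauchy_Schwarz_L2_norm:
  assumes f: "L2_fun M f" and g: "L2_fun M g"
  shows "(\<integral>x. norm (f x) * norm (g x) \<partial>M) \<le> L2_norm M f * L2_norm M g"
proof -
  have nf: "L2_fun M (\<lambda>x. norm (f x))" and ng: "L2_fun M (\<lambda>x. norm (g x))"
    using f g by (auto simp: L2_fun_def)
  have i: "integrable M (\<lambda>x. norm (f x) * norm (g x))"
    using integrable_inner_L2[OF nf ng] by simp
  define a b where "a = L2_norm M f" and "b = L2_norm M g"
  consider "a = 0 \<or> b = 0" | "a > 0" "b > 0"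
    using L2_norm_nonneg[of M f] L2_norm_nonneg[of M g] unfolding a_def b_def by linarith
  then show ?thesis
  proof cases
    case 1
    then have "AE x in M. norm (f x) * norm (g x) = 0"
      using L2_norm_eq_0_iff[OF f] L2_norm_eq_0_iff[OF g] unfolding a_def b_def by auto
    then have "(\<integral>x. norm (f x) * norm (g x) \<partial>M) = 0"
      by (intro integral_eq_zero_AE)
    then show ?thesis by simp
  next
    case 2
    have "(\<integral>x. norm (f x) * norm (g x) \<partial>M)
        \<le> (\<integral>x. (b / (2*a)) * (norm (f x))\<^sup>2 + (a / (2*b)) * (norm (g x))\<^sup>2 \<partial>M)"
    proof (rule integral_mono[OF i])
      show "integrable M (\<lambda>x. (b / (2*a)) * (norm (f x))\<^sup>2 + (a / (2*b)) * (norm (g x))\<^sup>2)"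
        using f g by (auto simp: L2_fun_def)
      fix x
      have "0 \<le> (b * norm (f x) - a * norm (g x))\<^sup>2" by simp
      then have "2 * (a * b) * (norm (f x) * norm (g x)) \<le> b\<^sup>2 * (norm (f x))\<^sup>2 + a\<^sup>2 * (norm (g x))\<^sup>2"
        by (simp add: power2_eq_square algebra_simps)
      then show "norm (f x) * norm (g x) \<le> (b / (2*a)) * (norm (f x))\<^sup>2 + (a / (2*b)) * (norm (g x))\<^sup>2"
        using 2 by (simp add: field_simps power2_eq_square)
    qed
    also have "\<dots> = (b / (2*a)) * a\<^sup>2 + (a / (2*b)) * b\<^sup>2"
      using f g unfolding a_def b_def L2_norm_power2 by (simp add: L2_fun_def)
    also have "\<dots> = a * b" using 2 by (simp add: field_simps power2_eq_square)
    finally show ?thesis by (simp add: a_def b_def)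
  qed
qed

lemma abs_integral_inner_le_L2_norm:
  assumes f: "L2_fun M f" and g: "L2_fun M g"
  shows "\<bar>\<integral>x. f x \<bullet> g x \<partial>M\<bar> \<le> L2_norm M f * L2_norm M g"
proof -
  have nf: "L2_fun M (\<lambda>x. norm (f x))" and ng: "L2_fun M (\<lambda>x. norm (g x))"
    using f g by (auto simp: L2_fun_def)
  have i: "integrable M (\<lambda>x. norm (f x) * norm (g x))"
    using integrable_inner_L2[OF nf ng] by simp
  have "\<bar>\<integral>x. f x \<bullet> g x \<partial>M\<bar> \<le> (\<integral>x. \<bar>f x \<bullet> g x\<bar> \<partial>M)"
    by (rule integral_abs_bound)
  also have "\<dots> \<le> (\<integral>x. norm (f x) * norm (g x) \<partial>M)"
    using integrable_inner_L2[OF f g] i by (intro integral_mono) (auto intro: Cauchy_Schwarz_ineq2)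
  also have "\<dots> \<le> L2_norm M f * L2_norm M g" by (rule Cauchy_Schwarz_L2_norm[OF f g])
  finally show ?thesis .
qed

lemma L2_norm_triangle:
  assumes f: "L2_fun M f" and g: "L2_fun M g"
  shows "L2_norm M (\<lambda>x. f x + g x) \<le> L2_norm M f + L2_norm M g"
proof -
  have eq: "(norm (f x + g x))\<^sup>2 = (norm (f x))\<^sup>2 + 2 * (f x \<bullet> g x) + (norm (g x))\<^sup>2" for x
    by (simp add: power2_norm_eq_inner inner_add_left inner_add_right inner_commute)
  have "(\<integral>x. (norm (f x + g x))\<^sup>2 \<partial>M)
     = (L2_norm M f)\<^sup>2 + 2 * (\<integral>x. f x \<bullet> g x \<partial>M) + (L2_norm M g)\<^sup>2"
    unfolding eq L2_norm_power2 using f g integrable_inner_L2[OF f g] by (simp add: L2_fun_def)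
  also have "\<dots> \<le> (L2_norm M f)\<^sup>2 + 2 * (L2_norm M f * L2_norm M g) + (L2_norm M g)\<^sup>2"
    using abs_integral_inner_le_L2_norm[OF f g] by linarith
  also have "\<dots> = (L2_norm M f + L2_norm M g)\<^sup>2" by (simp add: power2_sum)
  finally show ?thesis unfolding L2_norm_def[of M "\<lambda>x. f x + g x"]
    by (simp add: real_le_lsqrt)
qed

lemma L2_norm_minus_commute: "L2_norm M (\<lambda>x. f x - g x) = L2_norm M (\<lambda>x. g x - f x)"
  by (simp add: L2_norm_def norm_minus_commute)

lemma L2_norm_triangle_diff:
  assumes f: "L2_fun M f" and g: "L2_fun M g" and h: "L2_fun M h"
  shows "L2_norm M (\<lambda>x. f x - h x) \<le> L2_norm M (\<lambda>x. f x - g x) + L2_norm M (\<lambda>x. g x - h x)"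
  using L2_norm_triangle[OF L2_fun_diff[OF f g] L2_fun_diff[OF g h]] by simp

lemma L2_limit_unique:
  assumes f: "\<And>m. L2_fun M (f m)" and g: "L2_fun M g" and h: "L2_fun M h"
    and "(\<lambda>m. L2_norm M (\<lambda>x. f m x - g x)) \<longlonglongrightarrow> 0"
    and "(\<lambda>m. L2_norm M (\<lambda>x. f m x - h x)) \<longlonglongrightarrow> 0"
  shows "AE x in M. g x = h x"
proof -
  have "L2_norm M (\<lambda>x. g x - h x) \<le> L2_norm M (\<lambda>x. f m x - g x) + L2_norm M (\<lambda>x. f m x - h x)" for m
    using L2_norm_triangle_diff[OF g f h, of m] by (simp add: L2_norm_minus_commute)
  moreover have "(\<lambda>m. L2_norm M (\<lambda>x. f m x - g x) + L2_norm M (\<lambda>x. f m x - h x)) \<longlonglongrightarrow> 0"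
    using tendsto_add[OF assms(4,5)] by simp
  ultimately have "L2_norm M (\<lambda>x. g x - h x) \<le> 0"
    by (intro LIMSEQ_le_const) auto
  then have "L2_norm M (\<lambda>x. g x - h x) = 0"
    using L2_norm_nonneg[of M "\<lambda>x. g x - h x"] by linarith
  then show ?thesis using L2_norm_eq_0_iff[OF L2_fun_diff[OF g h]] by auto
qed

lemma L2_limit_add:
  assumes f: "\<And>m. L2_fun M (f m)" "L2_fun M g" and f': "\<And>m. L2_fun M (f' m)" "L2_fun M g'"
    and lim: "(\<lambda>m. L2_norm M (\<lambda>x. f m x - g x)) \<longlonglongrightarrow> 0" "(\<lambda>m. L2_norm M (\<lambda>x. f' m x - g' x)) \<longlonglongrightarrow> 0"
  shows "(\<lambda>m. L2_norm M (\<lambda>x. (f m x + f' m x) - (g x + g' x))) \<longlonglongrightarrow> 0"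
proof (rule tendsto_sandwich[OF _ _ tendsto_const])
  show "\<forall>\<^sub>F m in sequentially. L2_norm M (\<lambda>x. (f m x + f' m x) - (g x + g' x))
      \<le> L2_norm M (\<lambda>x. f m x - g x) + L2_norm M (\<lambda>x. f' m x - g' x)"
    using L2_norm_triangle[OF L2_fun_diff[OF f] L2_fun_diff[OF f']]
    by (simp add: algebra_simps)
  show "(\<lambda>m. L2_norm M (\<lambda>x. f m x - g x) + L2_norm M (\<lambda>x. f' m x - g' x)) \<longlonglongrightarrow> 0"
    using tendsto_add[OF lim] by simp
qed auto

lemma L2_limit_scaleR:
  assumes lim: "(\<lambda>m. L2_norm M (\<lambda>x. f m x - g x)) \<longlonglongrightarrow> 0"
  shows "(\<lambda>m. L2_norm M (\<lambda>x. c *\<^sub>R f m x - c *\<^sub>R g x)) \<longlonglongrightarrow> 0"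
proof -
  have "(\<lambda>m. \<bar>c\<bar> * L2_norm M (\<lambda>x. f m x - g x)) \<longlonglongrightarrow> 0"
    using tendsto_mult_left[OF lim, of "\<bar>c\<bar>"] by simp
  then show ?thesis by (simp add: L2_norm_scaleR flip: scaleR_diff_right)
qed

text \<open>Passage to the limit in a pairing with a fixed L2 function; in this form the terms of
  Green's formula converge.\<close>

lemma L2_limit_inner:
  assumes f: "\<And>m. L2_fun M (f m)" "L2_fun M g" and h: "L2_fun M h"
    and lim: "(\<lambda>m. L2_norm M (\<lambda>x. f m x - g x)) \<longlonglongrightarrow> 0"
  shows "(\<lambda>m. \<integral>x. f m x \<bullet> h x \<partial>M) \<longlonglongrightarrow> (\<integral>x. g x \<bullet> h x \<partial>M)"
proof -
  have "(\<lambda>m. (\<integral>x. f m x \<bullet> h x \<partial>M) - (\<integral>x. g x \<bullet> h x \<partial>M)) \<longlonglongrightarrow> 0"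
  proof (rule Lim_null_comparison)
    show "(\<lambda>m. L2_norm M (\<lambda>x. f m x - g x) * L2_norm M h) \<longlonglongrightarrow> 0"
      using tendsto_mult_right[OF lim] by simp
    have "(\<integral>x. f m x \<bullet> h x \<partial>M) - (\<integral>x. g x \<bullet> h x \<partial>M) = (\<integral>x. (f m x - g x) \<bullet> h x \<partial>M)" for m
      using integrable_inner_L2[OF f(1) h] integrable_inner_L2[OF f(2) h] by (simp add: inner_diff_left)
    then show "\<forall>\<^sub>F m in sequentially. norm ((\<integral>x. f m x \<bullet> h x \<partial>M) - (\<integral>x. g x \<bullet> h x \<partial>M))
        \<le> L2_norm M (\<lambda>x. f m x - g x) * L2_norm M h"
      using abs_integral_inner_le_L2_norm[OF L2_fun_diff[OF f] h] by simp
  qed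
  then show ?thesis by (simp add: LIM_zero_iff)
qed

text \<open>On a finite measure space \<open>L2\<close> convergence implies \<open>L1\<close> convergence, which provides the
  pointwise limit; Fatou's lemma then recovers the \<open>L2\<close> distance.\<close>

lemma (in finite_measure) L2_complete:
  fixes f :: "nat \<Rightarrow> 'a \<Rightarrow> 'b::euclidean_space"
  assumes f: "\<And>m. L2_fun M (f m)"
    and cauchy: "\<And>e. e > 0 \<Longrightarrow> \<exists>N. \<forall>m\<ge>N. \<forall>n\<ge>N. L2_norm M (\<lambda>x. f m x - f n x) < e"
  shows "\<exists>g. L2_fun M g \<and> (\<lambda>m. L2_norm M (\<lambda>x. f m x - g x)) \<longlonglongrightarrow> 0"
proof -
  define c where "c = L2_norm M (\<lambda>_. 1::real)"
  have one: "L2_fun M (\<lambda>_. 1::real)" by (simp add: L2_fun_def)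
  have L1: "(\<integral>x. norm (h x) \<partial>M) \<le> L2_norm M h * c" "integrable M h" if "L2_fun M h" for h :: "'a \<Rightarrow> 'b"
  proof -
    show "(\<integral>x. norm (h x) \<partial>M) \<le> L2_norm M h * c"
      using Cauchy_Schwarz_L2_norm[OF that one] by (simp add: c_def)
    have "L2_fun M (\<lambda>x. norm (h x))" using that by (auto simp: L2_fun_def)
    from integrable_inner_L2[OF this one] show "integrable M h"
      using that by (simp add: L2_fun_def integrable_norm_iff)
  qed
  have [measurable]: "f m \<in> borel_measurable M" for m using f by (auto simp: L2_fun_def)
  obtain r where r: "strict_mono r" "AE x in M. Cauchy (\<lambda>i. f (r i) x)"
  proof (rule cauchy_L1_AE_cauchy_subseq[of M f])
    show "integrable M (f n)" for n using L1(2)[OF f] .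
    fix e :: real assume "e > 0"
    have c: "c \<ge> 0" by (simp add: c_def)
    \<comment> \<open>Dividing by c + 1 rather than c covers the zero measure, where c = 0, and
      still leaves a bound strictly below e.\<close>
    from cauchy[of "e / (c + 1)"] \<open>e > 0\<close> c obtain N where
      N: "\<forall>m\<ge>N. \<forall>n\<ge>N. L2_norm M (\<lambda>x. f m x - f n x) < e / (c+1)"
      by (auto simp: add_nonneg_pos)
    show "\<exists>N. \<forall>i\<ge>N. \<forall>j\<ge>N. (\<integral>x. norm (f i x - f j x) \<partial>M) < e"
    proof (intro exI allI impI)
      fix i j assume ij: "i \<ge> N" "j \<ge> N"
      have "(\<integral>x. norm (f i x - f j x) \<partial>M) \<le> L2_norm M (\<lambda>x. f i x - f j x) * c"
        by (rule L1(1)[OF L2_fun_diff[OF f f]])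
      also have "\<dots> \<le> e / (c+1) * c"
        using N ij c by (intro mult_right_mono) (auto intro: less_imp_le)
      also have "\<dots> < e" using c \<open>e > 0\<close> by (simp add: field_simps)
      finally show "(\<integral>x. norm (f i x - f j x) \<partial>M) < e" .
    qed
  qed auto
  define g where "g x = lim (\<lambda>i. f (r i) x)" for x
  have [measurable]: "g \<in> borel_measurable M" unfolding g_def by measurable
  have lim: "AE x in M. (\<lambda>i. f (r i) x) \<longlonglongrightarrow> g x"
    using r(2) by eventually_elim (simp add: g_def Cauchy_convergent_iff convergent_LIMSEQ_iff)
  \<comment> \<open>One index m is held fixed against all later n, because Fatou's lemma is applied
    in the second index along the subsequence r.\<close>
  have key: "L2_fun M (\<lambda>x. f m x - g x) \<and> L2_norm M (\<lambda>x. f m x - g x) \<le> e"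
    if "e > 0" and N: "\<forall>n\<ge>N. L2_norm M (\<lambda>x. f m x - f n x) < e" for m N e
  proof -
    have "(\<integral>\<^sup>+x. ennreal ((norm (f m x - g x))\<^sup>2) \<partial>M)
        = (\<integral>\<^sup>+x. liminf (\<lambda>i. ennreal ((norm (f m x - f (r i) x))\<^sup>2)) \<partial>M)"
    proof (rule nn_integral_cong_AE)
      show "AE x in M. ennreal ((norm (f m x - g x))\<^sup>2) = liminf (\<lambda>i. ennreal ((norm (f m x - f (r i) x))\<^sup>2))"
        using lim
      proof eventually_elim
        case (elim x)
        have "(\<lambda>i. ennreal ((norm (f m x - f (r i) x))\<^sup>2)) \<longlonglongrightarrow> ennreal ((norm (f m x - g x))\<^sup>2)"
          by (intro tendsto_ennrealI tendsto_intros elim)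
        from lim_imp_Liminf[OF _ this] show ?case by simp
      qed
    qed
    also have "\<dots> \<le> liminf (\<lambda>i. \<integral>\<^sup>+x. ennreal ((norm (f m x - f (r i) x))\<^sup>2) \<partial>M)"
      by (rule nn_integral_liminf) auto
    also have "\<dots> \<le> ennreal (e\<^sup>2)"
    proof (rule Liminf_le)
      have "(\<integral>\<^sup>+x. ennreal ((norm (f m x - f (r i) x))\<^sup>2) \<partial>M) \<le> ennreal (e\<^sup>2)" if "i \<ge> N" for i
      proof -
        have "r i \<ge> N" using that r(1) by (meson le_trans seq_suble)
        then have "L2_norm M (\<lambda>x. f m x - f (r i) x) < e" using N by auto
        then have "(L2_norm M (\<lambda>x. f m x - f (r i) x))\<^sup>2 \<le> e\<^sup>2"
          by (intro power_mono) auto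
        then show ?thesis
          using L2_funD(2)[OF L2_fun_diff[OF f f], of m "r i"]
          by (subst nn_integral_eq_integral) (auto simp: L2_norm_power2 intro: ennreal_leI)
      qed
      then show "\<forall>\<^sub>F i in sequentially. (\<integral>\<^sup>+x. ennreal ((norm (f m x - f (r i) x))\<^sup>2) \<partial>M) \<le> ennreal (e\<^sup>2)"
        by (auto simp: eventually_sequentially)
    qed simp
    finally have le: "(\<integral>\<^sup>+x. ennreal ((norm (f m x - g x))\<^sup>2) \<partial>M) \<le> ennreal (e\<^sup>2)" .
    have int: "integrable M (\<lambda>x. (norm (f m x - g x))\<^sup>2)"
      by (rule integrableI_nonneg) (use le in \<open>auto simp: le_less_trans\<close>)
    have "(\<integral>x. (norm (f m x - g x))\<^sup>2 \<partial>M) \<le> e\<^sup>2"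
      using le by (subst (asm) nn_integral_eq_integral[OF int]) (auto simp: ennreal_le_iff)
    then show ?thesis using int \<open>e > 0\<close>
      by (auto simp: L2_fun_def L2_norm_def intro: real_le_lsqrt)
  qed
  have "L2_fun M g"
  proof -
    from cauchy[of 1] obtain N where "\<forall>m\<ge>N. \<forall>n\<ge>N. L2_norm M (\<lambda>x. f m x - f n x) < 1" by auto
    then have "L2_fun M (\<lambda>x. f N x - g x)" using key[of 1 N N] by auto
    from L2_fun_diff[OF f this, of N] show ?thesis by simp
  qed
  moreover have "(\<lambda>m. L2_norm M (\<lambda>x. f m x - g x)) \<longlonglongrightarrow> 0"
  proof (rule LIMSEQ_I)
    fix e :: real assume "e > 0"
    from cauchy[of "e/2"] \<open>e > 0\<close> obtain N where
      N: "\<forall>m\<ge>N. \<forall>n\<ge>N. L2_norm M (\<lambda>x. f m x - f n x) < e/2" by auto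
    have "L2_norm M (\<lambda>x. f m x - g x) \<le> e/2" if "m \<ge> N" for m
      using key[of "e/2" N m] N that \<open>e > 0\<close> by auto
    then show "\<exists>no. \<forall>m\<ge>no. norm (L2_norm M (\<lambda>x. f m x - g x) - 0) < e"
      using \<open>e > 0\<close> by (intro exI[of _ N]) (fastforce simp: abs_of_nonneg)
  qed
  ultimately show ?thesis by blast
qed

section \<open>Calculus of \<open>C_k\<close> functions and bump functions\<close>

lemma C_k_Suc_imp: "C_k (Suc k) f \<Longrightarrow> C_k k f"
proof (induction k arbitrary: f)
  case 0
  then have "f differentiable (at x)" for x by simp
  then show ?case
    by (auto simp: continuous_on_eq_continuous_at differentiable_imp_continuous_within)
next
  case (Suc k)
  then show ?case by simp
qed

lemma C_k_continuous: "C_k k f \<Longrightarrow> continuous_on UNIV f"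
proof (induction k)
  case (Suc k) then show ?case using C_k_Suc_imp by blast
qed simp

lemma C_k_has_derivative:
  "C_k (Suc k) f \<Longrightarrow> (f has_derivative frechet_derivative f (at x)) (at x)"
  by (simp add: frechet_derivative_works[symmetric])

text \<open>Lets the inductions below work with an explicit candidate for the derivative; uniqueness
  of the derivative identifies it with \<open>frechet_derivative\<close>.\<close>

lemma C_k_SucI:
  assumes "\<And>x. (f has_derivative f' x) (at x)" "\<And>v. C_k k (\<lambda>x. f' x v)"
  shows "C_k (Suc k) f"
proof -
  have "frechet_derivative f (at x) = f' x" for x
    using frechet_derivative_at[OF assms(1)[of x]] by simp
  then show ?thesis using assms by (auto simp: differentiable_def)
qed

lemma C_k_const: "C_k k (\<lambda>x. c)"
  by (induction k arbitrary: c) auto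

lemma C_k_bounded_linear:
  assumes "bounded_linear L" shows "C_k k L"
proof (cases k)
  case 0 then show ?thesis using assms by (simp add: linear_continuous_on)
next
  case (Suc j)
  show ?thesis unfolding Suc
    by (rule C_k_SucI[where f'="\<lambda>_. L"])
       (auto intro: bounded_linear_imp_has_derivative assms C_k_const)
qed

lemma C_k_add: "C_k k f \<Longrightarrow> C_k k g \<Longrightarrow> C_k k (\<lambda>x. f x + g x)"
proof (induction k arbitrary: f g)
  case 0 then show ?case by (auto intro: continuous_intros)
next
  case (Suc k)
  show ?case
    by (rule C_k_SucI[where f'="\<lambda>x v. frechet_derivative f (at x) v + frechet_derivative g (at x) v"])
       (use Suc in \<open>auto intro!: has_derivative_add simp: frechet_derivative_works[symmetric]\<close>)
qed

text \<open>The Leibniz rule writes the derivative as a sum of products under the same p, with each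
  factor still of order k, so the induction generalises over both factors. One proof serves scalar
  multiplication, multiplication and the inner product.\<close>

lemma C_k_bilinear:
  assumes p: "bounded_bilinear p"
  shows "C_k k f \<Longrightarrow> C_k k g \<Longrightarrow> C_k k (\<lambda>x. p (f x) (g x))"
proof (induction k arbitrary: f g)
  case 0 then show ?case using bounded_bilinear.continuous_on[OF p] by auto
next
  case (Suc k)
  show ?case
  proof (rule C_k_SucI)
    show "((\<lambda>x. p (f x) (g x)) has_derivative
       (\<lambda>h. p (f x) (frechet_derivative g (at x) h) + p (frechet_derivative f (at x) h) (g x))) (at x)" for x
      by (rule bounded_bilinear.FDERIV[OF p C_k_has_derivative C_k_has_derivative]) (use Suc in auto)
    show "C_k k (\<lambda>x. p (f x) (frechet_derivative g (at x) v) + p (frechet_derivative f (at x) v) (g x))" for v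
      using Suc.prems by (intro C_k_add Suc.IH C_k_Suc_imp[of k f] C_k_Suc_imp[of k g]) auto
  qed
qed

lemmas C_k_scaleR = C_k_bilinear[OF bounded_bilinear_scaleR]
lemmas C_k_mult = C_k_bilinear[OF bounded_bilinear_mult]
lemmas C_k_inner = C_k_bilinear[OF bounded_bilinear_inner]

lemma C_k_linear_comp:
  assumes L: "bounded_linear L"
  shows "C_k k f \<Longrightarrow> C_k k (\<lambda>x. L (f x))"
proof (induction k arbitrary: f)
  case 0 then show ?case using linear_continuous_on[OF L] continuous_on_compose2[of UNIV L UNIV f] by auto
next
  case (Suc k)
  show ?case
  proof (rule C_k_SucI)
    show "((\<lambda>x. L (f x)) has_derivative (\<lambda>h. L (frechet_derivative f (at x) h))) (at x)" for x
      by (rule bounded_linear.has_derivative[OF L C_k_has_derivative]) (use Suc in auto)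
  qed (use Suc in auto)
qed

lemma C_k_affine:
  fixes f :: "'a::real_normed_vector \<Rightarrow> 'b::real_normed_vector"
  shows "C_k k f \<Longrightarrow> C_k k (\<lambda>x. f (a *\<^sub>R x + b))"
proof (induction k arbitrary: f)
  case 0 then show ?case
    by (auto intro!: continuous_on_compose2[of UNIV f UNIV "\<lambda>x. a *\<^sub>R x + b"] continuous_intros)
next
  case (Suc k)
  show ?case
  proof (rule C_k_SucI)
    fix x
    have "((\<lambda>x. a *\<^sub>R x + b) has_derivative (\<lambda>h. a *\<^sub>R h)) (at x)" by (auto intro!: derivative_eq_intros)
    then have "((\<lambda>x. f (a *\<^sub>R x + b)) has_derivative (\<lambda>h. frechet_derivative f (at (a *\<^sub>R x + b)) (a *\<^sub>R h))) (at x)"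
      using has_derivative_compose[OF _ C_k_has_derivative, of "\<lambda>x. a *\<^sub>R x + b"] Suc.prems by blast
    moreover have "linear (frechet_derivative f (at (a *\<^sub>R x + b)))"
      using Suc.prems by (intro linear_frechet_derivative) simp
    ultimately show "((\<lambda>x. f (a *\<^sub>R x + b)) has_derivative (\<lambda>h. a *\<^sub>R frechet_derivative f (at (a *\<^sub>R x + b)) h)) (at x)"
      by (simp add: linear_cmul)
  next
    show "C_k k (\<lambda>x. a *\<^sub>R frechet_derivative f (at (a *\<^sub>R x + b)) v)" for v
      using Suc by (intro C_k_scaleR C_k_const) auto
  qed
qed

text \<open>With an outer function of one real variable the chain rule is a product, h' (g x) times
  the derivative of g in direction v. The induction generalises over h because h' is again
  smooth.\<close>

lemma C_k_compose_real:
  fixes g :: "'a::real_normed_vector \<Rightarrow> real" and h :: "real \<Rightarrow> real"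
  shows "smooth h \<Longrightarrow> C_k k g \<Longrightarrow> C_k k (\<lambda>x. h (g x))"
proof (induction k arbitrary: h)
  case 0
  then have "continuous_on UNIV h" by (metis C_k.simps(1) smooth_def)
  with 0 show ?case by (auto intro!: continuous_on_compose2[of UNIV h UNIV g])
next
  case (Suc k)
  have h1: "C_k (Suc j) h" for j using Suc.prems by (simp only: smooth_def)
  show ?case
  proof (rule C_k_SucI)
    fix x
    have "((\<lambda>x. h (g x)) has_derivative (\<lambda>v. frechet_derivative h (at (g x)) (frechet_derivative g (at x) v))) (at x)"
      using has_derivative_compose[OF C_k_has_derivative C_k_has_derivative, OF Suc.prems(2) h1] by blast
    moreover have "linear (frechet_derivative h (at (g x)))"
      using h1[of 0] by (intro linear_frechet_derivative) simp
    then have "(\<lambda>v. frechet_derivative h (at (g x)) (frechet_derivative g (at x) v)) =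
        (\<lambda>v. frechet_derivative g (at x) v * frechet_derivative h (at (g x)) 1)"
      using linear_cmul[of "frechet_derivative h (at (g x))" _ 1]
      by (metis mult.right_neutral real_scaleR_def)
    ultimately show "((\<lambda>x. h (g x)) has_derivative (\<lambda>v. frechet_derivative g (at x) v * frechet_derivative h (at (g x)) 1)) (at x)"
      by (simp only:)
  next
    show "C_k k (\<lambda>x. frechet_derivative g (at x) v * frechet_derivative h (at (g x)) 1)" for v
    proof (intro C_k_mult)
      show "C_k k (\<lambda>x. frechet_derivative g (at x) v)" using Suc.prems by auto
      have "smooth (\<lambda>x. frechet_derivative h (at x) 1)"
        using h1 by (auto simp: smooth_def)
      then show "C_k k (\<lambda>x. frechet_derivative h (at (g x)) 1)"
        by (rule Suc.IH) (use Suc.prems C_k_Suc_imp in blast)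
    qed
  qed
qed

lemma smooth_differentiable: "smooth f \<Longrightarrow> f differentiable (at x)"
  unfolding smooth_def using C_k.simps(2) by blast

lemma smooth_has_derivative:
  "smooth f \<Longrightarrow> (f has_derivative frechet_derivative f (at x)) (at x)"
  using smooth_differentiable frechet_derivative_works by blast

lemma smooth_frechet_derivative: "smooth f \<Longrightarrow> smooth (\<lambda>x. frechet_derivative f (at x) v)"
  unfolding smooth_def using C_k.simps(2) by blast

lemma smooth_continuous: "smooth f \<Longrightarrow> continuous_on UNIV f"
  unfolding smooth_def using C_k_continuous by blast

lemma smooth_bilinear: "bounded_bilinear p \<Longrightarrow> smooth f \<Longrightarrow> smooth g \<Longrightarrow> smooth (\<lambda>x. p (f x) (g x))"
  by (simp add: smooth_def C_k_bilinear)

lemma smooth_add: "smooth f \<Longrightarrow> smooth g \<Longrightarrow> smooth (\<lambda>x. f x + g x)"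
  by (simp add: smooth_def C_k_add)

lemma smooth_scaleR_const: "smooth f \<Longrightarrow> smooth (\<lambda>x. c *\<^sub>R f x)"
  by (simp add: smooth_def C_k_scaleR C_k_const)

lemma smooth_diff: "smooth f \<Longrightarrow> smooth g \<Longrightarrow> smooth (\<lambda>x. f x - g x)"
  using smooth_add[OF _ smooth_scaleR_const[of g "-1"], of f] by simp

lemma smooth_linear_comp: "bounded_linear L \<Longrightarrow> smooth f \<Longrightarrow> smooth (\<lambda>x. L (f x))"
  by (simp add: smooth_def C_k_linear_comp)

lemma smooth_affine: "smooth f \<Longrightarrow> smooth (\<lambda>x. f (a *\<^sub>R x + b))"
  by (simp add: smooth_def C_k_affine)

lemma frechet_derivative_affine:
  assumes "smooth f"
  shows "frechet_derivative (\<lambda>x. f (a *\<^sub>R x + b)) (at x) v = a *\<^sub>R frechet_derivative f (at (a *\<^sub>R x + b)) v"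
proof -
  have "((\<lambda>x. a *\<^sub>R x + b) has_derivative (\<lambda>h. a *\<^sub>R h)) (at x)" by (auto intro!: derivative_eq_intros)
  then have "((\<lambda>x. f (a *\<^sub>R x + b)) has_derivative (\<lambda>h. frechet_derivative f (at (a *\<^sub>R x + b)) (a *\<^sub>R h))) (at x)"
    using has_derivative_compose[OF _ smooth_has_derivative[OF assms], of "\<lambda>x. a *\<^sub>R x + b"] by blast
  from frechet_derivative_at[OF this]
  have "frechet_derivative (\<lambda>x. f (a *\<^sub>R x + b)) (at x) v = frechet_derivative f (at (a *\<^sub>R x + b)) (a *\<^sub>R v)"
    by metis
  also have "\<dots> = a *\<^sub>R frechet_derivative f (at (a *\<^sub>R x + b)) v"
    using linear_cmul[OF linear_frechet_derivative[OF smooth_differentiable[OF assms]]] .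
  finally show ?thesis .
qed

subsection \<open>The flat exponential\<close>

text \<open>The flat function exp (-1/t) with a polynomial factor in 1/t. The factor makes the
  family closed under differentiation, so that smoothness follows by induction on the order with p
  arbitrary.\<close>

definition flat_exp :: "real poly \<Rightarrow> real \<Rightarrow> real" where
  "flat_exp p t = (if t > 0 then poly p (1/t) * exp (- (1/t)) else 0)"

lemma poly_exp_tendsto_0: "((\<lambda>s. poly p s * exp (- s)) \<longlongrightarrow> (0::real)) at_top"
proof (induction p)
  case (pCons a p)
  have "((\<lambda>s. a * exp (- s)) \<longlongrightarrow> 0) at_top"
    using tendsto_mult_right_zero[OF tendsto_power_div_exp_0[of 0], of a]
    by (simp add: exp_minus field_simps)
  have p: "((\<lambda>s. s ^ k * exp (- s)) \<longlongrightarrow> (0::real)) at_top" for k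
    using tendsto_power_div_exp_0[of k] by (simp add: exp_minus field_simps)
  have "((\<lambda>s. \<Sum>i\<le>degree (pCons a p). coeff (pCons a p) i * (s ^ i * exp (- s))) \<longlongrightarrow>
     (\<Sum>i\<le>degree (pCons a p). coeff (pCons a p) i * 0)) at_top"
    by (intro tendsto_intros p)
  then show ?case by (simp only: poly_altdef sum_distrib_right mult.assoc mult_zero_right sum.neutral_const)
qed simp

text \<open>In terms of s = 1/t, the derivative of p(s) exp(-s) with respect to t is s^2 (p(s) -
  p'(s)) exp(-s), and \<open>[:0,0,1:]\<close> is the polynomial s^2. At t = 0 the exponential beats
  every polynomial.\<close>

lemma flat_exp_has_derivative:
  "(flat_exp p has_real_derivative flat_exp ([:0,0,1:] * (p - pderiv p)) t) (at t)"
proof -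
  consider "t > 0" | "t < 0" | "t = 0" by linarith
  then show ?thesis
  proof cases
    case 1
    have "((\<lambda>t. poly p (1/t) * exp (- (1/t))) has_real_derivative
        flat_exp ([:0,0,1:] * (p - pderiv p)) t) (at t)"
      using 1 by (auto intro!: derivative_eq_intros DERIV_chain2[OF poly_DERIV]
          simp: flat_exp_def field_simps power2_eq_square)
    then show ?thesis
      by (rule has_field_derivative_transform_within_open[where S="{0<..}"])
         (use 1 in \<open>auto simp: flat_exp_def\<close>)
  next
    case 2
    have "((\<lambda>t::real. 0::real) has_real_derivative flat_exp ([:0,0,1:] * (p - pderiv p)) t) (at t)"
      using 2 by (simp add: flat_exp_def)
    then show ?thesis
      by (rule has_field_derivative_transform_within_open[where S="{..<0}"])
         (use 2 in \<open>auto simp: flat_exp_def\<close>)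
  next
    case 3
    \<comment> \<open>The right difference quotient at 0 is s p(s) exp(-s) with s = 1/h; the
      division by h is the extra factor \<open>[:0,1:]\<close>.\<close>
    have "((\<lambda>h. poly ([:0,1:] * p) (inverse h) * exp (- inverse h)) \<longlongrightarrow> 0) (at_right (0::real))"
      using filterlim_compose[OF poly_exp_tendsto_0 filterlim_inverse_at_top_right, of "[:0,1:] * p"] .
    then have "((\<lambda>h. (flat_exp p (0 + h) - flat_exp p 0) / h) \<longlongrightarrow> 0) (at_right 0)"
      by (rule Lim_transform_eventually)
         (auto simp: flat_exp_def eventually_at_right_field field_simps intro!: exI[of _ 1])
    moreover have "((\<lambda>h. (flat_exp p (0 + h) - flat_exp p 0) / h) \<longlongrightarrow> 0) (at_left 0)"
      by (rule Lim_transform_eventually[OF tendsto_const])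
         (auto simp: flat_exp_def eventually_at_left_field intro!: exI[of _ "-1"])
    ultimately have "((\<lambda>h. (flat_exp p (0 + h) - flat_exp p 0) / h) \<longlongrightarrow> 0) (at 0)"
      by (simp add: filterlim_split_at)
    then show ?thesis using 3 by (simp add: DERIV_def flat_exp_def)
  qed
qed

lemma smooth_flat_exp: "smooth (flat_exp p)"
proof -
  have "C_k k (flat_exp p)" for k
  proof (induction k arbitrary: p)
    case 0
    show ?case using flat_exp_has_derivative[of p]
      by (auto simp: continuous_on_eq_continuous_at intro: DERIV_isCont)
  next
    case (Suc k)
    show ?case
      by (rule C_k_SucI[OF flat_exp_has_derivative[of p, unfolded has_field_derivative_def]])
         (intro C_k_mult Suc.IH C_k_const)
  qed
  then show ?thesis by (simp add: smooth_def)
qed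

subsection \<open>Test functions\<close>

lemma test_functionD:
  assumes "test_function U \<phi>"
  shows "smooth \<phi>" "\<And>x. x \<notin> U \<Longrightarrow> \<phi> x = 0" "compact (closure {x. \<phi> x \<noteq> 0})"
    "continuous_on UNIV \<phi>" "\<phi> \<in> borel_measurable borel"
proof -
  show s: "smooth \<phi>" and "compact (closure {x. \<phi> x \<noteq> 0})"
    using assms by (auto simp: test_function_def)
  show "\<phi> x = 0" if "x \<notin> U" for x
    using assms that closure_subset[of "{x. \<phi> x \<noteq> 0}"] by (auto simp: test_function_def)
  show "continuous_on UNIV \<phi>" using s by (rule smooth_continuous)
  then show "\<phi> \<in> borel_measurable borel" by (rule borel_measurable_continuous_onI)
qed

lemma test_function_mono: "test_function U \<phi> \<Longrightarrow> U \<subseteq> V \<Longrightarrow> test_function V \<phi>"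
  by (auto simp: test_function_def)

lemma continuous_compact_support_bounded:
  fixes f :: "'a::euclidean_space \<Rightarrow> 'b::real_normed_vector"
  assumes "continuous_on UNIV f" "compact (closure {x. f x \<noteq> 0})"
  shows "\<exists>B. \<forall>x. norm (f x) \<le> B"
proof -
  have "bounded (f ` closure {x. f x \<noteq> 0})"
    by (rule compact_imp_bounded[OF compact_continuous_image])
       (use assms continuous_on_subset in auto)
  then obtain B where B: "\<And>y. y \<in> f ` closure {x. f x \<noteq> 0} \<Longrightarrow> norm y \<le> B" and "B > 0"
    unfolding bounded_pos by blast
  have "norm (f x) \<le> B" for x
    using B[of "f x"] \<open>B > 0\<close> closure_subset[of "{x. f x \<noteq> 0}"] by (cases "f x = 0") auto
  then show ?thesis by blast
qed

lemma frechet_derivative_eq_0_outside_support: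
  assumes "x \<notin> closure {x. \<phi> x \<noteq> 0}"
  shows "frechet_derivative \<phi> (at x) v = 0"
proof -
  have "(\<phi> has_derivative (\<lambda>_. 0)) (at x)"
    by (rule has_derivative_transform_within_open[of "\<lambda>_. 0" _ _ _ "- closure {x. \<phi> x \<noteq> 0}"])
       (use assms closure_subset[of "{x. \<phi> x \<noteq> 0}"] in auto)
  from frechet_derivative_at[OF this] show ?thesis by metis
qed

lemma test_function_derivative:
  assumes "test_function U \<phi>"
  shows "test_function U (\<lambda>x. frechet_derivative \<phi> (at x) v)"
proof -
  have sub: "closure {x. frechet_derivative \<phi> (at x) v \<noteq> 0} \<subseteq> closure {x. \<phi> x \<noteq> 0}"
    by (rule closure_minimal) (use frechet_derivative_eq_0_outside_support in \<open>blast+\<close>)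
  have "compact (closure {x. frechet_derivative \<phi> (at x) v \<noteq> 0})"
    using assms sub by (auto simp: test_function_def intro: closed_Int_compact dest: compact_imp_bounded bounded_subset simp: compact_eq_bounded_closed)
  then show ?thesis
    using assms sub by (auto simp: test_function_def smooth_frechet_derivative)
qed

lemma exists_test_function:
  fixes U :: "(real ^ 'n) set"
  assumes "open U" "U \<noteq> {}"
  obtains \<rho> where "test_function U \<rho>" "\<And>x. 0 \<le> \<rho> x" "(\<integral>x. \<rho> x \<partial>lborel) = 1" "integrable lborel \<rho>"
proof -
  obtain c r where r: "r > 0" "cball c r \<subseteq> U"
    using assms open_contains_cball by (metis all_not_in_conv)
  \<comment> \<open>The squared distance keeps the argument of \<open>flat_exp\<close> a quadratic
    polynomial, smooth also at the centre c; it is positive exactly on the open ball.\<close>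
  define g where "g x = r\<^sup>2 - (x - c) \<bullet> (x - c)" for x :: "real ^ 'n"
  define b where "b x = flat_exp 1 (g x)" for x
  have b_eq: "b x = (if dist x c < r then exp (- (1 / g x)) else 0)" for x
  proof -
    have "g x > 0 \<longleftrightarrow> dist x c < r"
      using r(1) by (auto simp: g_def dist_norm power2_norm_eq_inner[symmetric] abs_le_square_iff[symmetric]
          power2_eq_iff_nonneg not_less[symmetric] intro: power_strict_mono power_less_imp_less_base)
    then show ?thesis by (simp add: b_def flat_exp_def)
  qed
  have "C_k k g" for k
  proof -
    have "C_k k (\<lambda>x. r\<^sup>2 + (-1) * ((1 *\<^sub>R x + (-c)) \<bullet> (1 *\<^sub>R x + (-c))))"
      by (intro C_k_add C_k_const C_k_mult C_k_inner C_k_affine[where f="\<lambda>x. x"] C_k_bounded_linear bounded_linear_ident)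
    then show ?thesis by (simp add: g_def[abs_def])
  qed
  then have sb: "smooth b" unfolding b_def[abs_def] smooth_def
    using C_k_compose_real[OF smooth_flat_exp] by blast
  have supp: "closure {x. b x \<noteq> 0} \<subseteq> cball c r"
    by (rule closure_minimal) (auto simp: b_eq dist_commute split: if_splits)
  have test: "test_function U b"
    using sb supp r by (auto simp: test_function_def compact_eq_bounded_closed intro: bounded_subset)
  have cont: "continuous_on UNIV b" using sb by (rule smooth_continuous)
  have nn: "b x \<ge> 0" for x by (auto simp: b_eq)
  have int: "integrable lborel b"
  proof -
    have "integrable lborel (\<lambda>x. indicator (cball c r) x *\<^sub>R b x)"
      by (rule borel_integrable_compact) (use cont continuous_on_subset in auto)
    moreover have "(\<lambda>x. indicator (cball c r) x *\<^sub>R b x) = b"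
      by (auto simp: fun_eq_iff b_eq indicator_def dist_commute)
    ultimately show ?thesis by simp
  qed
  have "(\<integral>x. b x \<partial>lborel) \<noteq> 0"
  proof
    assume "(\<integral>x. b x \<partial>lborel) = 0"
    then have "AE x in lborel. b x = 0"
      using integral_nonneg_eq_0_iff_AE[OF int] nn by simp
    then have "AE x in lborel. x \<notin> ball c r"
      by eventually_elim (auto simp: b_eq dist_commute split: if_splits)
    then have "emeasure lborel (ball c r) = 0"
      by (subst (asm) AE_iff_null_sets[symmetric]) auto
    moreover have "emeasure lborel (ball c r) \<noteq> 0"
      using r(1) emeasure_lborel_ball_finite open_not_negligible[of "ball c r"]
      by (auto simp: negligible_iff_null_sets null_sets_completion_iff null_sets_def)
    ultimately show False by simp
  qed
  then have I: "(\<integral>x. b x \<partial>lborel) > 0"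
    using integral_nonneg_AE[of b lborel] nn by (simp add: less_le)
  define m where "m = (\<integral>x. b x \<partial>lborel)"
  show ?thesis
  proof (rule that[of "\<lambda>x. inverse m *\<^sub>R b x"])
    have "{x. inverse m *\<^sub>R b x \<noteq> 0} = {x. b x \<noteq> 0}" using I by (auto simp: m_def)
    then show "test_function U (\<lambda>x. inverse m *\<^sub>R b x)"
      using test unfolding test_function_def by (auto intro: smooth_scaleR_const[where 'b=real, simplified])
    show "0 \<le> inverse m *\<^sub>R b x" for x using I nn by (simp add: m_def)
    show "(\<integral>x. inverse m *\<^sub>R b x \<partial>lborel) = 1" using I by (simp add: m_def)
    show "integrable lborel (\<lambda>x. inverse m *\<^sub>R b x)" using int by simp
  qed
qed

section \<open>Differentiation under the integral sign\<close>

lemma test_function_UNIV_scale: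
  "test_function UNIV \<eta> \<Longrightarrow> test_function UNIV (\<lambda>x. c * \<eta> x)"
proof -
  assume t: "test_function UNIV \<eta>"
  have "closure {x. c * \<eta> x \<noteq> 0} \<subseteq> closure {x. \<eta> x \<noteq> 0}" by (intro closure_mono) auto
  then have "compact (closure {x. c * \<eta> x \<noteq> 0})"
    using t by (auto simp: test_function_def compact_eq_bounded_closed intro: bounded_subset)
  then show ?thesis using t smooth_scaleR_const[of \<eta> c] by (simp add: test_function_def)
qed

lemma test_function_bounded:
  assumes "test_function U \<phi>" shows "\<exists>B\<ge>0. \<forall>x. \<bar>\<phi> x\<bar> \<le> B"
proof -
  obtain B where "\<forall>x. norm (\<phi> x) \<le> B"
    using continuous_compact_support_bounded[OF test_functionD(4,3)[OF assms]] by blast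
  moreover from this have "B \<ge> 0" using norm_ge_zero[of "\<phi> 0"] by (meson order_trans)
  ultimately show ?thesis by auto
qed

lemma linear_eq_sum_Basis:
  fixes f :: "'a::euclidean_space \<Rightarrow> real"
  assumes "linear f" shows "f v = (\<Sum>b\<in>Basis. (v \<bullet> b) * f b)"
proof -
  have "f v = f (\<Sum>b\<in>Basis. (v \<bullet> b) *\<^sub>R b)" by (simp add: euclidean_representation)
  then show ?thesis by (simp add: linear_sum[OF assms] linear_cmul[OF assms])
qed

lemma test_function_derivative_bounded:
  fixes \<phi> :: "real ^ 'n \<Rightarrow> real"
  assumes "test_function U \<phi>"
  shows "\<exists>B\<ge>0. \<forall>x v. \<bar>frechet_derivative \<phi> (at x) v\<bar> \<le> B * norm v"
proof -
  have "\<forall>e. \<exists>B\<ge>0. \<forall>x. \<bar>frechet_derivative \<phi> (at x) e\<bar> \<le> B"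
    using test_function_bounded[OF test_function_derivative[OF assms]] by blast
  then obtain B where B: "\<And>e. B e \<ge> 0" "\<And>e x. \<bar>frechet_derivative \<phi> (at x) e\<bar> \<le> B e"
    by metis
  have "\<bar>frechet_derivative \<phi> (at x) v\<bar> \<le> (\<Sum>e\<in>Basis. B e) * norm v" for x v
  proof -
    have lin: "linear (frechet_derivative \<phi> (at x))"
      by (rule linear_frechet_derivative[OF smooth_differentiable[OF test_functionD(1)[OF assms]]])
    have "frechet_derivative \<phi> (at x) v = (\<Sum>e\<in>Basis. (v \<bullet> e) * frechet_derivative \<phi> (at x) e)"
      by (rule linear_eq_sum_Basis[OF lin])
    also have "\<bar>\<dots>\<bar> \<le> (\<Sum>e\<in>Basis. \<bar>(v \<bullet> e) * frechet_derivative \<phi> (at x) e\<bar>)" by (rule sum_abs)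
    also have "\<dots> \<le> (\<Sum>e\<in>Basis. norm v * B e)"
      using B by (intro sum_mono) (auto simp: abs_mult intro!: mult_mono Basis_le_norm)
    finally show ?thesis by (simp add: sum_distrib_left mult.commute)
  qed
  then show ?thesis using B(1) by (intro exI[of _ "\<Sum>e\<in>Basis. B e"]) (auto intro: sum_nonneg)
qed

lemma test_function_Lipschitz:
  fixes \<phi> :: "real ^ 'n \<Rightarrow> real"
  assumes "test_function U \<phi>"
  shows "\<exists>B\<ge>0. \<forall>x y. \<bar>\<phi> x - \<phi> y\<bar> \<le> B * norm (x - y)"
proof -
  obtain B where B: "B \<ge> 0" "\<And>x v. \<bar>frechet_derivative \<phi> (at x) v\<bar> \<le> B * norm v"
    using test_function_derivative_bounded[OF assms] by blast
  have "norm (\<phi> x - \<phi> y) \<le> B * norm (x - y)" for x y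
  proof (rule differentiable_bound[OF convex_UNIV])
    show "(\<phi> has_derivative frechet_derivative \<phi> (at x)) (at x within UNIV)" for x
      using smooth_has_derivative[OF test_functionD(1)[OF assms]] by simp
    show "onorm (frechet_derivative \<phi> (at x)) \<le> B" for x
      using B by (intro onorm_bound) auto
  qed auto
  then show ?thesis using B(1) by auto
qed

text \<open>The remainder bound is uniform in the base point u: every partial derivative is again a
  test function and hence Lipschitz, which bounds the change of the derivative along the segment
  from u to u + k.\<close>

lemma test_function_Taylor:
  fixes \<phi> :: "real ^ 'n \<Rightarrow> real"
  assumes "test_function U \<phi>"
  shows "\<exists>B\<ge>0. \<forall>u k. \<bar>\<phi> (u + k) - \<phi> u - frechet_derivative \<phi> (at u) k\<bar> \<le> B * (norm k)\<^sup>2"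
proof -
  have "\<forall>e. \<exists>B\<ge>0. \<forall>x y. \<bar>frechet_derivative \<phi> (at x) e - frechet_derivative \<phi> (at y) e\<bar> \<le> B * norm (x - y)"
    using test_function_Lipschitz[OF test_function_derivative[OF assms]] by blast
  then obtain B where B: "\<And>e. B e \<ge> 0"
    "\<And>e x y. \<bar>frechet_derivative \<phi> (at x) e - frechet_derivative \<phi> (at y) e\<bar> \<le> B e * norm (x - y)"
    by metis
  define C where "C = (\<Sum>e\<in>Basis. B e)"
  have "C \<ge> 0" unfolding C_def using B by (auto intro: sum_nonneg)
  have lin: "linear (frechet_derivative \<phi> (at x))" for x
    by (rule linear_frechet_derivative[OF smooth_differentiable[OF test_functionD(1)[OF assms]]])
  have D: "\<bar>frechet_derivative \<phi> (at x) v - frechet_derivative \<phi> (at y) v\<bar> \<le> C * norm (x - y) * norm v" for x y v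
  proof -
    have "frechet_derivative \<phi> (at x) v = (\<Sum>e\<in>Basis. (v \<bullet> e) * frechet_derivative \<phi> (at x) e)" for x
      by (rule linear_eq_sum_Basis[OF lin])
    then have "\<bar>frechet_derivative \<phi> (at x) v - frechet_derivative \<phi> (at y) v\<bar> =
        \<bar>\<Sum>e\<in>Basis. (v \<bullet> e) * (frechet_derivative \<phi> (at x) e - frechet_derivative \<phi> (at y) e)\<bar>"
      by (simp add: sum_subtractf algebra_simps)
    also have "\<dots> \<le> (\<Sum>e\<in>Basis. \<bar>(v \<bullet> e) * (frechet_derivative \<phi> (at x) e - frechet_derivative \<phi> (at y) e)\<bar>)"
      by (rule sum_abs)
    also have "\<dots> \<le> (\<Sum>e\<in>Basis. norm v * (B e * norm (x - y)))"
      unfolding abs_mult using B by (intro sum_mono mult_mono Basis_le_norm) auto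
    also have "\<dots> = C * norm (x - y) * norm v"
      by (simp add: C_def sum_distrib_right sum_distrib_left mult_ac)
    finally show ?thesis .
  qed
  have "\<bar>\<phi> (u + k) - \<phi> u - frechet_derivative \<phi> (at u) k\<bar> \<le> C * (norm k)\<^sup>2" for u k
  proof -
    have "norm (\<phi> (u + k) - \<phi> u - frechet_derivative \<phi> (at u) ((u + k) - u)) \<le> norm ((u + k) - u) * (C * norm k)"
    proof (rule differentiable_bound_linearization[where S="closed_segment u (u+k)"])
      show "u + t *\<^sub>R (u + k - u) \<in> closed_segment u (u + k)" if "t \<in> {0..1}" for t
        using that unfolding in_segment by (intro exI[of _ t]) (auto simp: algebra_simps)
      show "(\<phi> has_derivative frechet_derivative \<phi> (at x)) (at x within closed_segment u (u + k))" for x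
        using smooth_has_derivative[OF test_functionD(1)[OF assms]] has_derivative_at_withinI by blast
      show "onorm (frechet_derivative \<phi> (at x) - frechet_derivative \<phi> (at u)) \<le> C * norm k"
        if x: "x \<in> closed_segment u (u + k)" for x
      proof (rule onorm_bound)
        show "0 \<le> C * norm k" using \<open>C \<ge> 0\<close> by simp
        fix v :: "real ^ 'n"
        have "norm (x - u) \<le> norm k" using segment_bound1[OF x] by simp
        then have "C * norm (x - u) * norm v \<le> C * norm k * norm v"
          using \<open>C \<ge> 0\<close> by (intro mult_right_mono mult_left_mono) auto
        then show "norm ((frechet_derivative \<phi> (at x) - frechet_derivative \<phi> (at u)) v) \<le> C * norm k * norm v"
          using D[of x v u] by simp
      qed
    qed auto
    then show ?thesis by (simp add: power2_eq_square mult_ac)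
  qed
  then show ?thesis using \<open>C \<ge> 0\<close> by blast
qed

lemma integrable_test_function_mult:
  fixes f :: "real ^ 'n \<Rightarrow> 'b::euclidean_space"
  assumes \<eta>: "test_function U \<eta>" and f: "integrable lborel f"
  shows "integrable lborel (\<lambda>y. \<eta> (a *\<^sub>R y + c) *\<^sub>R f y)"
proof -
  obtain B where B: "B \<ge> 0" "\<And>x. \<bar>\<eta> x\<bar> \<le> B" using test_function_bounded[OF \<eta>] by blast
  note [measurable] = test_functionD(5)[OF \<eta>]
  show ?thesis
  proof (rule Bochner_Integration.integrable_bound)
    show "integrable lborel (\<lambda>y. B *\<^sub>R f y)" using f by simp
    show "AE y in lborel. norm (\<eta> (a *\<^sub>R y + c) *\<^sub>R f y) \<le> norm (B *\<^sub>R f y)"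
      using B by (auto intro!: mult_right_mono)
  qed (use f in auto)
qed

text \<open>The argument a y + b x covers both the dilated averages and the plain translations y + x
  and y - x used later. The uniform Taylor bound of the kernel is integrated against the norm of f,
  so all smoothness comes from the kernel.\<close>

lemma has_derivative_convolution:
  fixes f :: "real ^ 'n \<Rightarrow> 'b::euclidean_space"
  assumes \<eta>: "test_function U \<eta>" and f: "integrable lborel f"
  shows "((\<lambda>x. \<integral>y. \<eta> (a *\<^sub>R y + b *\<^sub>R x) *\<^sub>R f y \<partial>lborel) has_derivative
      (\<lambda>v. \<integral>y. (b * frechet_derivative \<eta> (at (a *\<^sub>R y + b *\<^sub>R x)) v) *\<^sub>R f y \<partial>lborel)) (at x)"
    (is "(?V has_derivative ?D) _")
proof -
  obtain B where B: "B \<ge> 0" "\<And>u k. \<bar>\<eta> (u + k) - \<eta> u - frechet_derivative \<eta> (at u) k\<bar> \<le> B * (norm k)\<^sup>2"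
    using test_function_Taylor[OF \<eta>] by blast
  have lin: "linear (frechet_derivative \<eta> (at x))" for x
    by (rule linear_frechet_derivative[OF smooth_differentiable[OF test_functionD(1)[OF \<eta>]]])
  have i0: "integrable lborel (\<lambda>y. \<eta> (a *\<^sub>R y + b *\<^sub>R x) *\<^sub>R f y)" for x
    by (rule integrable_test_function_mult[OF \<eta> f])
  have i1: "integrable lborel (\<lambda>y. (b * frechet_derivative \<eta> (at (a *\<^sub>R y + b *\<^sub>R x)) v) *\<^sub>R f y)" for v
    using integrable_test_function_mult[OF test_function_derivative[OF \<eta>, of v] f, of a "b *\<^sub>R x"]
    by (simp flip: scaleR_scaleR)
  have "linear ?D"
  proof (rule linearI)
    show "?D (u + v) = ?D u + ?D v" for u v
      using i1 by (simp add: linear_add[OF lin] algebra_simps)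
    show "?D (c *\<^sub>R v) = c *\<^sub>R ?D v" for c v
      by (simp add: linear_cmul[OF lin] flip: integral_scaleR_right) (simp add: mult_ac)
  qed
  then have bl: "bounded_linear ?D" by (simp add: linear_conv_bounded_linear)
  define C where "C = B * b\<^sup>2 * (\<integral>y. norm (f y) \<partial>lborel)"
  have est: "norm (?V z - ?V x - ?D (z - x)) \<le> C * (norm (z - x))\<^sup>2" for z
  proof -
    have "?V z - ?V x - ?D (z - x) = (\<integral>y. (\<eta> (a *\<^sub>R y + b *\<^sub>R z) - \<eta> (a *\<^sub>R y + b *\<^sub>R x)
        - b * frechet_derivative \<eta> (at (a *\<^sub>R y + b *\<^sub>R x)) (z - x)) *\<^sub>R f y \<partial>lborel)"
      using i0 i1 by (simp add: scaleR_diff_left)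
    also have "norm \<dots> \<le> (\<integral>y. (B * b\<^sup>2 * (norm (z - x))\<^sup>2) * norm (f y) \<partial>lborel)"
    proof (rule Bochner_Integration.integral_norm_bound_integral)
      show "integrable lborel (\<lambda>y. (\<eta> (a *\<^sub>R y + b *\<^sub>R z) - \<eta> (a *\<^sub>R y + b *\<^sub>R x)
        - b * frechet_derivative \<eta> (at (a *\<^sub>R y + b *\<^sub>R x)) (z - x)) *\<^sub>R f y)"
        using i0 i1 by (simp add: scaleR_diff_left)
      show "integrable lborel (\<lambda>y. (B * b\<^sup>2 * (norm (z - x))\<^sup>2) * norm (f y))" using f by simp
      fix y
      have z: "a *\<^sub>R y + b *\<^sub>R z = (a *\<^sub>R y + b *\<^sub>R x) + b *\<^sub>R (z - x)"
        by (simp add: algebra_simps)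
      have "\<bar>\<eta> (a *\<^sub>R y + b *\<^sub>R z) - \<eta> (a *\<^sub>R y + b *\<^sub>R x)
        - b * frechet_derivative \<eta> (at (a *\<^sub>R y + b *\<^sub>R x)) (z - x)\<bar> \<le> B * b\<^sup>2 * (norm (z - x))\<^sup>2"
        using B(2)[of "a *\<^sub>R y + b *\<^sub>R x" "b *\<^sub>R (z - x)"] unfolding z[symmetric] linear_cmul[OF lin]
        by (simp only: norm_scaleR power_mult_distrib power2_abs real_scaleR_def mult.assoc)
      then show "norm ((\<eta> (a *\<^sub>R y + b *\<^sub>R z) - \<eta> (a *\<^sub>R y + b *\<^sub>R x)
        - b * frechet_derivative \<eta> (at (a *\<^sub>R y + b *\<^sub>R x)) (z - x)) *\<^sub>R f y)
        \<le> (B * b\<^sup>2 * (norm (z - x))\<^sup>2) * norm (f y)"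
        by (simp add: mult_right_mono)
    qed
    also have "\<dots> = C * (norm (z - x))\<^sup>2" by (simp add: C_def)
    finally show ?thesis .
  qed
  show ?thesis unfolding has_derivative_iff_norm
  proof (intro conjI bl)
    show "((\<lambda>z. norm (?V z - ?V x - ?D (z - x)) / norm (z - x)) \<longlongrightarrow> 0) (at x)"
    proof (rule Lim_null_comparison)
      show "\<forall>\<^sub>F z in at x. norm (norm (?V z - ?V x - ?D (z - x)) / norm (z - x)) \<le> C * norm (z - x)"
      proof (rule always_eventually, rule allI)
        fix z show "norm (norm (?V z - ?V x - ?D (z - x)) / norm (z - x)) \<le> C * norm (z - x)"
          using est[of z] by (cases "z = x") (auto simp: divide_simps power2_eq_square mult_ac)
      qed
      have "((\<lambda>z. C * norm (z - x)) \<longlongrightarrow> C * norm (x - x)) (at x)" by (intro tendsto_intros)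
      then show "((\<lambda>z. C * norm (z - x)) \<longlongrightarrow> 0) (at x)" by simp
    qed
  qed
qed

text \<open>Each directional derivative is a convolution of the same shape whose kernel is again a
  test function, so the induction generalises over the kernel.\<close>

lemma smooth_convolution:
  fixes f :: "real ^ 'n \<Rightarrow> 'b::euclidean_space"
  assumes \<eta>: "test_function UNIV \<eta>" and f: "integrable lborel f"
  shows "smooth (\<lambda>x. \<integral>y. \<eta> (a *\<^sub>R y + b *\<^sub>R x) *\<^sub>R f y \<partial>lborel)"
proof -
  have "C_k k (\<lambda>x. \<integral>y. \<eta> (a *\<^sub>R y + b *\<^sub>R x) *\<^sub>R f y \<partial>lborel)" for k
    using \<eta>
  proof (induction k arbitrary: \<eta>)
    case 0
    then show ?case
      using has_derivative_continuous[OF has_derivative_convolution[OF 0 f, of a b]]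
      unfolding C_k.simps continuous_on_eq_continuous_at[OF open_UNIV] by blast
  next
    case (Suc k)
    show ?case
      by (rule C_k_SucI[OF has_derivative_convolution[OF Suc.prems f]])
         (rule Suc.IH[OF test_function_UNIV_scale[OF test_function_derivative[OF Suc.prems]]])
  qed
  then show ?thesis by (simp add: smooth_def)
qed

lemma frechet_derivative_convolution:
  fixes f :: "real ^ 'n \<Rightarrow> 'b::euclidean_space"
  assumes \<eta>: "test_function U \<eta>" and f: "integrable lborel f"
  shows "frechet_derivative (\<lambda>x. \<integral>y. \<eta> (a *\<^sub>R y + b *\<^sub>R x) *\<^sub>R f y \<partial>lborel) (at x) v =
      (\<integral>y. (b * frechet_derivative \<eta> (at (a *\<^sub>R y + b *\<^sub>R x)) v) *\<^sub>R f y \<partial>lborel)"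
  by (rule fun_cong[OF frechet_derivative_at[OF has_derivative_convolution[OF assms]], symmetric])

lemma integral_lborel_affine:
  fixes f :: "'a::euclidean_space \<Rightarrow> 'b::{banach, second_countable_topology}"
  assumes [measurable]: "f \<in> borel_measurable borel" and c: "c \<noteq> 0"
  shows "(\<integral>x. f x \<partial>lborel) = \<bar>c\<bar> ^ DIM('a) *\<^sub>R (\<integral>x. f (t + c *\<^sub>R x) \<partial>lborel)"
  by (subst lborel_affine[OF c, of t])
     (simp add: integral_density integral_distr)

lemma nn_integral_lborel_affine:
  fixes f :: "'a::euclidean_space \<Rightarrow> ennreal"
  assumes [measurable]: "f \<in> borel_measurable borel" and c: "c \<noteq> 0"
  shows "(\<integral>\<^sup>+x. f x \<partial>lborel) = ennreal (\<bar>c\<bar> ^ DIM('a)) * (\<integral>\<^sup>+x. f (t + c *\<^sub>R x) \<partial>lborel)"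
  by (subst lborel_affine[OF c, of t])
     (simp add: nn_integral_density nn_integral_distr nn_integral_cmult)

section \<open>Density of smooth functions\<close>

lemma AE_lebesgue_on_negligible:
  assumes "negligible N" "U \<in> sets lebesgue"
  shows "AE x in lebesgue_on U. x \<notin> N"
  using assms by (auto simp: AE_restrict_space_iff negligible_iff_null_sets intro: AE_not_in eventually_mono[OF AE_not_in])

lemma L2_dominated:
  fixes f :: "'a \<Rightarrow> 'b::euclidean_space" and G :: "'a \<Rightarrow> real"
  assumes [measurable]: "\<And>k. s k \<in> borel_measurable M" "f \<in> borel_measurable M"
    and G: "L2_fun M G" and lim: "AE x in M. (\<lambda>k. s k x) \<longlonglongrightarrow> f x"
    and bd: "\<And>k. AE x in M. norm (s k x - f x) \<le> G x"
  shows "(\<lambda>k. L2_norm M (\<lambda>x. s k x - f x)) \<longlonglongrightarrow> 0"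
proof -
  have "(\<lambda>k. \<integral>x. (norm (s k x - f x))\<^sup>2 \<partial>M) \<longlonglongrightarrow> (\<integral>x. 0 \<partial>M)"
  proof (rule integral_dominated_convergence[where w="\<lambda>x. (norm (G x))\<^sup>2"])
    show "integrable M (\<lambda>x. (norm (G x))\<^sup>2)" using G by (simp add: L2_fun_def)
    show "AE x in M. (\<lambda>k. (norm (s k x - f x))\<^sup>2) \<longlonglongrightarrow> 0"
      using lim
    proof eventually_elim
      case (elim x)
      have "(\<lambda>k. (norm (s k x - f x))\<^sup>2) \<longlonglongrightarrow> (norm (f x - f x))\<^sup>2" by (intro tendsto_intros elim)
      then show ?case by simp
    qed
    show "AE x in M. norm ((norm (s k x - f x))\<^sup>2) \<le> (norm (G x))\<^sup>2" for k
      using bd[of k] by eventually_elim (simp add: power_mono order_trans[OF norm_ge_zero])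
  qed auto
  from tendsto_real_sqrt[OF this] show ?thesis by (simp add: L2_norm_def)
qed

text \<open>Truncation makes f bounded; continuous functions then approximate it pointwise almost
  everywhere, and once their values are confined to a fixed ball, dominated convergence with a
  constant bound gives L2 convergence.\<close>

lemma L2_approx_continuous:
  fixes f :: "'a::euclidean_space \<Rightarrow> 'b::euclidean_space"
  assumes U: "U \<in> lmeasurable" and f: "L2_fun (lebesgue_on U) f" and e: "e > 0"
  shows "\<exists>g. continuous_on UNIV g \<and> L2_fun (lebesgue_on U) g \<and> L2_norm (lebesgue_on U) (\<lambda>x. f x - g x) < e"
proof -
  interpret finite_measure "lebesgue_on U" by (rule finite_measure_lebesgue_on[OF U])
  note fm [measurable] = L2_funD(1)[OF f]
  have Us: "U \<in> sets lebesgue" using U by auto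
  define t where "t N x = (if norm (f x) \<le> real N then f x else 0)" for N :: nat and x
  have tm [measurable]: "t N \<in> borel_measurable (lebesgue_on U)" for N unfolding t_def by measurable
  have tb: "norm (t N x) \<le> real N" for N x by (simp add: t_def)
  have t2: "L2_fun (lebesgue_on U) (t N)" for N by (rule L2_fun_bounded) (use tb in auto)
  have "(\<lambda>N. L2_norm (lebesgue_on U) (\<lambda>x. t N x - f x)) \<longlonglongrightarrow> 0"
  proof (rule L2_dominated[where G="\<lambda>x. norm (f x)"])
    show "L2_fun (lebesgue_on U) (\<lambda>x. norm (f x))" using f by (simp add: L2_fun_def)
    show "AE x in lebesgue_on U. (\<lambda>N. t N x) \<longlonglongrightarrow> f x"
    proof (rule AE_I2)
      fix x
      obtain N0 where "norm (f x) \<le> real N0" using real_arch_simple by blast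
      then have "t N x = f x" if "N \<ge> N0" for N using that by (auto simp: t_def)
      then show "(\<lambda>N. t N x) \<longlonglongrightarrow> f x"
        by (intro tendsto_eventually) (auto simp: eventually_sequentially)
    qed
  qed (auto simp: t_def)
  from LIMSEQ_D[OF this, of "e/2"] e obtain N where N: "L2_norm (lebesgue_on U) (\<lambda>x. t N x - f x) < e/2"
    by auto
  have "(\<lambda>x. if x \<in> U then t N x else 0) \<in> borel_measurable lebesgue"
    by (rule borel_measurable_if_I[OF tm Us])
  then have "(\<lambda>x. if x \<in> U then t N x else 0) measurable_on UNIV"
    by (rule lebesgue_measurable_imp_measurable_on) auto
  then obtain Z g where Z: "negligible Z" and g: "\<And>n. continuous_on UNIV (g n)"
    and lim: "\<And>x. x \<notin> Z \<Longrightarrow> (\<lambda>n. g n x) \<longlonglongrightarrow> (if x \<in> U then t N x else 0)"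
    unfolding measurable_on_def by auto
  \<comment> \<open>Projection onto the ball of radius N: continuous, bounded, and the identity on
    the values of \<open>t N\<close>, so it preserves the pointwise limit while supplying the
    dominating constant.\<close>
  define P where "P = closest_point (cball (0::'b) (real N))"
  have Pc: "continuous_on UNIV P" unfolding P_def by (rule continuous_on_closest_point) auto
  have Pb: "norm (P y) \<le> real N" for y
    using closest_point_in_set[of "cball (0::'b) (real N)" y] by (simp add: P_def)
  have Pid: "P y = y" if "norm y \<le> real N" for y
    unfolding P_def by (rule closest_point_self) (use that in simp)
  have hc: "continuous_on UNIV (\<lambda>x. P (g n x))" for n
    by (rule continuous_on_compose2[OF Pc g]) auto
  have hm [measurable]: "(\<lambda>x. P (g n x)) \<in> borel_measurable (lebesgue_on U)" for n
    by (rule continuous_imp_measurable_on_sets_lebesgue[OF continuous_on_subset[OF hc] Us]) auto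
  have "(\<lambda>n. L2_norm (lebesgue_on U) (\<lambda>x. P (g n x) - t N x)) \<longlonglongrightarrow> 0"
  proof (rule L2_dominated[where G="\<lambda>x. 2 * real N"])
    show "L2_fun (lebesgue_on U) (\<lambda>x. 2 * real N)" by (rule L2_fun_bounded) auto
    show "AE x in lebesgue_on U. (\<lambda>n. P (g n x)) \<longlonglongrightarrow> t N x"
    proof -
      have "AE x in lebesgue_on U. x \<in> U" by (rule AE_I2) simp
      with AE_lebesgue_on_negligible[OF Z Us] show ?thesis
      proof eventually_elim
        case (elim x)
        have "(\<lambda>n. P (g n x)) \<longlonglongrightarrow> P (t N x)"
          using lim[of x] elim Pc by (intro continuous_on_tendsto_compose[OF Pc]) auto
        then show ?case using Pid[OF tb] by simp
      qed
    qed
    show "AE x in lebesgue_on U. norm (P (g n x) - t N x) \<le> 2 * real N" for n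
    proof (rule AE_I2)
      fix x show "norm (P (g n x) - t N x) \<le> 2 * real N"
        using norm_triangle_ineq4[of "P (g n x)" "t N x"] Pb[of "g n x"] tb[of N x] by linarith
    qed
  qed auto
  from LIMSEQ_D[OF this, of "e/2"] e obtain n where n: "L2_norm (lebesgue_on U) (\<lambda>x. P (g n x) - t N x) < e/2"
    by auto
  have g2: "L2_fun (lebesgue_on U) (\<lambda>x. P (g n x))" by (rule L2_fun_bounded) (use Pb in auto)
  have "L2_norm (lebesgue_on U) (\<lambda>x. f x - P (g n x)) \<le>
      L2_norm (lebesgue_on U) (\<lambda>x. f x - t N x) + L2_norm (lebesgue_on U) (\<lambda>x. t N x - P (g n x))"
    by (rule L2_norm_triangle_diff[OF f t2 g2])
  also have "\<dots> < e"
    using N n by (simp add: L2_norm_minus_commute[of _ f] L2_norm_minus_commute[of _ "t N" "\<lambda>x. P (g n x)"])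
  finally show ?thesis using g2 hc by blast
qed

text \<open>If \<rho> is supported in U, this averages f over the shrunken copy (1 - \<epsilon>) x +
  \<epsilon> U. For x in a convex U that copy stays inside U, however close x is to the
  boundary.\<close>

definition conv_average ::
  "('a::euclidean_space \<Rightarrow> real) \<Rightarrow> real \<Rightarrow> ('a \<Rightarrow> 'b::euclidean_space) \<Rightarrow> 'a \<Rightarrow> 'b" where
  "conv_average \<rho> \<epsilon> f x = (\<integral>z. \<rho> z *\<^sub>R f ((1 - \<epsilon>) *\<^sub>R x + \<epsilon> *\<^sub>R z) \<partial>lborel)"

lemma conv_average_measurable [measurable]:
  assumes [measurable]: "\<rho> \<in> borel_measurable borel" "f \<in> borel_measurable borel"
  shows "conv_average \<rho> \<epsilon> f \<in> borel_measurable borel"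
  unfolding conv_average_def[abs_def] by measurable

text \<open>\<rho> is the density of a probability measure P and the average is an expectation under
  P, so the squared deviation from c is at most the expected squared deviation. An infinite
  right-hand side, the only case in which f might fail to be integrable along the average, is
  trivial.\<close>

lemma conv_average_Jensen:
  fixes f :: "'a::euclidean_space \<Rightarrow> 'b::euclidean_space"
  assumes [measurable]: "\<rho> \<in> borel_measurable borel" "f \<in> borel_measurable borel"
    and nn: "\<And>z. 0 \<le> \<rho> z" and int: "integrable lborel \<rho>" "(\<integral>z. \<rho> z \<partial>lborel) = 1"
  shows "ennreal ((norm (conv_average \<rho> \<epsilon> f x - c))\<^sup>2) \<le>
    (\<integral>\<^sup>+z. ennreal (\<rho> z) * ennreal ((norm (f ((1 - \<epsilon>) *\<^sub>R x + \<epsilon> *\<^sub>R z) - c))\<^sup>2) \<partial>lborel)"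
proof -
  define P where "P = density lborel (\<lambda>z. ennreal (\<rho> z))"
  define h where "h z = f ((1 - \<epsilon>) *\<^sub>R x + \<epsilon> *\<^sub>R z) - c" for z
  have hm [measurable]: "h \<in> borel_measurable borel" unfolding h_def by measurable
  have mass: "emeasure P (space P) = 1"
    unfolding P_def by (simp add: emeasure_density nn_integral_eq_integral[OF int(1)] nn int(2))
  then interpret finite_measure P by (intro finite_measureI) simp
  have hP [measurable]: "h \<in> borel_measurable P" by (simp add: P_def)
  have rhs: "(\<integral>\<^sup>+z. ennreal (\<rho> z) * ennreal ((norm (h z))\<^sup>2) \<partial>lborel) = (\<integral>\<^sup>+z. ennreal ((norm (h z))\<^sup>2) \<partial>P)"
    unfolding P_def by (subst nn_integral_density) auto
  show ?thesis
  proof (cases "(\<integral>\<^sup>+z. ennreal ((norm (h z))\<^sup>2) \<partial>P) = \<infinity>")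
    case True then show ?thesis using rhs by (simp add: h_def)
  next
    case False
    have i2: "integrable P (\<lambda>z. (norm (h z))\<^sup>2)"
      by (rule integrableI_nonneg) (use False in \<open>auto simp: less_top\<close>)
    then have h2: "L2_fun P h" by (simp add: L2_fun_def)
    have one: "L2_fun P (\<lambda>_. 1::real)" by (simp add: L2_fun_def)
    have m1: "measure P (space P) = 1" using mass by (simp add: measure_def)
    have n1: "L2_norm P (\<lambda>_. 1::real) = 1" by (simp add: L2_norm_def m1)
    have "integrable P (\<lambda>z. norm (h z))"
      using integrable_inner_L2[of P "\<lambda>z. norm (h z)" "\<lambda>_. 1::real"] h2 one by (simp add: L2_fun_def)
    then have ih: "integrable P h" by (simp add: integrable_norm_iff)
    have "integrable P (\<lambda>z. h z + c)" using ih by simp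
    then have if': "integrable P (\<lambda>z. f ((1 - \<epsilon>) *\<^sub>R x + \<epsilon> *\<^sub>R z))" by (simp add: h_def)
    have "conv_average \<rho> \<epsilon> f x = (\<integral>z. f ((1 - \<epsilon>) *\<^sub>R x + \<epsilon> *\<^sub>R z) \<partial>P)"
      unfolding conv_average_def P_def by (subst integral_density) (auto simp: nn)
    then have "conv_average \<rho> \<epsilon> f x - c = (\<integral>z. h z \<partial>P)"
      using if' by (simp add: h_def m1)
    also have "norm \<dots> \<le> (\<integral>z. norm (h z) \<partial>P)" by (rule integral_norm_bound)
    also have "\<dots> \<le> L2_norm P h" using Cauchy_Schwarz_L2_norm[OF h2 one] n1 by simp
    finally have "(norm (conv_average \<rho> \<epsilon> f x - c))\<^sup>2 \<le> (L2_norm P h)\<^sup>2"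
      by (intro power_mono) auto
    then have "ennreal ((norm (conv_average \<rho> \<epsilon> f x - c))\<^sup>2) \<le> (\<integral>\<^sup>+z. ennreal ((norm (h z))\<^sup>2) \<partial>P)"
      using nn_integral_eq_integral[OF i2] by (simp add: L2_norm_power2 ennreal_leI)
    then show ?thesis using rhs by (simp add: h_def)
  qed
qed

text \<open>Tonelli moves the integral over x inside. The substitution x to (1 - \<epsilon>) x +
  \<epsilon> z scales volume by (1 - \<epsilon>)^d, and \<epsilon> \<le> 1/2 bounds the inverse
  factor by 2^d, uniformly in \<epsilon>.\<close>

lemma conv_average_nn_integral_bound:
  fixes u :: "'a::euclidean_space \<Rightarrow> ennreal"
  assumes [measurable]: "\<rho> \<in> borel_measurable borel" "u \<in> borel_measurable borel"
    and nn: "\<And>z. 0 \<le> \<rho> z" and int: "integrable lborel \<rho>" "(\<integral>z. \<rho> z \<partial>lborel) = 1"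
    and \<epsilon>: "0 \<le> \<epsilon>" "\<epsilon> \<le> 1/2"
  shows "(\<integral>\<^sup>+x. \<integral>\<^sup>+z. ennreal (\<rho> z) * u ((1 - \<epsilon>) *\<^sub>R x + \<epsilon> *\<^sub>R z) \<partial>lborel \<partial>lborel)
    \<le> ennreal (2 ^ DIM('a)) * (\<integral>\<^sup>+x. u x \<partial>lborel)"
proof -
  have "(\<integral>\<^sup>+x. \<integral>\<^sup>+z. ennreal (\<rho> z) * u ((1 - \<epsilon>) *\<^sub>R x + \<epsilon> *\<^sub>R z) \<partial>lborel \<partial>lborel) =
    (\<integral>\<^sup>+z. \<integral>\<^sup>+x. ennreal (\<rho> z) * u ((1 - \<epsilon>) *\<^sub>R x + \<epsilon> *\<^sub>R z) \<partial>lborel \<partial>lborel)"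
    by (rule lborel_pair.Fubini'[symmetric]) measurable
  also have "\<dots> \<le> (\<integral>\<^sup>+z. ennreal (\<rho> z) * (ennreal (2 ^ DIM('a)) * (\<integral>\<^sup>+x. u x \<partial>lborel)) \<partial>lborel)"
  proof (rule nn_integral_mono)
    fix z :: 'a
    have "(\<integral>\<^sup>+x. u x \<partial>lborel) = ennreal (\<bar>1 - \<epsilon>\<bar> ^ DIM('a)) * (\<integral>\<^sup>+x. u (\<epsilon> *\<^sub>R z + (1 - \<epsilon>) *\<^sub>R x) \<partial>lborel)"
      using \<epsilon> by (intro nn_integral_lborel_affine) auto
    also have "\<dots> \<ge> ennreal ((1/2) ^ DIM('a)) * (\<integral>\<^sup>+x. u (\<epsilon> *\<^sub>R z + (1 - \<epsilon>) *\<^sub>R x) \<partial>lborel)"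
      using \<epsilon> by (intro mult_right_mono ennreal_leI power_mono) auto
    finally have "ennreal (2 ^ DIM('a)) * (ennreal ((1/2) ^ DIM('a)) * (\<integral>\<^sup>+x. u (\<epsilon> *\<^sub>R z + (1 - \<epsilon>) *\<^sub>R x) \<partial>lborel))
        \<le> ennreal (2 ^ DIM('a)) * (\<integral>\<^sup>+x. u x \<partial>lborel)"
      by (intro mult_left_mono) auto
    then have "(\<integral>\<^sup>+x. u ((1 - \<epsilon>) *\<^sub>R x + \<epsilon> *\<^sub>R z) \<partial>lborel) \<le> ennreal (2 ^ DIM('a)) * (\<integral>\<^sup>+x. u x \<partial>lborel)"
      by (simp add: mult.assoc[symmetric] ennreal_mult[symmetric] power_mult_distrib[symmetric] add.commute)
    then show "(\<integral>\<^sup>+x. ennreal (\<rho> z) * u ((1 - \<epsilon>) *\<^sub>R x + \<epsilon> *\<^sub>R z) \<partial>lborel)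
        \<le> ennreal (\<rho> z) * (ennreal (2 ^ DIM('a)) * (\<integral>\<^sup>+x. u x \<partial>lborel))"
      by (subst nn_integral_cmult) (auto intro: mult_left_mono)
  qed
  also have "\<dots> = ennreal (2 ^ DIM('a)) * (\<integral>\<^sup>+x. u x \<partial>lborel)"
    using int nn by (subst nn_integral_multc) (auto simp: nn_integral_eq_integral)
  finally show ?thesis .
qed

section \<open>L2 bounds obtained from extended nonnegative integrals\<close>

lemma nn_integral_lebesgue_on:
  assumes [measurable]: "U \<in> sets borel"
  shows "(\<integral>\<^sup>+x. h x \<partial>lebesgue_on U) = (\<integral>\<^sup>+x. h x * indicator U x \<partial>lborel)"
  by (subst nn_integral_restrict_space) (auto simp: nn_integral_completion)

lemma measurable_lebesgue_on:
  "f \<in> borel_measurable borel \<Longrightarrow> f \<in> borel_measurable (lebesgue_on U)"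
  by (intro measurable_restrict_space1 measurable_completion) simp

lemma L2_lebesgue_onI:
  fixes h :: "'a::euclidean_space \<Rightarrow> 'b::euclidean_space"
  assumes h: "h \<in> borel_measurable borel" and U: "U \<in> sets borel" and B: "B \<ge> 0"
    and le: "(\<integral>\<^sup>+x. ennreal ((norm (h x))\<^sup>2) * indicator U x \<partial>lborel) \<le> ennreal (B\<^sup>2)"
  shows "L2_fun (lebesgue_on U) h" "L2_norm (lebesgue_on U) h \<le> B"
proof -
  note [measurable] = measurable_lebesgue_on[OF h, of U]
  have le': "(\<integral>\<^sup>+x. ennreal ((norm (h x))\<^sup>2) \<partial>lebesgue_on U) \<le> ennreal (B\<^sup>2)"
    using le by (simp add: nn_integral_lebesgue_on[OF U])
  have i: "integrable (lebesgue_on U) (\<lambda>x. (norm (h x))\<^sup>2)"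
    by (rule integrableI_nonneg) (use le' in \<open>auto simp: le_less_trans\<close>)
  then show "L2_fun (lebesgue_on U) h" by (simp add: L2_fun_def)
  have "(\<integral>x. (norm (h x))\<^sup>2 \<partial>lebesgue_on U) \<le> B\<^sup>2"
    using le' by (subst (asm) nn_integral_eq_integral[OF i]) (auto simp: ennreal_le_iff)
  then show "L2_norm (lebesgue_on U) h \<le> B"
    unfolding L2_norm_def using B by (simp add: real_le_lsqrt)
qed

lemma nn_integral_L2_norm:
  fixes h :: "'a::euclidean_space \<Rightarrow> 'b::euclidean_space"
  assumes "L2_fun (lebesgue_on U) h" "U \<in> sets borel"
  shows "(\<integral>\<^sup>+x. ennreal ((norm (h x))\<^sup>2) * indicator U x \<partial>lborel) = ennreal ((L2_norm (lebesgue_on U) h)\<^sup>2)"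
  using nn_integral_eq_integral[OF L2_funD(2)[OF assms(1)]] nn_integral_lebesgue_on[OF assms(2)]
  by (simp add: L2_norm_power2)

text \<open>A three-term comparison through the continuous g: the error f - g at the averaged point
  costs a factor 2^d, the error at x costs 1, and g itself oscillates by at most \<omega>. The
  factors 3 come from (r + s + t)^2 \<le> 3 (r^2 + s^2 + t^2).\<close>

lemma conv_average_diff_bound:
  fixes f g :: "'a::euclidean_space \<Rightarrow> 'b::euclidean_space"
  assumes U: "open U" "convex U" "bounded U" and \<rho>: "\<rho> \<in> borel_measurable borel" "\<And>z. z \<notin> U \<Longrightarrow> \<rho> z = 0"
    and nn: "\<And>z. 0 \<le> \<rho> z" and int: "integrable lborel \<rho>" "(\<integral>z. \<rho> z \<partial>lborel) = 1"
    and f: "f \<in> borel_measurable borel" "L2_fun (lebesgue_on U) f"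
    and g: "continuous_on UNIV g" "L2_fun (lebesgue_on U) g"
    and \<epsilon>: "0 \<le> \<epsilon>" "\<epsilon> \<le> 1/2"
    and \<omega>: "\<omega> \<ge> 0" "\<And>x z. x \<in> U \<Longrightarrow> z \<in> U \<Longrightarrow> norm (g ((1 - \<epsilon>) *\<^sub>R x + \<epsilon> *\<^sub>R z) - g x) \<le> \<omega>"
  defines "a \<equiv> L2_norm (lebesgue_on U) (\<lambda>x. f x - g x)"
  shows "(\<integral>\<^sup>+x. ennreal ((norm (conv_average \<rho> \<epsilon> f x - f x))\<^sup>2) * indicator U x \<partial>lborel)
    \<le> ennreal (3 * (2 ^ DIM('a) + 1) * a\<^sup>2 + 3 * \<omega>\<^sup>2 * measure lborel U)"
proof -
  note [measurable] = \<rho>(1) f(1) borel_measurable_continuous_onI[OF g(1)] borel_open[OF U(1)]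
  \<comment> \<open>Cut off at U so that the bound for averages on the whole space applies; at the
    averaged points the cut-off is 1, since convexity keeps them in U.\<close>
  define u where "u y = ennreal ((norm (f y - g y))\<^sup>2) * indicator U y" for y
  have [measurable]: "u \<in> borel_measurable borel" unfolding u_def by measurable
  have pt: "ennreal (\<rho> z) * ennreal ((norm (f ((1 - \<epsilon>) *\<^sub>R x + \<epsilon> *\<^sub>R z) - f x))\<^sup>2) \<le>
      3 * (ennreal (\<rho> z) * u ((1 - \<epsilon>) *\<^sub>R x + \<epsilon> *\<^sub>R z)) + ennreal (\<rho> z) * (ennreal (3 * \<omega>\<^sup>2) + 3 * u x)"
    if x: "x \<in> U" for x z
  proof (cases "z \<in> U")
    case True
    define p where "p = (1 - \<epsilon>) *\<^sub>R x + \<epsilon> *\<^sub>R z"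
    have p: "p \<in> U" unfolding p_def using U(2) x True \<epsilon> by (intro convexD) auto
    have "norm (f p - f x) \<le> norm (f p - g p) + norm (g p - g x) + norm (f x - g x)"
      by norm
    also have "\<dots> \<le> norm (f p - g p) + \<omega> + norm (f x - g x)"
      using \<omega>(2)[OF x True] by (simp add: p_def)
    finally have "(norm (f p - f x))\<^sup>2 \<le> (norm (f p - g p) + \<omega> + norm (f x - g x))\<^sup>2"
      by (intro power_mono) auto
    also have "\<dots> \<le> 3 * (norm (f p - g p))\<^sup>2 + 3 * \<omega>\<^sup>2 + 3 * (norm (f x - g x))\<^sup>2"
    proof -
      have "(r + s + t)\<^sup>2 \<le> 3 * r\<^sup>2 + 3 * s\<^sup>2 + 3 * t\<^sup>2" for r s t :: real
        using zero_le_power2[of "r - s"] zero_le_power2[of "r - t"] zero_le_power2[of "s - t"]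
        by (simp add: power2_eq_square algebra_simps)
      then show ?thesis by blast
    qed
    finally have "ennreal ((norm (f p - f x))\<^sup>2) \<le> ennreal (3 * (norm (f p - g p))\<^sup>2 + 3 * \<omega>\<^sup>2 + 3 * (norm (f x - g x))\<^sup>2)"
      by (rule ennreal_leI)
    also have "\<dots> = 3 * u p + (ennreal (3 * \<omega>\<^sup>2) + 3 * u x)"
      using p x by (simp add: u_def ennreal_plus ennreal_mult'' add.assoc flip: ennreal_numeral)
    finally have "ennreal (\<rho> z) * ennreal ((norm (f p - f x))\<^sup>2) \<le> ennreal (\<rho> z) * (3 * u p + (ennreal (3 * \<omega>\<^sup>2) + 3 * u x))"
      by (intro mult_left_mono) auto
    then show ?thesis unfolding p_def[symmetric] by (simp add: distrib_left mult_ac)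
  qed (use \<rho>(2) in simp)
  have i1: "(\<integral>\<^sup>+z. ennreal (\<rho> z) \<partial>lborel) = 1"
    using int nn by (simp add: nn_integral_eq_integral)
  have pt2: "ennreal ((norm (conv_average \<rho> \<epsilon> f x - f x))\<^sup>2) * indicator U x \<le>
      3 * (\<integral>\<^sup>+z. ennreal (\<rho> z) * u ((1 - \<epsilon>) *\<^sub>R x + \<epsilon> *\<^sub>R z) \<partial>lborel) + (ennreal (3 * \<omega>\<^sup>2) * indicator U x + 3 * u x)" for x
  proof (cases "x \<in> U")
    case True
    have "ennreal ((norm (conv_average \<rho> \<epsilon> f x - f x))\<^sup>2) \<le>
      (\<integral>\<^sup>+z. ennreal (\<rho> z) * ennreal ((norm (f ((1 - \<epsilon>) *\<^sub>R x + \<epsilon> *\<^sub>R z) - f x))\<^sup>2) \<partial>lborel)"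
      by (rule conv_average_Jensen[OF \<rho>(1) f(1) nn int])
    also have "\<dots> \<le> (\<integral>\<^sup>+z. 3 * (ennreal (\<rho> z) * u ((1 - \<epsilon>) *\<^sub>R x + \<epsilon> *\<^sub>R z)) + ennreal (\<rho> z) * (ennreal (3 * \<omega>\<^sup>2) + 3 * u x) \<partial>lborel)"
      by (intro nn_integral_mono pt True)
    also have "\<dots> = 3 * (\<integral>\<^sup>+z. ennreal (\<rho> z) * u ((1 - \<epsilon>) *\<^sub>R x + \<epsilon> *\<^sub>R z) \<partial>lborel) + (ennreal (3 * \<omega>\<^sup>2) + 3 * u x)"
      by (subst nn_integral_add) (auto simp: nn_integral_cmult nn_integral_multc i1)
    finally show ?thesis using True by simp
  qed simp
  have "(\<integral>\<^sup>+x. ennreal ((norm (conv_average \<rho> \<epsilon> f x - f x))\<^sup>2) * indicator U x \<partial>lborel) \<le>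
    (\<integral>\<^sup>+x. 3 * (\<integral>\<^sup>+z. ennreal (\<rho> z) * u ((1 - \<epsilon>) *\<^sub>R x + \<epsilon> *\<^sub>R z) \<partial>lborel) + (ennreal (3 * \<omega>\<^sup>2) * indicator U x + 3 * u x) \<partial>lborel)"
    by (intro nn_integral_mono pt2)
  also have "\<dots> = 3 * (\<integral>\<^sup>+x. \<integral>\<^sup>+z. ennreal (\<rho> z) * u ((1 - \<epsilon>) *\<^sub>R x + \<epsilon> *\<^sub>R z) \<partial>lborel \<partial>lborel)
      + (ennreal (3 * \<omega>\<^sup>2) * emeasure lborel U + 3 * (\<integral>\<^sup>+x. u x \<partial>lborel))"
    by (subst nn_integral_add, measurable)+ (auto simp: nn_integral_cmult nn_integral_add nn_integral_cmult_indicator)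
  also have "\<dots> \<le> 3 * (ennreal (2 ^ DIM('a)) * (\<integral>\<^sup>+x. u x \<partial>lborel))
      + (ennreal (3 * \<omega>\<^sup>2) * emeasure lborel U + 3 * (\<integral>\<^sup>+x. u x \<partial>lborel))"
    by (intro add_mono mult_left_mono conv_average_nn_integral_bound[OF \<rho>(1) _ nn int \<epsilon>]) auto
  also have "(\<integral>\<^sup>+x. u x \<partial>lborel) = ennreal (a\<^sup>2)"
    unfolding u_def a_def by (rule nn_integral_L2_norm[OF L2_fun_diff[OF f(2) g(2)]]) measurable
  also have "emeasure lborel U = ennreal (measure lborel U)"
    using emeasure_bounded_finite[OF U(3)] by (simp add: emeasure_eq_ennreal_measure less_top)
  also have "3 * (ennreal (2 ^ DIM('a)) * ennreal (a\<^sup>2)) + (ennreal (3 * \<omega>\<^sup>2) * ennreal (measure lborel U) + 3 * ennreal (a\<^sup>2))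
      = ennreal (3 * (2 ^ DIM('a) + 1) * a\<^sup>2 + 3 * \<omega>\<^sup>2 * measure lborel U)"
    by (simp add: ennreal_mult'[symmetric] ennreal_plus[symmetric] algebra_simps del: ennreal_plus flip: ennreal_numeral)
  finally show ?thesis .
qed

text \<open>The choice \<epsilon> = 1 / (m + 2) tends to zero and stays in the range (0, 1/2] in
  which the averages are uniformly bounded.\<close>

lemma conv_average_L2:
  fixes f :: "'a::euclidean_space \<Rightarrow> 'b::euclidean_space"
  assumes U: "open U" "convex U" "bounded U" and \<rho>: "\<rho> \<in> borel_measurable borel" "\<And>z. z \<notin> U \<Longrightarrow> \<rho> z = 0"
    and nn: "\<And>z. 0 \<le> \<rho> z" and int: "integrable lborel \<rho>" "(\<integral>z. \<rho> z \<partial>lborel) = 1"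
    and f: "f \<in> borel_measurable borel" "L2_fun (lebesgue_on U) f"
  shows "L2_fun (lebesgue_on U) (conv_average \<rho> (1 / real (m + 2)) f)"
    and "(\<lambda>m. L2_norm (lebesgue_on U) (\<lambda>x. conv_average \<rho> (1 / real (m + 2)) f x - f x)) \<longlonglongrightarrow> 0"
proof -
  have lm: "U \<in> lmeasurable" using U by (simp add: lmeasurable_open)
  define \<epsilon> where "\<epsilon> m = 1 / real (m + 2)" for m :: nat
  have \<epsilon>: "0 \<le> \<epsilon> m" "\<epsilon> m \<le> 1/2" for m by (auto simp: \<epsilon>_def field_simps)
  have meas: "(\<lambda>x. conv_average \<rho> (\<epsilon> m) f x - f x) \<in> borel_measurable borel" for m
    using conv_average_measurable[OF \<rho>(1) f(1), of "\<epsilon> m"] f(1) by measurable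
  have main: "\<exists>M. \<forall>m\<ge>M. L2_fun (lebesgue_on U) (\<lambda>x. conv_average \<rho> (\<epsilon> m) f x - f x) \<and>
      L2_norm (lebesgue_on U) (\<lambda>x. conv_average \<rho> (\<epsilon> m) f x - f x) \<le> e" if "e > 0" for e
  proof -
    \<comment> \<open>The error bound splits into an approximation part with coefficient K and an
      oscillation part with coefficient L; \<delta> and \<omega> are chosen to make each of them at
      most e^2 / 2. The summand 1 in L keeps it positive when U has measure zero.\<close>
    define K where "K = 3 * (2 ^ DIM('a) + 1 :: real)"
    have K: "K > 0" unfolding K_def by (intro mult_pos_pos add_pos_pos) auto
    define \<delta> where "\<delta> = sqrt (e\<^sup>2 / (2 * K))"
    have \<delta>: "\<delta> > 0" "K * \<delta>\<^sup>2 = e\<^sup>2 / 2" using K that by (auto simp: \<delta>_def)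
    obtain g where g: "continuous_on UNIV g" "L2_fun (lebesgue_on U) g"
      "L2_norm (lebesgue_on U) (\<lambda>x. f x - g x) < \<delta>"
      using L2_approx_continuous[OF lm f(2) \<delta>(1)] by blast
    define L where "L = 3 * measure lborel U + 1"
    have L: "L > 0" by (simp add: L_def add_nonneg_pos)
    define \<omega> where "\<omega> = sqrt (e\<^sup>2 / (2 * L))"
    have \<omega>: "\<omega> > 0" "L * \<omega>\<^sup>2 = e\<^sup>2 / 2" using L that by (auto simp: \<omega>_def)
    have "uniformly_continuous_on (closure U) g"
      by (rule compact_uniformly_continuous) (use g U continuous_on_subset in \<open>auto simp: compact_eq_bounded_closed\<close>)
    then obtain d where d: "d > 0" "\<And>x y. x \<in> closure U \<Longrightarrow> y \<in> closure U \<Longrightarrow> dist y x < d \<Longrightarrow> dist (g y) (g x) < \<omega>"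
      unfolding uniformly_continuous_on_def using \<omega>(1) by metis
    obtain R where R: "\<And>x. x \<in> U \<Longrightarrow> norm x \<le> R" "R > 0" using U(3) by (meson bounded_pos)
    obtain M :: nat where M: "2 * R / d < real M" using reals_Archimedean2 by blast
    show ?thesis
    proof (intro exI[of _ M] allI impI)
      fix m assume m: "m \<ge> M"
      have osc: "norm (g ((1 - \<epsilon> m) *\<^sub>R x + \<epsilon> m *\<^sub>R z) - g x) \<le> \<omega>" if xz: "x \<in> U" "z \<in> U" for x z
      proof -
        define p where "p = (1 - \<epsilon> m) *\<^sub>R x + \<epsilon> m *\<^sub>R z"
        have p: "p \<in> U" unfolding p_def using U(2) xz \<epsilon>[of m] by (intro convexD) auto
        have "p - x = \<epsilon> m *\<^sub>R (z - x)" by (simp add: p_def algebra_simps)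
        then have "dist p x = \<epsilon> m * norm (z - x)" using \<epsilon>[of m] by (simp add: dist_norm)
        also have "\<dots> \<le> \<epsilon> m * (2 * R)"
          using \<epsilon>[of m] R(1)[OF xz(1)] R(1)[OF xz(2)] norm_triangle_ineq4[of z x] by (intro mult_left_mono) auto
        also have "\<dots> < d"
        proof -
          have "2 * R < d * real M" using M d(1) by (simp add: field_simps)
          also have "\<dots> \<le> d * real (m + 2)" using m d(1) by simp
          finally show ?thesis by (simp add: \<epsilon>_def field_simps)
        qed
        finally show ?thesis using d(2)[of x p] xz p closure_subset[of U]
          by (fastforce simp: p_def dist_norm)
      qed
      have "(\<integral>\<^sup>+x. ennreal ((norm (conv_average \<rho> (\<epsilon> m) f x - f x))\<^sup>2) * indicator U x \<partial>lborel)
        \<le> ennreal (K * (L2_norm (lebesgue_on U) (\<lambda>x. f x - g x))\<^sup>2 + 3 * \<omega>\<^sup>2 * measure lborel U)"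
        unfolding K_def
        by (rule conv_average_diff_bound[OF U \<rho> nn int f g(1,2) \<epsilon>]) (use osc \<omega>(1) in auto)
      also have "\<dots> \<le> ennreal (e\<^sup>2)"
      proof (rule ennreal_leI)
        have "K * (L2_norm (lebesgue_on U) (\<lambda>x. f x - g x))\<^sup>2 \<le> K * \<delta>\<^sup>2"
          using g(3) K by (intro mult_left_mono power_mono) auto
        moreover have "3 * \<omega>\<^sup>2 * measure lborel U \<le> L * \<omega>\<^sup>2"
          by (simp add: L_def algebra_simps)
        ultimately show "K * (L2_norm (lebesgue_on U) (\<lambda>x. f x - g x))\<^sup>2 + 3 * \<omega>\<^sup>2 * measure lborel U \<le> e\<^sup>2"
          using \<delta>(2) \<omega>(2) by simp
      qed
      finally show "L2_fun (lebesgue_on U) (\<lambda>x. conv_average \<rho> (\<epsilon> m) f x - f x) \<and>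
        L2_norm (lebesgue_on U) (\<lambda>x. conv_average \<rho> (\<epsilon> m) f x - f x) \<le> e"
        using L2_lebesgue_onI[OF meas borel_open[OF U(1)], of e] that by auto
    qed
  qed
  show "(\<lambda>m. L2_norm (lebesgue_on U) (\<lambda>x. conv_average \<rho> (1 / real (m + 2)) f x - f x)) \<longlonglongrightarrow> 0"
  proof (rule LIMSEQ_I)
    fix e :: real assume "e > 0"
    from main[of "e/2"] this obtain M where
      "\<forall>m\<ge>M. L2_norm (lebesgue_on U) (\<lambda>x. conv_average \<rho> (\<epsilon> m) f x - f x) \<le> e/2" by auto
    then show "\<exists>M. \<forall>m\<ge>M. norm (L2_norm (lebesgue_on U) (\<lambda>x. conv_average \<rho> (1 / real (m + 2)) f x - f x) - 0) < e"
      using \<open>e > 0\<close> unfolding \<epsilon>_def by (intro exI[of _ M]) (fastforce simp: abs_of_nonneg)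
  qed
  show "L2_fun (lebesgue_on U) (conv_average \<rho> (1 / real (m + 2)) f)"
  proof -
    \<comment> \<open>The crude choice g = 0 and \<omega> = 0 in the same estimate gives square
      integrability for every m, not only for large m.\<close>
    define a where "a = L2_norm (lebesgue_on U) (\<lambda>x. f x - 0)"
    define B where "B = sqrt (3 * (2 ^ DIM('a) + 1) * a\<^sup>2)"
    have "(\<integral>\<^sup>+x. ennreal ((norm (conv_average \<rho> (\<epsilon> m) f x - f x))\<^sup>2) * indicator U x \<partial>lborel)
        \<le> ennreal (3 * (2 ^ DIM('a) + 1) * a\<^sup>2 + 3 * 0\<^sup>2 * measure lborel U)"
      unfolding a_def
      by (rule conv_average_diff_bound[OF U \<rho> nn int f _ _ \<epsilon>, where g="\<lambda>_. 0"]) auto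
    also have "\<dots> = ennreal (B\<^sup>2)" by (simp add: B_def)
    finally have "L2_fun (lebesgue_on U) (\<lambda>x. conv_average \<rho> (\<epsilon> m) f x - f x)"
      by (intro L2_lebesgue_onI[OF meas borel_open[OF U(1)], of B]) (auto simp: B_def)
    from L2_fun_add[OF this f(2)] show ?thesis by (simp add: \<epsilon>_def)
  qed
qed

text \<open>Substituting y = (1 - \<epsilon>) x + \<epsilon> z moves the dependence on x from f to
  the kernel, which is the shape required by \<open>has_derivative_convolution\<close>.\<close>

lemma conv_average_eq:
  fixes f :: "'a::euclidean_space \<Rightarrow> 'b::euclidean_space"
  assumes [measurable]: "\<rho> \<in> borel_measurable borel" "f \<in> borel_measurable borel" and \<epsilon>: "\<epsilon> > 0"
  shows "conv_average \<rho> \<epsilon> f x =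
    (\<integral>y. ((1/\<epsilon>) ^ DIM('a) * \<rho> ((1/\<epsilon>) *\<^sub>R y + (- (1 - \<epsilon>) / \<epsilon>) *\<^sub>R x)) *\<^sub>R f y \<partial>lborel)"
proof -
  define t where "t = (- (1 - \<epsilon>) / \<epsilon>) *\<^sub>R x"
  have "\<epsilon> * (- (1 - \<epsilon>) / \<epsilon>) = - (1 - \<epsilon>)" using \<epsilon> by simp
  then have t: "\<epsilon> *\<^sub>R t = - ((1 - \<epsilon>) *\<^sub>R x)"
    unfolding t_def scaleR_scaleR by (simp only: scaleR_minus_left)
  have "conv_average \<rho> \<epsilon> f x = \<bar>1/\<epsilon>\<bar> ^ DIM('a) *\<^sub>R
     (\<integral>y. \<rho> (t + (1/\<epsilon>) *\<^sub>R y) *\<^sub>R f ((1 - \<epsilon>) *\<^sub>R x + \<epsilon> *\<^sub>R (t + (1/\<epsilon>) *\<^sub>R y)) \<partial>lborel)"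
    unfolding conv_average_def by (rule integral_lborel_affine) (use \<epsilon> in auto)
  also have "(\<lambda>y. \<rho> (t + (1/\<epsilon>) *\<^sub>R y) *\<^sub>R f ((1 - \<epsilon>) *\<^sub>R x + \<epsilon> *\<^sub>R (t + (1/\<epsilon>) *\<^sub>R y))) =
     (\<lambda>y. \<rho> ((1/\<epsilon>) *\<^sub>R y + t) *\<^sub>R f y)"
    using \<epsilon> by (simp add: scaleR_add_right t add.commute)
  finally show ?thesis using \<epsilon> by (simp add: t_def flip: integral_scaleR_right)
qed

text \<open>Fubini and affine substitutions are carried out for \<open>lborel\<close> and Borel
  functions. A representative that also vanishes outside U makes integrals over U and over the whole
  space interchangeable.\<close>

lemma borel_representative:
  fixes f :: "'a::euclidean_space \<Rightarrow> 'b::euclidean_space"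
  assumes U: "U \<in> sets borel" and f: "f \<in> borel_measurable (lebesgue_on U)"
  shows "\<exists>g\<in>borel_measurable borel. (\<forall>x. x \<notin> U \<longrightarrow> g x = 0) \<and> (AE x in lebesgue_on U. f x = g x)"
proof -
  have Ul: "U \<in> sets lebesgue" using U by simp
  have "(\<lambda>x. if x \<in> U then f x else 0) \<in> borel_measurable lebesgue"
    by (rule borel_measurable_if_I[OF f Ul])
  then have "(\<lambda>x. (if x \<in> U then f x else 0) \<bullet> b) \<in> borel_measurable lebesgue" for b
    by measurable
  then have "\<forall>b. \<exists>g. g \<in> borel_measurable lborel \<and> (AE x in lborel. (if x \<in> U then f x else 0) \<bullet> b = g x)"
    using completion_ex_borel_measurable_real by blast
  then obtain g where g: "\<And>b. g b \<in> borel_measurable lborel"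
    "\<And>b. AE x in lborel. (if x \<in> U then f x else 0) \<bullet> b = g b x"
    by metis
  have [measurable]: "g b \<in> borel_measurable borel" for b using g(1)[of b] by simp
  define h where "h x = indicator U x *\<^sub>R (\<Sum>b\<in>Basis. g b x *\<^sub>R b)" for x
  show ?thesis
  proof (intro bexI[of _ h] conjI allI impI)
    show "h \<in> borel_measurable borel" unfolding h_def using U by measurable
    show "h x = 0" if "x \<notin> U" for x using that by (simp add: h_def)
    have "AE x in lborel. \<forall>b\<in>Basis. (if x \<in> U then f x else 0) \<bullet> b = g b x"
      using g(2) by (intro AE_finite_allI) auto
    then have "AE x in lebesgue. \<forall>b\<in>Basis. (if x \<in> U then f x else 0) \<bullet> b = g b x"
      by (rule AE_completion)
    then have "AE x in lebesgue. x \<in> U \<longrightarrow> f x = h x"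
    proof eventually_elim
      case (elim x)
      show ?case
      proof
        assume "x \<in> U"
        then have "h x = (\<Sum>b\<in>Basis. (f x \<bullet> b) *\<^sub>R b)" using elim by (simp add: h_def)
        then show "f x = h x" by (simp add: euclidean_representation)
      qed
    qed
    then show "AE x in lebesgue_on U. f x = h x"
      using Ul by (simp add: AE_restrict_space_iff)
  qed
qed

lemma integral_lebesgue_on_borel:
  fixes f :: "'a::euclidean_space \<Rightarrow> 'b::euclidean_space"
  assumes f: "f \<in> borel_measurable borel" and U: "U \<in> sets borel" and 0: "\<And>x. x \<notin> U \<Longrightarrow> f x = 0"
  shows "(\<integral>x. f x \<partial>lebesgue_on U) = (\<integral>x. f x \<partial>lborel)"
proof -
  have "(\<integral>x. f x \<partial>lebesgue_on U) = (\<integral>x. indicator U x *\<^sub>R f x \<partial>lebesgue)"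
    using U by (subst integral_restrict_space) auto
  also have "(\<lambda>x. indicator U x *\<^sub>R f x) = f" using 0 by (auto simp: indicator_def fun_eq_iff)
  also have "(\<integral>x. f x \<partial>lebesgue) = (\<integral>x. f x \<partial>lborel)" by (rule integral_completion) (use f in simp)
  finally show ?thesis .
qed

lemma integrable_lborel_L2:
  fixes f :: "'a::euclidean_space \<Rightarrow> 'b::euclidean_space"
  assumes f: "f \<in> borel_measurable borel" and U: "U \<in> sets borel" "bounded U" and 0: "\<And>x. x \<notin> U \<Longrightarrow> f x = 0"
    and L2: "L2_fun (lebesgue_on U) f"
  shows "integrable lborel f"
proof -
  have "U \<in> lmeasurable" using U by (simp add: bounded_set_imp_lmeasurable)
  then interpret finite_measure "lebesgue_on U" by (rule finite_measure_lebesgue_on)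
  have one: "L2_fun (lebesgue_on U) (\<lambda>_. 1::real)" by (simp add: L2_fun_def)
  have nf: "L2_fun (lebesgue_on U) (\<lambda>z. norm (f z))" using L2 by (auto simp: L2_fun_def)
  have "integrable (lebesgue_on U) (\<lambda>z. norm (f z))" using integrable_inner_L2[OF nf one] by simp
  then have "integrable (lebesgue_on U) f" using integrable_norm_iff[OF L2_funD(1)[OF L2]] by blast
  then have "integrable lebesgue (\<lambda>x. indicator U x *\<^sub>R f x)"
    using U by (subst (asm) integrable_restrict_space) auto
  moreover have "(\<lambda>x. indicator U x *\<^sub>R f x) = f" using 0 by (auto simp: indicator_def fun_eq_iff)
  ultimately show ?thesis using f by (simp add: integrable_completion)
qed

section \<open>Components, pulled back kernels and smooth functions on bounded open sets\<close>

lemma integral_vec_nth: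
  fixes f :: "'a \<Rightarrow> ('b::euclidean_space) ^ 'n"
  assumes "integrable M f"
  shows "(\<integral>x. f x \<partial>M) $ i = (\<integral>x. f x $ i \<partial>M)"
  using integral_bounded_linear[OF bounded_linear_vec_nth assms, of i] by simp

lemma integrable_vec_nth:
  fixes f :: "'a \<Rightarrow> ('b::euclidean_space) ^ 'n"
  assumes "integrable M f" shows "integrable M (\<lambda>x. f x $ i)"
  using integrable_bounded_linear[OF bounded_linear_vec_nth assms, of i] by simp

lemma borel_measurable_vec_nth [measurable]:
  fixes f :: "'a \<Rightarrow> ('b::euclidean_space) ^ 'n"
  assumes "f \<in> borel_measurable M" shows "(\<lambda>x. f x $ i) \<in> borel_measurable M"
proof (rule measurable_compose[OF assms])
  show "(\<lambda>x::'b ^ 'n. x $ i) \<in> borel_measurable borel"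
    by (rule borel_measurable_continuous_onI) (intro continuous_intros)
qed

lemma L2_fun_vec_nth:
  fixes f :: "'a \<Rightarrow> ('b::euclidean_space) ^ 'n"
  assumes "L2_fun M f"
  shows "L2_fun M (\<lambda>x. f x $ i)" "L2_norm M (\<lambda>x. f x $ i) \<le> L2_norm M f"
proof -
  have m: "(\<lambda>x. f x $ i) \<in> borel_measurable M" using assms by (auto simp: L2_fun_def)
  have b: "AE x in M. norm (f x $ i) \<le> 1 * norm (f x)" by (rule AE_I2) (simp add: Finite_Cartesian_Product.norm_nth_le)
  from L2_fun_bound[OF assms m b]
  show "L2_fun M (\<lambda>x. f x $ i)" "L2_norm M (\<lambda>x. f x $ i) \<le> L2_norm M f" by auto
qed

lemma test_function_pullback:
  fixes \<rho> :: "real ^ 'n \<Rightarrow> real"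
  assumes \<rho>: "test_function U \<rho>" and a: "a \<noteq> 0"
    and sub: "\<And>z. z \<in> U \<Longrightarrow> (1/a) *\<^sub>R (z - b) \<in> V"
  shows "test_function V (\<lambda>y. k * \<rho> (a *\<^sub>R y + b))"
proof -
  define K where "K = (\<lambda>z. (1/a) *\<^sub>R (z - b)) ` closure {x. \<rho> x \<noteq> 0}"
  have cK: "compact K" unfolding K_def
    by (intro compact_continuous_image continuous_intros) (use \<rho> in \<open>simp add: test_function_def\<close>)
  have KV: "K \<subseteq> V" unfolding K_def using sub \<rho> by (auto simp: test_function_def)
  have "{y. k * \<rho> (a *\<^sub>R y + b) \<noteq> 0} \<subseteq> K"
  proof
    fix y assume "y \<in> {y. k * \<rho> (a *\<^sub>R y + b) \<noteq> 0}"
    then have "a *\<^sub>R y + b \<in> closure {x. \<rho> x \<noteq> 0}" using closure_subset[of "{x. \<rho> x \<noteq> 0}"] by auto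
    then show "y \<in> K" unfolding K_def
      by (rule rev_image_eqI) (use a in \<open>simp add: algebra_simps\<close>)
  qed
  then have c: "closure {y. k * \<rho> (a *\<^sub>R y + b) \<noteq> 0} \<subseteq> K"
    using compact_imp_closed[OF cK] by (intro closure_minimal)
  have "compact (closure {y. k * \<rho> (a *\<^sub>R y + b) \<noteq> 0})"
    using c cK by (auto simp: compact_eq_bounded_closed intro: bounded_subset)
  then show ?thesis
    using c KV smooth_scaleR_const[OF smooth_affine[OF test_functionD(1)[OF \<rho>], of a b], of k]
    by (auto simp: test_function_def)
qed

lemma jacobian_nth:
  assumes "smooth f"
  shows "jacobian f (at x) $ i $ j = frechet_derivative f (at x) (axis j 1) $ i"
  by (simp add: jacobian_def matrix_def)

lemma continuous_jacobian:
  assumes "smooth f" shows "continuous_on UNIV (\<lambda>x. jacobian f (at x))"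
proof -
  have "continuous_on UNIV (\<lambda>x. \<chi> i j. frechet_derivative f (at x) (axis j 1) $ i)"
    by (intro continuous_on_vec_lambda continuous_intros smooth_continuous smooth_frechet_derivative assms)
  then show ?thesis by (simp add: jacobian_def matrix_def)
qed

lemma L2_fun_lebesgue_on_continuous:
  fixes f :: "'a::euclidean_space \<Rightarrow> 'b::euclidean_space"
  assumes f: "continuous_on UNIV f" and U: "open U" "bounded U"
  shows "L2_fun (lebesgue_on U) f"
proof -
  have "U \<in> lmeasurable" using U by (simp add: lmeasurable_open)
  then interpret finite_measure "lebesgue_on U" by (rule finite_measure_lebesgue_on)
  have "bounded (f ` closure U)"
    by (rule compact_imp_bounded[OF compact_continuous_image])
       (use f U continuous_on_subset in \<open>auto simp: compact_eq_bounded_closed\<close>)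
  then obtain B where B: "\<And>x. x \<in> closure U \<Longrightarrow> norm (f x) \<le> B" unfolding bounded_iff by blast
  show ?thesis
  proof (rule L2_fun_bounded)
    show "f \<in> borel_measurable (lebesgue_on U)"
      by (intro measurable_lebesgue_on borel_measurable_continuous_onI f)
    show "AE x in lebesgue_on U. norm (f x) \<le> B"
      using B closure_subset[of U] by (intro AE_I2) auto
  qed
qed

lemma conv_average_smooth:
  fixes f :: "real ^ 'n \<Rightarrow> 'b::euclidean_space"
  assumes \<rho>: "test_function U \<rho>" and f: "f \<in> borel_measurable borel" "integrable lborel f" and \<epsilon>: "\<epsilon> > 0"
  shows "smooth (conv_average \<rho> \<epsilon> f)"
proof -
  have \<rho>': "test_function UNIV (\<lambda>x. (1/\<epsilon>) ^ DIM(real ^ 'n) * \<rho> x)"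
    by (intro test_function_UNIV_scale test_function_mono[OF \<rho>]) auto
  have "conv_average \<rho> \<epsilon> f = (\<lambda>x. \<integral>y. ((1/\<epsilon>) ^ DIM(real ^ 'n) * \<rho> ((1/\<epsilon>) *\<^sub>R y + (- (1 - \<epsilon>) / \<epsilon>) *\<^sub>R x)) *\<^sub>R f y \<partial>lborel)"
    by (rule ext, rule conv_average_eq[OF test_functionD(5)[OF \<rho>] f(1) \<epsilon>])
  with smooth_convolution[OF \<rho>' f(2), of "1/\<epsilon>" "- (1 - \<epsilon>) / \<epsilon>"] show ?thesis by simp
qed

lemma conv_kernel_inverse:
  fixes x z :: "'a::real_vector"
  assumes "\<epsilon> \<noteq> 0"
  shows "(1 / (1 / \<epsilon>)) *\<^sub>R (z - (- (1 - \<epsilon>) / \<epsilon>) *\<^sub>R x) = (1 - \<epsilon>) *\<^sub>R x + \<epsilon> *\<^sub>R z"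
proof -
  have "1 / (1 / \<epsilon>) = \<epsilon>" "\<epsilon> * (- (1 - \<epsilon>) / \<epsilon>) = - (1 - \<epsilon>)" using assms by simp_all
  then show ?thesis
    by (simp only: scaleR_diff_right scaleR_scaleR scaleR_minus_left diff_minus_eq_add add.commute)
qed

lemma has_L2_weak_gradientD:
  assumes "has_L2_weak_gradient U w G"
  shows "L2_fun (lebesgue_on U) G"
    "test_function U \<phi> \<Longrightarrow> (\<integral>x. w x $ i * frechet_derivative \<phi> (at x) (axis j 1) \<partial>lebesgue_on U) =
        - (\<integral>x. G x $ i $ j * \<phi> x \<partial>lebesgue_on U)"
  using assms by (auto simp: has_L2_weak_gradient_def)

text \<open>This is where convexity pays off: the kernel y to \<rho>((y - (1 - \<epsilon>) x) /
  \<epsilon>) is supported in (1 - \<epsilon>) x + \<epsilon> supp \<rho>, a compact subset of U,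
  and may therefore be inserted into the definition of the weak gradient.\<close>

lemma conv_kernel_test_function:
  fixes \<rho> :: "real ^ 'n \<Rightarrow> real"
  assumes U: "convex U" and \<rho>: "test_function U \<rho>" and \<epsilon>: "0 < \<epsilon>" "\<epsilon> < 1" and x: "x \<in> U"
  shows "test_function U (\<lambda>y. k * \<rho> ((1 / \<epsilon>) *\<^sub>R y + (- (1 - \<epsilon>) / \<epsilon>) *\<^sub>R x))"
proof (rule test_function_pullback[OF \<rho>])
  show "1 / \<epsilon> \<noteq> 0" using \<epsilon> by simp
  fix z assume z: "z \<in> U"
  have "(1 / (1 / \<epsilon>)) *\<^sub>R (z - (- (1 - \<epsilon>) / \<epsilon>) *\<^sub>R x) = (1 - \<epsilon>) *\<^sub>R x + \<epsilon> *\<^sub>R z"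
    by (rule conv_kernel_inverse) (use \<epsilon> in simp)
  also have "\<dots> \<in> U" using U x z \<epsilon> by (intro convexD) auto
  finally show "(1 / (1 / \<epsilon>)) *\<^sub>R (z - (- (1 - \<epsilon>) / \<epsilon>) *\<^sub>R x) \<in> U" .
qed

text \<open>The factor \<open>1 - \<epsilon>\<close> comes from the dilation.\<close>

lemma conv_average_weak_gradient:
  fixes w :: "real ^ 'n \<Rightarrow> real ^ 'n"
  assumes U: "open U" "convex U" "bounded U" and \<rho>: "test_function U \<rho>"
    and w: "w \<in> borel_measurable borel" "\<And>x. x \<notin> U \<Longrightarrow> w x = 0" "L2_fun (lebesgue_on U) w"
    and G: "G \<in> borel_measurable borel" "\<And>x. x \<notin> U \<Longrightarrow> G x = 0"
    and wG: "has_L2_weak_gradient U w G"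
    and \<epsilon>: "0 < \<epsilon>" "\<epsilon> < 1" and x: "x \<in> U"
  shows "jacobian (conv_average \<rho> \<epsilon> w) (at x) = (1 - \<epsilon>) *\<^sub>R conv_average \<rho> \<epsilon> G x"
proof -
  have Ub: "U \<in> sets borel" using U by auto
  define d where "d = DIM(real ^ 'n)"
  define a where "a = 1 / \<epsilon>"
  define b where "b = - (1 - \<epsilon>) / \<epsilon>"
  have iw: "integrable lborel w" by (rule integrable_lborel_L2[OF w(1) Ub U(3) w(2,3)])
  have iG: "integrable lborel G"
    by (rule integrable_lborel_L2[OF G(1) Ub U(3) G(2) has_L2_weak_gradientD(1)[OF wG]])
  define \<eta> where "\<eta> z = a ^ d * \<rho> z" for z
  have \<eta>: "test_function UNIV \<eta>" unfolding \<eta>_def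
    by (intro test_function_UNIV_scale test_function_mono[OF \<rho>]) auto
  have rep: "conv_average \<rho> \<epsilon> f x = (\<integral>y. \<eta> (a *\<^sub>R y + b *\<^sub>R x) *\<^sub>R f y \<partial>lborel)"
    if "f \<in> borel_measurable borel" for f :: "real ^ 'n \<Rightarrow> 'c::euclidean_space" and x
    unfolding \<eta>_def a_def b_def d_def by (rule conv_average_eq[OF test_functionD(5)[OF \<rho>] that \<epsilon>(1)])
  define \<psi> where "\<psi> y = \<eta> (a *\<^sub>R y + b *\<^sub>R x)" for y
  have \<psi>: "test_function U \<psi>" unfolding \<psi>_def \<eta>_def a_def b_def
    by (rule conv_kernel_test_function[OF U(2) \<rho> \<epsilon> x])
  have D\<psi>: "frechet_derivative \<psi> (at y) v = a * frechet_derivative \<eta> (at (a *\<^sub>R y + b *\<^sub>R x)) v" for y v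
    unfolding \<psi>_def using frechet_derivative_affine[OF test_functionD(1)[OF \<eta>]] by simp
  \<comment> \<open>The chain rule in x produces the factor b and in y the factor a. Their ratio
    turns the x-derivative of the kernel into a y-derivative, which can be moved onto w
    weakly.\<close>
  have b: "b = - (1 - \<epsilon>) * a" by (simp add: a_def b_def)
  note [measurable] = w(1) G(1) test_functionD(5)[OF \<psi>] test_functionD(5)[OF test_function_derivative[OF \<psi>]]
  have "jacobian (conv_average \<rho> \<epsilon> w) (at x) $ i $ j = ((1 - \<epsilon>) *\<^sub>R conv_average \<rho> \<epsilon> G x) $ i $ j" for i j
  proof -
    have i1: "integrable lborel (\<lambda>y. (b * frechet_derivative \<eta> (at (a *\<^sub>R y + b *\<^sub>R x)) (axis j 1)) *\<^sub>R w y)"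
      using integrable_test_function_mult[OF test_function_UNIV_scale[OF test_function_derivative[OF \<eta>]] iw] .
    have "jacobian (conv_average \<rho> \<epsilon> w) (at x) $ i $ j =
        (\<integral>y. (b * frechet_derivative \<eta> (at (a *\<^sub>R y + b *\<^sub>R x)) (axis j 1)) *\<^sub>R w y \<partial>lborel) $ i"
      unfolding jacobian_nth[OF conv_average_smooth[OF \<rho> w(1) iw \<epsilon>(1)]]
      unfolding rep[OF w(1), abs_def] frechet_derivative_convolution[OF \<eta> iw] ..
    also have "\<dots> = (\<integral>y. - (1 - \<epsilon>) * (w y $ i * frechet_derivative \<psi> (at y) (axis j 1)) \<partial>lborel)"
      by (subst integral_vec_nth[OF i1]) (simp add: D\<psi> b mult_ac)
    also have "\<dots> = - (1 - \<epsilon>) * (\<integral>y. w y $ i * frechet_derivative \<psi> (at y) (axis j 1) \<partial>lborel)"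
      by (rule integral_mult_right_zero)
    also have "(\<integral>y. w y $ i * frechet_derivative \<psi> (at y) (axis j 1) \<partial>lborel) =
        (\<integral>y. w y $ i * frechet_derivative \<psi> (at y) (axis j 1) \<partial>lebesgue_on U)"
      by (rule integral_lebesgue_on_borel[OF _ Ub, symmetric]) (use w(2) in \<open>measurable, simp\<close>)
    also have "\<dots> = - (\<integral>y. G y $ i $ j * \<psi> y \<partial>lebesgue_on U)"
      by (rule has_L2_weak_gradientD(2)[OF wG \<psi>])
    also have "(\<integral>y. G y $ i $ j * \<psi> y \<partial>lebesgue_on U) = (\<integral>y. G y $ i $ j * \<psi> y \<partial>lborel)"
      by (rule integral_lebesgue_on_borel[OF _ Ub]) (use G(2) in \<open>measurable, simp\<close>)
    also have "\<dots> = (\<integral>y. \<eta> (a *\<^sub>R y + b *\<^sub>R x) *\<^sub>R G y \<partial>lborel) $ i $ j"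
      unfolding integral_vec_nth[OF integrable_test_function_mult[OF \<eta> iG]]
        integral_vec_nth[OF integrable_vec_nth[OF integrable_test_function_mult[OF \<eta> iG]]]
      by (simp add: \<psi>_def mult.commute)
    finally show ?thesis by (simp add: rep[OF G(1)] algebra_simps)
  qed
  then show ?thesis by (simp add: vec_eq_iff)
qed

text \<open>Measurability survives a change on a null set because Lebesgue measure is
  complete.\<close>

lemma L2_cong_AE_lebesgue_on:
  fixes f g :: "'a::euclidean_space \<Rightarrow> 'b::euclidean_space"
  assumes U: "U \<in> sets lebesgue" and f: "f \<in> borel_measurable (lebesgue_on U)"
    and ae: "AE x in lebesgue_on U. f x = g x"
  shows "g \<in> borel_measurable (lebesgue_on U)"
proof -
  have "(\<lambda>x. if x \<in> U then g x else 0) \<in> borel_measurable lebesgue"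
  proof (rule borel_measurable_AE[OF borel_measurable_if_I[OF f U]])
    have "AE x in lebesgue. x \<in> U \<longrightarrow> f x = g x" using ae U by (simp add: AE_restrict_space_iff)
    then show "AE x in lebesgue. (if x \<in> U then f x else 0) = (if x \<in> U then g x else 0)"
      by eventually_elim auto
  qed
  then show ?thesis by (rule borel_measurable_if_D)
qed

lemma L2_fun_cong_AE:
  fixes f g :: "'a::euclidean_space \<Rightarrow> 'b::euclidean_space"
  assumes U: "U \<in> sets lebesgue" and f: "L2_fun (lebesgue_on U) f"
    and ae: "AE x in lebesgue_on U. f x = g x"
  shows "L2_fun (lebesgue_on U) g"
proof (rule L2_fun_bound(1)[OF f L2_cong_AE_lebesgue_on[OF U L2_funD(1)[OF f] ae]])
  show "AE x in lebesgue_on U. norm (g x) \<le> 1 * norm (f x)" using ae by eventually_elim auto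
qed

lemma has_L2_weak_gradient_cong_AE:
  fixes v w :: "real ^ 'n \<Rightarrow> real ^ 'n"
  assumes U: "U \<in> sets lebesgue" and v: "v \<in> borel_measurable (lebesgue_on U)"
    and ae: "AE x in lebesgue_on U. v x = w x"
    and G: "has_L2_weak_gradient U v G" and aeG: "AE x in lebesgue_on U. G x = H x"
  shows "has_L2_weak_gradient U w H"
  unfolding has_L2_weak_gradient_def
proof (intro conjI allI impI)
  note GL = has_L2_weak_gradientD(1)[OF G]
  show HL: "L2_fun (lebesgue_on U) H" by (rule L2_fun_cong_AE[OF U GL aeG])
  note [measurable] = v L2_cong_AE_lebesgue_on[OF U v ae] L2_funD(1)[OF GL] L2_funD(1)[OF HL]
  fix \<phi> :: "real ^ 'n \<Rightarrow> real" and i j assume \<phi>: "test_function U \<phi>"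
  note [measurable] = measurable_lebesgue_on[OF test_functionD(5)[OF \<phi>]]
    measurable_lebesgue_on[OF test_functionD(5)[OF test_function_derivative[OF \<phi>]]]
  have "(\<integral>x. w x $ i * frechet_derivative \<phi> (at x) (axis j 1) \<partial>lebesgue_on U) =
      (\<integral>x. v x $ i * frechet_derivative \<phi> (at x) (axis j 1) \<partial>lebesgue_on U)"
    by (rule integral_cong_AE, measurable) (use ae in \<open>eventually_elim, simp\<close>)
  also have "\<dots> = - (\<integral>x. G x $ i $ j * \<phi> x \<partial>lebesgue_on U)"
    by (rule has_L2_weak_gradientD(2)[OF G \<phi>])
  also have "(\<integral>x. G x $ i $ j * \<phi> x \<partial>lebesgue_on U) = (\<integral>x. H x $ i $ j * \<phi> x \<partial>lebesgue_on U)"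
    by (rule integral_cong_AE, measurable) (use aeG in \<open>eventually_elim, simp\<close>)
  finally show "(\<integral>x. w x $ i * frechet_derivative \<phi> (at x) (axis j 1) \<partial>lebesgue_on U) =
      - (\<integral>x. H x $ i $ j * \<phi> x \<partial>lebesgue_on U)" .
qed

text \<open>The approximants are averages of a Borel representative. Their Jacobian is 1 -
  \<epsilon> times the average of G, so the gradient error is (1 - \<epsilon>) times the averaging
  error of G minus \<epsilon> G, and both parts vanish in the limit.\<close>

theorem smooth_dense_H1:
  fixes w :: "real ^ 'n \<Rightarrow> real ^ 'n"
  assumes U: "open U" "convex U" "bounded U" "U \<noteq> {}"
    and w: "L2_fun (lebesgue_on U) w" and G: "has_L2_weak_gradient U w G"
  obtains \<phi> :: "nat \<Rightarrow> real ^ 'n \<Rightarrow> real ^ 'n" where "\<And>m. smooth (\<phi> m)"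
    "(\<lambda>m. L2_norm (lebesgue_on U) (\<lambda>x. \<phi> m x - w x)) \<longlonglongrightarrow> 0"
    "(\<lambda>m. L2_norm (lebesgue_on U) (\<lambda>x. jacobian (\<phi> m) (at x) - G x)) \<longlonglongrightarrow> 0"
proof -
  have Ub: "U \<in> sets borel" "U \<in> sets lebesgue" using U by auto
  note GL = has_L2_weak_gradientD(1)[OF G]
  obtain w' where w': "w' \<in> borel_measurable borel" "\<And>x. x \<notin> U \<Longrightarrow> w' x = 0" "AE x in lebesgue_on U. w x = w' x"
    using borel_representative[OF Ub(1) L2_funD(1)[OF w]] by blast
  obtain G' where G': "G' \<in> borel_measurable borel" "\<And>x. x \<notin> U \<Longrightarrow> G' x = 0" "AE x in lebesgue_on U. G x = G' x"
    using borel_representative[OF Ub(1) L2_funD(1)[OF GL]] by blast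
  have w'L: "L2_fun (lebesgue_on U) w'" by (rule L2_fun_cong_AE[OF Ub(2) w w'(3)])
  have G'L: "L2_fun (lebesgue_on U) G'" by (rule L2_fun_cong_AE[OF Ub(2) GL G'(3)])
  have wG': "has_L2_weak_gradient U w' G'"
    by (rule has_L2_weak_gradient_cong_AE[OF Ub(2) L2_funD(1)[OF w] w'(3) G G'(3)])
  obtain \<rho> where \<rho>: "test_function U \<rho>" "\<And>x. 0 \<le> \<rho> x" "(\<integral>x. \<rho> x \<partial>lborel) = 1" "integrable lborel \<rho>"
    using exists_test_function[OF U(1,4)] by blast
  define \<epsilon> where "\<epsilon> m = 1 / real (m + 2)" for m :: nat
  have \<epsilon>: "0 < \<epsilon> m" "\<epsilon> m < 1" for m by (auto simp: \<epsilon>_def field_simps)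
  define \<phi> where "\<phi> m = conv_average \<rho> (\<epsilon> m) w'" for m
  have iw: "integrable lborel w'" by (rule integrable_lborel_L2[OF w'(1) Ub(1) U(3) w'(2) w'L])
  have sm: "smooth (\<phi> m)" for m
    unfolding \<phi>_def by (rule conv_average_smooth[OF \<rho>(1) w'(1) iw \<epsilon>(1)])
  note avg = conv_average_L2[OF U(1-3) test_functionD(5,2)[OF \<rho>(1)] \<rho>(2,4,3)]
  have gL: "L2_fun (lebesgue_on U) (conv_average \<rho> (\<epsilon> m) G')" for m
    using avg(1)[OF _ G'(1) G'L, of m] by (simp add: \<epsilon>_def)
  have "(\<lambda>m. L2_norm (lebesgue_on U) (\<lambda>x. \<phi> m x - w x)) \<longlonglongrightarrow> 0"
  proof -
    have "L2_norm (lebesgue_on U) (\<lambda>x. \<phi> m x - w x) = L2_norm (lebesgue_on U) (\<lambda>x. \<phi> m x - w' x)" for m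
    proof (rule L2_norm_cong_AE)
      note [measurable] = measurable_lebesgue_on[OF borel_measurable_continuous_onI[OF smooth_continuous[OF sm]]]
        L2_funD(1)[OF w] L2_funD(1)[OF w'L]
      show "(\<lambda>x. \<phi> m x - w x) \<in> borel_measurable (lebesgue_on U)"
        "(\<lambda>x. \<phi> m x - w' x) \<in> borel_measurable (lebesgue_on U)" by measurable
      show "AE x in lebesgue_on U. \<phi> m x - w x = \<phi> m x - w' x" using w'(3) by eventually_elim simp
    qed
    then show ?thesis using avg(2)[OF _ w'(1) w'L] by (simp add: \<phi>_def \<epsilon>_def)
  qed
  moreover have "(\<lambda>m. L2_norm (lebesgue_on U) (\<lambda>x. jacobian (\<phi> m) (at x) - G x)) \<longlonglongrightarrow> 0"
  proof (rule tendsto_sandwich[OF _ _ tendsto_const])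
    have "L2_norm (lebesgue_on U) (\<lambda>x. jacobian (\<phi> m) (at x) - G x) \<le>
       L2_norm (lebesgue_on U) (\<lambda>x. conv_average \<rho> (\<epsilon> m) G' x - G' x) + \<epsilon> m * L2_norm (lebesgue_on U) G'" for m
    proof -
      have "L2_norm (lebesgue_on U) (\<lambda>x. jacobian (\<phi> m) (at x) - G x) =
        L2_norm (lebesgue_on U) (\<lambda>x. (1 - \<epsilon> m) *\<^sub>R (conv_average \<rho> (\<epsilon> m) G' x - G' x) + (- \<epsilon> m) *\<^sub>R G' x)"
      proof (rule L2_norm_cong_AE)
        note [measurable] = measurable_lebesgue_on[OF borel_measurable_continuous_onI[OF continuous_jacobian[OF sm]]]
          L2_funD(1)[OF GL] L2_funD(1)[OF G'L] L2_funD(1)[OF gL]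
        show "(\<lambda>x. jacobian (\<phi> m) (at x) - G x) \<in> borel_measurable (lebesgue_on U)" by measurable
        show "(\<lambda>x. (1 - \<epsilon> m) *\<^sub>R (conv_average \<rho> (\<epsilon> m) G' x - G' x) + (- \<epsilon> m) *\<^sub>R G' x) \<in> borel_measurable (lebesgue_on U)"
          by measurable
        have "AE x in lebesgue_on U. x \<in> U" by (rule AE_I2) simp
        with G'(3) show "AE x in lebesgue_on U. jacobian (\<phi> m) (at x) - G x =
            (1 - \<epsilon> m) *\<^sub>R (conv_average \<rho> (\<epsilon> m) G' x - G' x) + (- \<epsilon> m) *\<^sub>R G' x"
        proof eventually_elim
          case (elim x)
          have "jacobian (\<phi> m) (at x) = (1 - \<epsilon> m) *\<^sub>R conv_average \<rho> (\<epsilon> m) G' x"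
            unfolding \<phi>_def
            by (rule conv_average_weak_gradient[OF U(1-3) \<rho>(1) w'(1,2) w'L G'(1,2) wG' \<epsilon> elim(2)])
          then show ?case using elim by (simp add: algebra_simps)
        qed
      qed
      also have "\<dots> \<le> \<bar>1 - \<epsilon> m\<bar> * L2_norm (lebesgue_on U) (\<lambda>x. conv_average \<rho> (\<epsilon> m) G' x - G' x)
          + \<bar>- \<epsilon> m\<bar> * L2_norm (lebesgue_on U) G'"
        using L2_norm_triangle[OF L2_fun_scaleR[OF L2_fun_diff[OF gL G'L]] L2_fun_scaleR[OF G'L]]
        unfolding L2_norm_scaleR by blast
      also have "\<dots> \<le> 1 * L2_norm (lebesgue_on U) (\<lambda>x. conv_average \<rho> (\<epsilon> m) G' x - G' x)
          + \<epsilon> m * L2_norm (lebesgue_on U) G'"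
        using \<epsilon>[of m] by (intro add_mono mult_right_mono) auto
      finally show ?thesis by simp
    qed
    then show "\<forall>\<^sub>F m in sequentially. L2_norm (lebesgue_on U) (\<lambda>x. jacobian (\<phi> m) (at x) - G x) \<le>
       L2_norm (lebesgue_on U) (\<lambda>x. conv_average \<rho> (\<epsilon> m) G' x - G' x) + \<epsilon> m * L2_norm (lebesgue_on U) G'"
      by simp
    have e0: "\<epsilon> \<longlonglongrightarrow> 0" unfolding \<epsilon>_def using LIMSEQ_ignore_initial_segment[OF lim_1_over_n, of 2] by simp
    have A: "(\<lambda>m. L2_norm (lebesgue_on U) (\<lambda>x. conv_average \<rho> (\<epsilon> m) G' x - G' x)) \<longlonglongrightarrow> 0"
      using avg(2)[OF _ G'(1) G'L] by (simp add: \<epsilon>_def)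
    have "(\<lambda>m. L2_norm (lebesgue_on U) (\<lambda>x. conv_average \<rho> (\<epsilon> m) G' x - G' x) + \<epsilon> m * L2_norm (lebesgue_on U) G')
        \<longlonglongrightarrow> 0 + 0 * L2_norm (lebesgue_on U) G'"
      by (intro tendsto_add tendsto_mult A e0 tendsto_const)
    then show "(\<lambda>m. L2_norm (lebesgue_on U) (\<lambda>x. conv_average \<rho> (\<epsilon> m) G' x - G' x) + \<epsilon> m * L2_norm (lebesgue_on U) G') \<longlonglongrightarrow> 0"
      by simp
  qed auto
  ultimately show ?thesis using that[of \<phi>] sm by blast
qed

text \<open>Each average of f at a point of U is an integral of f against a test function, hence
  zero; but the averages converge to f in L2.\<close>

theorem fundamental_lemma:
  fixes f :: "real ^ 'n \<Rightarrow> real"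
  assumes U: "open U" "convex U" "bounded U" and f: "L2_fun (lebesgue_on U) f"
    and 0: "\<And>\<phi>. test_function U \<phi> \<Longrightarrow> (\<integral>x. f x * \<phi> x \<partial>lebesgue_on U) = 0"
  shows "AE x in lebesgue_on U. f x = 0"
proof (cases "U = {}")
  case True then show ?thesis by (intro AE_I2) auto
next
  case False
  have Ub: "U \<in> sets borel" "U \<in> sets lebesgue" using U by auto
  obtain g where g: "g \<in> borel_measurable borel" "\<And>x. x \<notin> U \<Longrightarrow> g x = 0" "AE x in lebesgue_on U. f x = g x"
    using borel_representative[OF Ub(1) L2_funD(1)[OF f]] by blast
  have gL: "L2_fun (lebesgue_on U) g" by (rule L2_fun_cong_AE[OF Ub(2) f g(3)])
  obtain \<rho> where \<rho>: "test_function U \<rho>" "\<And>x. 0 \<le> \<rho> x" "(\<integral>x. \<rho> x \<partial>lborel) = 1" "integrable lborel \<rho>"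
    using exists_test_function[OF U(1) False] by blast
  define \<epsilon> where "\<epsilon> m = 1 / real (m + 2)" for m :: nat
  have \<epsilon>: "0 < \<epsilon> m" "\<epsilon> m < 1" for m by (auto simp: \<epsilon>_def field_simps)
  have z: "conv_average \<rho> (\<epsilon> m) g x = 0" if x: "x \<in> U" for m x
  proof -
    define a where "a = 1 / \<epsilon> m"
    define b where "b = - (1 - \<epsilon> m) / \<epsilon> m"
    define \<psi> where "\<psi> y = a ^ DIM(real ^ 'n) * \<rho> (a *\<^sub>R y + b *\<^sub>R x)" for y
    have \<psi>: "test_function U \<psi>" unfolding \<psi>_def a_def b_def
      by (rule conv_kernel_test_function[OF U(2) \<rho>(1) \<epsilon> x])
    have m: "(\<lambda>y. g y * \<psi> y) \<in> borel_measurable borel"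
      by (intro borel_measurable_times g(1) test_functionD(5)[OF \<psi>])
    have "conv_average \<rho> (\<epsilon> m) g x = (\<integral>y. g y * \<psi> y \<partial>lborel)"
      using conv_average_eq[OF test_functionD(5)[OF \<rho>(1)] g(1) \<epsilon>(1), of m x]
      by (simp add: \<psi>_def a_def b_def mult.commute)
    also have "\<dots> = (\<integral>y. g y * \<psi> y \<partial>lebesgue_on U)"
      by (rule integral_lebesgue_on_borel[OF m Ub(1), symmetric]) (use g(2) in simp)
    also have "\<dots> = (\<integral>y. f y * \<psi> y \<partial>lebesgue_on U)"
    proof (rule integral_cong_AE)
      show "(\<lambda>y. g y * \<psi> y) \<in> borel_measurable (lebesgue_on U)" by (rule measurable_lebesgue_on[OF m])
      show "(\<lambda>y. f y * \<psi> y) \<in> borel_measurable (lebesgue_on U)"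
        by (intro borel_measurable_times L2_funD(1)[OF f] measurable_lebesgue_on[OF test_functionD(5)[OF \<psi>]])
      show "AE y in lebesgue_on U. g y * \<psi> y = f y * \<psi> y" using g(3) by eventually_elim simp
    qed
    also have "\<dots> = 0" by (rule 0[OF \<psi>])
    finally show ?thesis .
  qed
  have "(\<lambda>m. L2_norm (lebesgue_on U) (\<lambda>x. conv_average \<rho> (\<epsilon> m) g x - g x)) \<longlonglongrightarrow> 0"
    using conv_average_L2(2)[OF U(1-3) test_functionD(5,2)[OF \<rho>(1)] \<rho>(2,4,3) g(1) gL] by (simp add: \<epsilon>_def)
  moreover have "L2_norm (lebesgue_on U) (\<lambda>x. conv_average \<rho> (\<epsilon> m) g x - g x) = L2_norm (lebesgue_on U) g" for m
  proof -
    have "(\<integral>x. (norm (conv_average \<rho> (\<epsilon> m) g x - g x))\<^sup>2 \<partial>lebesgue_on U) = (\<integral>x. (norm (g x))\<^sup>2 \<partial>lebesgue_on U)"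
      by (rule Bochner_Integration.integral_cong) (use z in auto)
    then show ?thesis by (simp add: L2_norm_def)
  qed
  ultimately have "L2_norm (lebesgue_on U) g = 0" by (simp add: LIMSEQ_const_iff)
  then have "AE x in lebesgue_on U. g x = 0" using L2_norm_eq_0_iff[OF gL] by simp
  with g(3) show ?thesis by eventually_elim simp
qed

lemma integrable_L2_test_function:
  fixes f :: "real ^ 'n \<Rightarrow> real"
  assumes U: "open U" "bounded U" and f: "L2_fun (lebesgue_on U) f" and \<phi>: "test_function V \<phi>"
  shows "integrable (lebesgue_on U) (\<lambda>x. f x * \<phi> x)"
  using integrable_inner_L2[OF f L2_fun_lebesgue_on_continuous[OF test_functionD(4)[OF \<phi>] U]] by simp

theorem weak_gradient_unique:
  fixes w :: "real ^ 'n \<Rightarrow> real ^ 'n"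
  assumes U: "open U" "convex U" "bounded U"
    and G: "has_L2_weak_gradient U w G" and H: "has_L2_weak_gradient U w H"
  shows "AE x in lebesgue_on U. G x = H x"
proof -
  note GL = has_L2_weak_gradientD(1)[OF G] and HL = has_L2_weak_gradientD(1)[OF H]
  note Gc = L2_fun_vec_nth(1)[OF L2_fun_vec_nth(1)[OF GL]] and Hc = L2_fun_vec_nth(1)[OF L2_fun_vec_nth(1)[OF HL]]
  have "AE x in lebesgue_on U. G x $ i $ j - H x $ i $ j = 0" for i j
  proof (rule fundamental_lemma[OF U L2_fun_diff[OF Gc Hc]])
    fix \<phi> assume \<phi>: "test_function U \<phi>"
    have "(\<integral>x. G x $ i $ j * \<phi> x \<partial>lebesgue_on U) = (\<integral>x. H x $ i $ j * \<phi> x \<partial>lebesgue_on U)"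
      using has_L2_weak_gradientD(2)[OF G \<phi>, of i j] has_L2_weak_gradientD(2)[OF H \<phi>, of i j] by simp
    then show "(\<integral>x. (G x $ i $ j - H x $ i $ j) * \<phi> x \<partial>lebesgue_on U) = 0"
      using integrable_L2_test_function[OF U(1,3) Gc \<phi>, of i j] integrable_L2_test_function[OF U(1,3) Hc \<phi>, of i j]
      by (simp add: left_diff_distrib)
  qed
  then have "AE x in lebesgue_on U. \<forall>i\<in>UNIV. \<forall>j\<in>UNIV. G x $ i $ j - H x $ i $ j = 0"
    by (intro AE_finite_allI) auto
  then show ?thesis by eventually_elim (simp add: vec_eq_iff)
qed

section \<open>Integration over a cone\<close>

text \<open>Both \<open>lborel\<close> and its image are translation invariant, hence proportional; the factor is read
  off on the unit ball, which is fixed by the transformation.\<close>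

lemma distr_lborel_orthogonal_transformation:
  fixes L :: "'a::euclidean_space \<Rightarrow> 'a"
  assumes L: "orthogonal_transformation L"
  shows "distr lborel borel L = lborel"
proof -
  have lin: "linear L" by (rule orthogonal_transformation_linear[OF L])
  have surj: "surj L" by (rule orthogonal_transformation_surj[OF L])
  have "continuous_on UNIV L" using lin by (simp add: linear_continuous_on linear_conv_bounded_linear)
  then have [measurable]: "L \<in> borel_measurable borel" by (rule borel_measurable_continuous_onI)
  define g :: "'a \<Rightarrow> ennreal" where "g = indicator (ball 0 1)"
  have [measurable]: "g \<in> borel_measurable borel" unfolding g_def by (intro borel_measurable_indicator) auto
  have gL: "g (L y) = g y" for y
    using orthogonal_transformation_norm[OF L, of y] by (simp add: g_def indicator_def)
  define I where "I = (\<integral>\<^sup>+x. g x \<partial>lborel)"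
  have "I = emeasure lborel (ball (0::'a) 1)" by (simp add: I_def g_def)
  then have I: "I \<noteq> 0" "I \<noteq> \<infinity>"
    using open_not_negligible[of "ball (0::'a) 1"] emeasure_lborel_ball_finite[of "0::'a" 1]
    by (auto simp: negligible_iff_null_sets null_sets_completion_iff null_sets_def)
  have key: "(\<integral>\<^sup>+x. f x \<partial>lborel) = (\<integral>\<^sup>+x. f (L x) \<partial>lborel)"
    if [measurable]: "f \<in> borel_measurable borel" for f :: "'a \<Rightarrow> ennreal"
  proof -
    \<comment> \<open>The double integral of f(L y + x) g(L y) is evaluated in two ways. Integrating
      out x first gives I times the integral of f; shifting y by a preimage of x separates f(L y)
      from g(L y - x) and gives I times the integral of f composed with L.\<close>
    have "(\<integral>\<^sup>+x. f x \<partial>lborel) * I = (\<integral>\<^sup>+y. (\<integral>\<^sup>+x. f x \<partial>lborel) * g (L y) \<partial>lborel)"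
      unfolding I_def gL by (subst nn_integral_cmult) auto
    also have "\<dots> = (\<integral>\<^sup>+y. \<integral>\<^sup>+x. f (L y + x) * g (L y) \<partial>lborel \<partial>lborel)"
    proof (rule nn_integral_cong)
      fix y
      have "(\<integral>\<^sup>+x. f x \<partial>lborel) = (\<integral>\<^sup>+x. f (L y + x) \<partial>lborel)"
        using nn_integral_lborel_affine[of f 1 "L y"] by simp
      then show "(\<integral>\<^sup>+x. f x \<partial>lborel) * g (L y) = (\<integral>\<^sup>+x. f (L y + x) * g (L y) \<partial>lborel)"
        by (subst nn_integral_multc) auto
    qed
    also have "\<dots> = (\<integral>\<^sup>+x. \<integral>\<^sup>+y. f (L y + x) * g (L y) \<partial>lborel \<partial>lborel)"
      by (rule lborel_pair.Fubini') measurable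
    also have "\<dots> = (\<integral>\<^sup>+x. \<integral>\<^sup>+y. f (L y) * g (L y - x) \<partial>lborel \<partial>lborel)"
    proof (rule nn_integral_cong)
      fix x
      obtain x' where x': "L x' = x" using surj by (metis surjD)
      have "(\<integral>\<^sup>+y. f (L y + x) * g (L y) \<partial>lborel) = (\<integral>\<^sup>+y. f (L (- x' + y) + x) * g (L (- x' + y)) \<partial>lborel)"
        using nn_integral_lborel_affine[of "\<lambda>y. f (L y + x) * g (L y)" 1 "- x'"] by simp
      then show "(\<integral>\<^sup>+y. f (L y + x) * g (L y) \<partial>lborel) = (\<integral>\<^sup>+y. f (L y) * g (L y - x) \<partial>lborel)"
        by (simp add: linear_add[OF lin] linear_neg[OF lin] linear_diff[OF lin] x' algebra_simps)
    qed
    also have "\<dots> = (\<integral>\<^sup>+y. \<integral>\<^sup>+x. f (L y) * g (L y - x) \<partial>lborel \<partial>lborel)"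
      by (rule lborel_pair.Fubini') measurable
    also have "\<dots> = (\<integral>\<^sup>+y. f (L y) * I \<partial>lborel)"
    proof (rule nn_integral_cong)
      fix y
      have "I = (\<integral>\<^sup>+x. g (L y - x) \<partial>lborel)"
        unfolding I_def using nn_integral_lborel_affine[of g "-1" "L y"] by simp
      then show "(\<integral>\<^sup>+x. f (L y) * g (L y - x) \<partial>lborel) = f (L y) * I"
        by (subst nn_integral_cmult) auto
    qed
    also have "\<dots> = (\<integral>\<^sup>+y. f (L y) \<partial>lborel) * I" by (rule nn_integral_multc) measurable
    finally show ?thesis using I by (simp add: mult.commute[of _ I] ennreal_mult_cancel_left)
  qed
  show ?thesis
  proof (rule measure_eqI)
    fix A assume "A \<in> sets (distr lborel borel L)"
    then have [measurable]: "A \<in> sets borel" by simp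
    have "emeasure (distr lborel borel L) A = (\<integral>\<^sup>+x. indicator A x \<partial>distr lborel borel L)" by simp
    also have "\<dots> = (\<integral>\<^sup>+x. indicator A (L x) \<partial>lborel)" by (rule nn_integral_distr) auto
    also have "\<dots> = emeasure lborel A" using key[of "indicator A"] by simp
    finally show "emeasure (distr lborel borel L) A = emeasure lborel A" .
  qed simp
qed

lemma measurable_coordinates [measurable]:
  fixes B :: "'a::euclidean_space set"
  shows "(\<lambda>c. \<Sum>b\<in>B. c b *\<^sub>R b) \<in> borel_measurable (\<Pi>\<^sub>M b\<in>B. lborel)"
  by measurable

text \<open>B is the image of the standard basis under an orthogonal map L, and L preserves
  \<open>lborel\<close>. What remains is to relabel the coordinates of the product measure along the
  bijection between the two bases.\<close>

lemma lborel_eq_orthonormal: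
  fixes B :: "(real ^ 'n) set"
  assumes fin: "finite B" and orth: "pairwise orthogonal B" and unit: "\<And>b. b \<in> B \<Longrightarrow> norm b = 1"
    and card: "card B = DIM(real ^ 'n)"
  shows "(lborel :: (real ^ 'n) measure) = distr (\<Pi>\<^sub>M b\<in>B. lborel) borel (\<lambda>c. \<Sum>b\<in>B. c b *\<^sub>R b)"
proof -
  interpret P: product_sigma_finite "\<lambda>_::real ^ 'n. lborel :: real measure" by standard
  obtain \<phi> where \<phi>: "bij_betw \<phi> (Basis :: (real ^ 'n) set) B"
    using finite_same_card_bij[of "Basis :: (real ^ 'n) set" B] fin card by auto
  define L where "L x = (\<Sum>e\<in>Basis. (x \<bullet> e) *\<^sub>R \<phi> e)" for x :: "real ^ 'n"
  have in_B: "\<phi> e \<in> B" if "e \<in> Basis" for e using \<phi> that by (auto simp: bij_betw_def)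
  have dot: "\<phi> e \<bullet> \<phi> e' = (if e = e' then 1 else 0)" if "e \<in> Basis" "e' \<in> Basis" for e e'
  proof (cases "e = e'")
    case True then show ?thesis using unit[OF in_B[OF that(1)]] by (simp add: norm_eq_sqrt_inner)
  next
    case False
    then have "\<phi> e \<noteq> \<phi> e'" using \<phi> that by (auto simp: bij_betw_def inj_on_def)
    then show ?thesis using orth in_B that False by (auto simp: pairwise_def orthogonal_def)
  qed
  have "orthogonal_transformation L"
    unfolding orthogonal_transformation_def
  proof (intro conjI allI)
    show "linear L" by (rule linearI) (simp_all add: L_def inner_add_left scaleR_add_left sum.distrib scaleR_sum_right)
    fix v w
    have "L v \<bullet> L w = (\<Sum>e\<in>Basis. \<Sum>e'\<in>Basis. (v \<bullet> e) * ((w \<bullet> e') * (\<phi> e \<bullet> \<phi> e')))"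
      unfolding L_def inner_sum_left
      by (intro sum.cong refl) (simp only: inner_sum_right inner_scaleR_left inner_scaleR_right sum_distrib_left mult.left_commute)
    also have "\<dots> = (\<Sum>e\<in>Basis. \<Sum>e'\<in>Basis. if e = e' then (v \<bullet> e) * (w \<bullet> e') else 0)"
      by (intro sum.cong refl) (simp add: dot)
    also have "\<dots> = (\<Sum>e\<in>Basis. (v \<bullet> e) * (w \<bullet> e))" by simp
    also have "\<dots> = v \<bullet> w" by (rule euclidean_inner[symmetric])
    finally show "L v \<bullet> L w = v \<bullet> w" .
  qed
  then have L: "distr lborel borel L = lborel" by (rule distr_lborel_orthogonal_transformation)
  have Lm [measurable]: "L \<in> borel_measurable borel" unfolding L_def by measurable
  have re: "distr (\<Pi>\<^sub>M b\<in>B. lborel) (\<Pi>\<^sub>M e\<in>Basis. lborel) (\<lambda>\<omega>. \<lambda>e\<in>Basis. \<omega> (\<phi> e)) = (\<Pi>\<^sub>M e\<in>(Basis :: (real ^ 'n) set). (lborel :: real measure))"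
  proof (rule P.PiM_eqI)
    fix A :: "real ^ 'n \<Rightarrow> real set" assume A: "\<And>e. e \<in> Basis \<Longrightarrow> A e \<in> sets (lborel :: real measure)"
    have m: "(\<lambda>\<omega>. \<lambda>e\<in>Basis. \<omega> (\<phi> e)) \<in> measurable (\<Pi>\<^sub>M b\<in>B. (lborel :: real measure)) (\<Pi>\<^sub>M e\<in>Basis. lborel)"
      by (rule measurable_restrict) (use in_B in measurable)
    define A' where "A' b = A (inv_into Basis \<phi> b)" for b
    have A': "A' (\<phi> e) = A e" if "e \<in> Basis" for e
      using \<phi> that by (simp add: A'_def bij_betw_def)
    have A'm: "A' b \<in> sets (lborel :: real measure)" if "b \<in> B" for b
      using A \<phi> that unfolding A'_def by (metis bij_betw_def inv_into_into)
    have "(\<lambda>\<omega>. \<lambda>e\<in>Basis. \<omega> (\<phi> e)) -` (Pi\<^sub>E Basis A) \<inter> space (\<Pi>\<^sub>M b\<in>B. (lborel :: real measure)) = Pi\<^sub>E B A'"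
    proof -
      have "B = \<phi> ` Basis" using \<phi> by (simp add: bij_betw_def)
      then have "(\<forall>e\<in>Basis. \<omega> (\<phi> e) \<in> A e) \<longleftrightarrow> (\<forall>b\<in>B. \<omega> b \<in> A' b)" for \<omega>
        by (simp add: A')
      then show ?thesis
        by (simp add: set_eq_iff space_PiM PiE_iff extensional_def restrict_def Ball_def)
    qed
    then have "emeasure (distr (\<Pi>\<^sub>M b\<in>B. lborel) (\<Pi>\<^sub>M e\<in>Basis. lborel) (\<lambda>\<omega>. \<lambda>e\<in>Basis. \<omega> (\<phi> e))) (Pi\<^sub>E Basis A)
        = emeasure (\<Pi>\<^sub>M b\<in>B. (lborel :: real measure)) (Pi\<^sub>E B A')"
      using A by (subst emeasure_distr[OF m]) (auto intro!: sets_PiM_I_finite)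
    also have "\<dots> = (\<Prod>b\<in>B. emeasure lborel (A' b))"
      using A'm fin by (intro P.emeasure_PiM) auto
    also have "\<dots> = (\<Prod>e\<in>Basis. emeasure lborel (A e))"
      using A' by (subst prod.reindex_bij_betw[OF \<phi>, symmetric]) simp
    finally show "emeasure (distr (\<Pi>\<^sub>M b\<in>B. lborel) (\<Pi>\<^sub>M e\<in>Basis. lborel) (\<lambda>\<omega>. \<lambda>e\<in>Basis. \<omega> (\<phi> e))) (Pi\<^sub>E Basis A)
        = (\<Prod>e\<in>Basis. emeasure lborel (A e))" .
  qed auto
  have m1: "(\<lambda>\<omega>. \<lambda>e\<in>Basis. \<omega> (\<phi> e)) \<in> measurable (\<Pi>\<^sub>M b\<in>B. (lborel :: real measure)) (\<Pi>\<^sub>M e\<in>Basis. lborel)"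
    by (rule measurable_restrict) (use in_B in measurable)
  have "(lborel :: (real ^ 'n) measure) = distr (distr (\<Pi>\<^sub>M e\<in>Basis. lborel) borel (\<lambda>c. \<Sum>e\<in>Basis. c e *\<^sub>R e)) borel L"
    unfolding lborel_eq[symmetric] L ..
  also have "\<dots> = distr (\<Pi>\<^sub>M e\<in>(Basis :: (real ^ 'n) set). lborel) borel (L \<circ> (\<lambda>c. \<Sum>e\<in>Basis. c e *\<^sub>R e))"
    by (rule distr_distr) measurable
  also have "L \<circ> (\<lambda>c. \<Sum>e\<in>Basis. c e *\<^sub>R e) = (\<lambda>c. \<Sum>e\<in>Basis. c e *\<^sub>R \<phi> e)"
    by (simp add: L_def fun_eq_iff)
  also have "distr (\<Pi>\<^sub>M e\<in>(Basis :: (real ^ 'n) set). lborel) borel (\<lambda>c. \<Sum>e\<in>Basis. c e *\<^sub>R \<phi> e) =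
      distr (\<Pi>\<^sub>M b\<in>B. lborel) borel ((\<lambda>c. \<Sum>e\<in>Basis. c e *\<^sub>R \<phi> e) \<circ> (\<lambda>\<omega>. \<lambda>e\<in>Basis. \<omega> (\<phi> e)))"
    by (subst re[symmetric], rule distr_distr[OF _ m1]) measurable
  also have "((\<lambda>c. \<Sum>e\<in>Basis. c e *\<^sub>R \<phi> e) \<circ> (\<lambda>\<omega>. \<lambda>e\<in>Basis. \<omega> (\<phi> e))) = (\<lambda>c. \<Sum>b\<in>B. c b *\<^sub>R b)"
    using sum.reindex_bij_betw[OF \<phi>] by (auto simp: fun_eq_iff)
  finally show ?thesis .
qed

text \<open>Product measures are determined by boxes, and on a box every coordinate contributes one
  factor s.\<close>

lemma nn_integral_PiM_affine:
  fixes B :: "'i set" and \<alpha> :: "'i \<Rightarrow> real"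
  assumes fin: "finite B" and s: "s > 0"
    and v [measurable]: "v \<in> borel_measurable (\<Pi>\<^sub>M b\<in>B. lborel)"
  shows "(\<integral>\<^sup>+c. v c \<partial>(\<Pi>\<^sub>M b\<in>B. lborel)) =
    ennreal (s ^ card B) * (\<integral>\<^sup>+c. v (\<lambda>b\<in>B. \<alpha> b + s * c b) \<partial>(\<Pi>\<^sub>M b\<in>B. lborel))"
proof -
  interpret P: product_sigma_finite "\<lambda>_::'i. lborel :: real measure" by standard
  let ?P = "\<Pi>\<^sub>M b\<in>B. (lborel :: real measure)"
  let ?T = "\<lambda>c. \<lambda>b\<in>B. \<alpha> b + s * c b"
  have m [measurable]: "?T \<in> measurable ?P ?P"
    by (rule measurable_restrict) measurable
  have "density (distr ?P ?P ?T) (\<lambda>_. ennreal (s ^ card B)) = ?P"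
  proof (rule P.PiM_eqI[OF fin])
    fix A assume A: "\<And>b. b \<in> B \<Longrightarrow> A b \<in> sets (lborel :: real measure)"
    define A' where "A' b = (\<lambda>y. \<alpha> b + s * y) -` A b" for b
    have A'm: "A' b \<in> sets (lborel :: real measure)" if "b \<in> B" for b
      using measurable_sets_borel[of "\<lambda>y. \<alpha> b + s * y" borel "A b"] A[OF that] by (simp add: A'_def)
    have AP: "Pi\<^sub>E B A \<in> sets ?P" using A fin by (intro sets_PiM_I_finite) auto
    have pre: "?T -` (Pi\<^sub>E B A) \<inter> space ?P = Pi\<^sub>E B A'"
      by (auto simp: space_PiM PiE_iff A'_def)
    have one: "ennreal s * emeasure lborel (A' b) = emeasure lborel (A b)" if b: "b \<in> B" for b
    proof -
      have "emeasure lborel (A b) = emeasure (density (distr lborel borel (\<lambda>x. \<alpha> b + s * x)) (\<lambda>_. ennreal \<bar>s\<bar>)) (A b)"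
        using lborel_real_affine[of s "\<alpha> b"] s by simp
      also have "\<dots> = ennreal s * emeasure (distr lborel borel (\<lambda>x. \<alpha> b + s * x)) (A b)"
        using s A[OF b] by (subst emeasure_density) (auto simp: nn_integral_cmult_indicator)
      also have "emeasure (distr lborel borel (\<lambda>x. \<alpha> b + s * x)) (A b) = emeasure lborel (A' b)"
        using A[OF b] by (subst emeasure_distr) (auto simp: A'_def)
      finally show ?thesis ..
    qed
    have "emeasure (density (distr ?P ?P ?T) (\<lambda>_. ennreal (s ^ card B))) (Pi\<^sub>E B A) =
        ennreal (s ^ card B) * emeasure (distr ?P ?P ?T) (Pi\<^sub>E B A)"
      using AP by (subst emeasure_density) (auto simp: nn_integral_cmult_indicator)
    also have "emeasure (distr ?P ?P ?T) (Pi\<^sub>E B A) = emeasure ?P (Pi\<^sub>E B A')"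
      using AP by (subst emeasure_distr) (auto simp: pre)
    also have "\<dots> = (\<Prod>b\<in>B. emeasure lborel (A' b))"
      using A'm fin by (intro P.emeasure_PiM) auto
    also have "ennreal (s ^ card B) * (\<Prod>b\<in>B. emeasure lborel (A' b)) = (\<Prod>b\<in>B. ennreal s * emeasure lborel (A' b))"
      using s by (simp add: prod.distrib ennreal_power)
    also have "\<dots> = (\<Prod>b\<in>B. emeasure lborel (A b))" by (rule prod.cong) (auto simp: one)
    finally show "emeasure (density (distr ?P ?P ?T) (\<lambda>_. ennreal (s ^ card B))) (Pi\<^sub>E B A) =
        (\<Prod>b\<in>B. emeasure lborel (A b))" .
  qed simp
  then have "(\<integral>\<^sup>+c. v c \<partial>?P) = (\<integral>\<^sup>+c. v c \<partial>density (distr ?P ?P ?T) (\<lambda>_. ennreal (s ^ card B)))" by simp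
  also have "\<dots> = ennreal (s ^ card B) * (\<integral>\<^sup>+c. v (?T c) \<partial>?P)"
    by (subst nn_integral_density) (auto simp: nn_integral_distr nn_integral_cmult)
  finally show ?thesis .
qed

text \<open>The slice of K at height s h from the apex is the copy (1 - s) a + s F of the face.
  Scaling by s multiplies its (d - 1)-dimensional measure by s^(d - 1), and the height contributes h
  ds.\<close>

lemma nn_integral_cone:
  fixes B F K :: "(real ^ 'n) set" and a n p :: "real ^ 'n"
  assumes fin: "finite B" and orth: "pairwise orthogonal (insert n B)" and unit: "\<And>b. b \<in> insert n B \<Longrightarrow> norm b = 1"
    and n: "n \<notin> B" and card: "Suc (card B) = CARD('n)"
    and h: "(p - a) \<bullet> n = h" "h > 0"
    and F: "F \<in> sets borel" "\<And>x. x \<in> F \<Longrightarrow> (x - p) \<bullet> n = 0"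
    and K: "K \<in> sets borel" "K = {(1 - s) *\<^sub>R a + s *\<^sub>R y |s y. 0 \<le> s \<and> s \<le> 1 \<and> y \<in> F}"
    and u [measurable]: "u \<in> borel_measurable borel"
  defines "S \<equiv> restrict_space (distr (\<Pi>\<^sub>M b\<in>B. lborel) borel (\<lambda>c. p + (\<Sum>b\<in>B. c b *\<^sub>R b))) F"
  shows "(\<integral>\<^sup>+x. u x * indicator K x \<partial>lborel) =
    (\<integral>\<^sup>+s. (\<integral>\<^sup>+y. indicator {0..1} s * ennreal (h * s ^ (CARD('n) - 1)) * u ((1 - s) *\<^sub>R a + s *\<^sub>R y) \<partial>S) \<partial>lborel)"
proof -
  interpret P: product_sigma_finite "\<lambda>_::real ^ 'n. lborel :: real measure" by standard
  note [measurable] = F(1) K(1)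
  define Y where "Y c = p + (\<Sum>b\<in>B. c b *\<^sub>R b)" for c :: "real ^ 'n \<Rightarrow> real"
  have Ym [measurable]: "Y \<in> borel_measurable (\<Pi>\<^sub>M b\<in>B. lborel)" unfolding Y_def by measurable
  have Bn: "b \<bullet> n = 0" if "b \<in> B" for b
    using orth that n by (auto simp: pairwise_def orthogonal_def)
  have nn1: "n \<bullet> n = 1" using unit[of n] by (simp add: norm_eq_sqrt_inner)
  have Yn: "(Y c - p) \<bullet> n = 0" for c
    by (simp add: Y_def inner_sum_left Bn)
  \<comment> \<open>Coordinates of the foot of the perpendicular from the apex to the hyperplane of
    F; \<open>Y \<alpha>\<close> is that foot.\<close>
  define \<alpha> where "\<alpha> b = (a - p) \<bullet> b" for b
  define uK where "uK x = u x * indicator K x" for x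
  have uKm [measurable]: "uK \<in> borel_measurable borel" unfolding uK_def by measurable
  have ortho: "pairwise orthogonal B" using orth by (simp add: pairwise_insert)
  have spanB: "span (insert n B) = UNIV"
  proof -
    have "0 \<notin> insert n B" using unit by force
    then have "independent (insert n B)" using orth pairwise_orthogonal_independent by blast
    moreover have "card (insert n B) = DIM(real ^ 'n)" using fin n card by simp
    ultimately show ?thesis using card_eq_dim[of "insert n B" UNIV] fin by (auto simp: dim_UNIV)
  qed
  have a_eq: "a = Y \<alpha> - h *\<^sub>R n"
  proof -
    have "x = 0" if "\<And>b. b \<in> insert n B \<Longrightarrow> x \<bullet> b = 0" for x
    proof -
      have "x \<in> span (insert n B)" using spanB by simp
      then have "orthogonal x x" by (rule orthogonal_to_span) (use that in \<open>auto simp: orthogonal_def inner_commute\<close>)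
      then show ?thesis by (simp add: orthogonal_def)
    qed
    moreover have "(Y \<alpha> - h *\<^sub>R n - a) \<bullet> b = 0" if b: "b \<in> insert n B" for b
    proof (cases "b = n")
      case True
      then show ?thesis using Yn[of \<alpha>] h(1) nn1 by (simp add: algebra_simps inner_diff_left)
    next
      case False
      then have bB: "b \<in> B" using b by simp
      have "(\<Sum>b'\<in>B. \<alpha> b' * (b' \<bullet> b)) = (\<Sum>b'\<in>B. if b' = b then \<alpha> b else 0)"
        using ortho bB unit[OF b]
        by (intro sum.cong) (auto simp: pairwise_def orthogonal_def norm_eq_sqrt_inner)
      then have "(Y \<alpha> - p) \<bullet> b = \<alpha> b" using fin bB by (simp add: Y_def inner_sum_left)
      then show ?thesis using Bn[OF bB] by (simp add: \<alpha>_def inner_diff_left inner_commute[of n])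
    qed
    ultimately have "Y \<alpha> - h *\<^sub>R n - a = 0" by blast
    then show ?thesis by simp
  qed
  \<comment> \<open>The affine change c to (1 - s) \<alpha> + s c of the face coordinates realises
    the homothety with centre a and ratio s, seen in the parallel hyperplane at signed height (s -
    1) h.\<close>
  have Yaff: "Y (\<lambda>b\<in>B. (1 - s) * \<alpha> b + s * c b) + (s - 1) *\<^sub>R (h *\<^sub>R n) = (1 - s) *\<^sub>R a + s *\<^sub>R Y c" for s c
  proof -
    have "Y (\<lambda>b\<in>B. (1 - s) * \<alpha> b + s * c b) = (1 - s) *\<^sub>R Y \<alpha> + s *\<^sub>R Y c"
      by (simp add: Y_def scaleR_add_left sum.distrib scaleR_add_right scaleR_sum_right sum_subtractf algebra_simps)
    then show ?thesis by (subst a_eq) (simp add: algebra_simps)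
  qed
  have height: "((1 - s) *\<^sub>R a + s *\<^sub>R y - a) \<bullet> n = s * h" if "(y - p) \<bullet> n = 0" for s y
  proof -
    have "(1 - s) *\<^sub>R a + s *\<^sub>R y - a = s *\<^sub>R ((y - p) + (p - a))" by (simp add: algebra_simps)
    then show ?thesis using that h(1) by (simp only: inner_add_left inner_scaleR_left add_0)
  qed
  \<comment> \<open>The height determines s, so a point of the slice lies in K exactly when its
    radial projection lies in F. The value s = 0, the apex, is excluded; it is a null set of
    parameters.\<close>
  have inK: "(1 - s) *\<^sub>R a + s *\<^sub>R Y c \<in> K \<longleftrightarrow> s \<le> 1 \<and> 0 < s \<and> Y c \<in> F" if "s \<noteq> 0" for s c
  proof
    assume "(1 - s) *\<^sub>R a + s *\<^sub>R Y c \<in> K"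
    then obtain s' y where sy: "(1 - s) *\<^sub>R a + s *\<^sub>R Y c = (1 - s') *\<^sub>R a + s' *\<^sub>R y" "0 \<le> s'" "s' \<le> 1" "y \<in> F"
      using K(2) by blast
    have "s * h = s' * h" 
      by (rule trans[OF height[OF Yn, of s c, unfolded sy(1), symmetric] height[OF F(2)[OF sy(4)], of s']])
    then have "s = s'" using h(2) by simp
    then show "s \<le> 1 \<and> 0 < s \<and> Y c \<in> F" using sy that by auto
  next
    assume "s \<le> 1 \<and> 0 < s \<and> Y c \<in> F"
    then show "(1 - s) *\<^sub>R a + s *\<^sub>R Y c \<in> K" unfolding K(2) by (intro CollectI exI[of _ s] exI[of _ "Y c"]) auto
  qed
  have "(\<integral>\<^sup>+x. uK x \<partial>lborel) = (\<integral>\<^sup>+x. uK (p + x) \<partial>lborel)"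
    using nn_integral_lborel_affine[OF uKm, of 1 p] by simp
  also have "\<dots> = (\<integral>\<^sup>+c. uK (p + (\<Sum>b\<in>insert n B. c b *\<^sub>R b)) \<partial>(\<Pi>\<^sub>M b\<in>insert n B. lborel))"
    by (subst lborel_eq_orthonormal[of "insert n B"])
       (use fin orth unit n card in \<open>auto intro!: nn_integral_distr\<close>)
  also have "\<dots> = (\<integral>\<^sup>+t. \<integral>\<^sup>+c. uK (p + (\<Sum>b\<in>insert n B. (c(n := t)) b *\<^sub>R b)) \<partial>(\<Pi>\<^sub>M b\<in>B. lborel) \<partial>lborel)"
    by (rule P.product_nn_integral_insert_rev[OF fin n]) measurable
  also have "\<dots> = (\<integral>\<^sup>+t. \<integral>\<^sup>+c. uK (Y c + t *\<^sub>R n) \<partial>(\<Pi>\<^sub>M b\<in>B. lborel) \<partial>lborel)"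
  proof -
    have "p + (\<Sum>b\<in>insert n B. (c(n := t)) b *\<^sub>R b) = Y c + t *\<^sub>R n" for c t
    proof -
      have "(\<Sum>b\<in>B. (c(n := t)) b *\<^sub>R b) = (\<Sum>b\<in>B. c b *\<^sub>R b)"
        using n by (intro sum.cong) auto
      then show ?thesis using fin n by (simp add: Y_def)
    qed
    then show ?thesis by simp
  qed
  \<comment> \<open>Substitution t = h (s - 1): the face sits at t = 0, that is s = 1, and the apex
    at t = -h, that is s = 0.\<close>
  also have "\<dots> = ennreal \<bar>h\<bar> * (\<integral>\<^sup>+s. \<integral>\<^sup>+c. uK (Y c + (- h + h * s) *\<^sub>R n) \<partial>(\<Pi>\<^sub>M b\<in>B. lborel) \<partial>lborel)"
  proof -
    interpret F: sigma_finite_measure "\<Pi>\<^sub>M b\<in>B. (lborel :: real measure)"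
      using P.sigma_finite[OF fin] .
    have "(\<lambda>t. \<integral>\<^sup>+c. uK (Y c + t *\<^sub>R n) \<partial>(\<Pi>\<^sub>M b\<in>B. lborel)) \<in> borel_measurable borel"
      by measurable
    from nn_integral_real_affine[OF this, of h "-h"] h(2) show ?thesis by simp
  qed
  also have "\<dots> = ennreal h * (\<integral>\<^sup>+s. indicator {0..1} s * (ennreal (s ^ (CARD('n) - 1)) *
      (\<integral>\<^sup>+c. uK ((1 - s) *\<^sub>R a + s *\<^sub>R Y c) \<partial>(\<Pi>\<^sub>M b\<in>B. lborel))) \<partial>lborel)"
  proof -
    have "(\<integral>\<^sup>+c. uK (Y c + (- h + h * s) *\<^sub>R n) \<partial>(\<Pi>\<^sub>M b\<in>B. lborel)) =
        indicator {0..1} s * (ennreal (s ^ (CARD('n) - 1)) * (\<integral>\<^sup>+c. uK ((1 - s) *\<^sub>R a + s *\<^sub>R Y c) \<partial>(\<Pi>\<^sub>M b\<in>B. lborel)))"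
      if s0: "s \<noteq> 0" for s
    proof -
      have sh: "(- h + h * s) *\<^sub>R n = (s - 1) *\<^sub>R (h *\<^sub>R n)" by (simp add: algebra_simps)
      show ?thesis
      proof (cases "s > 0")
        case True
        have "(\<lambda>c. uK (Y c + (s - 1) *\<^sub>R (h *\<^sub>R n))) \<in> borel_measurable (\<Pi>\<^sub>M b\<in>B. lborel)"
          by measurable
        from nn_integral_PiM_affine[OF fin True this, of "\<lambda>b. (1 - s) * \<alpha> b"]
        have "(\<integral>\<^sup>+c. uK (Y c + (- h + h * s) *\<^sub>R n) \<partial>(\<Pi>\<^sub>M b\<in>B. lborel)) =
          ennreal (s ^ card B) * (\<integral>\<^sup>+c. uK ((1 - s) *\<^sub>R a + s *\<^sub>R Y c) \<partial>(\<Pi>\<^sub>M b\<in>B. lborel))"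
          unfolding Yaff sh .
        moreover have "CARD('n) - 1 = card B" using card by simp
        moreover have "(\<integral>\<^sup>+c. uK ((1 - s) *\<^sub>R a + s *\<^sub>R Y c) \<partial>(\<Pi>\<^sub>M b\<in>B. lborel)) = 0" if "s > 1"
          using that inK[OF s0] by (auto simp: uK_def)
        ultimately show ?thesis using True by (cases "s \<le> 1") auto
      next
        case False
        have "uK (Y c + (- h + h * s) *\<^sub>R n) = 0" for c
        proof -
          \<comment> \<open>Solves c = (1 - s) \<alpha> + s c' for c', possible since s is nonzero;
            it exhibits the point in radial form, so that \<open>inK\<close> rules it out for
            negative s.\<close>
          define c' where "c' = (\<lambda>b. (c b - (1 - s) * \<alpha> b) / s)"
          have "Y c = Y (\<lambda>b\<in>B. (1 - s) * \<alpha> b + s * c' b)"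
            unfolding Y_def using s0 by (intro arg_cong2[where f="(+)"] refl sum.cong) (auto simp: c'_def)
          then have "Y c + (- h + h * s) *\<^sub>R n = (1 - s) *\<^sub>R a + s *\<^sub>R Y c'"
            unfolding sh using Yaff[of s c'] by simp
          then show ?thesis using inK[OF s0, of c'] False by (simp add: uK_def)
        qed
        then show ?thesis using False s0 by simp
      qed
    qed
    then have "(\<integral>\<^sup>+s. \<integral>\<^sup>+c. uK (Y c + (- h + h * s) *\<^sub>R n) \<partial>(\<Pi>\<^sub>M b\<in>B. lborel) \<partial>lborel) =
      (\<integral>\<^sup>+s. indicator {0..1} s * (ennreal (s ^ (CARD('n) - 1)) *
      (\<integral>\<^sup>+c. uK ((1 - s) *\<^sub>R a + s *\<^sub>R Y c) \<partial>(\<Pi>\<^sub>M b\<in>B. lborel))) \<partial>lborel)"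
      by (intro nn_integral_cong_AE eventually_mono[OF AE_lborel_singleton[of 0]])
    then show ?thesis using h(2) by simp
  qed
  also have "\<dots> = (\<integral>\<^sup>+s. ennreal h * (indicator {0..1} s * (ennreal (s ^ (CARD('n) - 1)) *
      (\<integral>\<^sup>+c. uK ((1 - s) *\<^sub>R a + s *\<^sub>R Y c) \<partial>(\<Pi>\<^sub>M b\<in>B. lborel)))) \<partial>lborel)"
  proof (rule nn_integral_cmult[symmetric])
    interpret F: sigma_finite_measure "\<Pi>\<^sub>M b\<in>B. (lborel :: real measure)"
      using P.sigma_finite[OF fin] .
    show "(\<lambda>s. indicator {0..1} s * (ennreal (s ^ (CARD('n) - 1)) *
      (\<integral>\<^sup>+c. uK ((1 - s) *\<^sub>R a + s *\<^sub>R Y c) \<partial>(\<Pi>\<^sub>M b\<in>B. lborel)))) \<in> borel_measurable lborel"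
      by measurable
  qed
  also have "\<dots> = (\<integral>\<^sup>+s. (\<integral>\<^sup>+y. indicator {0..1} s * ennreal (h * s ^ (CARD('n) - 1)) * u ((1 - s) *\<^sub>R a + s *\<^sub>R y) \<partial>S) \<partial>lborel)"
  proof (rule nn_integral_cong_AE, rule eventually_mono[OF AE_lborel_singleton[of 0]])
    fix s :: real assume s0: "s \<noteq> 0"
    have "(\<integral>\<^sup>+y. indicator {0..1} s * ennreal (h * s ^ (CARD('n) - 1)) * u ((1 - s) *\<^sub>R a + s *\<^sub>R y) \<partial>S) =
      (\<integral>\<^sup>+c. indicator {0..1} s * ennreal (h * s ^ (CARD('n) - 1)) * u ((1 - s) *\<^sub>R a + s *\<^sub>R Y c) * indicator F (Y c) \<partial>(\<Pi>\<^sub>M b\<in>B. lborel))"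
      unfolding S_def Y_def[symmetric]
      by (subst nn_integral_restrict_space) (auto intro!: nn_integral_distr)
    also have "\<dots> = (\<integral>\<^sup>+c. indicator {0..1} s * ennreal (h * s ^ (CARD('n) - 1)) * uK ((1 - s) *\<^sub>R a + s *\<^sub>R Y c) \<partial>(\<Pi>\<^sub>M b\<in>B. lborel))"
      using inK[OF s0] s0 by (intro nn_integral_cong) (auto simp: uK_def indicator_def)
    also have "\<dots> = indicator {0..1} s * ennreal (h * s ^ (CARD('n) - 1)) * (\<integral>\<^sup>+c. uK ((1 - s) *\<^sub>R a + s *\<^sub>R Y c) \<partial>(\<Pi>\<^sub>M b\<in>B. lborel))"
      by (rule nn_integral_cmult) measurable
    finally show "ennreal h * (indicator {0..1} s * (ennreal (s ^ (CARD('n) - 1)) *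
      (\<integral>\<^sup>+c. uK ((1 - s) *\<^sub>R a + s *\<^sub>R Y c) \<partial>(\<Pi>\<^sub>M b\<in>B. lborel)))) =
      (\<integral>\<^sup>+y. indicator {0..1} s * ennreal (h * s ^ (CARD('n) - 1)) * u ((1 - s) *\<^sub>R a + s *\<^sub>R y) \<partial>S)"
      using h(2) by (auto simp: ennreal_mult indicator_def mult_ac)
  qed
  finally show ?thesis by (simp add: uK_def)
qed

section \<open>Faces of a simplex\<close>

lemma simplex_facetE:
  fixes K F :: "'a::euclidean_space set"
  assumes K: "int DIM('a) simplex K" and F: "F facet_of K"
  obtains C a where "\<not> affine_dependent C" "finite C" "card C = DIM('a) + 1" "a \<in> C"
    "K = convex hull C" "F = convex hull (C - {a})" "C - {a} \<noteq> {}"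
proof -
  obtain C where C: "\<not> affine_dependent C" "int (card C) = int DIM('a) + 1" "K = convex hull C"
    using K unfolding simplex_def by blast
  have fin: "finite C" using C(2) card.infinite by fastforce
  have "F \<noteq> {} \<and> (\<exists>a. a \<in> C \<and> F = convex hull (C - {a}))"
    using F facet_of_convex_hull_affine_independent[OF C(1), of F] unfolding C(3) by blast
  then obtain a where a: "a \<in> C" "F = convex hull (C - {a})" "F \<noteq> {}" by blast
  have "C - {a} \<noteq> {}" using a(2,3) by auto
  with C fin a show ?thesis by (intro that[of C a]) auto
qed

definition outward_unit_normal :: "'a::euclidean_space set \<Rightarrow> 'a set \<Rightarrow> 'a \<Rightarrow> bool" where
  "outward_unit_normal K F n \<longleftrightarrow>
     norm n = 1 \<and> (\<forall>x\<in>F. \<forall>y\<in>F. (x - y) \<bullet> n = 0) \<and> (\<forall>x\<in>K. \<forall>y\<in>F. (x - y) \<bullet> n \<le> 0)"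

lemma span_differences:
  fixes F :: "'a::euclidean_space set"
  assumes p: "p \<in> F"
  shows "span {x - y |x y. x \<in> F \<and> y \<in> F} = span ((+) (- p) ` F)"
proof
  show "span {x - y |x y. x \<in> F \<and> y \<in> F} \<subseteq> span ((+) (- p) ` F)"
  proof (rule span_minimal)
    show "{x - y |x y. x \<in> F \<and> y \<in> F} \<subseteq> span ((+) (- p) ` F)"
    proof clarify
      fix x y assume "x \<in> F" "y \<in> F"
      then have "(- p + x) - (- p + y) \<in> span ((+) (- p) ` F)"
        by (intro span_diff span_base) auto
      then show "x - y \<in> span ((+) (- p) ` F)" by simp
    qed
  qed simp
  have "(+) (- p) ` F \<subseteq> {x - y |x y. x \<in> F \<and> y \<in> F}"
    using p by force
  then show "span ((+) (- p) ` F) \<subseteq> span {x - y |x y. x \<in> F \<and> y \<in> F}" by (rule span_mono)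
qed

lemma facet_directions:
  fixes K F :: "'a::euclidean_space set"
  assumes K: "int DIM('a) simplex K" and F: "F facet_of K" and B: "orthonormal_directions F B"
  shows "finite B" "independent B" "Suc (card B) = DIM('a)"
proof -
  have "0 \<notin> B" using B by (force simp: orthonormal_directions_def)
  then show ind: "independent B" using B pairwise_orthogonal_independent by (auto simp: orthonormal_directions_def)
  then show fin: "finite B" by (rule independent_imp_finite)
  obtain p where p: "p \<in> F" using F by (auto simp: facet_of_def)
  have "int (card B) = int (dim (span B))"
    using ind by (simp add: dim_eq_card_independent)
  also have "\<dots> = int (dim ((+) (- p) ` F))"
    using B span_differences[OF p] by (simp add: orthonormal_directions_def)
  also have "\<dots> = aff_dim F"
    using aff_dim_eq_dim[of p F] p by (simp add: hull_inc)
  also have "\<dots> = int DIM('a) - 1" using F aff_dim_simplex[OF K] by (simp add: facet_of_def)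
  finally show "Suc (card B) = DIM('a)" by linarith
qed

lemma exists_orthonormal_directions: "\<exists>B. orthonormal_directions F B"
  by (rule orthonormal_basis_subspace[OF subspace_span, of "{x - y |x y. x \<in> F \<and> y \<in> F}"])
     (auto simp: orthonormal_directions_def)

lemma normal_orthogonal_directions:
  assumes n: "\<And>x y. x \<in> F \<Longrightarrow> y \<in> F \<Longrightarrow> (x - y) \<bullet> n = 0" and B: "orthonormal_directions F B" and b: "b \<in> B"
  shows "b \<bullet> n = 0"
proof -
  have "b \<in> span {x - y |x y. x \<in> F \<and> y \<in> F}"
    using B b span_base unfolding orthonormal_directions_def by blast
  then have "orthogonal n b" by (rule orthogonal_to_span) (use n in \<open>auto simp: orthogonal_def inner_commute\<close>)
  then show ?thesis by (simp add: orthogonal_def inner_commute)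
qed

lemma facet_frame:
  fixes K F :: "'a::euclidean_space set"
  assumes K: "int DIM('a) simplex K" and F: "F facet_of K" and B: "orthonormal_directions F B"
    and n: "norm n = 1" "\<And>x y. x \<in> F \<Longrightarrow> y \<in> F \<Longrightarrow> (x - y) \<bullet> n = 0"
  shows "pairwise orthogonal (insert n B)" "n \<notin> B" "span (insert n B) = UNIV"
proof -
  have bn: "b \<bullet> n = 0" if "b \<in> B" for b by (rule normal_orthogonal_directions[OF n(2) B that])
  have nn: "n \<bullet> n = 1" using n(1) by (simp add: norm_eq_sqrt_inner)
  show nB: "n \<notin> B" using bn nn by force
  show po: "pairwise orthogonal (insert n B)"
    using B bn by (auto simp: orthonormal_directions_def pairwise_insert orthogonal_def inner_commute)
  have "0 \<notin> insert n B" using B n(1) by (force simp: orthonormal_directions_def)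
  then have "independent (insert n B)" using po pairwise_orthogonal_independent by blast
  moreover have "card (insert n B) = dim (UNIV :: 'a set)"
    using facet_directions[OF K F B] nB by simp
  ultimately show "span (insert n B) = UNIV"
    using card_eq_dim[of "insert n B" UNIV] facet_directions(1)[OF K F B] by auto
qed

text \<open>The directions of a facet together with n span the whole space, so m, being orthogonal
  to the former, is a multiple of n.\<close>

lemma facet_normal_unique:
  fixes K F :: "'a::euclidean_space set"
  assumes K: "int DIM('a) simplex K" and F: "F facet_of K"
    and n: "norm n = 1" "\<And>x y. x \<in> F \<Longrightarrow> y \<in> F \<Longrightarrow> (x - y) \<bullet> n = 0"
    and m: "norm m = 1" "\<And>x y. x \<in> F \<Longrightarrow> y \<in> F \<Longrightarrow> (x - y) \<bullet> m = 0"
  shows "m = n \<or> m = - n"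
proof -
  obtain B where B: "orthonormal_directions F B" using exists_orthonormal_directions by blast
  have nn: "n \<bullet> n = 1" using n(1) by (simp add: norm_eq_sqrt_inner)
  define x where "x = m - (m \<bullet> n) *\<^sub>R n"
  have "x \<in> span (insert n B)" using facet_frame(3)[OF K F B n] by simp
  then have "orthogonal x x"
  proof (rule orthogonal_to_span)
    fix b assume b: "b \<in> insert n B"
    show "orthogonal x b"
    proof (cases "b = n")
      case True then show ?thesis by (simp add: orthogonal_def x_def inner_diff_left nn)
    next
      case False
      then have "b \<in> B" using b by simp
      then show ?thesis
        using normal_orthogonal_directions[OF n(2) B] normal_orthogonal_directions[OF m(2) B]
        by (simp add: orthogonal_def x_def inner_diff_left inner_diff_right inner_commute)
    qed
  qed
  then have x: "m = (m \<bullet> n) *\<^sub>R n" by (simp add: orthogonal_def x_def)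
  then have "\<bar>m \<bullet> n\<bar> = 1" using n(1) m(1) by (metis norm_scaleR mult.right_neutral)
  then have "m \<bullet> n = 1 \<or> m \<bullet> n = -1" by linarith
  then show ?thesis using x by (metis scaleR_one scaleR_minus1_left)
qed

lemma cone_of_facet:
  fixes K F :: "'a::euclidean_space set"
  assumes C: "finite C" "a \<in> C" "K = convex hull C" "F = convex hull (C - {a})" "C - {a} \<noteq> {}"
  shows "K = {(1 - s) *\<^sub>R a + s *\<^sub>R y |s y. 0 \<le> s \<and> s \<le> 1 \<and> y \<in> F}"
proof -
  have "K = convex hull (insert a (C - {a}))" using C by (simp add: insert_absorb)
  also have "\<dots> = {x. \<exists>u\<ge>0. \<exists>v\<ge>0. \<exists>b. u + v = 1 \<and> b \<in> F \<and> x = u *\<^sub>R a + v *\<^sub>R b}"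
    unfolding C(4) by (rule convex_hull_insert[OF C(5)])
  also have "\<dots> = {(1 - s) *\<^sub>R a + s *\<^sub>R y |s y. 0 \<le> s \<and> s \<le> 1 \<and> y \<in> F}"
  proof (intro set_eqI iffI)
    fix x assume "x \<in> {x. \<exists>u\<ge>0. \<exists>v\<ge>0. \<exists>b. u + v = 1 \<and> b \<in> F \<and> x = u *\<^sub>R a + v *\<^sub>R b}"
    then obtain u v b where "u \<ge> 0" "v \<ge> 0" "u + v = 1" "b \<in> F" "x = u *\<^sub>R a + v *\<^sub>R b" by blast
    then show "x \<in> {(1 - s) *\<^sub>R a + s *\<^sub>R y |s y. 0 \<le> s \<and> s \<le> 1 \<and> y \<in> F}"
      by (intro CollectI exI[of _ v] exI[of _ b]) (auto simp: eq_diff_eq[symmetric])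
  next
    fix x assume "x \<in> {(1 - s) *\<^sub>R a + s *\<^sub>R y |s y. 0 \<le> s \<and> s \<le> 1 \<and> y \<in> F}"
    then obtain s y where "0 \<le> s" "s \<le> 1" "y \<in> F" "x = (1 - s) *\<^sub>R a + s *\<^sub>R y" by blast
    then show "x \<in> {x. \<exists>u\<ge>0. \<exists>v\<ge>0. \<exists>b. u + v = 1 \<and> b \<in> F \<and> x = u *\<^sub>R a + v *\<^sub>R b}"
      by (intro CollectI exI[of _ "1 - s"] exI[of _ s] exI[of _ y] conjI) auto
  qed
  finally show ?thesis .
qed

text \<open>Otherwise the apex would lie in the hyperplane of F, and so would all of K, against its
  full dimension.\<close>

lemma facet_height:
  fixes K F :: "'a::euclidean_space set"
  assumes K: "int DIM('a) simplex K" and C: "K = convex hull C" "a \<in> C" "F = convex hull (C - {a})" "C - {a} \<noteq> {}" "finite C"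
    and F: "F facet_of K"
    and n: "norm n = 1" "\<And>x y. x \<in> F \<Longrightarrow> y \<in> F \<Longrightarrow> (x - y) \<bullet> n = 0"
    and p: "p \<in> F"
  shows "(p - a) \<bullet> n \<noteq> 0"
proof
  assume 0: "(p - a) \<bullet> n = 0"
  have n0: "n \<noteq> 0" using n(1) by auto
  have "K \<subseteq> {x. n \<bullet> x = n \<bullet> p}"
  proof
    fix x assume "x \<in> K"
    then obtain s y where "y \<in> F" and x: "x = (1 - s) *\<^sub>R a + s *\<^sub>R y"
      using cone_of_facet[OF C(5,2,1,3,4)] by blast
    then have "y \<bullet> n = p \<bullet> n" using n(2)[OF _ p] by (simp add: inner_diff_left)
    moreover have "a \<bullet> n = p \<bullet> n" using 0 by (simp add: inner_diff_left)
    ultimately have "x \<bullet> n = p \<bullet> n" by (simp add: x inner_add_left algebra_simps)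
    then show "x \<in> {x. n \<bullet> x = n \<bullet> p}" by (simp add: inner_commute)
  qed
  then have "aff_dim K \<le> aff_dim {x. n \<bullet> x = n \<bullet> p}" by (rule aff_dim_subset)
  then show False using aff_dim_simplex[OF K] n0 by (simp add: aff_dim_hyperplane)
qed

text \<open>Every point of K lies on a segment from the apex to the face, so the sign at the apex
  decides the sign on K.\<close>

lemma outward_unit_normalI:
  fixes K F :: "'a::euclidean_space set"
  assumes C: "K = convex hull C" "a \<in> C" "F = convex hull (C - {a})" "C - {a} \<noteq> {}" "finite C"
    and n: "norm n = 1" "\<And>x y. x \<in> F \<Longrightarrow> y \<in> F \<Longrightarrow> (x - y) \<bullet> n = 0"
    and p: "p \<in> F" "(p - a) \<bullet> n \<ge> 0"
  shows "outward_unit_normal K F n"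
  unfolding outward_unit_normal_def
proof (intro conjI ballI n)
  fix x y assume x: "x \<in> K" and y: "y \<in> F"
  obtain s z where z: "z \<in> F" "0 \<le> s" "s \<le> 1" and xs: "x = (1 - s) *\<^sub>R a + s *\<^sub>R z"
    using x cone_of_facet[OF C(5,2,1,3,4)] by blast
  have e: "y \<bullet> n = p \<bullet> n" "z \<bullet> n = p \<bullet> n" using n(2)[OF y p(1)] n(2)[OF z(1) p(1)] by (auto simp: inner_diff_left)
  have "(x - y) \<bullet> n = - ((1 - s) * ((p - a) \<bullet> n))"
    by (simp add: xs inner_add_left inner_diff_left e algebra_simps)
  also have "\<dots> \<le> 0" using z(3) p(2) by simp
  finally show "(x - y) \<bullet> n \<le> 0" .
qed

lemma exists_outward_unit_normal:
  fixes K F :: "'a::euclidean_space set"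
  assumes K: "int DIM('a) simplex K" and F: "F facet_of K"
  shows "\<exists>n. outward_unit_normal K F n"
proof -
  obtain C a where C: "finite C" "a \<in> C" "K = convex hull C" "F = convex hull (C - {a})" "C - {a} \<noteq> {}"
    using simplex_facetE[OF K F] by metis
  obtain p where p: "p \<in> F" using F by (auto simp: facet_of_def)
  obtain B where B: "orthonormal_directions F B" using exists_orthonormal_directions by blast
  have "dim B < DIM('a)"
    using facet_directions[OF K F B] by (simp add: dim_eq_card_independent)
  then obtain x where x: "x \<noteq> 0" "\<And>y. y \<in> span B \<Longrightarrow> orthogonal x y"
    using orthogonal_to_subspace_exists by blast
  define n where "n = (1 / norm x) *\<^sub>R x"
  have n1: "norm n = 1" using x(1) by (simp add: n_def)
  have n0: "(y - z) \<bullet> n = 0" if "y \<in> F" "z \<in> F" for y z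
  proof -
    have "y - z \<in> span B" using B that unfolding orthonormal_directions_def by (auto intro: span_base)
    then show ?thesis using x(2)[of "y - z"] by (simp add: n_def orthogonal_def inner_commute)
  qed
  \<comment> \<open>Of the two unit normals, the one pointing from the apex towards the face is
    outward.\<close>
  show ?thesis
  proof (cases "(p - a) \<bullet> n \<ge> 0")
    case True
    then show ?thesis using outward_unit_normalI[OF C(3,2,4,5,1) n1 n0 p] by blast
  next
    case False
    then have "(p - a) \<bullet> (- n) \<ge> 0" by simp
    moreover have "norm (- n) = 1" "\<And>y z. y \<in> F \<Longrightarrow> z \<in> F \<Longrightarrow> (y - z) \<bullet> (- n) = 0" using n1 n0 by auto
    ultimately show ?thesis using outward_unit_normalI[OF C(3,2,4,5,1) _ _ p, of "- n"] by blast
  qed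
qed

definition face_normal :: "'a::euclidean_space set \<Rightarrow> 'a set \<Rightarrow> 'a" where
  "face_normal K F = (SOME n. outward_unit_normal K F n)"

lemma face_normal:
  fixes K F :: "'a::euclidean_space set"
  assumes "int DIM('a) simplex K" "F facet_of K"
  shows "norm (face_normal K F) = 1"
    "\<And>x y. x \<in> F \<Longrightarrow> y \<in> F \<Longrightarrow> (x - y) \<bullet> face_normal K F = 0"
    "\<And>x y. x \<in> K \<Longrightarrow> y \<in> F \<Longrightarrow> (x - y) \<bullet> face_normal K F \<le> 0"
proof -
  have "outward_unit_normal K F (face_normal K F)"
    unfolding face_normal_def by (rule someI_ex[OF exists_outward_unit_normal[OF assms]])
  then show "norm (face_normal K F) = 1"
    "\<And>x y. x \<in> F \<Longrightarrow> y \<in> F \<Longrightarrow> (x - y) \<bullet> face_normal K F = 0"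
    "\<And>x y. x \<in> K \<Longrightarrow> y \<in> F \<Longrightarrow> (x - y) \<bullet> face_normal K F \<le> 0"
    unfolding outward_unit_normal_def by blast+
qed

lemma simplex_compact:
  fixes K :: "'a::euclidean_space set"
  assumes "n simplex K" shows "compact K" "convex K"
proof -
  obtain C where "finite C" "K = convex hull C"
    using assms unfolding simplex by blast
  then show "compact K" "convex K" by (auto intro: finite_imp_compact_convex_hull)
qed

lemma facet_compact:
  fixes K F :: "'a::euclidean_space set"
  assumes "int DIM('a) simplex K" "F facet_of K" shows "compact F" "convex F" "F \<noteq> {}" "F \<subseteq> K"
proof -
  obtain C a where C: "finite C" "a \<in> C" "K = convex hull C" "F = convex hull (C - {a})" "C - {a} \<noteq> {}"
    using simplex_facetE[OF assms] by metis
  then show "compact F" "convex F" "F \<noteq> {}" by (auto intro: finite_imp_compact_convex_hull)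
  show "F \<subseteq> K" using assms(2) facet_of_imp_subset by blast
qed

text \<open>The origin and the basis selected by \<open>SOME\<close> inside
  \<open>surface_measure\<close>, completed by the face normal, form the orthonormal frame of the
  cone formula. Positivity of h is recorded because later formulas divide by it.\<close>

theorem nn_integral_simplex_facet:
  fixes K F :: "(real ^ 'n) set"
  assumes K: "int DIM(real ^ 'n) simplex K" and F: "F facet_of K"
    and C: "finite C" "a \<in> C" "K = convex hull C" "F = convex hull (C - {a})" "C - {a} \<noteq> {}"
    and h: "\<And>y. y \<in> F \<Longrightarrow> (y - a) \<bullet> face_normal K F = h"
    and u: "u \<in> borel_measurable borel"
  shows "h > 0"
    "(\<integral>\<^sup>+x. u x * indicator K x \<partial>lborel) =
    (\<integral>\<^sup>+s. (\<integral>\<^sup>+y. indicator {0..1} s * ennreal (h * s ^ (CARD('n) - 1)) * u ((1 - s) *\<^sub>R a + s *\<^sub>R y)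
      \<partial>surface_measure F) \<partial>lborel)"
proof -
  define n where "n = face_normal K F"
  note n = face_normal[OF K F, folded n_def]
  define p where "p = (SOME p. p \<in> F)"
  have p: "p \<in> F" unfolding p_def using facet_compact(3)[OF K F] by (auto intro: someI)
  define B where "B = (SOME B. orthonormal_directions F B)"
  have B: "orthonormal_directions F B" unfolding B_def by (rule someI_ex[OF exists_orthonormal_directions])
  have "a \<in> K" using C by (auto intro: hull_inc)
  then have "h \<ge> 0" using n(3)[OF _ p, of a] h[OF p] by (simp add: n_def inner_diff_left)
  then show h0: "h > 0" using facet_height[OF K C(3,2,4,5,1) F n(1,2) p] h[OF p] by (simp add: n_def)
  have Fb: "F \<in> sets borel" "K \<in> sets borel"
    using facet_compact(1)[OF K F] simplex_compact(1)[OF K] by (auto intro: borel_compact)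
  show "(\<integral>\<^sup>+x. u x * indicator K x \<partial>lborel) =
    (\<integral>\<^sup>+s. (\<integral>\<^sup>+y. indicator {0..1} s * ennreal (h * s ^ (CARD('n) - 1)) * u ((1 - s) *\<^sub>R a + s *\<^sub>R y)
      \<partial>surface_measure F) \<partial>lborel)"
    unfolding surface_measure_def Let_def p_def[symmetric] B_def[symmetric]
  proof (rule nn_integral_cone[OF facet_directions(1)[OF K F B] facet_frame(1)[OF K F B n(1,2)] _ facet_frame(2)[OF K F B n(1,2)] _ h[OF p, folded n_def] h0 Fb(1) n(2)[OF _ p] Fb(2) cone_of_facet[OF C] u])
    show "norm b = 1" if "b \<in> insert n B" for b using that n(1) B by (auto simp: orthonormal_directions_def)
    show "Suc (card B) = CARD('n)" using facet_directions(3)[OF K F B] by simp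
  qed
qed

section \<open>The divergence theorem on a simplex\<close>

lemma space_surface_measure [simp]: "space (surface_measure F) = F"
  by (simp add: surface_measure_def Let_def space_restrict_space)

lemma sets_surface_measure: "sets (surface_measure F) = sets (restrict_space borel F)"
  unfolding surface_measure_def Let_def by (rule sets_restrict_space_cong) simp

lemma measurable_surface_measure:
  "f \<in> borel_measurable borel \<Longrightarrow> f \<in> borel_measurable (surface_measure F)"
  unfolding measurable_cong_sets[OF sets_surface_measure refl] by (rule measurable_restrict_space1)

text \<open>Sobolev functions live on the open element, the cone formula on the closed simplex. The
  frontier of a convex set is null, so the integrals agree.\<close>

lemma integral_interior_compact_convex:
  fixes g :: "'a::euclidean_space \<Rightarrow> real"
  assumes g: "g \<in> borel_measurable borel" and K: "compact K" "convex K"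
  shows "(\<integral>x. g x \<partial>lebesgue_on (interior K)) = (\<integral>x. indicator K x *\<^sub>R g x \<partial>lborel)"
proof -
  have Kb: "K \<in> sets borel" using K by (auto intro: borel_compact)
  have "(\<integral>x. g x \<partial>lebesgue_on (interior K)) = (\<integral>x. indicator (interior K) x *\<^sub>R g x \<partial>lebesgue)"
    by (subst integral_restrict_space) auto
  also have "\<dots> = (\<integral>x. indicator (interior K) x *\<^sub>R g x \<partial>lborel)"
    by (rule integral_completion) (use g in measurable)
  also have "\<dots> = (\<integral>x. indicator K x *\<^sub>R g x \<partial>lborel)"
  proof (rule integral_cong_AE)
    have "frontier K \<in> null_sets lborel"
      using negligible_convex_frontier[OF K(2)] K(1)
      by (simp add: negligible_iff_null_sets null_sets_completion_iff borel_closed frontier_closed)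
    then have "AE x in lborel. x \<notin> frontier K" by (rule AE_not_in)
    then show "AE x in lborel. indicator (interior K) x *\<^sub>R g x = indicator K x *\<^sub>R g x"
    proof eventually_elim
      case (elim x)
      then show ?case using K(1) interior_subset[of K]
        by (auto simp: frontier_def indicator_def compact_imp_closed closure_closed)
    qed
    show "(\<lambda>x. indicator (interior K) x *\<^sub>R g x) \<in> borel_measurable lborel"
      "(\<lambda>x. indicator K x *\<^sub>R g x) \<in> borel_measurable lborel" using g Kb by measurable
  qed
  finally show ?thesis .
qed

text \<open>Read off from volume: on the part 1/2 \<le> s \<le> 1 of the cone over F the weight h
  s^(d - 1) is at least k > 0, so a positive multiple of the measure of F is bounded by the volume
  of K.\<close>

lemma surface_measure_finite:
  fixes K F :: "(real ^ 'n) set"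
  assumes K: "int DIM(real ^ 'n) simplex K" and F: "F facet_of K"
  shows "finite_measure (surface_measure F)"
proof
  obtain C a where C: "finite C" "a \<in> C" "K = convex hull C" "F = convex hull (C - {a})" "C - {a} \<noteq> {}"
    using simplex_facetE[OF K F] by metis
  obtain p where p: "p \<in> F" using F by (auto simp: facet_of_def)
  define h where "h = (p - a) \<bullet> face_normal K F"
  have h: "(y - a) \<bullet> face_normal K F = h" if "y \<in> F" for y
    using face_normal(2)[OF K F that p] by (simp add: h_def inner_diff_left)
  define M where "M = emeasure (surface_measure F) F"
  have h0: "h > 0" by (rule nn_integral_simplex_facet(1)[OF K F C h, of "\<lambda>_. 0"]) auto
  define k where "k = h * (1/2) ^ (CARD('n) - 1)"
  have k: "k > 0" using h0 by (simp add: k_def)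
  have "ennreal (1/2) * ennreal k * M = (\<integral>\<^sup>+s. (ennreal k * M) * indicator {1/2..1} s \<partial>(lborel :: real measure))"
    by (subst nn_integral_cmult_indicator) (simp_all add: mult_ac)
  also have "\<dots> \<le> (\<integral>\<^sup>+s. (\<integral>\<^sup>+y. indicator {0..1} s * ennreal (h * s ^ (CARD('n) - 1)) * 1 \<partial>surface_measure F) \<partial>lborel)"
  proof (rule nn_integral_mono)
    fix s :: real
    have "ennreal k \<le> ennreal (h * s ^ (CARD('n) - 1))" if "s \<in> {1/2..1}"
      unfolding k_def using that h0 by (intro ennreal_leI mult_left_mono power_mono) auto
    then show "(ennreal k * M) * indicator {1/2..1} s \<le> (\<integral>\<^sup>+y. indicator {0..1} s * ennreal (h * s ^ (CARD('n) - 1)) * 1 \<partial>surface_measure F)"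
      by (auto simp: M_def indicator_def intro!: mult_right_mono)
  qed
  also have "\<dots> = (\<integral>\<^sup>+x. 1 * indicator K x \<partial>lborel)"
    by (rule nn_integral_simplex_facet(2)[OF K F C h, symmetric]) auto
  also have "\<dots> = emeasure lborel K"
    using borel_compact[OF simplex_compact(1)[OF K]] by simp
  also have "\<dots> < \<infinity>"
    using simplex_compact(1)[OF K] by (intro emeasure_bounded_finite compact_imp_bounded)
  finally have "ennreal (1/2) * ennreal k * M < \<infinity>" .
  moreover have "ennreal (1/2) * ennreal k = ennreal (1/2 * k)"
    by (rule ennreal_mult[symmetric]) (use k in auto)
  ultimately have "ennreal (1/2 * k) * M < \<infinity>" by (simp only:)
  then show "emeasure (surface_measure F) (space (surface_measure F)) \<noteq> \<infinity>"
    using k by (auto simp: M_def ennreal_mult_less_top ennreal_mult_eq_top_iff)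
qed

text \<open>For k = d the function is the divergence of the field f(x) (x - a), which is tangential
  to all facets through a; only the facet opposite to a contributes a flux.\<close>

lemma continuous_apex_integrand:
  fixes f :: "'a::euclidean_space \<Rightarrow> real"
  assumes f: "C_k (Suc 0) f"
  shows "continuous_on UNIV (\<lambda>x. k * f x + frechet_derivative f (at x) (x - a))"
proof -
  have lin: "linear (frechet_derivative f (at x))" for x using f by (intro linear_frechet_derivative) simp
  have e: "frechet_derivative f (at x) (x - a) = (\<Sum>b\<in>Basis. ((x - a) \<bullet> b) * frechet_derivative f (at x) b)" for x
    by (rule linear_eq_sum_Basis[OF lin])
  show ?thesis unfolding e using f C_k_continuous[OF f] by (intro continuous_intros) auto
qed

text \<open>Integrating \<open>\<partial>\<^sub>s (s\<^sup>d f(a + s (y - a)))\<close> along the segments from the apex \<open>a\<close> to the points \<open>y\<close>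
  of the face.\<close>

lemma facet_integral_eq:
  fixes K F :: "(real ^ 'n) set" and f :: "real ^ 'n \<Rightarrow> real"
  assumes K: "int DIM(real ^ 'n) simplex K" and F: "F facet_of K"
    and C: "finite C" "a \<in> C" "K = convex hull C" "F = convex hull (C - {a})" "C - {a} \<noteq> {}"
    and h: "\<And>y. y \<in> F \<Longrightarrow> (y - a) \<bullet> face_normal K F = h"
    and f: "C_k (Suc 0) f"
  shows "h * (\<integral>y. f y \<partial>surface_measure F) =
    (\<integral>x. real CARD('n) * f x + frechet_derivative f (at x) (x - a) \<partial>lebesgue_on (interior K))"
proof -
  define d where "d = CARD('n)"
  have d: "d > 0" by (simp add: d_def)
  have h0: "h > 0" by (rule nn_integral_simplex_facet(1)[OF K F C h, of "\<lambda>_. 0"]) auto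
  define S where "S = surface_measure F"
  interpret S: finite_measure S unfolding S_def by (rule surface_measure_finite[OF K F])
  interpret P: pair_sigma_finite "lborel :: real measure" S ..
  have lin: "linear (frechet_derivative f (at x))" for x using f by (intro linear_frechet_derivative) simp
  define g where "g x = real d * f x + frechet_derivative f (at x) (x - a)" for x
  have fc: "continuous_on UNIV f" using f by (rule C_k_continuous)
  have gc: "continuous_on UNIV g" unfolding g_def by (rule continuous_apex_integrand[OF f])
  then have gm [measurable]: "g \<in> borel_measurable borel" by (rule borel_measurable_continuous_onI)
  have fm: "f \<in> borel_measurable borel" using fc by (rule borel_measurable_continuous_onI)
  have Kb [measurable]: "K \<in> sets borel" using simplex_compact(1)[OF K] by (rule borel_compact)
  have idS [measurable]: "(\<lambda>y. y) \<in> borel_measurable S" unfolding S_def by (rule measurable_surface_measure) simp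
  define T where "T z = (1 - fst z) *\<^sub>R a + fst z *\<^sub>R snd z" for z :: "real \<times> (real ^ 'n)"
  have "(\<lambda>z. snd z) \<in> borel_measurable (lborel \<Otimes>\<^sub>M S)" by (rule measurable_compose[OF measurable_snd idS])
  then have Tm [measurable]: "T \<in> borel_measurable (lborel \<Otimes>\<^sub>M S)" unfolding T_def by measurable
  define w where "w s = indicator {0..1} s * (h * s ^ (d - 1))" for s :: real
  have wm [measurable]: "w \<in> borel_measurable borel" unfolding w_def by measurable
  have w0: "w s \<ge> 0" for s using h0 by (auto simp: w_def indicator_def)
  \<comment> \<open>The cone formula on indicator functions is an equality of measures, Lebesgue
    measure on K being the image of a weighted product measure under T. In this form it transfers to
    the signed integrand g.\<close>
  have eq: "density lborel (\<lambda>x. ennreal (indicator K x)) =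
      distr (density (lborel \<Otimes>\<^sub>M S) (\<lambda>z. ennreal (w (fst z)))) borel T"
  proof (rule measure_eqI)
    fix A assume "A \<in> sets (density lborel (\<lambda>x. ennreal (indicator K x)))"
    then have A [measurable]: "A \<in> sets borel" by simp
    have "emeasure (density lborel (\<lambda>x. ennreal (indicator K x))) A = (\<integral>\<^sup>+x. indicator A x * indicator K x \<partial>lborel)"
      by (subst emeasure_density) (auto simp: ennreal_indicator mult.commute intro!: nn_integral_cong)
    also have "\<dots> = (\<integral>\<^sup>+s. (\<integral>\<^sup>+y. indicator {0..1} s * ennreal (h * s ^ (CARD('n) - 1)) * indicator A ((1 - s) *\<^sub>R a + s *\<^sub>R y)
      \<partial>surface_measure F) \<partial>lborel)"
      by (rule nn_integral_simplex_facet(2)[OF K F C h]) auto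
    also have "\<dots> = (\<integral>\<^sup>+s. (\<integral>\<^sup>+y. ennreal (w (fst (s, y))) * indicator A (T (s, y)) \<partial>S) \<partial>lborel)"
      by (intro nn_integral_cong) (auto simp: S_def w_def T_def d_def indicator_def)
    also have "\<dots> = (\<integral>\<^sup>+z. ennreal (w (fst z)) * indicator A (T z) \<partial>(lborel \<Otimes>\<^sub>M S))"
      by (rule S.nn_integral_fst) measurable
    also have "\<dots> = emeasure (distr (density (lborel \<Otimes>\<^sub>M S) (\<lambda>z. ennreal (w (fst z)))) borel T) A"
    proof -
      have "emeasure (distr (density (lborel \<Otimes>\<^sub>M S) (\<lambda>z. ennreal (w (fst z)))) borel T) A =
          (\<integral>\<^sup>+x. indicator A x \<partial>distr (density (lborel \<Otimes>\<^sub>M S) (\<lambda>z. ennreal (w (fst z)))) borel T)" by simp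
      also have "\<dots> = (\<integral>\<^sup>+z. indicator A (T z) \<partial>density (lborel \<Otimes>\<^sub>M S) (\<lambda>z. ennreal (w (fst z))))"
        by (rule nn_integral_distr) auto
      also have "\<dots> = (\<integral>\<^sup>+z. ennreal (w (fst z)) * indicator A (T z) \<partial>(lborel \<Otimes>\<^sub>M S))"
        by (rule nn_integral_density) auto
      finally show ?thesis ..
    qed
    finally show "emeasure (density lborel (\<lambda>x. ennreal (indicator K x))) A =
      emeasure (distr (density (lborel \<Otimes>\<^sub>M S) (\<lambda>z. ennreal (w (fst z)))) borel T) A" .
  qed simp
  have ig: "integrable (lborel \<Otimes>\<^sub>M S) (\<lambda>z. w (fst z) *\<^sub>R g (T z))"
  proof -
    have "integrable lborel (\<lambda>x. indicator K x *\<^sub>R g x)"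
      by (rule borel_integrable_compact[OF simplex_compact(1)[OF K]]) (use gc continuous_on_subset in auto)
    then have "integrable (density lborel (\<lambda>x. ennreal (indicator K x))) g"
      by (subst integrable_density) auto
    then have "integrable (density (lborel \<Otimes>\<^sub>M S) (\<lambda>z. ennreal (w (fst z)))) (\<lambda>z. g (T z))"
      unfolding eq by (subst (asm) integrable_distr_eq) auto
    then show ?thesis by (subst (asm) integrable_density) (auto simp: w0)
  qed
  \<comment> \<open>Along the segment to y the integrand is the s-derivative of h s^d f(a + s (y -
    a)). The lower limit contributes nothing because d > 0.\<close>
  have inner: "(\<integral>s. w s *\<^sub>R g (T (s, y)) \<partial>lborel) = h * f y" for y
  proof -
    have "(\<integral>s. indicator {0..1} s *\<^sub>R (h * (s ^ (d - 1) * g (a + s *\<^sub>R (y - a)))) \<partial>lborel) =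
       h * (1 ^ d * f (a + 1 *\<^sub>R (y - a))) - h * (0 ^ d * f (a + 0 *\<^sub>R (y - a)))"
    proof (rule integral_FTC_Icc)
      fix s :: real
      have "((\<lambda>s. a + s *\<^sub>R (y - a)) has_derivative (\<lambda>t. t *\<^sub>R (y - a))) (at s)" by (auto intro!: derivative_eq_intros)
      from has_derivative_compose[OF this C_k_has_derivative[OF f]]
      have D: "((\<lambda>s. f (a + s *\<^sub>R (y - a))) has_derivative
          (\<lambda>t. frechet_derivative f (at (a + s *\<^sub>R (y - a))) (t *\<^sub>R (y - a)))) (at s)" .
      have e: "(\<lambda>t. frechet_derivative f (at (a + s *\<^sub>R (y - a))) (t *\<^sub>R (y - a))) =
          (*) (frechet_derivative f (at (a + s *\<^sub>R (y - a))) (y - a))"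
        by (rule ext) (simp only: linear_cmul[OF lin] real_scaleR_def mult.commute)
      have "((\<lambda>s. f (a + s *\<^sub>R (y - a))) has_real_derivative frechet_derivative f (at (a + s *\<^sub>R (y - a))) (y - a)) (at s)"
        using D unfolding has_field_derivative_def e .
      from DERIV_cmult[OF DERIV_mult[OF DERIV_pow[of d s UNIV] this], of h]
      have "((\<lambda>s. h * (s ^ d * f (a + s *\<^sub>R (y - a)))) has_real_derivative
         h * (real d * s ^ (d - Suc 0) * f (a + s *\<^sub>R (y - a)) + frechet_derivative f (at (a + s *\<^sub>R (y - a))) (y - a) * s ^ d)) (at s)" .
      moreover have "h * (real d * s ^ (d - Suc 0) * f (a + s *\<^sub>R (y - a)) + frechet_derivative f (at (a + s *\<^sub>R (y - a))) (y - a) * s ^ d)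
          = h * (s ^ (d - 1) * g (a + s *\<^sub>R (y - a)))"
      proof -
        define x where "x = a + s *\<^sub>R (y - a)"
        have "x - a = s *\<^sub>R (y - a)" by (simp add: x_def)
        then have "g x = real d * f x + s * frechet_derivative f (at x) (y - a)"
          by (simp add: g_def linear_cmul[OF lin])
        moreover obtain k where k: "d = Suc k" using d by (cases d) auto
        ultimately show ?thesis unfolding x_def[symmetric] by (simp add: k algebra_simps)
      qed
      ultimately have "((\<lambda>s. h * (s ^ d * f (a + s *\<^sub>R (y - a)))) has_real_derivative
         h * (s ^ (d - 1) * g (a + s *\<^sub>R (y - a)))) (at s)"
        by (simp only:)
      then show "((\<lambda>s. h * (s ^ d * f (a + s *\<^sub>R (y - a)))) has_vector_derivative
         h * (s ^ (d - 1) * g (a + s *\<^sub>R (y - a)))) (at s within {0..1})"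
        by (simp add: has_real_derivative_iff_has_vector_derivative has_vector_derivative_at_within)
    next
      show "continuous_on {0..1} (\<lambda>s. h * (s ^ (d - 1) * g (a + s *\<^sub>R (y - a))))"
        by (intro continuous_intros continuous_on_compose2[OF gc]) auto
    qed simp
    moreover have "w s *\<^sub>R g (T (s, y)) = indicator {0..1} s *\<^sub>R (h * (s ^ (d - 1) * g (a + s *\<^sub>R (y - a))))" for s
    proof -
      have "T (s, y) = a + s *\<^sub>R (y - a)" by (simp add: T_def algebra_simps)
      then show ?thesis by (simp add: w_def)
    qed
    moreover have "h * (1 ^ d * f (a + 1 *\<^sub>R (y - a))) - h * (0 ^ d * f (a + 0 *\<^sub>R (y - a))) = h * f y"
      using d by simp
    ultimately show ?thesis by (simp only:)
  qed
  have "(\<integral>x. g x \<partial>lebesgue_on (interior K)) = (\<integral>x. indicator K x *\<^sub>R g x \<partial>lborel)"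
    by (rule integral_interior_compact_convex[OF gm simplex_compact[OF K]])
  also have "\<dots> = (\<integral>x. g x \<partial>density lborel (\<lambda>x. ennreal (indicator K x)))"
    by (subst integral_density) auto
  also have "\<dots> = (\<integral>z. g (T z) \<partial>density (lborel \<Otimes>\<^sub>M S) (\<lambda>z. ennreal (w (fst z))))"
    unfolding eq by (rule integral_distr) auto
  also have "\<dots> = (\<integral>z. w (fst z) *\<^sub>R g (T z) \<partial>(lborel \<Otimes>\<^sub>M S))"
    by (rule integral_density) (auto simp: w0)
  also have "\<dots> = (\<integral>y. (\<integral>s. w s *\<^sub>R g (T (s, y)) \<partial>lborel) \<partial>S)"
    using P.integral_snd[of "\<lambda>s y. w s *\<^sub>R g (T (s, y))"] ig by (simp add: case_prod_unfold)
  also have "\<dots> = h * (\<integral>y. f y \<partial>S)" unfolding inner by simp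
  finally show ?thesis by (simp add: g_def S_def d_def)
qed

text \<open>The function 1 - (x - c) . n / h with n and h taken at c is affine, equals 1 at c and 0
  on the opposite facet, so it is the barycentric coordinate of c. Expressing it through face
  normals ties the coordinates to the fluxes of the divergence theorem.\<close>

lemma simplex_barycentric:
  fixes C :: "'a::euclidean_space set"
  assumes aff: "\<not> affine_dependent C" and card: "card C = DIM('a) + 1" and fin: "finite C"
  obtains h where "\<And>c. c \<in> C \<Longrightarrow> h c > 0"
    "\<And>c y. c \<in> C \<Longrightarrow> y \<in> convex hull (C - {c}) \<Longrightarrow>
      (y - c) \<bullet> face_normal (convex hull C) (convex hull (C - {c})) = h c"
    "\<And>x. (\<Sum>c\<in>C. 1 - (x - c) \<bullet> face_normal (convex hull C) (convex hull (C - {c})) / h c) = 1"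
    "\<And>x. (\<Sum>c\<in>C. (1 - (x - c) \<bullet> face_normal (convex hull C) (convex hull (C - {c})) / h c) *\<^sub>R c) = x"
    "\<And>c. c \<in> C \<Longrightarrow> convex hull (C - {c}) facet_of convex hull C"
    "\<And>c. c \<in> C \<Longrightarrow> C - {c} \<noteq> {}"
    "int DIM('a) simplex convex hull C"
proof -
  define K where "K = convex hull C"
  define Fc where "Fc c = convex hull (C - {c})" for c
  define n where "n c = face_normal K (Fc c)" for c
  have K: "int DIM('a) simplex K" unfolding simplex_def K_def using aff card by auto
  have ne: "C - {c} \<noteq> {}" if "c \<in> C" for c
  proof
    assume "C - {c} = {}"
    then have "card C \<le> card {c}" by (intro card_mono) auto
    then show False using card DIM_positive[where 'a='a] by simp
  qed
  have facet: "Fc c facet_of K" if "c \<in> C" for c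
    using facet_of_convex_hull_affine_independent[OF aff, of "Fc c"] ne[OF that] that by (auto simp: Fc_def K_def)
  define p where "p c = (SOME y. y \<in> C - {c})" for c
  have pc: "p c \<in> C - {c}" if "c \<in> C" for c
    using someI_ex[of "\<lambda>y. y \<in> C - {c}"] ne[OF that] unfolding p_def by blast
  have pF: "p c \<in> Fc c" if "c \<in> C" for c using pc[OF that] by (auto simp: Fc_def intro: hull_inc)
  define h where "h c = (p c - c) \<bullet> n c" for c
  have hy: "(y - c) \<bullet> n c = h c" if c: "c \<in> C" and y: "y \<in> Fc c" for c y
    using face_normal(2)[OF K facet[OF c] y pF[OF c]] by (simp add: h_def n_def inner_diff_left)
  have h0: "h c > 0" if c: "c \<in> C" for c
  proof -
    have "c \<in> K" using c by (auto simp: K_def intro: hull_inc)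
    then have "h c \<ge> 0" using face_normal(3)[OF K facet[OF c] _ pF[OF c], of c]
      by (simp add: h_def n_def inner_diff_left)
    moreover have "h c \<noteq> 0" unfolding h_def n_def
      by (rule facet_height[OF K K_def c Fc_def ne[OF c] fin facet[OF c] _ _ pF[OF c]])
         (use face_normal[OF K facet[OF c]] in auto)
    ultimately show ?thesis by simp
  qed
  define l where "l c x = 1 - (x - c) \<bullet> n c / h c" for c x
  have l_vertex: "l c c' = (if c = c' then 1 else 0)" if "c \<in> C" "c' \<in> C" for c c'
  proof (cases "c = c'")
    case False
    then have "c' \<in> Fc c" using that by (auto simp: Fc_def intro: hull_inc)
    then show ?thesis using hy[OF that(1)] h0[OF that(1)] False by (simp add: l_def)
  qed (simp add: l_def)
  \<comment> \<open>An affine function is determined by its values at the vertices. As x ranges over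
    the whole space, the weights u come from the affine hull and may be negative.\<close>
  have l_eq: "\<exists>u. sum u C = 1 \<and> (\<Sum>c\<in>C. u c *\<^sub>R c) = x \<and> (\<forall>c\<in>C. l c x = u c)" for x
  proof -
    have "affine hull C = UNIV"
      using aff_dim_affine_independent[OF aff] card by (simp add: aff_dim_eq_full[symmetric])
    then obtain u where u: "sum u C = 1" "(\<Sum>c\<in>C. u c *\<^sub>R c) = x"
      using affine_hull_finite[OF fin] by blast
    have "l c x = u c" if c: "c \<in> C" for c
    proof -
      have "x - c = (\<Sum>c'\<in>C. u c' *\<^sub>R (c' - c))"
        using u by (simp add: scaleR_diff_right sum_subtractf flip: scaleR_sum_left)
      then have "l c x = 1 - (\<Sum>c'\<in>C. u c' * ((c' - c) \<bullet> n c / h c))"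
        by (simp add: l_def inner_sum_left sum_divide_distrib)
      also have "\<dots> = (\<Sum>c'\<in>C. u c' * l c c')"
        using u(1) by (simp add: l_def algebra_simps sum_subtractf)
      also have "\<dots> = (\<Sum>c'\<in>C. if c' = c then u c else 0)"
        using c by (intro sum.cong refl) (auto simp: l_vertex)
      finally show ?thesis using fin c by simp
    qed
    then show ?thesis using u by blast
  qed
  show ?thesis
  proof (rule that[of h])
    fix x
    obtain u where u: "sum u C = 1" "(\<Sum>c\<in>C. u c *\<^sub>R c) = x" "\<forall>c\<in>C. l c x = u c" using l_eq by blast
    have "(\<Sum>c\<in>C. l c x) = (\<Sum>c\<in>C. u c)" by (rule sum.cong) (use u(3) in auto)
    then have "(\<Sum>c\<in>C. l c x) = 1" by (simp only: u(1))
    then show "(\<Sum>c\<in>C. 1 - (x - c) \<bullet> face_normal (convex hull C) (convex hull (C - {c})) / h c) = 1"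
      by (simp add: l_def n_def K_def Fc_def)
    have "(\<Sum>c\<in>C. l c x *\<^sub>R c) = (\<Sum>c\<in>C. u c *\<^sub>R c)" by (rule sum.cong) (use u(3) in auto)
    then have "(\<Sum>c\<in>C. l c x *\<^sub>R c) = x" by (simp only: u(2))
    then show "(\<Sum>c\<in>C. (1 - (x - c) \<bullet> face_normal (convex hull C) (convex hull (C - {c})) / h c) *\<^sub>R c) = x"
      by (simp add: l_def n_def K_def Fc_def)
  qed (use h0 hy facet ne K in \<open>auto simp: n_def K_def Fc_def\<close>)
qed

lemma facets_of_simplex:
  fixes C :: "'a::euclidean_space set"
  assumes aff: "\<not> affine_dependent C" and ne: "\<And>c. c \<in> C \<Longrightarrow> C - {c} \<noteq> {}"
  shows "bij_betw (\<lambda>c. convex hull (C - {c})) C {F. F facet_of convex hull C}"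
proof -
  have "inj_on (\<lambda>c. convex hull (C - {c})) C"
  proof (rule inj_onI, rule ccontr)
    fix c c' assume c: "c \<in> C" "c' \<in> C" "convex hull (C - {c}) = convex hull (C - {c'})" "c \<noteq> c'"
    then have "c' \<in> convex hull (C - {c'})" by (metis Diff_iff empty_iff hull_inc insert_iff)
    then have "c' \<in> affine hull (C - {c'})" using convex_hull_subset_affine_hull by blast
    then show False using aff c(2) unfolding affine_dependent_def by blast
  qed
  moreover have "(\<lambda>c. convex hull (C - {c})) ` C = {F. F facet_of convex hull C}"
    using facet_of_convex_hull_affine_independent[OF aff] ne by auto
  ultimately show ?thesis by (simp add: bij_betw_def)
qed

lemma integrable_continuous_interior:
  fixes f :: "'a::euclidean_space \<Rightarrow> 'b::euclidean_space"
  assumes f: "continuous_on UNIV f" and K: "compact K"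
  shows "integrable (lebesgue_on (interior K)) f"
proof -
  have bd: "bounded (interior K)" using K by (meson bounded_subset compact_imp_bounded interior_subset)
  then have "interior K \<in> lmeasurable" by (simp add: lmeasurable_open)
  then interpret finite_measure "lebesgue_on (interior K)" by (rule finite_measure_lebesgue_on)
  have one: "L2_fun (lebesgue_on (interior K)) (\<lambda>_. 1::real)" by (simp add: L2_fun_def)
  have f2: "L2_fun (lebesgue_on (interior K)) f" using L2_fun_lebesgue_on_continuous[OF f open_interior bd] .
  then have nf: "L2_fun (lebesgue_on (interior K)) (\<lambda>z. norm (f z))" by (auto simp: L2_fun_def)
  have "integrable (lebesgue_on (interior K)) (\<lambda>z. norm (f z))" using integrable_inner_L2[OF nf one] by simp
  then show ?thesis using integrable_norm_iff[OF L2_funD(1)[OF f2]] by blast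
qed

text \<open>The apex formulas for all faces, weighted with \<open>n\<^sub>c / h\<^sub>c\<close>, combine to the divergence theorem because
  the barycentric coordinates sum to one and reproduce the identity.\<close>

theorem divergence_theorem_simplex:
  fixes K :: "(real ^ 'n) set" and f :: "real ^ 'n \<Rightarrow> real"
  assumes K: "int DIM(real ^ 'n) simplex K" and f: "C_k (Suc 0) f"
  shows "(\<integral>x. frechet_derivative f (at x) (axis j 1) \<partial>lebesgue_on (interior K)) =
    (\<Sum>F | F facet_of K. face_normal K F $ j * (\<integral>y. f y \<partial>surface_measure F))"
proof -
  obtain C where C: "\<not> affine_dependent C" "int (card C) = int DIM(real ^ 'n) + 1" "K = convex hull C"
    using K unfolding simplex_def by blast
  have fin: "finite C" using C(2) card.infinite by fastforce
  have card: "card C = DIM(real ^ 'n) + 1" using C(2) by linarith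
  obtain h where h: "\<And>c. c \<in> C \<Longrightarrow> h c > 0"
    "\<And>c y. c \<in> C \<Longrightarrow> y \<in> convex hull (C - {c}) \<Longrightarrow> (y - c) \<bullet> face_normal K (convex hull (C - {c})) = h c"
    "\<And>x. (\<Sum>c\<in>C. 1 - (x - c) \<bullet> face_normal K (convex hull (C - {c})) / h c) = 1"
    "\<And>x. (\<Sum>c\<in>C. (1 - (x - c) \<bullet> face_normal K (convex hull (C - {c})) / h c) *\<^sub>R c) = x"
    "\<And>c. c \<in> C \<Longrightarrow> convex hull (C - {c}) facet_of K"
    "\<And>c. c \<in> C \<Longrightarrow> C - {c} \<noteq> {}"
    by (rule simplex_barycentric[OF C(1) card fin, folded C(3)], rule that) blast+
  define n where "n c = face_normal K (convex hull (C - {c}))" for c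
  \<comment> \<open>\<open>- r c\<close> is the j-th partial derivative of the barycentric
    coordinate of c, computed as an exact difference since the coordinate is affine. Differentiating
    the two barycentric identities gives \<open>s0\<close> and \<open>s1\<close>.\<close>
  define r where "r c = n c $ j / h c" for c
  have lin: "linear (frechet_derivative f (at x))" for x using f by (intro linear_frechet_derivative) simp
  have diff: "(1 - (axis j 1 - c) \<bullet> n c / h c) - (1 - (0 - c) \<bullet> n c / h c) = - r c" for c
    by (simp add: r_def inner_diff_left inner_axis' diff_divide_distrib)
  note hn = h(3,4)[folded n_def]
  have s0: "(\<Sum>c\<in>C. r c) = 0"
  proof -
    have "(\<Sum>c\<in>C. - r c) = (\<Sum>c\<in>C. 1 - (axis j 1 - c) \<bullet> n c / h c) - (\<Sum>c\<in>C. 1 - (0 - c) \<bullet> n c / h c)"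
      by (simp only: sum_subtractf[symmetric] diff)
    also have "\<dots> = 0" unfolding hn by simp
    finally show ?thesis by (simp add: sum_negf)
  qed
  have s1: "(\<Sum>c\<in>C. r c *\<^sub>R c) = - axis j 1"
  proof -
    have "(\<Sum>c\<in>C. (- r c) *\<^sub>R c) = (\<Sum>c\<in>C. (1 - (axis j 1 - c) \<bullet> n c / h c) *\<^sub>R c) - (\<Sum>c\<in>C. (1 - (0 - c) \<bullet> n c / h c) *\<^sub>R c)"
      by (simp only: sum_subtractf[symmetric] scaleR_diff_left[symmetric] diff)
    also have "\<dots> = axis j 1" unfolding hn by simp
    finally show ?thesis by (simp add: sum_negf minus_equation_iff)
  qed
  have s2: "(\<Sum>c\<in>C. r c *\<^sub>R (x - c)) = axis j 1" for x
    using s0 s1 by (simp add: scaleR_diff_right sum_subtractf flip: scaleR_sum_left)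
  have int: "integrable (lebesgue_on (interior K)) (\<lambda>x. real CARD('n) * f x + frechet_derivative f (at x) (x - c))" for c
    by (rule integrable_continuous_interior[OF continuous_apex_integrand[OF f] simplex_compact(1)[OF K]])
  have "(\<Sum>F | F facet_of K. face_normal K F $ j * (\<integral>y. f y \<partial>surface_measure F)) =
     (\<Sum>c\<in>C. n c $ j * (\<integral>y. f y \<partial>surface_measure (convex hull (C - {c}))))"
    unfolding n_def C(3) by (rule sum.reindex_bij_betw[OF facets_of_simplex[OF C(1) h(6)], symmetric])
  also have "\<dots> = (\<Sum>c\<in>C. r c * (\<integral>x. real CARD('n) * f x + frechet_derivative f (at x) (x - c) \<partial>lebesgue_on (interior K)))"
  proof (rule sum.cong[OF refl])
    fix c assume c: "c \<in> C"
    have "h c * (\<integral>y. f y \<partial>surface_measure (convex hull (C - {c}))) =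
      (\<integral>x. real CARD('n) * f x + frechet_derivative f (at x) (x - c) \<partial>lebesgue_on (interior K))"
      by (rule facet_integral_eq[OF K h(5)[OF c] fin c C(3) refl h(6)[OF c] h(2)[OF c] f])
    then show "n c $ j * (\<integral>y. f y \<partial>surface_measure (convex hull (C - {c}))) =
      r c * (\<integral>x. real CARD('n) * f x + frechet_derivative f (at x) (x - c) \<partial>lebesgue_on (interior K))"
      using h(1)[OF c] by (simp add: r_def field_simps)
  qed
  also have "\<dots> = (\<integral>x. (\<Sum>c\<in>C. r c * (real CARD('n) * f x + frechet_derivative f (at x) (x - c))) \<partial>lebesgue_on (interior K))"
    using int by (simp add: integral_sum)
  also have "(\<lambda>x. \<Sum>c\<in>C. r c * (real CARD('n) * f x + frechet_derivative f (at x) (x - c))) =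
     (\<lambda>x. frechet_derivative f (at x) (axis j 1))"
  proof
    fix x
    have "(\<Sum>c\<in>C. r c * (real CARD('n) * f x + frechet_derivative f (at x) (x - c))) =
      (\<Sum>c\<in>C. r c) * (real CARD('n) * f x) + frechet_derivative f (at x) (\<Sum>c\<in>C. r c *\<^sub>R (x - c))"
      by (simp add: linear_sum[OF lin] linear_cmul[OF lin] distrib_left sum.distrib sum_distrib_right)
    then show "(\<Sum>c\<in>C. r c * (real CARD('n) * f x + frechet_derivative f (at x) (x - c))) = frechet_derivative f (at x) (axis j 1)"
      by (simp add: s0 s2)
  qed
  finally show ?thesis ..
qed

section \<open>The trace inequality\<close>

lemma norm_matrix_vector_mult_le:
  fixes A :: "real ^ 'n ^ 'm"
  shows "norm (A *v x) \<le> norm A * norm x"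
proof -
  have "norm (A *v x) = L2_set (\<lambda>i. norm ((A *v x) $ i)) UNIV" by (simp add: norm_vec_def)
  also have "\<dots> \<le> L2_set (\<lambda>i. norm (A $ i) * norm x) UNIV"
    by (rule L2_set_mono) (auto simp: matrix_mult_dot Cauchy_Schwarz_ineq2)
  also have "\<dots> = norm A * norm x" by (simp only: L2_set_left_distrib[OF norm_ge_zero, symmetric] norm_vec_def[of A])
  finally show ?thesis .
qed

lemma jacobian_vector:
  fixes v :: "real ^ 'n \<Rightarrow> real ^ 'm"
  assumes "smooth v" shows "frechet_derivative v (at x) y = jacobian v (at x) *v y"
proof -
  have "(v has_derivative (\<lambda>h. jacobian v (at x) *v h)) (at x)"
    by (rule iffD1[OF jacobian_works smooth_differentiable[OF assms]])
  from fun_cong[OF frechet_derivative_at[OF this], of y] show ?thesis by simp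
qed

text \<open>The apex formula for f = |v|^2 expresses h times the face integral as the integral of d
  |v|^2 + 2 v . Dv (x - a). With |x - a| \<le> D, Young's inequality bounds the integrand by (d + D)
  |v|^2 + D |Dv|^2, whence c^2 = (d + D) / h.\<close>

theorem trace_inequality:
  fixes K F :: "(real ^ 'n) set"
  assumes K: "int DIM(real ^ 'n) simplex K" and F: "F facet_of K"
  shows "\<exists>c\<ge>0. \<forall>v :: real ^ 'n \<Rightarrow> real ^ 'n. smooth v \<longrightarrow>
    L2_norm (surface_measure F) v \<le> c * (L2_norm (lebesgue_on (interior K)) v +
      L2_norm (lebesgue_on (interior K)) (\<lambda>x. jacobian v (at x)))"
proof -
  obtain C a where C: "finite C" "a \<in> C" "K = convex hull C" "F = convex hull (C - {a})" "C - {a} \<noteq> {}"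
    using simplex_facetE[OF K F] by metis
  obtain p where p: "p \<in> F" using F by (auto simp: facet_of_def)
  define h where "h = (p - a) \<bullet> face_normal K F"
  have h: "(y - a) \<bullet> face_normal K F = h" if "y \<in> F" for y
    using face_normal(2)[OF K F that p] by (simp add: h_def inner_diff_left)
  have h0: "h > 0" by (rule nn_integral_simplex_facet(1)[OF K F C h, of "\<lambda>_. 0"]) auto
  have cK: "compact K" by (rule simplex_compact(1)[OF K])
  have bi: "bounded (interior K)" using cK by (meson bounded_subset compact_imp_bounded interior_subset)
  obtain D where D: "D > 0" "\<And>x. x \<in> interior K \<Longrightarrow> norm (x - a) \<le> D"
  proof -
    have "bounded ((\<lambda>x. x - a) ` interior K)" using bi by (simp add: bounded_translation_minus)
    then show ?thesis using that unfolding bounded_pos by blast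
  qed
  define d where "d = real CARD('n)"
  define c where "c = sqrt ((d + D) / h)"
  show ?thesis
  proof (intro exI[of _ c] conjI allI impI)
    show "c \<ge> 0" using h0 D by (simp add: c_def d_def)
    fix v :: "real ^ 'n \<Rightarrow> real ^ 'n" assume v: "smooth v"
    let ?M = "lebesgue_on (interior K)"
    let ?J = "\<lambda>x. jacobian v (at x)"
    have v2: "L2_fun ?M v" by (rule L2_fun_lebesgue_on_continuous[OF smooth_continuous[OF v] open_interior bi])
    have J2: "L2_fun ?M ?J" by (rule L2_fun_lebesgue_on_continuous[OF continuous_jacobian[OF v] open_interior bi])
    have ck: "C_k (Suc 0) (\<lambda>x. v x \<bullet> v x)" using v by (intro C_k_inner) (simp_all only: smooth_def)
    have Dv: "frechet_derivative (\<lambda>x. v x \<bullet> v x) (at x) y = 2 * (v x \<bullet> (?J x *v y))" for x y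
    proof -
      have "((\<lambda>x. v x \<bullet> v x) has_derivative (\<lambda>y. v x \<bullet> frechet_derivative v (at x) y + frechet_derivative v (at x) y \<bullet> v x)) (at x)"
        by (rule has_derivative_inner[OF smooth_has_derivative[OF v] smooth_has_derivative[OF v]])
      from fun_cong[OF frechet_derivative_at[OF this], symmetric, of y]
      show ?thesis by (simp add: jacobian_vector[OF v] inner_commute)
    qed
    have cg: "continuous_on UNIV (\<lambda>x. d * (v x \<bullet> v x) + 2 * (v x \<bullet> (?J x *v (x - a))))"
      unfolding matrix_vector_mult_def
      by (intro continuous_intros continuous_on_vec_lambda continuous_on_component smooth_continuous[OF v] continuous_jacobian[OF v])
    have "h * (\<integral>y. v y \<bullet> v y \<partial>surface_measure F) = (\<integral>x. d * (v x \<bullet> v x) + 2 * (v x \<bullet> (?J x *v (x - a))) \<partial>?M)"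
      using facet_integral_eq[OF K F C h ck] by (simp add: Dv d_def)
    also have "\<dots> \<le> (\<integral>x. (d + D) * (norm (v x))\<^sup>2 + D * (norm (?J x))\<^sup>2 \<partial>?M)"
    proof (rule integral_mono)
      show "integrable ?M (\<lambda>x. d * (v x \<bullet> v x) + 2 * (v x \<bullet> (?J x *v (x - a))))"
        by (rule integrable_continuous_interior[OF cg cK])
      show "integrable ?M (\<lambda>x. (d + D) * (norm (v x))\<^sup>2 + D * (norm (?J x))\<^sup>2)"
        using v2 J2 by (auto simp: L2_fun_def)
      fix x assume "x \<in> space ?M"
      then have x: "x \<in> interior K" by simp
      have "v x \<bullet> (?J x *v (x - a)) \<le> norm (v x) * (norm (?J x) * norm (x - a))"
        by (rule order_trans[OF norm_cauchy_schwarz mult_left_mono[OF norm_matrix_vector_mult_le norm_ge_zero]])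
      also have "\<dots> \<le> norm (v x) * (norm (?J x) * D)" using D x by (intro mult_left_mono) auto
      finally have "2 * (v x \<bullet> (?J x *v (x - a))) \<le> D * (2 * norm (v x) * norm (?J x))" by (simp add: mult_ac)
      also have "\<dots> \<le> D * ((norm (v x))\<^sup>2 + (norm (?J x))\<^sup>2)"
        using D(1) sum_squares_bound[of "norm (v x)" "norm (?J x)"] by (intro mult_left_mono) auto
      finally show "d * (v x \<bullet> v x) + 2 * (v x \<bullet> (?J x *v (x - a))) \<le> (d + D) * (norm (v x))\<^sup>2 + D * (norm (?J x))\<^sup>2"
        by (simp add: power2_norm_eq_inner[symmetric] algebra_simps)
    qed
    also have "\<dots> = (d + D) * (L2_norm ?M v)\<^sup>2 + D * (L2_norm ?M ?J)\<^sup>2"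
      using v2 J2 by (simp add: L2_norm_power2 L2_fun_def)
    also have "\<dots> \<le> (d + D) * (L2_norm ?M v + L2_norm ?M ?J)\<^sup>2"
    proof -
      have "D * (L2_norm ?M ?J)\<^sup>2 \<le> (d + D) * (L2_norm ?M ?J)\<^sup>2" by (intro mult_right_mono) (auto simp: d_def)
      moreover have "(L2_norm ?M v)\<^sup>2 + (L2_norm ?M ?J)\<^sup>2 \<le> (L2_norm ?M v + L2_norm ?M ?J)\<^sup>2"
        by (simp add: power2_sum)
      then have "(d + D) * ((L2_norm ?M v)\<^sup>2 + (L2_norm ?M ?J)\<^sup>2) \<le> (d + D) * (L2_norm ?M v + L2_norm ?M ?J)\<^sup>2"
        using D(1) by (intro mult_left_mono) (auto simp: d_def)
      ultimately show ?thesis by (simp add: distrib_left)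
    qed
    finally have "(L2_norm (surface_measure F) v)\<^sup>2 \<le> (d + D) / h * (L2_norm ?M v + L2_norm ?M ?J)\<^sup>2"
      using h0 by (simp add: L2_norm_power2 power2_norm_eq_inner field_simps)
    also have "\<dots> = (c * (L2_norm ?M v + L2_norm ?M ?J))\<^sup>2"
      using h0 D by (simp add: c_def power_mult_distrib d_def)
    finally show "L2_norm (surface_measure F) v \<le> c * (L2_norm ?M v + L2_norm ?M ?J)"
      by (rule power2_le_imp_le) (use h0 D in \<open>simp add: c_def d_def\<close>)
  qed
qed

section \<open>Traces\<close>

lemma has_L2_weak_gradient_add:
  fixes v w :: "real ^ 'n \<Rightarrow> real ^ 'n"
  assumes U: "open U" "bounded U" and L: "L2_fun (lebesgue_on U) v" "L2_fun (lebesgue_on U) w"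
    and G: "has_L2_weak_gradient U v G" and H: "has_L2_weak_gradient U w H"
  shows "has_L2_weak_gradient U (\<lambda>x. v x + w x) (\<lambda>x. G x + H x)"
  unfolding has_L2_weak_gradient_def
proof (intro conjI allI impI)
  note GL = has_L2_weak_gradientD(1)[OF G] and HL = has_L2_weak_gradientD(1)[OF H]
  show "L2_fun (lebesgue_on U) (\<lambda>x. G x + H x)" by (rule L2_fun_add[OF GL HL])
  fix \<phi> :: "real ^ 'n \<Rightarrow> real" and i j assume \<phi>: "test_function U \<phi>"
  note \<phi>' = test_function_derivative[OF \<phi>]
  have "(\<integral>x. (v x + w x) $ i * frechet_derivative \<phi> (at x) (axis j 1) \<partial>lebesgue_on U) =
    (\<integral>x. v x $ i * frechet_derivative \<phi> (at x) (axis j 1) \<partial>lebesgue_on U) +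
    (\<integral>x. w x $ i * frechet_derivative \<phi> (at x) (axis j 1) \<partial>lebesgue_on U)"
    unfolding vector_add_component distrib_right
    by (rule Bochner_Integration.integral_add)
       (rule integrable_L2_test_function[OF U L2_fun_vec_nth(1)[OF L(1)] \<phi>'] integrable_L2_test_function[OF U L2_fun_vec_nth(1)[OF L(2)] \<phi>'])+
  also have "\<dots> = - ((\<integral>x. G x $ i $ j * \<phi> x \<partial>lebesgue_on U) + (\<integral>x. H x $ i $ j * \<phi> x \<partial>lebesgue_on U))"
    by (simp add: has_L2_weak_gradientD(2)[OF G \<phi>] has_L2_weak_gradientD(2)[OF H \<phi>])
  also have "(\<integral>x. G x $ i $ j * \<phi> x \<partial>lebesgue_on U) + (\<integral>x. H x $ i $ j * \<phi> x \<partial>lebesgue_on U) =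
    (\<integral>x. (G x + H x) $ i $ j * \<phi> x \<partial>lebesgue_on U)"
    unfolding vector_add_component distrib_right
    by (rule Bochner_Integration.integral_add[symmetric])
       (rule integrable_L2_test_function[OF U L2_fun_vec_nth(1)[OF L2_fun_vec_nth(1)[OF GL]] \<phi>]
         integrable_L2_test_function[OF U L2_fun_vec_nth(1)[OF L2_fun_vec_nth(1)[OF HL]] \<phi>])+
  finally show "(\<integral>x. (v x + w x) $ i * frechet_derivative \<phi> (at x) (axis j 1) \<partial>lebesgue_on U) =
    - (\<integral>x. (G x + H x) $ i $ j * \<phi> x \<partial>lebesgue_on U)" .
qed

lemma has_L2_weak_gradient_scaleR:
  assumes G: "has_L2_weak_gradient U v G"
  shows "has_L2_weak_gradient U (\<lambda>x. c *\<^sub>R v x) (\<lambda>x. c *\<^sub>R G x)"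
  using assms unfolding has_L2_weak_gradient_def
  by (simp add: L2_fun_scaleR mult.assoc)

lemma weak_gradient:
  assumes "w \<in> H1 U"
  shows "has_L2_weak_gradient U w (weak_gradient U w)" "L2_fun (lebesgue_on U) (weak_gradient U w)"
    "L2_fun (lebesgue_on U) w"
proof -
  show a: "has_L2_weak_gradient U w (weak_gradient U w)"
    using assms someI_ex[of "has_L2_weak_gradient U w"] unfolding H1_def weak_gradient_def by blast
  show "L2_fun (lebesgue_on U) (weak_gradient U w)" using a by (rule has_L2_weak_gradientD)
  show "L2_fun (lebesgue_on U) w" using assms by (simp add: H1_def)
qed

lemma H1_add:
  assumes U: "open U" "bounded U" and v: "v \<in> H1 U" and w: "w \<in> H1 U"
  shows "(\<lambda>x. v x + w x) \<in> H1 U"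
  using has_L2_weak_gradient_add[OF U weak_gradient(3)[OF v] weak_gradient(3)[OF w] weak_gradient(1)[OF v] weak_gradient(1)[OF w]]
    L2_fun_add[OF weak_gradient(3)[OF v] weak_gradient(3)[OF w]]
  by (auto simp: H1_def)

lemma H1_scaleR:
  assumes v: "v \<in> H1 U"
  shows "(\<lambda>x. c *\<^sub>R v x) \<in> H1 U"
  using has_L2_weak_gradient_scaleR[OF weak_gradient(1)[OF v], of c] L2_fun_scaleR[OF weak_gradient(3)[OF v], of c]
  by (auto simp: H1_def)

lemma weak_gradient_add:
  assumes U: "open U" "convex U" "bounded U" and v: "v \<in> H1 U" and w: "w \<in> H1 U"
  shows "AE x in lebesgue_on U. weak_gradient U (\<lambda>x. v x + w x) x = weak_gradient U v x + weak_gradient U w x"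
  by (rule weak_gradient_unique[OF U weak_gradient(1)[OF H1_add[OF U(1,3) v w]]
     has_L2_weak_gradient_add[OF U(1,3) weak_gradient(3)[OF v] weak_gradient(3)[OF w] weak_gradient(1)[OF v] weak_gradient(1)[OF w]]])

lemma weak_gradient_scaleR:
  assumes U: "open U" "convex U" "bounded U" and v: "v \<in> H1 U"
  shows "AE x in lebesgue_on U. weak_gradient U (\<lambda>x. c *\<^sub>R v x) x = c *\<^sub>R weak_gradient U v x"
  by (rule weak_gradient_unique[OF U weak_gradient(1)[OF H1_scaleR[OF v]]
     has_L2_weak_gradient_scaleR[OF weak_gradient(1)[OF v]]])

text \<open>The gradients agree at every point: v and w have the same set of weak gradients, and
  \<open>SOME\<close> picks the same element from the same set.\<close>

lemma weak_gradient_cong_AE: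
  fixes v w :: "real ^ 'n \<Rightarrow> real ^ 'n"
  assumes U: "U \<in> sets lebesgue" and v: "v \<in> H1 U" and ae: "AE x in lebesgue_on U. v x = w x"
  shows "w \<in> H1 U" "weak_gradient U w = weak_gradient U v"
proof -
  note vm = L2_funD(1)[OF weak_gradient(3)[OF v]]
  have wL: "L2_fun (lebesgue_on U) w" by (rule L2_fun_cong_AE[OF U weak_gradient(3)[OF v] ae])
  have ae': "AE x in lebesgue_on U. w x = v x" using ae by eventually_elim simp
  have "has_L2_weak_gradient U w G \<longleftrightarrow> has_L2_weak_gradient U v G" for G
    using has_L2_weak_gradient_cong_AE[OF U vm ae, of G G]
      has_L2_weak_gradient_cong_AE[OF U L2_funD(1)[OF wL] ae', of G G] by auto
  then have eq: "has_L2_weak_gradient U w = has_L2_weak_gradient U v" by blast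
  then show "weak_gradient U w = weak_gradient U v" by (simp add: weak_gradient_def)
  show "w \<in> H1 U" using v wL by (simp add: H1_def eq)
qed

lemma simplex_interior:
  fixes K :: "'a::euclidean_space set"
  assumes "int DIM('a) simplex K"
  shows "open (interior K)" "convex (interior K)" "bounded (interior K)" "interior K \<noteq> {}"
proof -
  show "open (interior K)" by simp
  show "convex (interior K)" using simplex_compact(2)[OF assms] by (rule convex_interior)
  show "bounded (interior K)"
    using simplex_compact(1)[OF assms] by (meson bounded_subset compact_imp_bounded interior_subset)
  have "aff_dim K = int DIM('a)" using aff_dim_simplex[OF assms] .
  moreover have "K \<noteq> {}" using calculation DIM_positive[where 'a='a] by auto
  ultimately show "interior K \<noteq> {}"
    using simplex_compact(2)[OF assms] rel_interior_eq_empty[of K] interior_rel_interior_gen[of K] by simp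
qed

lemma L2_fun_surface_continuous:
  fixes K F :: "(real ^ 'n) set" and f :: "real ^ 'n \<Rightarrow> 'b::euclidean_space"
  assumes K: "int DIM(real ^ 'n) simplex K" and F: "F facet_of K" and f: "continuous_on UNIV f"
  shows "L2_fun (surface_measure F) f"
proof -
  interpret finite_measure "surface_measure F" by (rule surface_measure_finite[OF K F])
  have "bounded (f ` F)"
    by (rule compact_imp_bounded[OF compact_continuous_image])
       (use f facet_compact(1)[OF K F] continuous_on_subset in auto)
  then obtain B where B: "\<And>x. x \<in> F \<Longrightarrow> norm (f x) \<le> B" unfolding bounded_iff by blast
  show ?thesis
  proof (rule L2_fun_bounded)
    show "f \<in> borel_measurable (surface_measure F)"
      by (intro measurable_surface_measure borel_measurable_continuous_onI f)
    show "AE x in surface_measure F. norm (f x) \<le> B"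
      using B by (intro AE_I2) auto
  qed
qed

section \<open>Approximating sequences and their limits on faces\<close>

lemma jacobian_diff:
  assumes "smooth f" "smooth g"
  shows "jacobian (\<lambda>x. f x - g x) (at x) = jacobian f (at x) - jacobian g (at x)"
proof -
  have "((\<lambda>x. f x - g x) has_derivative (\<lambda>h. frechet_derivative f (at x) h - frechet_derivative g (at x) h)) (at x)"
    by (intro has_derivative_diff smooth_has_derivative assms)
  from frechet_derivative_at[OF this, symmetric] show ?thesis by (simp add: jacobian_def matrix_def vec_eq_iff)
qed

lemma jacobian_add:
  assumes "smooth f" "smooth g"
  shows "jacobian (\<lambda>x. f x + g x) (at x) = jacobian f (at x) + jacobian g (at x)"
proof -
  have "((\<lambda>x. f x + g x) has_derivative (\<lambda>h. frechet_derivative f (at x) h + frechet_derivative g (at x) h)) (at x)"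
    by (intro has_derivative_add smooth_has_derivative assms)
  from frechet_derivative_at[OF this, symmetric] show ?thesis by (simp add: jacobian_def matrix_def vec_eq_iff)
qed

lemma jacobian_scaleR:
  assumes "smooth f"
  shows "jacobian (\<lambda>x. c *\<^sub>R f x) (at x) = c *\<^sub>R jacobian f (at x)"
proof -
  have "((\<lambda>x. c *\<^sub>R f x) has_derivative (\<lambda>h. c *\<^sub>R frechet_derivative f (at x) h)) (at x)"
    by (intro has_derivative_scaleR_right smooth_has_derivative assms)
  from frechet_derivative_at[OF this, symmetric] show ?thesis by (simp add: jacobian_def matrix_def vec_eq_iff)
qed

text \<open>The part of \<open>is_face_trace\<close> that does not mention the face. Isolating it
  allows one sequence to be used on all faces of an element at once, as Green's formula
  requires.\<close>

definition H1_approximation ::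
  "(real ^ 'n) set \<Rightarrow> (real ^ 'n \<Rightarrow> real ^ 'n) \<Rightarrow> (nat \<Rightarrow> real ^ 'n \<Rightarrow> real ^ 'n) \<Rightarrow> bool" where
  "H1_approximation U w \<phi> \<longleftrightarrow> (\<forall>m. smooth (\<phi> m)) \<and>
     (\<lambda>m. L2_norm (lebesgue_on U) (\<lambda>x. \<phi> m x - w x)) \<longlonglongrightarrow> 0 \<and>
     (\<lambda>m. L2_norm (lebesgue_on U) (\<lambda>x. jacobian (\<phi> m) (at x) - weak_gradient U w x)) \<longlonglongrightarrow> 0"

lemma is_face_trace_iff:
  "is_face_trace K F w g \<longleftrightarrow> L2_fun (surface_measure F) g \<and>
     (\<exists>\<phi>. H1_approximation (interior K) w \<phi> \<and> (\<lambda>m. L2_norm (surface_measure F) (\<lambda>x. \<phi> m x - g x)) \<longlonglongrightarrow> 0)"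
  by (simp add: is_face_trace_def H1_approximation_def conj_assoc)

lemma H1_approximation_L2:
  fixes U :: "(real ^ 'n) set"
  assumes U: "open U" "bounded U" and a: "H1_approximation U w \<phi>"
  shows "L2_fun (lebesgue_on U) (\<phi> m)" "L2_fun (lebesgue_on U) (\<lambda>x. jacobian (\<phi> m) (at x))"
proof -
  have s: "smooth (\<phi> m)" using a by (simp add: H1_approximation_def)
  show "L2_fun (lebesgue_on U) (\<phi> m)" by (rule L2_fun_lebesgue_on_continuous[OF smooth_continuous[OF s] U])
  show "L2_fun (lebesgue_on U) (\<lambda>x. jacobian (\<phi> m) (at x))"
    by (rule L2_fun_lebesgue_on_continuous[OF continuous_jacobian[OF s] U])
qed

lemma exists_H1_approximation:
  assumes K: "int DIM(real ^ 'n) simplex (K :: (real ^ 'n) set)" and w: "w \<in> H1 (interior K)"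
  shows "\<exists>\<phi>. H1_approximation (interior K) w \<phi>"
  by (rule smooth_dense_H1[OF simplex_interior[OF K] weak_gradient(3)[OF w] weak_gradient(1)[OF w]])
     (auto simp: H1_approximation_def)

lemma face_norm_convergence:
  fixes K F :: "(real ^ 'n) set"
  assumes K: "int DIM(real ^ 'n) simplex K" and F: "F facet_of K" and w: "w \<in> H1 (interior K)"
    and a: "H1_approximation (interior K) w \<phi>" and b: "H1_approximation (interior K) w \<psi>"
  shows "\<exists>\<epsilon>. \<epsilon> \<longlonglongrightarrow> 0 \<and> (\<forall>m n. L2_norm (surface_measure F) (\<lambda>x. \<phi> m x - \<psi> n x) \<le> \<epsilon> m + \<epsilon> n)"
proof -
  obtain c where c: "c \<ge> 0" "\<And>v :: real ^ 'n \<Rightarrow> real ^ 'n. smooth v \<Longrightarrow>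
    L2_norm (surface_measure F) v \<le> c * (L2_norm (lebesgue_on (interior K)) v +
      L2_norm (lebesgue_on (interior K)) (\<lambda>x. jacobian v (at x)))"
    using trace_inequality[OF K F] by blast
  let ?M = "lebesgue_on (interior K)" and ?G = "weak_gradient (interior K) w"
  note L = H1_approximation_L2[OF simplex_interior(1,3)[OF K] a] H1_approximation_L2[OF simplex_interior(1,3)[OF K] b]
  define e where "e m = L2_norm ?M (\<lambda>x. \<phi> m x - w x) + L2_norm ?M (\<lambda>x. jacobian (\<phi> m) (at x) - ?G x) +
    (L2_norm ?M (\<lambda>x. \<psi> m x - w x) + L2_norm ?M (\<lambda>x. jacobian (\<psi> m) (at x) - ?G x))" for m
  have e: "e \<longlonglongrightarrow> 0 + 0 + (0 + 0)"
    unfolding e_def by (intro tendsto_add) (use a b in \<open>auto simp: H1_approximation_def\<close>)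
  have "L2_norm (surface_measure F) (\<lambda>x. \<phi> m x - \<psi> n x) \<le> c * e m + c * e n" for m n
  proof -
    have s: "smooth (\<phi> m)" "smooth (\<psi> n)" using a b by (auto simp: H1_approximation_def)
    have "L2_norm (surface_measure F) (\<lambda>x. \<phi> m x - \<psi> n x) \<le> c * (L2_norm ?M (\<lambda>x. \<phi> m x - \<psi> n x) +
      L2_norm ?M (\<lambda>x. jacobian (\<phi> m) (at x) - jacobian (\<psi> n) (at x)))"
      using c(2)[OF smooth_diff[OF s]] by (simp add: jacobian_diff[OF s])
    also have "L2_norm ?M (\<lambda>x. \<phi> m x - \<psi> n x) \<le> L2_norm ?M (\<lambda>x. \<phi> m x - w x) + L2_norm ?M (\<lambda>x. \<psi> n x - w x)"
      using L2_norm_triangle_diff[OF L(1) weak_gradient(3)[OF w] L(3), of m n]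
      by (simp add: L2_norm_minus_commute[of ?M w])
    also have "L2_norm ?M (\<lambda>x. jacobian (\<phi> m) (at x) - jacobian (\<psi> n) (at x)) \<le>
      L2_norm ?M (\<lambda>x. jacobian (\<phi> m) (at x) - ?G x) + L2_norm ?M (\<lambda>x. jacobian (\<psi> n) (at x) - ?G x)"
      using L2_norm_triangle_diff[OF L(2) weak_gradient(2)[OF w] L(4), of m n]
      by (simp add: L2_norm_minus_commute[of ?M ?G])
    finally have "L2_norm (surface_measure F) (\<lambda>x. \<phi> m x - \<psi> n x) \<le>
      c * ((L2_norm ?M (\<lambda>x. \<phi> m x - w x) + L2_norm ?M (\<lambda>x. \<psi> n x - w x)) +
      (L2_norm ?M (\<lambda>x. jacobian (\<phi> m) (at x) - ?G x) + L2_norm ?M (\<lambda>x. jacobian (\<psi> n) (at x) - ?G x)))"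
      using c(1) by (simp add: mult_left_mono)
    also have "\<dots> \<le> c * (e m + e n)" using c(1) by (intro mult_left_mono) (auto simp: e_def)
    finally show ?thesis by (simp add: distrib_left)
  qed
  moreover have "(\<lambda>m. c * e m) \<longlonglongrightarrow> 0" using tendsto_mult_left[OF e, of c] by simp
  ultimately show ?thesis by blast
qed

lemma exists_face_trace:
  fixes K F :: "(real ^ 'n) set"
  assumes K: "int DIM(real ^ 'n) simplex K" and F: "F facet_of K" and w: "w \<in> H1 (interior K)"
  shows "\<exists>g. is_face_trace K F w g"
proof -
  obtain \<phi> where \<phi>: "H1_approximation (interior K) w \<phi>" using exists_H1_approximation[OF K w] by blast
  interpret finite_measure "surface_measure F" by (rule surface_measure_finite[OF K F])
  have L: "L2_fun (surface_measure F) (\<phi> m)" for m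
    by (rule L2_fun_surface_continuous[OF K F]) (use \<phi> in \<open>auto simp: H1_approximation_def intro: smooth_continuous\<close>)
  obtain \<epsilon> where \<epsilon>: "\<epsilon> \<longlonglongrightarrow> 0" "\<And>m n. L2_norm (surface_measure F) (\<lambda>x. \<phi> m x - \<phi> n x) \<le> \<epsilon> m + \<epsilon> n"
    using face_norm_convergence[OF K F w \<phi> \<phi>] by blast
  have "\<exists>N. \<forall>m\<ge>N. \<forall>n\<ge>N. L2_norm (surface_measure F) (\<lambda>x. \<phi> m x - \<phi> n x) < e" if "e > 0" for e
  proof -
    obtain N where N: "\<And>m. m \<ge> N \<Longrightarrow> norm (\<epsilon> m - 0) < e / 2" using LIMSEQ_D[OF \<epsilon>(1), of "e/2"] \<open>e > 0\<close> by auto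
    have "L2_norm (surface_measure F) (\<lambda>x. \<phi> m x - \<phi> n x) < e" if "m \<ge> N" "n \<ge> N" for m n
      using \<epsilon>(2)[of m n] N[OF that(1)] N[OF that(2)] unfolding real_norm_def by linarith
    then show ?thesis by blast
  qed
  from L2_complete[OF L this] show ?thesis using \<phi> unfolding is_face_trace_iff by blast
qed

text \<open>The definition of a trace provides only some approximating sequence. That every such
  sequence converges to it on F is the source of uniqueness, linearity and Green's formula.\<close>

lemma face_trace_limit:
  fixes K F :: "(real ^ 'n) set"
  assumes K: "int DIM(real ^ 'n) simplex K" and F: "F facet_of K" and w: "w \<in> H1 (interior K)"
    and g: "is_face_trace K F w g" and a: "H1_approximation (interior K) w \<phi>"
  shows "(\<lambda>m. L2_norm (surface_measure F) (\<lambda>x. \<phi> m x - g x)) \<longlonglongrightarrow> 0"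
proof -
  obtain \<psi> where \<psi>: "H1_approximation (interior K) w \<psi>"
    "(\<lambda>m. L2_norm (surface_measure F) (\<lambda>x. \<psi> m x - g x)) \<longlonglongrightarrow> 0" and gL: "L2_fun (surface_measure F) g"
    using g unfolding is_face_trace_iff by blast
  have L: "L2_fun (surface_measure F) (\<phi> m)" "L2_fun (surface_measure F) (\<psi> m)" for m
    by (rule L2_fun_surface_continuous[OF K F], use a \<psi> in \<open>auto simp: H1_approximation_def intro: smooth_continuous\<close>)+
  obtain \<epsilon> where \<epsilon>: "\<epsilon> \<longlonglongrightarrow> 0" "\<And>m n. L2_norm (surface_measure F) (\<lambda>x. \<phi> m x - \<psi> n x) \<le> \<epsilon> m + \<epsilon> n"
    using face_norm_convergence[OF K F w a \<psi>(1)] by blast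
  show ?thesis
  proof (rule tendsto_sandwich[OF _ _ tendsto_const])
    show "\<forall>\<^sub>F m in sequentially. L2_norm (surface_measure F) (\<lambda>x. \<phi> m x - g x) \<le>
      (\<epsilon> m + \<epsilon> m) + L2_norm (surface_measure F) (\<lambda>x. \<psi> m x - g x)"
    proof (rule always_eventually, rule allI)
      fix m show "L2_norm (surface_measure F) (\<lambda>x. \<phi> m x - g x) \<le>
        (\<epsilon> m + \<epsilon> m) + L2_norm (surface_measure F) (\<lambda>x. \<psi> m x - g x)"
        using L2_norm_triangle_diff[OF L(1) L(2) gL, of m m] \<epsilon>(2)[of m m] by linarith
    qed
    show "(\<lambda>m. (\<epsilon> m + \<epsilon> m) + L2_norm (surface_measure F) (\<lambda>x. \<psi> m x - g x)) \<longlonglongrightarrow> 0"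
      using tendsto_add[OF tendsto_add[OF \<epsilon>(1) \<epsilon>(1)] \<psi>(2)] by simp
  qed auto
qed

lemma face_trace_unique:
  fixes K F :: "(real ^ 'n) set"
  assumes K: "int DIM(real ^ 'n) simplex K" and F: "F facet_of K" and w: "w \<in> H1 (interior K)"
    and g: "is_face_trace K F w g" and h: "is_face_trace K F w h"
  shows "AE x in surface_measure F. g x = h x"
proof -
  obtain \<phi> where \<phi>: "H1_approximation (interior K) w \<phi>" using exists_H1_approximation[OF K w] by blast
  have L: "L2_fun (surface_measure F) (\<phi> m)" for m
    by (rule L2_fun_surface_continuous[OF K F]) (use \<phi> in \<open>auto simp: H1_approximation_def intro: smooth_continuous\<close>)
  show ?thesis
    by (rule L2_limit_unique[OF L _ _ face_trace_limit[OF K F w g \<phi>] face_trace_limit[OF K F w h \<phi>]])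
       (use g h in \<open>auto simp: is_face_trace_def\<close>)
qed

lemma face_trace:
  fixes K F :: "(real ^ 'n) set"
  assumes K: "int DIM(real ^ 'n) simplex K" and F: "F facet_of K" and w: "w \<in> H1 (interior K)"
  shows "is_face_trace K F w (face_trace K F w)" "L2_fun (surface_measure F) (face_trace K F w)"
proof -
  show a: "is_face_trace K F w (face_trace K F w)"
    unfolding face_trace_def by (rule someI_ex[OF exists_face_trace[OF assms]])
  then show "L2_fun (surface_measure F) (face_trace K F w)" by (simp add: is_face_trace_def)
qed

text \<open>For sums and multiples the natural gradient G is only almost everywhere equal to the one
  chosen by \<open>weak_gradient\<close>; this lets G be used instead.\<close>

lemma H1_approximation_cong:
  assumes U: "open U" "bounded U" and L: "L2_fun (lebesgue_on U) w"
    and G: "AE x in lebesgue_on U. weak_gradient U w x = G x" "L2_fun (lebesgue_on U) G" "L2_fun (lebesgue_on U) (weak_gradient U w)"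
    and s: "\<And>m. smooth (\<phi> m)"
    and l: "(\<lambda>m. L2_norm (lebesgue_on U) (\<lambda>x. \<phi> m x - w x)) \<longlonglongrightarrow> 0"
     "(\<lambda>m. L2_norm (lebesgue_on U) (\<lambda>x. jacobian (\<phi> m) (at x) - G x)) \<longlonglongrightarrow> 0"
  shows "H1_approximation U w \<phi>"
proof -
  have "L2_norm (lebesgue_on U) (\<lambda>x. jacobian (\<phi> m) (at x) - weak_gradient U w x) =
     L2_norm (lebesgue_on U) (\<lambda>x. jacobian (\<phi> m) (at x) - G x)" for m
  proof (rule L2_norm_cong_AE)
    note J = L2_funD(1)[OF L2_fun_lebesgue_on_continuous[OF continuous_jacobian[OF s] U]]
    show "(\<lambda>x. jacobian (\<phi> m) (at x) - weak_gradient U w x) \<in> borel_measurable (lebesgue_on U)"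
      by (rule borel_measurable_diff[OF J L2_funD(1)[OF G(3)]])
    show "(\<lambda>x. jacobian (\<phi> m) (at x) - G x) \<in> borel_measurable (lebesgue_on U)"
      by (rule borel_measurable_diff[OF J L2_funD(1)[OF G(2)]])
    show "AE x in lebesgue_on U. jacobian (\<phi> m) (at x) - weak_gradient U w x = jacobian (\<phi> m) (at x) - G x"
      using G(1) by eventually_elim simp
  qed
  then show ?thesis using s l by (simp add: H1_approximation_def)
qed

lemma face_trace_add:
  fixes K F :: "(real ^ 'n) set"
  assumes K: "int DIM(real ^ 'n) simplex K" and F: "F facet_of K" and v: "v \<in> H1 (interior K)" and w: "w \<in> H1 (interior K)"
  shows "AE x in surface_measure F. face_trace K F (\<lambda>x. v x + w x) x = face_trace K F v x + face_trace K F w x"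
proof -
  let ?U = "interior K"
  note U = simplex_interior[OF K]
  obtain \<phi> where \<phi>: "H1_approximation ?U v \<phi>" using exists_H1_approximation[OF K v] by blast
  obtain \<psi> where \<psi>: "H1_approximation ?U w \<psi>" using exists_H1_approximation[OF K w] by blast
  have s: "smooth (\<phi> m)" "smooth (\<psi> m)" for m using \<phi> \<psi> by (auto simp: H1_approximation_def)
  note vw = H1_add[OF U(1,3) v w]
  note L\<phi> = H1_approximation_L2[OF U(1,3) \<phi>] and L\<psi> = H1_approximation_L2[OF U(1,3) \<psi>]
  have a: "H1_approximation ?U (\<lambda>x. v x + w x) (\<lambda>m x. \<phi> m x + \<psi> m x)"
  proof (rule H1_approximation_cong[OF U(1,3) weak_gradient(3)[OF vw] weak_gradient_add[OF U(1-3) v w]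
        L2_fun_add[OF weak_gradient(2)[OF v] weak_gradient(2)[OF w]] weak_gradient(2)[OF vw] smooth_add[OF s]])
    show "(\<lambda>m. L2_norm (lebesgue_on ?U) (\<lambda>x. \<phi> m x + \<psi> m x - (v x + w x))) \<longlonglongrightarrow> 0"
      by (rule L2_limit_add[OF L\<phi>(1) weak_gradient(3)[OF v] L\<psi>(1) weak_gradient(3)[OF w]])
         (use \<phi> \<psi> in \<open>auto simp: H1_approximation_def\<close>)
    have "(\<lambda>m. L2_norm (lebesgue_on ?U) (\<lambda>x. jacobian (\<phi> m) (at x) + jacobian (\<psi> m) (at x) - (weak_gradient ?U v x + weak_gradient ?U w x))) \<longlonglongrightarrow> 0"
      by (rule L2_limit_add[OF L\<phi>(2) weak_gradient(2)[OF v] L\<psi>(2) weak_gradient(2)[OF w]])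
         (use \<phi> \<psi> in \<open>auto simp: H1_approximation_def\<close>)
    then show "(\<lambda>m. L2_norm (lebesgue_on ?U) (\<lambda>x. jacobian (\<lambda>x. \<phi> m x + \<psi> m x) (at x) - (weak_gradient ?U v x + weak_gradient ?U w x))) \<longlonglongrightarrow> 0"
      by (simp add: jacobian_add[OF s])
  qed
  have S: "L2_fun (surface_measure F) (\<phi> m)" "L2_fun (surface_measure F) (\<psi> m)" for m
    by (intro L2_fun_surface_continuous[OF K F] smooth_continuous s)+
  have "is_face_trace K F (\<lambda>x. v x + w x) (\<lambda>x. face_trace K F v x + face_trace K F w x)"
    unfolding is_face_trace_iff
    using a L2_fun_add[OF face_trace(2)[OF K F v] face_trace(2)[OF K F w]]
      L2_limit_add[OF S(1) face_trace(2)[OF K F v] S(2) face_trace(2)[OF K F w]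
        face_trace_limit[OF K F v face_trace(1)[OF K F v] \<phi>] face_trace_limit[OF K F w face_trace(1)[OF K F w] \<psi>]]
    by blast
  from face_trace_unique[OF K F vw face_trace(1)[OF K F vw] this] show ?thesis .
qed

lemma face_trace_scaleR:
  fixes K F :: "(real ^ 'n) set"
  assumes K: "int DIM(real ^ 'n) simplex K" and F: "F facet_of K" and v: "v \<in> H1 (interior K)"
  shows "AE x in surface_measure F. face_trace K F (\<lambda>x. c *\<^sub>R v x) x = c *\<^sub>R face_trace K F v x"
proof -
  let ?U = "interior K"
  note U = simplex_interior[OF K]
  obtain \<phi> where \<phi>: "H1_approximation ?U v \<phi>" using exists_H1_approximation[OF K v] by blast
  have s: "smooth (\<phi> m)" for m using \<phi> by (auto simp: H1_approximation_def)
  note cv = H1_scaleR[OF v, of c]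
  have a: "H1_approximation ?U (\<lambda>x. c *\<^sub>R v x) (\<lambda>m x. c *\<^sub>R \<phi> m x)"
  proof (rule H1_approximation_cong[OF U(1,3) weak_gradient(3)[OF cv] weak_gradient_scaleR[OF U(1-3) v]
        L2_fun_scaleR[OF weak_gradient(2)[OF v]] weak_gradient(2)[OF cv] smooth_scaleR_const[OF s]])
    show "(\<lambda>m. L2_norm (lebesgue_on ?U) (\<lambda>x. c *\<^sub>R \<phi> m x - c *\<^sub>R v x)) \<longlonglongrightarrow> 0"
      by (rule L2_limit_scaleR) (use \<phi> in \<open>auto simp: H1_approximation_def\<close>)
    have "(\<lambda>m. L2_norm (lebesgue_on ?U) (\<lambda>x. c *\<^sub>R jacobian (\<phi> m) (at x) - c *\<^sub>R weak_gradient ?U v x)) \<longlonglongrightarrow> 0"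
      by (rule L2_limit_scaleR) (use \<phi> in \<open>auto simp: H1_approximation_def\<close>)
    then show "(\<lambda>m. L2_norm (lebesgue_on ?U) (\<lambda>x. jacobian (\<lambda>x. c *\<^sub>R \<phi> m x) (at x) - c *\<^sub>R weak_gradient ?U v x)) \<longlonglongrightarrow> 0"
      by (simp add: jacobian_scaleR[OF s])
  qed
  have "is_face_trace K F (\<lambda>x. c *\<^sub>R v x) (\<lambda>x. c *\<^sub>R face_trace K F v x)"
    unfolding is_face_trace_iff
    using a L2_fun_scaleR[OF face_trace(2)[OF K F v]]
      L2_limit_scaleR[OF face_trace_limit[OF K F v face_trace(1)[OF K F v] \<phi>]]
    by blast
  from face_trace_unique[OF K F cv face_trace(1)[OF K F cv] this] show ?thesis .
qed

text \<open>As for weak gradients, the predicates under \<open>SOME\<close> coincide, so the traces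
  are equal as functions.\<close>

lemma face_trace_cong_AE:
  fixes K F :: "(real ^ 'n) set"
  assumes v: "v \<in> H1 (interior K)" and ae: "AE x in lebesgue_on (interior K). v x = w x"
  shows "face_trace K F w = face_trace K F v"
proof -
  have Ub: "interior K \<in> sets lebesgue" by simp
  note w = weak_gradient_cong_AE[OF Ub v ae]
  have "L2_norm (lebesgue_on (interior K)) (\<lambda>x. \<phi> x - w x) = L2_norm (lebesgue_on (interior K)) (\<lambda>x. \<phi> x - v x)"
    if s: "smooth \<phi>" for \<phi>
  proof (rule L2_norm_cong_AE)
    note m = measurable_lebesgue_on[OF borel_measurable_continuous_onI[OF smooth_continuous[OF s]], of "interior K"]
    show "(\<lambda>x. \<phi> x - w x) \<in> borel_measurable (lebesgue_on (interior K))"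
      by (rule borel_measurable_diff[OF m L2_funD(1)[OF weak_gradient(3)[OF w(1)]]])
    show "(\<lambda>x. \<phi> x - v x) \<in> borel_measurable (lebesgue_on (interior K))"
      by (rule borel_measurable_diff[OF m L2_funD(1)[OF weak_gradient(3)[OF v]]])
    show "AE x in lebesgue_on (interior K). \<phi> x - w x = \<phi> x - v x" using ae by eventually_elim simp
  qed
  then have "H1_approximation (interior K) w \<phi> \<longleftrightarrow> H1_approximation (interior K) v \<phi>" for \<phi>
    unfolding H1_approximation_def w(2) by (intro conj_cong refl) simp
  then show ?thesis unfolding face_trace_def is_face_trace_iff by simp
qed

text \<open>The divergence theorem for the product of \<theta> with a component of a smooth
  approximant, followed by the limit. The volume terms converge by L2 convergence of values and
  gradients, the face terms by L2 convergence to the trace.\<close>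

theorem Green_formula_simplex:
  fixes K :: "(real ^ 'n) set" and \<theta> :: "real ^ 'n \<Rightarrow> real"
  assumes K: "int DIM(real ^ 'n) simplex K" and w: "w \<in> H1 (interior K)" and \<theta>: "smooth \<theta>"
  shows "(\<integral>x. w x $ i * frechet_derivative \<theta> (at x) (axis j 1) \<partial>lebesgue_on (interior K)) +
      (\<integral>x. weak_gradient (interior K) w x $ i $ j * \<theta> x \<partial>lebesgue_on (interior K)) =
    (\<Sum>F | F facet_of K. face_normal K F $ j * (\<integral>y. face_trace K F w y $ i * \<theta> y \<partial>surface_measure F))"
proof -
  let ?U = "interior K"
  let ?M = "lebesgue_on (interior K)"
  note U = simplex_interior[OF K]
  obtain \<phi> where \<phi>: "H1_approximation ?U w \<phi>" using exists_H1_approximation[OF K w] by blast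
  have s: "smooth (\<phi> m)" for m using \<phi> by (auto simp: H1_approximation_def)
  note L = H1_approximation_L2[OF U(1,3) \<phi>]
  define d\<theta> where "d\<theta> x = frechet_derivative \<theta> (at x) (axis j 1)" for x
  have d\<theta>: "smooth d\<theta>" unfolding d\<theta>_def by (rule smooth_frechet_derivative[OF \<theta>])
  have \<theta>L: "L2_fun ?M \<theta>" "L2_fun ?M d\<theta>"
    by (intro L2_fun_lebesgue_on_continuous smooth_continuous \<theta> d\<theta> U)+
  have comp_lim: "(\<lambda>m. \<integral>x. (f m x :: real ^ 'n) $ i * \<eta> x \<partial>N) \<longlonglongrightarrow> (\<integral>x. g x $ i * \<eta> x \<partial>N)"
    if f: "\<And>m. L2_fun N (f m)" "L2_fun N g" and \<eta>: "L2_fun N \<eta>"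
      and lim: "(\<lambda>m. L2_norm N (\<lambda>x. f m x - g x)) \<longlonglongrightarrow> 0" for N :: "(real ^ 'n) measure" and f g \<eta> i
  proof -
    have "(\<lambda>m. \<integral>x. f m x $ i \<bullet> \<eta> x \<partial>N) \<longlonglongrightarrow> (\<integral>x. g x $ i \<bullet> \<eta> x \<partial>N)"
    proof (rule L2_limit_inner[OF L2_fun_vec_nth(1)[OF f(1)] L2_fun_vec_nth(1)[OF f(2)] \<eta>])
      show "(\<lambda>m. L2_norm N (\<lambda>x. f m x $ i - g x $ i)) \<longlonglongrightarrow> 0"
      proof (rule tendsto_sandwich[OF _ _ tendsto_const lim])
        show "\<forall>\<^sub>F m in sequentially. L2_norm N (\<lambda>x. f m x $ i - g x $ i) \<le> L2_norm N (\<lambda>x. f m x - g x)"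
          using L2_fun_vec_nth(2)[OF L2_fun_diff[OF f]] by simp
      qed auto
    qed
    then show ?thesis by simp
  qed
  have lim1: "(\<lambda>m. \<integral>x. \<phi> m x $ i * d\<theta> x \<partial>?M) \<longlonglongrightarrow> (\<integral>x. w x $ i * d\<theta> x \<partial>?M)"
    by (rule comp_lim[OF L(1) weak_gradient(3)[OF w] \<theta>L(2)]) (use \<phi> in \<open>auto simp: H1_approximation_def\<close>)
  have lim2: "(\<lambda>m. \<integral>x. jacobian (\<phi> m) (at x) $ i $ j * \<theta> x \<partial>?M) \<longlonglongrightarrow> (\<integral>x. weak_gradient ?U w x $ i $ j * \<theta> x \<partial>?M)"
  proof (rule comp_lim[OF L2_fun_vec_nth(1)[OF L(2)] L2_fun_vec_nth(1)[OF weak_gradient(2)[OF w]] \<theta>L(1)])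
    show "(\<lambda>m. L2_norm ?M (\<lambda>x. jacobian (\<phi> m) (at x) $ i - weak_gradient ?U w x $ i)) \<longlonglongrightarrow> 0"
    proof (rule tendsto_sandwich[OF _ _ tendsto_const])
      show "(\<lambda>m. L2_norm ?M (\<lambda>x. jacobian (\<phi> m) (at x) - weak_gradient ?U w x)) \<longlonglongrightarrow> 0"
        using \<phi> by (simp add: H1_approximation_def)
      show "\<forall>\<^sub>F m in sequentially. L2_norm ?M (\<lambda>x. jacobian (\<phi> m) (at x) $ i - weak_gradient ?U w x $ i) \<le>
          L2_norm ?M (\<lambda>x. jacobian (\<phi> m) (at x) - weak_gradient ?U w x)"
        using L2_fun_vec_nth(2)[OF L2_fun_diff[OF L(2) weak_gradient(2)[OF w]]] by simp
    qed auto
  qed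
  have lim3: "(\<lambda>m. \<Sum>F | F facet_of K. face_normal K F $ j * (\<integral>y. \<phi> m y $ i * \<theta> y \<partial>surface_measure F)) \<longlonglongrightarrow>
    (\<Sum>F | F facet_of K. face_normal K F $ j * (\<integral>y. face_trace K F w y $ i * \<theta> y \<partial>surface_measure F))"
  proof (intro tendsto_sum tendsto_mult_left)
    fix F assume "F \<in> {F. F facet_of K}"
    then have F: "F facet_of K" by simp
    show "(\<lambda>m. \<integral>y. \<phi> m y $ i * \<theta> y \<partial>surface_measure F) \<longlonglongrightarrow> (\<integral>y. face_trace K F w y $ i * \<theta> y \<partial>surface_measure F)"
      by (rule comp_lim[OF L2_fun_surface_continuous[OF K F smooth_continuous[OF s]] face_trace(2)[OF K F w]
          L2_fun_surface_continuous[OF K F smooth_continuous[OF \<theta>]] face_trace_limit[OF K F w face_trace(1)[OF K F w] \<phi>]])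
  qed
  have eq: "(\<integral>x. \<phi> m x $ i * d\<theta> x \<partial>?M) + (\<integral>x. jacobian (\<phi> m) (at x) $ i $ j * \<theta> x \<partial>?M) =
    (\<Sum>F | F facet_of K. face_normal K F $ j * (\<integral>y. \<phi> m y $ i * \<theta> y \<partial>surface_measure F))" for m
  proof -
    have sc: "smooth (\<lambda>x. \<phi> m x $ i)" by (rule smooth_linear_comp[OF bounded_linear_vec_nth s])
    have ck: "C_k (Suc 0) (\<lambda>x. \<phi> m x $ i * \<theta> x)"
      using smooth_bilinear[OF bounded_bilinear_mult sc \<theta>] unfolding smooth_def by blast
    have D: "frechet_derivative (\<lambda>x. \<phi> m x $ i * \<theta> x) (at x) (axis j 1) =
        \<phi> m x $ i * d\<theta> x + jacobian (\<phi> m) (at x) $ i $ j * \<theta> x" for x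
    proof -
      have "((\<lambda>x. \<phi> m x $ i) has_derivative (\<lambda>h. frechet_derivative (\<phi> m) (at x) h $ i)) (at x)"
        by (rule bounded_linear.has_derivative[OF bounded_linear_vec_nth smooth_has_derivative[OF s]])
      from fun_cong[OF frechet_derivative_at[OF has_derivative_mult[OF this smooth_has_derivative[OF \<theta>, of x]]], symmetric, of "axis j 1"]
      show ?thesis by (simp add: d\<theta>_def jacobian_nth[OF s])
    qed
    have "(\<Sum>F | F facet_of K. face_normal K F $ j * (\<integral>y. \<phi> m y $ i * \<theta> y \<partial>surface_measure F)) =
      (\<integral>x. \<phi> m x $ i * d\<theta> x + jacobian (\<phi> m) (at x) $ i $ j * \<theta> x \<partial>?M)"
      using divergence_theorem_simplex[OF K ck, of j] by (simp add: D)
    also have "\<dots> = (\<integral>x. \<phi> m x $ i * d\<theta> x \<partial>?M) + (\<integral>x. jacobian (\<phi> m) (at x) $ i $ j * \<theta> x \<partial>?M)"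
      using integrable_inner_L2[OF L2_fun_vec_nth(1)[OF L(1)] \<theta>L(2), of m i]
        integrable_inner_L2[OF L2_fun_vec_nth(1)[OF L2_fun_vec_nth(1)[OF L(2)]] \<theta>L(1), of m i j]
      by (intro Bochner_Integration.integral_add) simp_all
    finally show ?thesis ..
  qed
  have "(\<integral>x. w x $ i * d\<theta> x \<partial>?M) + (\<integral>x. weak_gradient ?U w x $ i $ j * \<theta> x \<partial>?M) =
    (\<Sum>F | F facet_of K. face_normal K F $ j * (\<integral>y. face_trace K F w y $ i * \<theta> y \<partial>surface_measure F))"
    using LIMSEQ_unique[OF tendsto_add[OF lim1 lim2]] lim3 unfolding eq by blast
  then show ?thesis by (simp add: d\<theta>_def)
qed

section \<open>Geometry of the mesh\<close>

lemma simplicial_meshD: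
  assumes "simplicial_mesh \<Omega> \<T>"
  shows "finite \<T>" "\<And>K. K \<in> \<T> \<Longrightarrow> int DIM('a::euclidean_space) simplex (K :: 'a set)"
    "\<And>K L. K \<in> \<T> \<Longrightarrow> L \<in> \<T> \<Longrightarrow> K \<inter> L face_of K" "\<Union>\<T> = closure \<Omega>"
  using assms by (auto simp: simplicial_mesh_def triangulation_def)

text \<open>Distinct elements meet in a face that is proper in at least one of them and hence of
  dimension below d, whereas a common interior point would give a nonempty open
  intersection.\<close>

lemma mesh_interiors_disjoint:
  fixes \<T> :: "'a::euclidean_space set set"
  assumes m: "simplicial_mesh \<Omega> \<T>" and K: "K \<in> \<T>" "L \<in> \<T>" "K \<noteq> L"
  shows "interior K \<inter> interior L = {}"
proof (rule ccontr)
  assume ne: "interior K \<inter> interior L \<noteq> {}"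
  note sK = simplicial_meshD(2)[OF m K(1)] and sL = simplicial_meshD(2)[OF m K(2)]
  have lt: "aff_dim (K \<inter> L) < int DIM('a)"
  proof (cases "K \<inter> L = K")
    case False
    then show ?thesis
      using face_of_aff_dim_lt[OF simplex_compact(2)[OF sK] simplicial_meshD(3)[OF m K(1,2)]] aff_dim_simplex[OF sK] by simp
  next
    case True
    have "L \<inter> K face_of L" by (rule simplicial_meshD(3)[OF m K(2,1)])
    moreover have "L \<inter> K \<noteq> L" using True K(3) by auto
    ultimately have "aff_dim (L \<inter> K) < aff_dim L"
      by (rule face_of_aff_dim_lt[OF simplex_compact(2)[OF sL]])
    then show ?thesis using aff_dim_simplex[OF sL] by (simp add: Int_commute)
  qed
  have "int DIM('a) = aff_dim (interior K \<inter> interior L)"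
    using ne by (intro aff_dim_open[symmetric]) auto
  also have "\<dots> \<le> aff_dim (K \<inter> L)"
    using interior_subset[of K] interior_subset[of L] by (intro aff_dim_subset) auto
  finally show False using lt by simp
qed

text \<open>At a relative interior point of a facet all barycentric coordinates other than that of
  the opposite vertex are positive, and they stay positive nearby. Locally K is therefore the
  half-ball cut out by the single constraint of F.\<close>

lemma simplex_near_facet:
  fixes K F :: "'a::euclidean_space set"
  assumes K: "int DIM('a) simplex K" and F: "F facet_of K" and q: "q \<in> rel_interior F"
  shows "\<exists>r>0. \<forall>x. dist x q < r \<longrightarrow> (x - q) \<bullet> face_normal K F \<le> 0 \<longrightarrow> x \<in> K"
proof -
  obtain C a where C: "\<not> affine_dependent C" "finite C" "card C = DIM('a) + 1" "a \<in> C"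
    "K = convex hull C" "F = convex hull (C - {a})" "C - {a} \<noteq> {}"
    using simplex_facetE[OF K F] by metis
  obtain h where h: "\<And>c. c \<in> C \<Longrightarrow> h c > 0"
    "\<And>c y. c \<in> C \<Longrightarrow> y \<in> convex hull (C - {c}) \<Longrightarrow> (y - c) \<bullet> face_normal K (convex hull (C - {c})) = h c"
    "\<And>x. (\<Sum>c\<in>C. 1 - (x - c) \<bullet> face_normal K (convex hull (C - {c})) / h c) = 1"
    "\<And>x. (\<Sum>c\<in>C. (1 - (x - c) \<bullet> face_normal K (convex hull (C - {c})) / h c) *\<^sub>R c) = x"
    by (rule simplex_barycentric[OF C(1,3,2), folded C(5)], rule that) blast+
  define n where "n c = face_normal K (convex hull (C - {c}))" for c
  define l where "l c x = 1 - (x - c) \<bullet> n c / h c" for c x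
  have qF: "q \<in> F" using q rel_interior_subset by blast
  have na: "n a = face_normal K F" by (simp add: n_def C(6))
  have "\<not> affine_dependent (C - {a})" using C(1) affine_dependent_subset by blast
  then obtain u where u: "\<And>c. c \<in> C - {a} \<Longrightarrow> 0 < u c" "sum u (C - {a}) = 1" "(\<Sum>c\<in>C - {a}. u c *\<^sub>R c) = q"
    using q rel_interior_convex_hull_explicit[of "C - {a}"] C(6) by auto
  have lq: "l c q > 0" if c: "c \<in> C - {a}" for c
  proof -
    have "q - c = (\<Sum>c'\<in>C - {a}. u c' *\<^sub>R (c' - c))"
      using u(2,3) by (simp add: scaleR_diff_right sum_subtractf flip: scaleR_sum_left)
    then have "(q - c) \<bullet> n c = (\<Sum>c'\<in>C - {a}. u c' * ((c' - c) \<bullet> n c))"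
      by (simp add: inner_sum_left)
    also have "\<dots> = (\<Sum>c'\<in>C - {a}. (if c' = c then 0 else u c' * h c))"
    proof (rule sum.cong[OF refl])
      fix c' assume c': "c' \<in> C - {a}"
      show "u c' * ((c' - c) \<bullet> n c) = (if c' = c then 0 else u c' * h c)"
      proof (cases "c' = c")
        case False
        then have "c' \<in> convex hull (C - {c})" using c' by (intro hull_inc) auto
        then show ?thesis using h(2)[of c c'] c False by (simp add: n_def)
      qed simp
    qed
    also have "\<dots> = (\<Sum>c'\<in>C - {a}. u c' * h c - (if c' = c then u c * h c else 0))"
      by (intro sum.cong) auto
    also have "\<dots> = (1 - u c) * h c"
      using c C(2) u(2) by (simp add: sum_subtractf left_diff_distrib flip: sum_distrib_right)
    finally have "l c q = u c" using h(1)[of c] c by (simp add: l_def)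
    then show ?thesis using u(1)[OF c] by simp
  qed
  have "eventually (\<lambda>x. \<forall>c\<in>C - {a}. l c x > 0) (nhds q)"
  proof (rule eventually_ball_finite)
    show "\<forall>c\<in>C - {a}. eventually (\<lambda>x. l c x > 0) (nhds q)"
    proof
      fix c assume c: "c \<in> C - {a}"
      have "h c \<noteq> 0" using h(1)[of c] c by auto
      have "((\<lambda>x. l c x) \<longlongrightarrow> l c q) (nhds q)"
        unfolding l_def using \<open>h c \<noteq> 0\<close> by (intro tendsto_intros filterlim_ident)
      then show "eventually (\<lambda>x. l c x > 0) (nhds q)" using lq[OF c] by (rule order_tendstoD)
    qed
  qed (use C(2) in simp)
  then obtain r where r: "r > 0" "\<And>x. dist x q < r \<Longrightarrow> \<forall>c\<in>C - {a}. l c x > 0"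
    unfolding eventually_nhds_metric by blast
  have "x \<in> K" if x: "dist x q < r" "(x - q) \<bullet> face_normal K F \<le> 0" for x
  proof -
    have "(q - a) \<bullet> n a = h a" using h(2)[OF C(4), of q] qF by (simp add: n_def C(6))
    moreover have "(x - a) \<bullet> n a = (x - q) \<bullet> n a + (q - a) \<bullet> n a" by (simp add: inner_diff_left)
    ultimately have "(x - a) \<bullet> n a \<le> h a" using x(2) by (simp add: na)
    then have la: "l a x \<ge> 0" using h(1)[OF C(4)] by (simp add: l_def)
    have lc: "l c x \<ge> 0" if "c \<in> C" for c
    proof (cases "c = a")
      case True then show ?thesis using la by simp
    next
      case False then show ?thesis using r(2)[OF x(1)] that by (simp add: less_imp_le)
    qed
    have "(\<Sum>c\<in>C. l c x *\<^sub>R c) \<in> convex hull C"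
      using lc h(3)[of x] by (intro convex_sum[OF C(2) convex_convex_hull]) (auto simp: l_def n_def intro: hull_inc)
    moreover have "(\<Sum>c\<in>C. l c x *\<^sub>R c) = x" using h(4)[of x] by (simp add: l_def n_def)
    ultimately show "x \<in> K" by (simp add: C(5))
  qed
  then show ?thesis using r(1) by blast
qed

lemma facet_rel_interior:
  fixes K F :: "'a::euclidean_space set"
  assumes "int DIM('a) simplex K" "F facet_of K"
  shows "rel_interior F \<noteq> {}"
  using facet_compact(2,3)[OF assms] rel_interior_eq_empty by blast

text \<open>The normals agree up to sign. If they were equal, both elements would contain the same
  half-ball at a relative interior point of F, and their interiors would meet.\<close>

lemma mesh_opposite_normals:
  fixes \<T> :: "'a::euclidean_space set set"
  assumes m: "simplicial_mesh \<Omega> \<T>" and K: "K \<in> \<T>" "L \<in> \<T>" "K \<noteq> L" and F: "F facet_of K" "F facet_of L"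
  shows "face_normal L F = - face_normal K F"
proof (rule ccontr)
  assume neq: "face_normal L F \<noteq> - face_normal K F"
  note sK = simplicial_meshD(2)[OF m K(1)] and sL = simplicial_meshD(2)[OF m K(2)]
  note nK = face_normal[OF sK F(1)] and nL = face_normal[OF sL F(2)]
  define n where "n = face_normal K F"
  have n: "face_normal L F = n"
    using facet_normal_unique[OF sK F(1) nK(1,2) nL(1,2)] neq by (simp add: n_def)
  have nn: "n \<bullet> n = 1" using nK(1) by (simp add: n_def norm_eq_sqrt_inner)
  obtain q where q: "q \<in> rel_interior F" using facet_rel_interior[OF sK F(1)] by blast
  obtain r where r: "r > 0" "\<And>x. dist x q < r \<Longrightarrow> (x - q) \<bullet> n \<le> 0 \<Longrightarrow> x \<in> K"
    using simplex_near_facet[OF sK F(1) q] by (auto simp: n_def)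
  obtain s where s: "s > 0" "\<And>x. dist x q < s \<Longrightarrow> (x - q) \<bullet> n \<le> 0 \<Longrightarrow> x \<in> L"
    using simplex_near_facet[OF sL F(2) q] by (auto simp: n)
  define W where "W = ball q (min r s) \<inter> {x. n \<bullet> x < n \<bullet> q}"
  have oW: "open W" unfolding W_def by (intro open_Int open_ball open_halfspace_lt)
  have "W \<subseteq> K" "W \<subseteq> L"
    using r(2) s(2) by (auto simp: W_def dist_commute inner_diff_left inner_commute[of n] less_imp_le)
  then have "W \<subseteq> interior K \<inter> interior L" using oW by (simp add: interior_maximal)
  then have "W = {}" using mesh_interiors_disjoint[OF m K] by blast
  moreover have "q - (min r s / 2) *\<^sub>R n \<in> W"
    using r(1) s(1) nK(1) nn by (auto simp: W_def dist_norm n_def inner_diff_right)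
  ultimately show False by blast
qed

text \<open>Two elements with the facet F in common fill a whole ball around a relative interior
  point of F, so this point lies in the interior of the closure of \<Omega>. As \<Omega> has no
  slits, that interior is \<Omega> itself, and an open set contains none of its frontier.\<close>

lemma boundary_face_unique:
  fixes \<T> :: "'a::euclidean_space set set"
  assumes m: "simplicial_mesh \<Omega> \<T>" and \<Omega>: "open \<Omega>" "interior (closure \<Omega>) = \<Omega>"
    and K: "K \<in> \<T>" "L \<in> \<T>" and F: "F facet_of K" "F facet_of L" and fr: "F \<subseteq> frontier \<Omega>"
  shows "K = L"
proof (rule ccontr)
  assume neq: "K \<noteq> L"
  note sK = simplicial_meshD(2)[OF m K(1)] and sL = simplicial_meshD(2)[OF m K(2)]
  define n where "n = face_normal K F"
  have n: "face_normal L F = - n"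
    using mesh_opposite_normals[OF m K neq F] by (simp add: n_def)
  obtain q where q: "q \<in> rel_interior F" using facet_rel_interior[OF sK F(1)] by blast
  obtain r where r: "r > 0" "\<And>x. dist x q < r \<Longrightarrow> (x - q) \<bullet> n \<le> 0 \<Longrightarrow> x \<in> K"
    using simplex_near_facet[OF sK F(1) q] by (auto simp: n_def)
  obtain s where s: "s > 0" "\<And>x. dist x q < s \<Longrightarrow> (x - q) \<bullet> (- n) \<le> 0 \<Longrightarrow> x \<in> L"
    using simplex_near_facet[OF sL F(2) q] unfolding n by blast
  have "ball q (min r s) \<subseteq> K \<union> L"
  proof
    fix x assume x: "x \<in> ball q (min r s)"
    then have d: "dist x q < r" "dist x q < s" by (auto simp: dist_commute)
    show "x \<in> K \<union> L"
    proof (cases "(x - q) \<bullet> n \<le> 0")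
      case True then show ?thesis using r(2)[OF d(1)] by simp
    next
      case False
      then have "(x - q) \<bullet> (- n) \<le> 0" by simp
      then show ?thesis using s(2)[OF d(2)] by simp
    qed
  qed
  also have "\<dots> \<subseteq> closure \<Omega>" using K simplicial_meshD(4)[OF m] by auto
  finally have "q \<in> interior (closure \<Omega>)"
    using r(1) s(1) by (intro interiorI[OF open_ball]) auto
  then have "q \<in> \<Omega>" using \<Omega>(2) by simp
  moreover have "q \<in> frontier \<Omega>" using q fr rel_interior_subset by blast
  ultimately show False using \<Omega>(1) by (simp add: frontier_def interior_open)
qed

section \<open>Passing between the domain and its elements\<close>

lemma mesh_interior_subset:
  assumes m: "simplicial_mesh \<Omega> \<T>" and \<Omega>: "interior (closure \<Omega>) = \<Omega>" and K: "K \<in> \<T>"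
  shows "interior K \<subseteq> \<Omega>"
proof -
  have "K \<subseteq> closure \<Omega>" using K simplicial_meshD(4)[OF m] by auto
  then show ?thesis using interior_mono \<Omega> by blast
qed

text \<open>The sum of indicators records covering and disjointness at once. The exceptional set is
  the mesh skeleton, a finite union of frontiers of convex sets.\<close>

lemma mesh_covers_AE:
  fixes \<T> :: "'a::euclidean_space set set"
  assumes m: "simplicial_mesh \<Omega> \<T>" and \<Omega>: "interior (closure \<Omega>) = \<Omega>"
  shows "AE x in lebesgue. (\<Sum>K\<in>\<T>. indicator (interior K) x :: real) = indicator \<Omega> x"
proof -
  have "negligible (\<Union>K\<in>\<T>. frontier K)"
    using simplicial_meshD(1)[OF m] simplex_compact(2)[OF simplicial_meshD(2)[OF m]]
    by (intro negligible_Union) (auto intro: negligible_convex_frontier)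
  then have "AE x in lebesgue. x \<notin> (\<Union>K\<in>\<T>. frontier K)"
    by (intro AE_not_in) (simp add: negligible_iff_null_sets)
  then show ?thesis
  proof eventually_elim
    case (elim x)
    show ?case
    proof (cases "\<exists>K\<in>\<T>. x \<in> interior K")
      case True
      then obtain K where K: "K \<in> \<T>" "x \<in> interior K" by blast
      have "(\<Sum>L\<in>\<T>. indicator (interior L) x :: real) = (\<Sum>L\<in>\<T>. if L = K then 1 else 0)"
        using mesh_interiors_disjoint[OF m] K by (intro sum.cong refl) (auto simp: indicator_def)
      then show ?thesis using K simplicial_meshD(1)[OF m] mesh_interior_subset[OF m \<Omega> K(1)] by (auto simp: indicator_def)
    next
      case False
      have "x \<notin> \<Omega>"
      proof
        assume "x \<in> \<Omega>"
        then obtain K where "K \<in> \<T>" "x \<in> K" using simplicial_meshD(4)[OF m] closure_subset[of \<Omega>] by blast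
        then show False using elim False simplex_compact(1)[OF simplicial_meshD(2)[OF m]]
          by (auto simp: frontier_def compact_imp_closed closure_closed)
      qed
      then show ?thesis using False by (auto simp: indicator_def)
    qed
  qed
qed

text \<open>Integrability is asked element by element, which is how the integrands of Green's
  formula are controlled; the mesh being finite, the pieces add up.\<close>

lemma integral_mesh:
  fixes f :: "'a::euclidean_space \<Rightarrow> real"
  assumes m: "simplicial_mesh \<Omega> \<T>" and \<Omega>: "interior (closure \<Omega>) = \<Omega>" "open \<Omega>"
    and f: "f \<in> borel_measurable (lebesgue_on \<Omega>)"
    and int: "\<And>K. K \<in> \<T> \<Longrightarrow> integrable (lebesgue_on (interior K)) f"
  shows "(\<integral>x. f x \<partial>lebesgue_on \<Omega>) = (\<Sum>K\<in>\<T>. \<integral>x. f x \<partial>lebesgue_on (interior K))"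
proof -
  have i: "integrable lebesgue (\<lambda>x. indicator (interior K) x *\<^sub>R f x)" if "K \<in> \<T>" for K
    using int[OF that] by (subst (asm) integrable_restrict_space) auto
  have "(\<integral>x. f x \<partial>lebesgue_on \<Omega>) = (\<integral>x. indicator \<Omega> x *\<^sub>R f x \<partial>lebesgue)"
    using \<Omega>(2) by (subst integral_restrict_space) auto
  also have "\<dots> = (\<integral>x. (\<Sum>K\<in>\<T>. indicator (interior K) x *\<^sub>R f x) \<partial>lebesgue)"
  proof (rule integral_cong_AE)
    have "(\<lambda>x. if x \<in> \<Omega> then f x else 0) \<in> borel_measurable lebesgue"
      using f \<Omega>(2) by (intro borel_measurable_if_I) auto
    moreover have "(\<lambda>x. indicator \<Omega> x *\<^sub>R f x) = (\<lambda>x. if x \<in> \<Omega> then f x else 0)" by (auto simp: indicator_def)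
    ultimately show "(\<lambda>x. indicator \<Omega> x *\<^sub>R f x) \<in> borel_measurable lebesgue" by (simp only:)
    show "(\<lambda>x. \<Sum>K\<in>\<T>. indicator (interior K) x *\<^sub>R f x) \<in> borel_measurable lebesgue"
      using i by (intro borel_measurable_sum borel_measurable_integrable)
    show "AE x in lebesgue. indicator \<Omega> x *\<^sub>R f x = (\<Sum>K\<in>\<T>. indicator (interior K) x *\<^sub>R f x)"
      using mesh_covers_AE[OF m \<Omega>(1)] by eventually_elim (simp flip: sum_distrib_right)
  qed
  also have "\<dots> = (\<Sum>K\<in>\<T>. \<integral>x. indicator (interior K) x *\<^sub>R f x \<partial>lebesgue)"
    using i by (rule Bochner_Integration.integral_sum)
  also have "\<dots> = (\<Sum>K\<in>\<T>. \<integral>x. f x \<partial>lebesgue_on (interior K))"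
    by (intro sum.cong refl) (subst integral_restrict_space, auto)
  finally show ?thesis .
qed

lemma AE_mesh:
  fixes \<T> :: "'a::euclidean_space set set"
  assumes m: "simplicial_mesh \<Omega> \<T>" and \<Omega>: "interior (closure \<Omega>) = \<Omega>" "open \<Omega>"
    and P: "\<And>K. K \<in> \<T> \<Longrightarrow> AE x in lebesgue_on (interior K). P x"
  shows "AE x in lebesgue_on \<Omega>. P x"
proof -
  have "AE x in lebesgue. \<forall>K\<in>\<T>. x \<in> interior K \<longrightarrow> P x"
    using P simplicial_meshD(1)[OF m] by (intro AE_finite_allI) (simp_all add: AE_restrict_space_iff)
  with mesh_covers_AE[OF m \<Omega>(1)] have "AE x in lebesgue. x \<in> \<Omega> \<longrightarrow> P x"
  proof eventually_elim
    case (elim x)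
    show ?case
    proof
      assume "x \<in> \<Omega>"
      then have "(\<Sum>K\<in>\<T>. indicator (interior K) x :: real) \<noteq> 0" using elim(1) by simp
      then obtain K where "K \<in> \<T>" "indicator (interior K) x \<noteq> (0::real)" by (meson sum.neutral)
      then show "P x" using elim(2) by (auto simp: indicator_def split: if_splits)
    qed
  qed
  then show ?thesis using \<Omega>(2) by (simp add: AE_restrict_space_iff)
qed

lemma AE_lebesgue_on_subset:
  assumes "AE x in lebesgue_on \<Omega>. P x" "U \<subseteq> \<Omega>" "U \<in> sets lebesgue" "\<Omega> \<in> sets lebesgue"
  shows "AE x in lebesgue_on U. P x"
proof -
  have "AE x in lebesgue. x \<in> \<Omega> \<longrightarrow> P x" using assms(1,4) by (simp add: AE_restrict_space_iff)
  then have "AE x in lebesgue. x \<in> U \<longrightarrow> P x" by eventually_elim (use assms(2) in auto)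
  then show ?thesis using assms(3) by (simp add: AE_restrict_space_iff)
qed

lemma L2_fun_extend:
  fixes G :: "'a::euclidean_space \<Rightarrow> 'b::euclidean_space"
  assumes G: "L2_fun (lebesgue_on U) G" and U: "U \<in> sets lebesgue" "\<Omega> \<in> sets lebesgue"
  shows "L2_fun (lebesgue_on \<Omega>) (\<lambda>x. indicator U x *\<^sub>R G x)"
proof -
  have e: "(\<lambda>x. indicator U x *\<^sub>R G x) = (\<lambda>x. if x \<in> U then G x else 0)" by (auto simp: indicator_def)
  have "(\<lambda>x. indicator U x *\<^sub>R G x) \<in> borel_measurable lebesgue"
    unfolding e by (rule borel_measurable_if_I[OF L2_funD(1)[OF G] U(1)])
  then have m: "(\<lambda>x. indicator U x *\<^sub>R G x) \<in> borel_measurable (lebesgue_on \<Omega>)"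
    by (rule measurable_restrict_space1)
  have "integrable lebesgue (\<lambda>x. indicator U x *\<^sub>R (norm (G x))\<^sup>2)"
    using L2_funD(2)[OF G] U(1) by (subst (asm) integrable_restrict_space) auto
  then have "integrable lebesgue (\<lambda>x. indicator \<Omega> x *\<^sub>R (indicator U x *\<^sub>R (norm (G x))\<^sup>2))"
    by (rule integrable_mult_indicator[OF U(2)])
  then have "integrable (lebesgue_on \<Omega>) (\<lambda>x. indicator U x *\<^sub>R (norm (G x))\<^sup>2)"
    using U(2) by (subst integrable_restrict_space) auto
  moreover have "(\<lambda>x. indicator U x *\<^sub>R (norm (G x))\<^sup>2) = (\<lambda>x. (norm (indicator U x *\<^sub>R G x))\<^sup>2)"
    by (auto simp: indicator_def)
  ultimately show ?thesis using m by (simp add: L2_fun_def)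
qed

lemma broken_grad_interior:
  fixes \<T> :: "(real ^ 'n) set set"
  assumes m: "simplicial_mesh \<Omega> \<T>" and K: "K \<in> \<T>" "x \<in> interior K"
  shows "broken_grad \<T> w x = weak_gradient (interior K) w x"
proof -
  have "broken_grad \<T> w x = (\<Sum>L\<in>\<T>. if L = K then weak_gradient (interior K) w x else 0)"
    unfolding broken_grad_def
    using mesh_interiors_disjoint[OF m] K by (intro sum.cong refl) (auto simp: indicator_def)
  then show ?thesis using K simplicial_meshD(1)[OF m] by simp
qed

lemma broken_grad_L2:
  fixes \<T> :: "(real ^ 'n) set set"
  assumes m: "simplicial_mesh \<Omega> \<T>" and \<Omega>: "open \<Omega>" and w: "w \<in> broken_H1 \<Omega> \<T>"
  shows "L2_fun (lebesgue_on \<Omega>) (broken_grad \<T> w)"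
  unfolding broken_grad_def
  using w \<Omega> by (intro L2_fun_sum L2_fun_extend weak_gradient) (auto simp: broken_H1_def)

section \<open>The energy identity\<close>

lemma integrable_test_function:
  fixes f :: "real ^ 'n \<Rightarrow> real"
  assumes f: "test_function UNIV f"
  shows "integrable lborel f"
proof -
  have "integrable lborel (\<lambda>x. indicator (closure {x. f x \<noteq> 0}) x *\<^sub>R f x)"
    by (rule borel_integrable_compact) (use test_functionD(3,4)[OF f] continuous_on_subset in auto)
  moreover have "(\<lambda>x. indicator (closure {x. f x \<noteq> 0}) x *\<^sub>R f x) = f"
    using closure_subset[of "{x. f x \<noteq> 0}"] by (auto simp: fun_eq_iff indicator_def)
  ultimately show ?thesis by simp
qed

lemma test_function_mult:
  fixes f g :: "real ^ 'n \<Rightarrow> real"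
  assumes f: "test_function UNIV f" and g: "smooth g"
  shows "test_function UNIV (\<lambda>x. f x * g x)"
proof -
  have "closure {x. f x * g x \<noteq> 0} \<subseteq> closure {x. f x \<noteq> 0}" by (intro closure_mono) auto
  then have "compact (closure {x. f x * g x \<noteq> 0})"
    using test_functionD(3)[OF f] by (auto simp: compact_eq_bounded_closed intro: bounded_subset)
  then show ?thesis
    using smooth_bilinear[OF bounded_bilinear_mult test_functionD(1)[OF f] g] by (simp add: test_function_def)
qed

text \<open>The integral of \<open>f\<close> over a large ball does not change under small translations.\<close>

lemma integral_test_function_derivative:
  fixes f :: "real ^ 'n \<Rightarrow> real"
  assumes f: "test_function UNIV f"
  shows "(\<integral>x. frechet_derivative f (at x) v \<partial>lborel) = 0"
proof -
  obtain R where R: "R > 0" "closure {x. f x \<noteq> 0} \<subseteq> ball 0 R"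
    using test_functionD(3)[OF f] compact_imp_bounded bounded_subset_ballD[of _ 0] by metis
  \<comment> \<open>The margin 1 beyond the support of f keeps the shifted support inside the ball
    for every shift of length below 1.\<close>
  define b where "b = (indicator (ball 0 (R + 1)) :: real ^ 'n \<Rightarrow> real)"
  have b: "integrable lborel b" unfolding b_def
    using emeasure_lborel_ball_finite[of "0 :: real ^ 'n" "R + 1"] by (intro integrable_real_indicator) auto
  note fm = test_functionD(5)[OF f]
  \<comment> \<open>The factors 1 match the shape of \<open>has_derivative_convolution\<close>. The
    derivative of V at 0 is found twice: under the integral sign, and as zero because V is constant
    near 0.\<close>
  define V where "V x = (\<integral>y. f (1 *\<^sub>R y + 1 *\<^sub>R x) *\<^sub>R b y \<partial>lborel)" for x
  have const: "V x = (\<integral>y. f y \<partial>lborel)" if "x \<in> ball 0 1" for x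
  proof -
    have "f (y + x) * b y = f (y + x)" for y
    proof (cases "f (y + x) = 0")
      case False
      then have "y + x \<in> ball 0 R" using R(2) closure_subset[of "{x. f x \<noteq> 0}"] by auto
      then have "norm y < R + 1" using that norm_triangle_ineq4[of "y + x" x] by simp
      then show ?thesis by (simp add: b_def)
    qed simp
    then have "(\<lambda>y. f (y + x) * b y) = (\<lambda>y. f (y + x))" by blast
    then have "V x = (\<integral>y. f (x + y) \<partial>lborel)" by (simp add: V_def add.commute)
    also have "\<dots> = (\<integral>y. f y \<partial>lborel)" using integral_lborel_affine[OF fm, of 1 x] by simp
    finally show ?thesis .
  qed
  have "(V has_derivative (\<lambda>v. \<integral>y. (1 * frechet_derivative f (at (1 *\<^sub>R y + 1 *\<^sub>R 0)) v) *\<^sub>R b y \<partial>lborel)) (at 0)"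
    unfolding V_def by (rule has_derivative_convolution[OF f b])
  moreover have "(V has_derivative (\<lambda>v. 0)) (at 0)"
    by (rule has_derivative_transform_within_open[of "\<lambda>_. \<integral>y. f y \<partial>lborel" _ _ _ "ball 0 1"])
       (use const in auto)
  ultimately have "(\<lambda>v. \<integral>y. (1 * frechet_derivative f (at (1 *\<^sub>R y + 1 *\<^sub>R 0)) v) *\<^sub>R b y \<partial>lborel) = (\<lambda>v. 0)"
    by (rule has_derivative_unique)
  from fun_cong[OF this, of v] have 0: "(\<integral>y. frechet_derivative f (at y) v * b y \<partial>lborel) = 0" by simp
  have "frechet_derivative f (at y) v * b y = frechet_derivative f (at y) v" for y
  proof (cases "y \<in> closure {x. f x \<noteq> 0}")
    case True
    then have "norm y < R" using R(2) by auto
    then show ?thesis by (simp add: b_def)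
  qed (simp add: frechet_derivative_eq_0_outside_support)
  then have "(\<lambda>y. frechet_derivative f (at y) v * b y) = (\<lambda>y. frechet_derivative f (at y) v)" by blast
  then show ?thesis using 0 by (simp only:)
qed

lemma integral_by_parts_test_function:
  fixes f g :: "real ^ 'n \<Rightarrow> real"
  assumes f: "test_function UNIV f" and g: "smooth g"
  shows "(\<integral>x. frechet_derivative f (at x) v * g x \<partial>lborel) = - (\<integral>x. f x * frechet_derivative g (at x) v \<partial>lborel)"
proof -
  have D: "frechet_derivative (\<lambda>x. f x * g x) (at x) v = f x * frechet_derivative g (at x) v + frechet_derivative f (at x) v * g x" for x
    using fun_cong[OF frechet_derivative_at[OF has_derivative_mult[OF smooth_has_derivative[OF test_functionD(1)[OF f]] smooth_has_derivative[OF g, of x]]], symmetric, of v]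
    by simp
  have "0 = (\<integral>x. f x * frechet_derivative g (at x) v + frechet_derivative f (at x) v * g x \<partial>lborel)"
    using integral_test_function_derivative[OF test_function_mult[OF f g], of v] by (simp add: D)
  also have "\<dots> = (\<integral>x. f x * frechet_derivative g (at x) v \<partial>lborel) + (\<integral>x. frechet_derivative f (at x) v * g x \<partial>lborel)"
    by (rule Bochner_Integration.integral_add[OF integrable_test_function[OF test_function_mult[OF f smooth_frechet_derivative[OF g]]]
        integrable_test_function[OF test_function_mult[OF test_function_derivative[OF f] g]]])
  finally show ?thesis by simp
qed

text \<open>Both sides are derivatives at \<open>0\<close> of the correlation
  \<open>X \<mapsto> \<integral> g(y + X) \<partial>\<^sub>v f(y) dy = - \<integral> f(y - X) \<partial>\<^sub>v g(y) dy\<close>, so no symmetry of second derivatives is needed.\<close>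

lemma integral_derivative_swap:
  fixes f g :: "real ^ 'n \<Rightarrow> real"
  assumes f: "test_function UNIV f" and g: "test_function UNIV g"
  shows "(\<integral>x. frechet_derivative f (at x) v * frechet_derivative g (at x) u \<partial>lborel) =
    (\<integral>x. frechet_derivative f (at x) u * frechet_derivative g (at x) v \<partial>lborel)"
proof -
  let ?df = "\<lambda>y. frechet_derivative f (at y) v" and ?dg = "\<lambda>y. frechet_derivative g (at y) v"
  note df = test_function_derivative[OF f, of v] and dg = test_function_derivative[OF g, of v]
  define V where "V X = (\<integral>y. g (1 *\<^sub>R y + 1 *\<^sub>R X) *\<^sub>R ?df y \<partial>lborel)" for X
  define W where "W X = (\<integral>y. f (1 *\<^sub>R y + (-1) *\<^sub>R X) *\<^sub>R ?dg y \<partial>lborel)" for X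
  have "V X = - W X" for X
  proof -
    have sg: "smooth (\<lambda>y. g (1 *\<^sub>R y + X))" by (rule smooth_affine[OF test_functionD(1)[OF g]])
    have "V X = (\<integral>y. ?df y * g (1 *\<^sub>R y + X) \<partial>lborel)" by (simp add: V_def mult.commute)
    also have "\<dots> = - (\<integral>y. f y * ?dg (y + X) \<partial>lborel)"
      unfolding integral_by_parts_test_function[OF f sg] frechet_derivative_affine[OF test_functionD(1)[OF g]] by simp
    also have "(\<integral>y. f y * ?dg (y + X) \<partial>lborel) = (\<integral>y. f (y - X) * ?dg y \<partial>lborel)"
    proof -
      have "(\<lambda>y. f (y - X) * ?dg y) \<in> borel_measurable borel"
        by (intro borel_measurable_times test_functionD(5)[OF dg]
            measurable_compose[OF _ test_functionD(5)[OF f]]) simp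
      from integral_lborel_affine[OF this, of 1 X] show ?thesis by (simp add: add.commute)
    qed
    finally show ?thesis by (simp add: W_def)
  qed
  then have VW: "V = (\<lambda>X. - W X)" by blast
  have "(V has_derivative (\<lambda>u. \<integral>y. (1 * frechet_derivative g (at (1 *\<^sub>R y + 1 *\<^sub>R 0)) u) *\<^sub>R ?df y \<partial>lborel)) (at 0)"
    unfolding V_def by (rule has_derivative_convolution[OF g integrable_test_function[OF df]])
  moreover have "(V has_derivative (\<lambda>u. - (\<integral>y. (-1 * frechet_derivative f (at (1 *\<^sub>R y + (-1) *\<^sub>R 0)) u) *\<^sub>R ?dg y \<partial>lborel))) (at 0)"
    unfolding VW W_def by (intro has_derivative_minus has_derivative_convolution[OF f integrable_test_function[OF dg]])
  ultimately have "(\<lambda>u. \<integral>y. (1 * frechet_derivative g (at (1 *\<^sub>R y + 1 *\<^sub>R 0)) u) *\<^sub>R ?df y \<partial>lborel) =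
     (\<lambda>u. - (\<integral>y. (-1 * frechet_derivative f (at (1 *\<^sub>R y + (-1) *\<^sub>R 0)) u) *\<^sub>R ?dg y \<partial>lborel))"
    by (rule has_derivative_unique)
  from fun_cong[OF this, of u] show ?thesis by (simp add: mult.commute)
qed

section \<open>Algebra of the strain operator and rigidity on the whole space\<close>

definition dev_sym :: "real ^ 'n ^ 'n \<Rightarrow> real ^ 'n ^ 'n" where
  "dev_sym A = A + transpose A - ((2/3) * (\<Sum>i\<in>UNIV. A $ i $ i)) *\<^sub>R mat 1"

lemma linear_dev_sym: "linear dev_sym"
proof (rule linearI)
  show "dev_sym (A + B) = dev_sym A + dev_sym B" for A B :: "real ^ 'n ^ 'n"
    by (simp add: dev_sym_def vec_eq_iff transpose_def sum.distrib algebra_simps)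
  show "dev_sym (c *\<^sub>R A) = c *\<^sub>R dev_sym A" for c and A :: "real ^ 'n ^ 'n"
    by (simp add: dev_sym_def vec_eq_iff transpose_def algebra_simps flip: sum_distrib_left)
qed

lemma bounded_linear_dev_sym: "bounded_linear dev_sym"
  using linear_dev_sym linear_conv_bounded_linear by blast

lemma sym_strain_eq: "sym_strain \<T> w x = dev_sym (broken_grad \<T> w x)"
  by (simp add: sym_strain_def broken_div_def dev_sym_def)

text \<open>Contracting \<open>dev_sym A = 0\<close> with \<open>A\<close>.\<close>

lemma dev_sym_eq_0:
  fixes A :: "real ^ 'n ^ 'n"
  assumes "dev_sym A = 0"
  shows "(\<Sum>i\<in>UNIV. \<Sum>j\<in>UNIV. (A $ i $ j)\<^sup>2) + (\<Sum>i\<in>UNIV. \<Sum>j\<in>UNIV. A $ i $ j * A $ j $ i) =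
    2/3 * (\<Sum>i\<in>UNIV. \<Sum>j\<in>UNIV. A $ i $ i * A $ j $ j)"
proof -
  define q where "q = (\<Sum>i\<in>UNIV. A $ i $ i)"
  have e: "A $ i $ j + A $ j $ i = (if i = j then 2/3 * q else 0)" for i j
  proof -
    have "dev_sym A $ i $ j = 0" using assms by simp
    then show ?thesis by (auto simp: dev_sym_def transpose_def mat_def q_def)
  qed
  have "(\<Sum>i\<in>UNIV. \<Sum>j\<in>UNIV. (A $ i $ j)\<^sup>2) + (\<Sum>i\<in>UNIV. \<Sum>j\<in>UNIV. A $ i $ j * A $ j $ i) =
    (\<Sum>i\<in>UNIV. \<Sum>j\<in>UNIV. A $ i $ j * (A $ i $ j + A $ j $ i))"
    by (simp add: distrib_left sum.distrib power2_eq_square)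
  also have "\<dots> = (\<Sum>i\<in>UNIV. \<Sum>j\<in>UNIV. if i = j then A $ i $ i * (2/3 * q) else 0)"
    unfolding e by (intro sum.cong refl) auto
  also have "\<dots> = 2/3 * (q * q)" by (simp add: q_def sum_distrib_right mult.left_commute flip: sum_distrib_left)
  also have "q * q = (\<Sum>i\<in>UNIV. \<Sum>j\<in>UNIV. A $ i $ i * A $ j $ j)" by (simp add: q_def sum_product)
  finally show ?thesis .
qed

theorem dev_sym_rigidity:
  fixes V :: "real ^ 'n \<Rightarrow> real ^ 'n"
  assumes V: "smooth V" and supp: "compact (closure {x. V x \<noteq> 0})"
    and dev: "\<And>x. dev_sym (jacobian V (at x)) = 0"
  shows "V x = 0"
proof -
  define A where "A x = jacobian V (at x)" for x
  have Vi: "test_function UNIV (\<lambda>x. V x $ i)" for i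
  proof -
    have "closure {x. V x $ i \<noteq> 0} \<subseteq> closure {x. V x \<noteq> 0}" by (intro closure_mono) auto
    then have "compact (closure {x. V x $ i \<noteq> 0})"
      using supp by (auto simp: compact_eq_bounded_closed intro: bounded_subset)
    then show ?thesis using smooth_linear_comp[OF bounded_linear_vec_nth V, of i] by (simp add: test_function_def)
  qed
  have Aij: "A x $ i $ j = frechet_derivative (\<lambda>x. V x $ i) (at x) (axis j 1)" for x i j
  proof -
    have "((\<lambda>x. V x $ i) has_derivative (\<lambda>h. frechet_derivative V (at x) h $ i)) (at x)"
      by (rule bounded_linear.has_derivative[OF bounded_linear_vec_nth smooth_has_derivative[OF V]])
    from fun_cong[OF frechet_derivative_at[OF this], of "axis j 1"] show ?thesis
      by (simp add: A_def jacobian_nth[OF V])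
  qed
  have tA: "test_function UNIV (\<lambda>x. A x $ i $ j)" for i j
    unfolding Aij by (rule test_function_derivative[OF Vi])
  have int: "integrable lborel (\<lambda>x. A x $ i $ j * A x $ k $ l)" for i j k l
    by (rule integrable_test_function[OF test_function_mult[OF tA test_functionD(1)[OF tA]]])
  have int2: "integrable lborel (\<lambda>x. (A x $ i $ j)\<^sup>2)" for i j
    using int[of i j i j] by (simp add: power2_eq_square)
  have swap: "(\<integral>x. A x $ i $ j * A x $ j $ i \<partial>lborel) = (\<integral>x. A x $ i $ i * A x $ j $ j \<partial>lborel)" for i j
    unfolding Aij by (rule integral_derivative_swap[OF Vi Vi])
  define q where "q x = (\<Sum>i\<in>UNIV. A x $ i $ i)" for x
  have qq: "(q x)\<^sup>2 = (\<Sum>i\<in>UNIV. \<Sum>j\<in>UNIV. A x $ i $ i * A x $ j $ j)" for x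
    by (simp add: q_def power2_eq_square sum_product)
  have iq: "integrable lborel (\<lambda>x. (q x)\<^sup>2)" unfolding qq using int by auto
  have isq: "integrable lborel (\<lambda>x. \<Sum>i\<in>UNIV. \<Sum>j\<in>UNIV. (A x $ i $ j)\<^sup>2)" using int2 by auto
  have it: "integrable lborel (\<lambda>x. \<Sum>i\<in>UNIV. \<Sum>j\<in>UNIV. A x $ i $ j * A x $ j $ i)" using int by auto
  have "(\<integral>x. (\<Sum>i\<in>UNIV. \<Sum>j\<in>UNIV. A x $ i $ j * A x $ j $ i) \<partial>lborel) = (\<integral>x. (q x)\<^sup>2 \<partial>lborel)"
    unfolding qq using int by (simp add: Bochner_Integration.integral_sum swap)
  moreover have "(\<integral>x. (\<Sum>i\<in>UNIV. \<Sum>j\<in>UNIV. (A x $ i $ j)\<^sup>2) + (\<Sum>i\<in>UNIV. \<Sum>j\<in>UNIV. A x $ i $ j * A x $ j $ i) \<partial>lborel) =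
      (\<integral>x. 2/3 * (q x)\<^sup>2 \<partial>lborel)"
    unfolding qq dev_sym_eq_0[OF dev[folded A_def]] ..
  ultimately have "(\<integral>x. (\<Sum>i\<in>UNIV. \<Sum>j\<in>UNIV. (A x $ i $ j)\<^sup>2) \<partial>lborel) + (\<integral>x. (q x)\<^sup>2 \<partial>lborel) = 2/3 * (\<integral>x. (q x)\<^sup>2 \<partial>lborel)"
    using isq it iq by simp
  moreover have "(\<integral>x. (q x)\<^sup>2 \<partial>lborel) \<ge> 0" by simp
  moreover have "(\<integral>x. (\<Sum>i\<in>UNIV. \<Sum>j\<in>UNIV. (A x $ i $ j)\<^sup>2) \<partial>lborel) \<ge> 0" by (intro Bochner_Integration.integral_nonneg sum_nonneg) auto
  ultimately have "(\<integral>x. (\<Sum>i\<in>UNIV. \<Sum>j\<in>UNIV. (A x $ i $ j)\<^sup>2) \<partial>lborel) = 0" by linarith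
  then have ae: "AE x in lborel. (\<Sum>i\<in>UNIV. \<Sum>j\<in>UNIV. (A x $ i $ j)\<^sup>2) = 0"
    by (subst (asm) integral_nonneg_eq_0_iff_AE[OF isq]) (auto intro!: sum_nonneg)
  \<comment> \<open>A is continuous and zero almost everywhere, and a nonempty open set is never
    null.\<close>
  have A0: "A x = 0" for x
  proof -
    have cA: "continuous_on UNIV A" unfolding A_def by (rule continuous_jacobian[OF V])
    have "open (A -` (- {0}))" by (rule open_vimage[OF _ cA]) (intro open_Compl closed_singleton)
    moreover have "A -` (- {0}) = {x. A x \<noteq> 0}" by auto
    ultimately have op: "open {x. A x \<noteq> 0}" by simp
    have "AE x in lborel. x \<notin> {x. A x \<noteq> 0}"
      using ae
    proof eventually_elim
      case (elim x)
      then have "A x $ i $ j = 0" for i j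
        by (simp add: sum_nonneg_eq_0_iff sum_nonneg)
      then show ?case by (simp add: vec_eq_iff)
    qed
    then have "{x. A x \<noteq> 0} \<in> null_sets lborel"
      using op by (subst (asm) AE_iff_null_sets[symmetric]) auto
    then have "negligible {x. A x \<noteq> 0}" by (simp add: negligible_iff_null_sets null_sets_completionI)
    then have "{x. A x \<noteq> 0} = {}" using op open_not_negligible by blast
    then show ?thesis by blast
  qed
  have "(V has_derivative (\<lambda>h. 0)) (at x within UNIV)" for x
  proof -
    have "frechet_derivative V (at x) = (\<lambda>h. 0)"
      by (rule ext) (simp add: jacobian_vector[OF V] A0[unfolded A_def])
    then show ?thesis using smooth_has_derivative[OF V, of x] by simp
  qed
  then obtain c where c: "\<And>x. V x = c" using has_derivative_zero_constant[OF convex_UNIV, of V] by blast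
  show ?thesis
  proof (rule ccontr)
    assume "V x \<noteq> 0"
    then have "{x. V x \<noteq> 0} = UNIV" using c by auto
    then show False using supp not_bounded_UNIV[where 'a="real ^ 'n"] by (simp add: compact_eq_bounded_closed)
  qed
qed

section \<open>The norm\<close>

lemma mesh_faces_finite:
  fixes \<T> :: "'a::euclidean_space set set"
  assumes m: "simplicial_mesh \<Omega> \<T>"
  shows "finite (mesh_faces \<T>)"
proof -
  have "finite {F. F facet_of K}" if K: "K \<in> \<T>" for K
  proof -
    obtain C where "finite C" "K = convex hull C"
      using simplicial_meshD(2)[OF m K] unfolding simplex by blast
    then have "polytope K" by (auto simp: polytope_def)
    then show ?thesis by (rule finite_polytope_facets)
  qed
  then have "finite (\<Union>K\<in>\<T>. {F. F facet_of K})" using simplicial_meshD(1)[OF m] by blast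
  moreover have "(\<Union>K\<in>\<T>. {F. F facet_of K}) = mesh_faces \<T>" by (auto simp: mesh_faces_def)
  ultimately show ?thesis by simp
qed

text \<open>Eliminates \<open>THE\<close> and the case distinction in \<open>jump\<close>. Each case
  also lists all elements adjacent to F, since the face sums of the broken Green formula run over
  exactly this set.\<close>

lemma jump_cases:
  fixes \<Omega> :: "(real ^ 'n) set"
  assumes m: "simplicial_mesh \<Omega> \<T>" and \<Omega>: "open \<Omega>" "interior (closure \<Omega>) = \<Omega>"
    and s: "face_sides \<Omega> \<T> Kp Km" and F: "F \<in> mesh_faces \<T>"
  obtains (boundary) K where "{K \<in> \<T>. F facet_of K} = {K}" "\<And>w. jump \<Omega> \<T> Kp Km w F = face_trace K F w"
  | (interior) K L where "K \<noteq> L" "{K \<in> \<T>. F facet_of K} = {K, L}"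
      "\<And>w. jump \<Omega> \<T> Kp Km w F = (\<lambda>x. face_trace K F w x - face_trace L F w x)"
proof (cases "F \<in> boundary_faces \<Omega> \<T>")
  case True
  then obtain K where K: "K \<in> \<T>" "F facet_of K" and fr: "F \<subseteq> frontier \<Omega>"
    unfolding boundary_faces_def mesh_faces_def by blast
  have un: "L = K" if L: "L \<in> \<T>" "F facet_of L" for L
    by (rule boundary_face_unique[OF m \<Omega> L(1) K(1) L(2) K(2) fr])
  have "(THE K. K \<in> \<T> \<and> F facet_of K) = K" by (rule the_equality) (use K un in blast)+
  then have "jump \<Omega> \<T> Kp Km w F = face_trace K F w" for w using True by (simp add: jump_def)
  moreover have "{K \<in> \<T>. F facet_of K} = {K}" using K un by blast
  ultimately show ?thesis by (intro boundary[of K])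
next
  case False
  then have "F \<in> interior_faces \<Omega> \<T>" using F by (simp add: interior_faces_def)
  then show ?thesis using s False
    by (intro interior[of "Kp F" "Km F"]) (auto simp: face_sides_def jump_def)
qed

lemma H1_of_broken:
  assumes "w \<in> broken_H1 \<Omega> \<T>" "K \<in> \<T>" shows "w \<in> H1 (interior K)"
  using assms by (simp add: broken_H1_def)

lemma jump_L2:
  fixes \<Omega> :: "(real ^ 'n) set"
  assumes m: "simplicial_mesh \<Omega> \<T>" and \<Omega>: "open \<Omega>" "interior (closure \<Omega>) = \<Omega>"
    and s: "face_sides \<Omega> \<T> Kp Km" and F: "F \<in> mesh_faces \<T>" and w: "w \<in> broken_H1 \<Omega> \<T>"
  shows "L2_fun (surface_measure F) (jump \<Omega> \<T> Kp Km w F)"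
  using m \<Omega> s F
proof (cases rule: jump_cases)
  case (boundary K)
  then have "K \<in> \<T>" "F facet_of K" by auto
  then show ?thesis using boundary face_trace(2)[OF simplicial_meshD(2)[OF m] _ H1_of_broken[OF w]] by simp
next
  case (interior K L)
  then have "K \<in> \<T>" "F facet_of K" "L \<in> \<T>" "F facet_of L" by auto
  then show ?thesis
    unfolding interior by (intro L2_fun_diff face_trace(2) simplicial_meshD(2)[OF m] H1_of_broken[OF w])
qed

lemma jump_add:
  fixes \<Omega> :: "(real ^ 'n) set"
  assumes m: "simplicial_mesh \<Omega> \<T>" and \<Omega>: "open \<Omega>" "interior (closure \<Omega>) = \<Omega>"
    and s: "face_sides \<Omega> \<T> Kp Km" and F: "F \<in> mesh_faces \<T>" and v: "v \<in> broken_H1 \<Omega> \<T>" and w: "w \<in> broken_H1 \<Omega> \<T>"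
  shows "AE x in surface_measure F. jump \<Omega> \<T> Kp Km (\<lambda>x. v x + w x) F x =
    jump \<Omega> \<T> Kp Km v F x + jump \<Omega> \<T> Kp Km w F x"
  using m \<Omega> s F
proof (cases rule: jump_cases)
  case (boundary K)
  then have "K \<in> \<T>" "F facet_of K" by auto
  from face_trace_add[OF simplicial_meshD(2)[OF m this(1)] this(2) H1_of_broken[OF v this(1)] H1_of_broken[OF w this(1)]]
  show ?thesis by (simp add: boundary(2))
next
  case (interior K L)
  then have "K \<in> \<T>" "F facet_of K" "L \<in> \<T>" "F facet_of L" by auto
  from face_trace_add[OF simplicial_meshD(2)[OF m this(1)] this(2) H1_of_broken[OF v this(1)] H1_of_broken[OF w this(1)]]
    face_trace_add[OF simplicial_meshD(2)[OF m this(3)] this(4) H1_of_broken[OF v this(3)] H1_of_broken[OF w this(3)]]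
  show ?thesis unfolding interior(3) by eventually_elim simp
qed

lemma jump_scaleR:
  fixes \<Omega> :: "(real ^ 'n) set"
  assumes m: "simplicial_mesh \<Omega> \<T>" and \<Omega>: "open \<Omega>" "interior (closure \<Omega>) = \<Omega>"
    and s: "face_sides \<Omega> \<T> Kp Km" and F: "F \<in> mesh_faces \<T>" and v: "v \<in> broken_H1 \<Omega> \<T>"
  shows "AE x in surface_measure F. jump \<Omega> \<T> Kp Km (\<lambda>x. c *\<^sub>R v x) F x = c *\<^sub>R jump \<Omega> \<T> Kp Km v F x"
  using m \<Omega> s F
proof (cases rule: jump_cases)
  case (boundary K)
  then have "K \<in> \<T>" "F facet_of K" by auto
  from face_trace_scaleR[OF simplicial_meshD(2)[OF m this(1)] this(2) H1_of_broken[OF v this(1)]]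
  show ?thesis by (simp add: boundary(2))
next
  case (interior K L)
  then have "K \<in> \<T>" "F facet_of K" "L \<in> \<T>" "F facet_of L" by auto
  from face_trace_scaleR[OF simplicial_meshD(2)[OF m this(1)] this(2) H1_of_broken[OF v this(1)], of c]
    face_trace_scaleR[OF simplicial_meshD(2)[OF m this(3)] this(4) H1_of_broken[OF v this(3)], of c]
  show ?thesis unfolding interior(3) by eventually_elim (simp add: scaleR_diff_right)
qed

section \<open>The broken space and the strain seminorm\<close>

lemma broken_H1_cong_AE:
  fixes \<Omega> :: "(real ^ 'n) set"
  assumes m: "simplicial_mesh \<Omega> \<T>" and \<Omega>: "open \<Omega>" "interior (closure \<Omega>) = \<Omega>"
    and v: "v \<in> broken_H1 \<Omega> \<T>" and ae: "AE x in lebesgue_on \<Omega>. v x = w x"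
  shows "w \<in> broken_H1 \<Omega> \<T>" "broken_grad \<T> w = broken_grad \<T> v"
    "\<And>K F. K \<in> \<T> \<Longrightarrow> face_trace K F w = face_trace K F v"
proof -
  have \<Omega>l: "\<Omega> \<in> sets lebesgue" using \<Omega> by auto
  have aeK: "AE x in lebesgue_on (interior K). v x = w x" if "K \<in> \<T>" for K
    by (rule AE_lebesgue_on_subset[OF ae mesh_interior_subset[OF m \<Omega>(2) that]]) (use \<Omega>l in auto)
  have h: "w \<in> H1 (interior K)" "weak_gradient (interior K) w = weak_gradient (interior K) v" if "K \<in> \<T>" for K
    using weak_gradient_cong_AE[OF _ H1_of_broken[OF v that] aeK[OF that]] by auto
  have "L2_fun (lebesgue_on \<Omega>) w"
    by (rule L2_fun_cong_AE[OF \<Omega>l _ ae]) (use v in \<open>simp add: broken_H1_def\<close>)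
  then show "w \<in> broken_H1 \<Omega> \<T>" using h by (simp add: broken_H1_def)
  show "broken_grad \<T> w = broken_grad \<T> v" by (simp add: fun_eq_iff broken_grad_def h cong: sum.cong)
  show "face_trace K F w = face_trace K F v" if "K \<in> \<T>" for K F
    by (rule face_trace_cong_AE[OF H1_of_broken[OF v that] aeK[OF that]])
qed

lemma sym_norm_cong_AE:
  fixes \<Omega> :: "(real ^ 'n) set"
  assumes m: "simplicial_mesh \<Omega> \<T>" and \<Omega>: "open \<Omega>" "interior (closure \<Omega>) = \<Omega>"
    and s: "face_sides \<Omega> \<T> Kp Km"
    and v: "v \<in> broken_H1 \<Omega> \<T>" and ae: "AE x in lebesgue_on \<Omega>. v x = w x"
  shows "sym_norm \<Omega> \<T> Kp Km w = sym_norm \<Omega> \<T> Kp Km v"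
proof -
  note c = broken_H1_cong_AE[OF m \<Omega> v ae]
  have "sym_strain \<T> w = sym_strain \<T> v" by (simp add: fun_eq_iff sym_strain_eq c(2))
  moreover have "jump \<Omega> \<T> Kp Km w F = jump \<Omega> \<T> Kp Km v F" if F: "F \<in> mesh_faces \<T>" for F
    using m \<Omega> s F
  proof (cases rule: jump_cases)
    case (boundary K)
    then have "K \<in> \<T>" by auto
    then show ?thesis by (simp add: boundary(2) c(3))
  next
    case (interior K L)
    then have "K \<in> \<T>" "L \<in> \<T>" by auto
    then show ?thesis by (simp add: interior(3) c(3))
  qed
  ultimately show ?thesis by (simp add: sym_norm_def cong: sum.cong)
qed

lemma broken_H1_add:
  fixes \<Omega> :: "(real ^ 'n) set"
  assumes m: "simplicial_mesh \<Omega> \<T>" and v: "v \<in> broken_H1 \<Omega> \<T>" and w: "w \<in> broken_H1 \<Omega> \<T>"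
  shows "(\<lambda>x. v x + w x) \<in> broken_H1 \<Omega> \<T>"
  using v w simplex_interior[OF simplicial_meshD(2)[OF m]] by (auto simp: broken_H1_def intro!: L2_fun_add H1_add)

lemma broken_H1_scaleR:
  assumes v: "v \<in> broken_H1 \<Omega> \<T>"
  shows "(\<lambda>x. c *\<^sub>R v x) \<in> broken_H1 \<Omega> \<T>"
  using v by (auto simp: broken_H1_def intro!: L2_fun_scaleR H1_scaleR)

lemma zero_broken_H1: "(\<lambda>x. 0) \<in> broken_H1 \<Omega> \<T>"
proof -
  have "has_L2_weak_gradient U (\<lambda>x. 0) (\<lambda>x. 0)" for U :: "(real ^ 'n) set"
    by (simp add: has_L2_weak_gradient_def)
  then show ?thesis by (auto simp: broken_H1_def H1_def)
qed

lemma sym_strain_L2: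
  fixes \<Omega> :: "(real ^ 'n) set"
  assumes m: "simplicial_mesh \<Omega> \<T>" and \<Omega>: "open \<Omega>" and w: "w \<in> broken_H1 \<Omega> \<T>"
  shows "L2_fun (lebesgue_on \<Omega>) (sym_strain \<T> w)"
proof -
  note L = broken_grad_L2[OF m \<Omega> w]
  obtain c where c: "\<And>A :: real ^ 'n ^ 'n. norm (dev_sym A) \<le> norm A * c"
    using bounded_linear.bounded[OF bounded_linear_dev_sym] by blast
  have "L2_fun (lebesgue_on \<Omega>) (\<lambda>x. dev_sym (broken_grad \<T> w x))"
  proof (rule L2_fun_bound(1)[OF L])
    show "(\<lambda>x. dev_sym (broken_grad \<T> w x)) \<in> borel_measurable (lebesgue_on \<Omega>)"
      by (rule measurable_compose[OF L2_funD(1)[OF L]])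
         (rule borel_measurable_continuous_onI[OF linear_continuous_on[OF bounded_linear_dev_sym]])
    show "AE x in lebesgue_on \<Omega>. norm (dev_sym (broken_grad \<T> w x)) \<le> c * norm (broken_grad \<T> w x)"
      using c by (simp add: mult.commute)
  qed
  then show ?thesis by (simp add: sym_strain_eq[abs_def])
qed

lemma sym_strain_add:
  fixes \<Omega> :: "(real ^ 'n) set"
  assumes m: "simplicial_mesh \<Omega> \<T>" and \<Omega>: "open \<Omega>" "interior (closure \<Omega>) = \<Omega>"
    and v: "v \<in> broken_H1 \<Omega> \<T>" and w: "w \<in> broken_H1 \<Omega> \<T>"
  shows "AE x in lebesgue_on \<Omega>. sym_strain \<T> (\<lambda>x. v x + w x) x = sym_strain \<T> v x + sym_strain \<T> w x"
proof (rule AE_mesh[OF m \<Omega>(2,1)])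
  fix K assume K: "K \<in> \<T>"
  have "AE x in lebesgue_on (interior K). x \<in> interior K" by (rule AE_I2) simp
  with weak_gradient_add[OF simplex_interior(1-3)[OF simplicial_meshD(2)[OF m K]] H1_of_broken[OF v K] H1_of_broken[OF w K]]
  show "AE x in lebesgue_on (interior K). sym_strain \<T> (\<lambda>x. v x + w x) x = sym_strain \<T> v x + sym_strain \<T> w x"
    by eventually_elim (simp add: sym_strain_eq broken_grad_interior[OF m K] linear_add[OF linear_dev_sym])
qed

lemma sym_strain_scaleR:
  fixes \<Omega> :: "(real ^ 'n) set"
  assumes m: "simplicial_mesh \<Omega> \<T>" and \<Omega>: "open \<Omega>" "interior (closure \<Omega>) = \<Omega>"
    and v: "v \<in> broken_H1 \<Omega> \<T>"
  shows "AE x in lebesgue_on \<Omega>. sym_strain \<T> (\<lambda>x. c *\<^sub>R v x) x = c *\<^sub>R sym_strain \<T> v x"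
proof (rule AE_mesh[OF m \<Omega>(2,1)])
  fix K assume K: "K \<in> \<T>"
  have "AE x in lebesgue_on (interior K). x \<in> interior K" by (rule AE_I2) simp
  with weak_gradient_scaleR[OF simplex_interior(1-3)[OF simplicial_meshD(2)[OF m K]] H1_of_broken[OF v K], of c]
  show "AE x in lebesgue_on (interior K). sym_strain \<T> (\<lambda>x. c *\<^sub>R v x) x = c *\<^sub>R sym_strain \<T> v x"
    by eventually_elim (simp add: sym_strain_eq broken_grad_interior[OF m K] linear_cmul[OF linear_dev_sym])
qed

text \<open>Summing Green's formula over the elements: the two contributions of an interior face carry opposite
  normals and equal traces, and on a boundary face the trace is zero.\<close>

lemma broken_gradient_weak:
  fixes \<Omega> :: "(real ^ 'n) set" and \<theta> :: "real ^ 'n \<Rightarrow> real"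
  assumes m: "simplicial_mesh \<Omega> \<T>" and \<Omega>: "open \<Omega>" "interior (closure \<Omega>) = \<Omega>" "bounded \<Omega>"
    and s: "face_sides \<Omega> \<T> Kp Km" and w: "w \<in> broken_H1 \<Omega> \<T>"
    and j0: "\<And>F. F \<in> mesh_faces \<T> \<Longrightarrow> AE x in surface_measure F. jump \<Omega> \<T> Kp Km w F x = 0"
    and \<theta>: "smooth \<theta>"
  shows "(\<integral>x. w x $ i * frechet_derivative \<theta> (at x) (axis j 1) \<partial>lebesgue_on \<Omega>) =
    - (\<integral>x. broken_grad \<T> w x $ i $ j * \<theta> x \<partial>lebesgue_on \<Omega>)"
proof -
  define d\<theta> where "d\<theta> x = frechet_derivative \<theta> (at x) (axis j 1)" for x
  have d\<theta>: "smooth d\<theta>" unfolding d\<theta>_def by (rule smooth_frechet_derivative[OF \<theta>])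
  define X where "X K F = face_normal K F $ j * (\<integral>y. face_trace K F w y $ i * \<theta> y \<partial>surface_measure F)" for K F
  note sK = simplicial_meshD(2)[OF m] and finT = simplicial_meshD(1)[OF m]
  have wL: "L2_fun (lebesgue_on \<Omega>) w" using w by (simp add: broken_H1_def)
  note GL = broken_grad_L2[OF m \<Omega>(1) w]
  have face0: "(\<Sum>K | K \<in> \<T> \<and> F facet_of K. X K F) = 0" if F: "F \<in> mesh_faces \<T>" for F
    using m \<Omega>(1,2) s F
  proof (cases rule: jump_cases)
    case (boundary K)
    have "AE y in surface_measure F. face_trace K F w y $ i * \<theta> y = 0"
      using j0[OF F] unfolding boundary(2) by eventually_elim simp
    then have "(\<integral>y. face_trace K F w y $ i * \<theta> y \<partial>surface_measure F) = 0" by (rule integral_eq_zero_AE)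
    then show ?thesis unfolding boundary(1) by (simp add: X_def)
  next
    case (interior K L)
    then have K: "K \<in> \<T>" "F facet_of K" and L: "L \<in> \<T>" "F facet_of L" by auto
    have n: "face_normal L F = - face_normal K F"
      by (rule mesh_opposite_normals[OF m K(1) L(1) interior(1) K(2) L(2)])
    have m1: "(\<lambda>y. face_trace N F w y $ i * \<theta> y) \<in> borel_measurable (surface_measure F)" if "N \<in> \<T>" "F facet_of N" for N
      by (intro borel_measurable_times borel_measurable_vec_nth L2_funD(1)[OF face_trace(2)[OF sK[OF that(1)] that(2) H1_of_broken[OF w that(1)]]]
          measurable_surface_measure borel_measurable_continuous_onI smooth_continuous \<theta>)
    have "(\<integral>y. face_trace K F w y $ i * \<theta> y \<partial>surface_measure F) = (\<integral>y. face_trace L F w y $ i * \<theta> y \<partial>surface_measure F)"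
    proof (rule integral_cong_AE[OF m1[OF K] m1[OF L]])
      show "AE y in surface_measure F. face_trace K F w y $ i * \<theta> y = face_trace L F w y $ i * \<theta> y"
        using j0[OF F] unfolding interior(3) by eventually_elim simp
    qed
    then show ?thesis unfolding interior(2) using interior(1) by (simp add: X_def n)
  qed
  have "(\<integral>x. w x $ i * d\<theta> x \<partial>lebesgue_on \<Omega>) + (\<integral>x. broken_grad \<T> w x $ i $ j * \<theta> x \<partial>lebesgue_on \<Omega>) =
    (\<Sum>K\<in>\<T>. (\<integral>x. w x $ i * d\<theta> x \<partial>lebesgue_on (interior K)) + (\<integral>x. weak_gradient (interior K) w x $ i $ j * \<theta> x \<partial>lebesgue_on (interior K)))"
  proof -
    have L: "L2_fun (lebesgue_on (interior K)) \<theta>" "L2_fun (lebesgue_on (interior K)) d\<theta>" if "K \<in> \<T>" for K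
      using simplex_interior[OF sK[OF that]] by (intro L2_fun_lebesgue_on_continuous smooth_continuous \<theta> d\<theta>; simp)+
    have iw: "integrable (lebesgue_on (interior K)) (\<lambda>x. w x $ i * d\<theta> x)" if "K \<in> \<T>" for K
      using integrable_inner_L2[OF L2_fun_vec_nth(1)[OF weak_gradient(3)[OF H1_of_broken[OF w that]]] L(2)[OF that], of i] by simp
    have ig: "integrable (lebesgue_on (interior K)) (\<lambda>x. weak_gradient (interior K) w x $ i $ j * \<theta> x)" if "K \<in> \<T>" for K
      using integrable_inner_L2[OF L2_fun_vec_nth(1)[OF L2_fun_vec_nth(1)[OF weak_gradient(2)[OF H1_of_broken[OF w that]]]] L(1)[OF that], of i j] by simp
    have ib: "integrable (lebesgue_on (interior K)) (\<lambda>x. broken_grad \<T> w x $ i $ j * \<theta> x)"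
      and eb: "(\<integral>x. broken_grad \<T> w x $ i $ j * \<theta> x \<partial>lebesgue_on (interior K)) =
        (\<integral>x. weak_gradient (interior K) w x $ i $ j * \<theta> x \<partial>lebesgue_on (interior K))" if K: "K \<in> \<T>" for K
    proof -
      have e: "broken_grad \<T> w x $ i $ j * \<theta> x = weak_gradient (interior K) w x $ i $ j * \<theta> x"
        if "x \<in> space (lebesgue_on (interior K))" for x
        using that broken_grad_interior[OF m K] by simp
      show "integrable (lebesgue_on (interior K)) (\<lambda>x. broken_grad \<T> w x $ i $ j * \<theta> x)"
        using ig[OF K] by (subst Bochner_Integration.integrable_cong[OF refl e])
      show "(\<integral>x. broken_grad \<T> w x $ i $ j * \<theta> x \<partial>lebesgue_on (interior K)) =
        (\<integral>x. weak_gradient (interior K) w x $ i $ j * \<theta> x \<partial>lebesgue_on (interior K))"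
        by (rule Bochner_Integration.integral_cong[OF refl e])
    qed
    have "(\<integral>x. w x $ i * d\<theta> x \<partial>lebesgue_on \<Omega>) = (\<Sum>K\<in>\<T>. \<integral>x. w x $ i * d\<theta> x \<partial>lebesgue_on (interior K))"
      by (rule integral_mesh[OF m \<Omega>(2,1) _ iw])
         (intro borel_measurable_times borel_measurable_vec_nth L2_funD(1)[OF wL] measurable_lebesgue_on borel_measurable_continuous_onI smooth_continuous d\<theta>)
    moreover have "(\<integral>x. broken_grad \<T> w x $ i $ j * \<theta> x \<partial>lebesgue_on \<Omega>) =
       (\<Sum>K\<in>\<T>. \<integral>x. broken_grad \<T> w x $ i $ j * \<theta> x \<partial>lebesgue_on (interior K))"
      by (rule integral_mesh[OF m \<Omega>(2,1) _ ib])
         (intro borel_measurable_times borel_measurable_vec_nth L2_funD(1)[OF GL] measurable_lebesgue_on borel_measurable_continuous_onI smooth_continuous \<theta>)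
    ultimately show ?thesis by (simp add: eb sum.distrib cong: sum.cong)
  qed
  also have "\<dots> = (\<Sum>K\<in>\<T>. \<Sum>F | F facet_of K. X K F)"
    unfolding X_def d\<theta>_def by (intro sum.cong refl Green_formula_simplex sK H1_of_broken[OF w] \<theta>)
  \<comment> \<open>Writing the facets of K as a restriction of the finite set
    \<open>mesh_faces \<T>\<close>, which does not depend on K, allows the two sums to be
    exchanged.\<close>
  also have "\<dots> = (\<Sum>K\<in>\<T>. \<Sum>F | F \<in> mesh_faces \<T> \<and> F facet_of K. X K F)"
    by (intro sum.cong refl) (auto simp: mesh_faces_def)
  also have "\<dots> = (\<Sum>F\<in>mesh_faces \<T>. \<Sum>K | K \<in> \<T> \<and> F facet_of K. X K F)"
    by (rule sum.swap_restrict[OF finT mesh_faces_finite[OF m]])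
  also have "\<dots> = 0" by (intro sum.neutral ballI face0)
  finally show ?thesis by (simp add: d\<theta>_def)
qed

text \<open>Extended by zero, \<open>w\<close> has a weak gradient on the whole space; its mollifications are smooth, compactly
  supported and have vanishing deviatoric strain.\<close>

lemma broken_H1_definite:
  fixes \<Omega> :: "(real ^ 'n) set"
  assumes m: "simplicial_mesh \<Omega> \<T>" and \<Omega>: "open \<Omega>" "interior (closure \<Omega>) = \<Omega>" "bounded \<Omega>"
    and s: "face_sides \<Omega> \<T> Kp Km" and w: "w \<in> broken_H1 \<Omega> \<T>"
    and j0: "\<And>F. F \<in> mesh_faces \<T> \<Longrightarrow> AE x in surface_measure F. jump \<Omega> \<T> Kp Km w F x = 0"
    and S0: "AE x in lebesgue_on \<Omega>. sym_strain \<T> w x = 0"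
  shows "AE x in lebesgue_on \<Omega>. w x = 0"
proof -
  have \<Omega>b: "\<Omega> \<in> sets borel" "\<Omega> \<in> sets lebesgue" using \<Omega> by auto
  have wL: "L2_fun (lebesgue_on \<Omega>) w" using w by (simp add: broken_H1_def)
  note GL = broken_grad_L2[OF m \<Omega>(1) w]
  obtain W where W: "W \<in> borel_measurable borel" "\<And>x. x \<notin> \<Omega> \<Longrightarrow> W x = 0" "AE x in lebesgue_on \<Omega>. w x = W x"
    using borel_representative[OF \<Omega>b(1) L2_funD(1)[OF wL]] by blast
  obtain G where G: "G \<in> borel_measurable borel" "\<And>x. x \<notin> \<Omega> \<Longrightarrow> G x = 0" "AE x in lebesgue_on \<Omega>. broken_grad \<T> w x = G x"
    using borel_representative[OF \<Omega>b(1) L2_funD(1)[OF GL]] by blast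
  have WL: "L2_fun (lebesgue_on \<Omega>) W" by (rule L2_fun_cong_AE[OF \<Omega>b(2) wL W(3)])
  have GL': "L2_fun (lebesgue_on \<Omega>) G" by (rule L2_fun_cong_AE[OF \<Omega>b(2) GL G(3)])
  have iW: "integrable lborel W" by (rule integrable_lborel_L2[OF W(1) \<Omega>b(1) \<Omega>(3) W(2) WL])
  have iG: "integrable lborel G" by (rule integrable_lborel_L2[OF G(1) \<Omega>b(1) \<Omega>(3) G(2) GL'])
  have "AE x in lebesgue. x \<in> \<Omega> \<longrightarrow> sym_strain \<T> w x = 0" "AE x in lebesgue. x \<in> \<Omega> \<longrightarrow> broken_grad \<T> w x = G x"
    using S0 G(3) \<Omega>b(2) by (simp_all add: AE_restrict_space_iff)
  then have "AE x in lebesgue. dev_sym (G x) = 0"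
    by eventually_elim (use G(2) linear_0[OF linear_dev_sym] in \<open>auto simp: sym_strain_eq\<close>)
  then have devG: "AE x in lborel. dev_sym (G x) = 0" by (simp add: AE_completion_iff)
  \<comment> \<open>Valid for every smooth \<theta>, also one that does not vanish on the frontier
    of \<Omega>, because the boundary traces of w are zero. This says that G is the weak gradient of
    the extension of w by zero.\<close>
  have weak: "(\<integral>y. W y $ i * frechet_derivative \<theta> (at y) (axis j 1) \<partial>lborel) = - (\<integral>y. G y $ i $ j * \<theta> y \<partial>lborel)"
    if \<theta>: "smooth \<theta>" for \<theta> i j
  proof -
    have \<theta>m: "\<theta> \<in> borel_measurable borel" "(\<lambda>y. frechet_derivative \<theta> (at y) (axis j 1)) \<in> borel_measurable borel"
      by (intro borel_measurable_continuous_onI smooth_continuous smooth_frechet_derivative \<theta>)+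
    note [measurable] = W(1) G(1) \<theta>m
    have mW: "(\<lambda>y. W y $ i * frechet_derivative \<theta> (at y) (axis j 1)) \<in> borel_measurable borel"
      and mG: "(\<lambda>y. G y $ i $ j * \<theta> y) \<in> borel_measurable borel" by measurable
    have "(\<integral>y. W y $ i * frechet_derivative \<theta> (at y) (axis j 1) \<partial>lborel) =
        (\<integral>y. W y $ i * frechet_derivative \<theta> (at y) (axis j 1) \<partial>lebesgue_on \<Omega>)"
      by (rule integral_lebesgue_on_borel[OF mW \<Omega>b(1), symmetric]) (use W(2) in simp)
    also have "\<dots> = (\<integral>y. w y $ i * frechet_derivative \<theta> (at y) (axis j 1) \<partial>lebesgue_on \<Omega>)"
    proof (rule integral_cong_AE[OF measurable_lebesgue_on[OF mW]])
      show "(\<lambda>y. w y $ i * frechet_derivative \<theta> (at y) (axis j 1)) \<in> borel_measurable (lebesgue_on \<Omega>)"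
        by (intro borel_measurable_times borel_measurable_vec_nth L2_funD(1)[OF wL] measurable_lebesgue_on \<theta>m)
      show "AE y in lebesgue_on \<Omega>. W y $ i * frechet_derivative \<theta> (at y) (axis j 1) = w y $ i * frechet_derivative \<theta> (at y) (axis j 1)"
        using W(3) by eventually_elim simp
    qed
    also have "\<dots> = - (\<integral>y. broken_grad \<T> w y $ i $ j * \<theta> y \<partial>lebesgue_on \<Omega>)"
      by (rule broken_gradient_weak[OF m \<Omega> s w j0 \<theta>])
    also have "(\<integral>y. broken_grad \<T> w y $ i $ j * \<theta> y \<partial>lebesgue_on \<Omega>) = (\<integral>y. G y $ i $ j * \<theta> y \<partial>lebesgue_on \<Omega>)"
    proof (rule integral_cong_AE[OF _ measurable_lebesgue_on[OF mG]])
      show "(\<lambda>y. broken_grad \<T> w y $ i $ j * \<theta> y) \<in> borel_measurable (lebesgue_on \<Omega>)"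
        by (intro borel_measurable_times borel_measurable_vec_nth L2_funD(1)[OF GL] measurable_lebesgue_on \<theta>m)
      show "AE y in lebesgue_on \<Omega>. broken_grad \<T> w y $ i $ j * \<theta> y = G y $ i $ j * \<theta> y"
        using G(3) by eventually_elim simp
    qed
    also have "\<dots> = (\<integral>y. G y $ i $ j * \<theta> y \<partial>lborel)"
      by (rule integral_lebesgue_on_borel[OF mG \<Omega>b(1)]) (use G(2) in simp)
    finally show ?thesis .
  qed
  \<comment> \<open>With the kernel \<psi>(y - x) the value V 0 is exactly this integral. Rigidity
    gives V = 0, so W is orthogonal to every test function on the whole space.\<close>
  have mollify: "(\<integral>y. \<psi> y *\<^sub>R W y \<partial>lborel) = 0" if \<psi>: "test_function UNIV \<psi>" for \<psi>
  proof -
    define V where "V x = (\<integral>y. \<psi> (1 *\<^sub>R y + (-1) *\<^sub>R x) *\<^sub>R W y \<partial>lborel)" for x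
    have V: "smooth V" unfolding V_def by (rule smooth_convolution[OF \<psi> iW])
    have jac: "jacobian V (at x) = (\<integral>y. \<psi> (1 *\<^sub>R y + (-1) *\<^sub>R x) *\<^sub>R G y \<partial>lborel)" for x
    proof -
      define \<theta> where "\<theta> y = \<psi> (1 *\<^sub>R y + (-1) *\<^sub>R x)" for y
      have \<theta>: "smooth \<theta>" unfolding \<theta>_def by (rule smooth_affine[OF test_functionD(1)[OF \<psi>]])
      have D\<theta>: "frechet_derivative \<theta> (at y) v = frechet_derivative \<psi> (at (1 *\<^sub>R y + (-1) *\<^sub>R x)) v" for y v
        unfolding \<theta>_def frechet_derivative_affine[OF test_functionD(1)[OF \<psi>]] by simp
      have iG\<theta>: "integrable lborel (\<lambda>y. \<theta> y *\<^sub>R G y)"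
        unfolding \<theta>_def by (rule integrable_test_function_mult[OF \<psi> iG])
      have "jacobian V (at x) $ i $ j = (\<integral>y. \<theta> y *\<^sub>R G y \<partial>lborel) $ i $ j" for i j
      proof -
        have iW': "integrable lborel (\<lambda>y. (-1 * frechet_derivative \<psi> (at (1 *\<^sub>R y + (-1) *\<^sub>R x)) (axis j 1)) *\<^sub>R W y)"
          by (rule integrable_test_function_mult[OF test_function_UNIV_scale[OF test_function_derivative[OF \<psi>]] iW])
        have "jacobian V (at x) $ i $ j =
            (\<integral>y. (-1 * frechet_derivative \<psi> (at (1 *\<^sub>R y + (-1) *\<^sub>R x)) (axis j 1)) *\<^sub>R W y \<partial>lborel) $ i"
          unfolding jacobian_nth[OF V] unfolding V_def frechet_derivative_convolution[OF \<psi> iW] ..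
        also have "\<dots> = (\<integral>y. - (W y $ i * frechet_derivative \<theta> (at y) (axis j 1)) \<partial>lborel)"
          unfolding integral_vec_nth[OF iW'] D\<theta> by (simp add: mult.commute)
        also have "\<dots> = (\<integral>y. G y $ i $ j * \<theta> y \<partial>lborel)"
          using weak[OF \<theta>, of i j] by simp
        also have "\<dots> = (\<integral>y. \<theta> y *\<^sub>R G y \<partial>lborel) $ i $ j"
          unfolding integral_vec_nth[OF iG\<theta>] integral_vec_nth[OF integrable_vec_nth[OF iG\<theta>]]
          by (simp add: mult.commute)
        finally show ?thesis .
      qed
      then show ?thesis by (simp add: vec_eq_iff \<theta>_def)
    qed
    have "dev_sym (jacobian V (at x)) = 0" for x
    proof -
      have "dev_sym (jacobian V (at x)) = (\<integral>y. dev_sym (\<psi> (1 *\<^sub>R y + (-1) *\<^sub>R x) *\<^sub>R G y) \<partial>lborel)"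
        unfolding jac
        by (rule integral_bounded_linear[OF bounded_linear_dev_sym integrable_test_function_mult[OF \<psi> iG], symmetric])
      also have "\<dots> = 0"
        by (rule integral_eq_zero_AE) (use devG in \<open>eventually_elim, simp add: linear_cmul[OF linear_dev_sym]\<close>)
      finally show ?thesis .
    qed
    \<comment> \<open>A kernel of radius R1 moves the support of W, contained in a ball of radius
      R2, by at most R1.\<close>
    moreover have "compact (closure {x. V x \<noteq> 0})"
    proof -
      obtain R1 where R1: "\<And>x. x \<in> closure {x. \<psi> x \<noteq> 0} \<Longrightarrow> norm x \<le> R1"
        using compact_imp_bounded[OF test_functionD(3)[OF \<psi>]] unfolding bounded_iff by blast
      obtain R2 where R2: "\<And>x. x \<in> \<Omega> \<Longrightarrow> norm x \<le> R2" using \<Omega>(3) unfolding bounded_iff by blast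
      have "norm x \<le> R2 + R1" if "V x \<noteq> 0" for x
      proof (rule ccontr)
        assume far: "\<not> norm x \<le> R2 + R1"
        have "\<psi> (1 *\<^sub>R y + (-1) *\<^sub>R x) *\<^sub>R W y = 0" for y
        proof (rule ccontr)
          assume "\<psi> (1 *\<^sub>R y + (-1) *\<^sub>R x) *\<^sub>R W y \<noteq> 0"
          then have "\<psi> (y - x) \<noteq> 0" "y \<in> \<Omega>" using W(2) by auto
          then have "norm (y - x) \<le> R1" "norm y \<le> R2" using R1 R2 closure_subset[of "{x. \<psi> x \<noteq> 0}"] by auto
          moreover have "norm x \<le> norm y + norm (y - x)" by norm
          ultimately show False using far by linarith
        qed
        then have "V x = 0" by (simp only: V_def integral_zero)
        then show False using that by simp
      qed
      then have "bounded {x. V x \<noteq> 0}" by (auto simp: bounded_iff)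
      then show ?thesis by (simp add: compact_eq_bounded_closed bounded_closure)
    qed
    ultimately have "V 0 = 0" using dev_sym_rigidity[OF V] by blast
    then show ?thesis by (simp add: V_def)
  qed
  \<comment> \<open>The fundamental lemma was proved by dilation and asks for a convex set, so it is
    applied on a ball around \<Omega>, on which W is still zero outside \<Omega>.\<close>
  obtain R where R: "R > 0" "\<Omega> \<subseteq> ball 0 R" using bounded_subset_ballD[OF \<Omega>(3)] by blast
  define U where "U = ball (0 :: real ^ 'n) R"
  have U: "open U" "convex U" "bounded U" "U \<in> sets borel" "\<Omega> \<subseteq> U" "U \<in> sets lebesgue"
    using R by (auto simp: U_def)
  have "AE x in lebesgue_on U. W x $ i = 0" for i
  proof (rule fundamental_lemma[OF U(1-3)])
    have "(\<lambda>x. indicator \<Omega> x *\<^sub>R W x) = W" using W(2) by (auto simp: fun_eq_iff indicator_def)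
    then have "L2_fun (lebesgue_on U) W" using L2_fun_extend[OF WL \<Omega>b(2) U(6)] by simp
    then show "L2_fun (lebesgue_on U) (\<lambda>x. W x $ i)" by (rule L2_fun_vec_nth)
    fix \<phi> assume "test_function U \<phi>"
    then have \<phi>: "test_function UNIV \<phi>" by (rule test_function_mono) simp
    have mW: "(\<lambda>x. W x $ i * \<phi> x) \<in> borel_measurable borel"
      by (intro borel_measurable_times borel_measurable_vec_nth W(1) test_functionD(5)[OF \<phi>])
    have iW\<phi>: "integrable lborel (\<lambda>y. \<phi> y *\<^sub>R W y)"
      using integrable_test_function_mult[OF \<phi> iW, of 1 0] by simp
    have "(\<integral>x. W x $ i * \<phi> x \<partial>lebesgue_on U) = (\<integral>x. W x $ i * \<phi> x \<partial>lborel)"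
    proof (rule integral_lebesgue_on_borel[OF mW U(4)])
      fix x assume "x \<notin> U"
      then have "W x = 0" using W(2) U(5) by blast
      then show "W x $ i * \<phi> x = 0" by simp
    qed
    also have "\<dots> = (\<integral>y. \<phi> y *\<^sub>R W y \<partial>lborel) $ i"
      unfolding integral_vec_nth[OF iW\<phi>] by (simp add: mult.commute)
    finally show "(\<integral>x. W x $ i * \<phi> x \<partial>lebesgue_on U) = 0" using mollify[OF \<phi>] by simp
  qed
  then have "AE x in lebesgue_on U. \<forall>i\<in>UNIV. W x $ i = 0" by (intro AE_finite_allI) auto
  then have "AE x in lebesgue_on \<Omega>. \<forall>i\<in>UNIV. W x $ i = 0"
    by (rule AE_lebesgue_on_subset[OF _ U(5) \<Omega>b(2) U(6)])
  with W(3) show ?thesis by eventually_elim (simp add: vec_eq_iff)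
qed

text \<open>For d \<ge> 2 a facet has dimension at least one and contains two distinct points.
  Positivity matters beyond convention: as 1 / 0 is 0, a face of diameter zero would silently drop
  out of the norm.\<close>

lemma facet_diameter_pos:
  fixes K F :: "'a::euclidean_space set"
  assumes K: "int DIM('a) simplex K" and F: "F facet_of K" and d: "DIM('a) \<ge> 2"
  shows "diameter F > 0"
proof -
  obtain p where p: "p \<in> F" using F by (auto simp: facet_of_def)
  have "aff_dim F = int DIM('a) - 1" using F aff_dim_simplex[OF K] by (simp add: facet_of_def)
  then have "F \<noteq> {p}" using d by auto
  then obtain q where q: "q \<in> F" "q \<noteq> p" using p by blast
  have "dist p q \<le> diameter F"
    by (rule diameter_bounded_bound[OF compact_imp_bounded[OF facet_compact(1)[OF K F]] p q(1)])
  moreover have "dist p q > 0" using q(2) by simp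
  ultimately show ?thesis by linarith
qed

text \<open>Displays the norm as a Euclidean combination of L2 seminorms, with the square root of
  the weight moved inside each face term. Minkowski's inequality, first over the faces and then in
  the plane, yields the triangle inequality.\<close>

lemma sym_norm_eq:
  assumes d: "\<And>F. F \<in> mesh_faces \<T> \<Longrightarrow> 0 < diameter F"
  shows "sym_norm \<Omega> \<T> Kp Km w = sqrt ((L2_norm (lebesgue_on \<Omega>) (sym_strain \<T> w))\<^sup>2 +
     (L2_set (\<lambda>F. sqrt (1 / diameter F) * L2_norm (surface_measure F) (jump \<Omega> \<T> Kp Km w F)) (mesh_faces \<T>))\<^sup>2)"
proof -
  have "(L2_set (\<lambda>F. sqrt (1 / diameter F) * L2_norm (surface_measure F) (jump \<Omega> \<T> Kp Km w F)) (mesh_faces \<T>))\<^sup>2 =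
     (\<Sum>F\<in>mesh_faces \<T>. (sqrt (1 / diameter F) * L2_norm (surface_measure F) (jump \<Omega> \<T> Kp Km w F))\<^sup>2)"
    by (simp add: L2_set_def sum_nonneg)
  also have "\<dots> = (\<Sum>F\<in>mesh_faces \<T>. (1 / diameter F) * (\<integral>x. jump \<Omega> \<T> Kp Km w F x \<bullet> jump \<Omega> \<T> Kp Km w F x \<partial>surface_measure F))"
    using less_imp_le[OF d] by (intro sum.cong refl) (simp add: power_mult_distrib L2_norm_power2 power2_norm_eq_inner)
  finally show ?thesis by (simp add: sym_norm_def)
qed

text \<open>The square integrability statements certify that the integrals in
  \<open>sym_norm\<close> are genuine: a Bochner integral of a non-integrable function is 0 by
  default, which could make the formula vanish for the wrong reason.\<close>

theorem lemma6p1: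
  fixes \<Omega> :: "(real ^ 'n) set"
    and \<T> :: "(real ^ 'n) set set"
    and Kp Km :: "(real ^ 'n) set \<Rightarrow> (real ^ 'n) set"
  assumes "CARD('n) \<in> {2, 3}"
    and "polyhedral_domain \<Omega>"
    and "simplicial_mesh \<Omega> \<T>"
    and "face_sides \<Omega> \<T> Kp Km"
  shows "(\<forall>w \<in> broken_H1 \<Omega> \<T>.
            L2_fun (lebesgue_on \<Omega>) (sym_strain \<T> w) \<and>
            (\<forall>F \<in> mesh_faces \<T>. L2_fun (surface_measure F) (jump \<Omega> \<T> Kp Km w F))) \<and>
         norm_on_ae_classes (lebesgue_on \<Omega>) (broken_H1 \<Omega> \<T>) (sym_norm \<Omega> \<T> Kp Km)"
proof -
  have \<Omega>: "open \<Omega>" "interior (closure \<Omega>) = \<Omega>" "bounded \<Omega>"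
    using assms(2) by (auto simp: polyhedral_domain_def)
  note m = assms(3) and s = assms(4)
  note SL = sym_strain_L2[OF m \<Omega>(1)] and JL = jump_L2[OF m \<Omega>(1,2) s]
  define S where "S w = L2_norm (lebesgue_on \<Omega>) (sym_strain \<T> w)" for w
  define j where "j w F = sqrt (1 / diameter F) * L2_norm (surface_measure F) (jump \<Omega> \<T> Kp Km w F)" for w F
  define J where "J w = L2_set (j w) (mesh_faces \<T>)" for w
  have diam: "diameter F > 0" if F: "F \<in> mesh_faces \<T>" for F
  proof -
    obtain K where "K \<in> \<T>" "F facet_of K" using F unfolding mesh_faces_def by blast
    then show ?thesis using assms(1) by (intro facet_diameter_pos[OF simplicial_meshD(2)[OF m]]) auto
  qed
  have N: "sym_norm \<Omega> \<T> Kp Km w = sqrt ((S w)\<^sup>2 + (J w)\<^sup>2)" for w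
    unfolding S_def J_def j_def by (rule sym_norm_eq[OF diam])
  have j_nonneg: "0 \<le> j w F" if "F \<in> mesh_faces \<T>" for w F
    using diam[OF that] by (simp add: j_def)
  have nonneg: "0 \<le> S w" "0 \<le> J w" for w by (simp_all add: S_def J_def)
  have S_scale: "S (\<lambda>x. c *\<^sub>R v x) = \<bar>c\<bar> * S v" if v: "v \<in> broken_H1 \<Omega> \<T>" for c v
  proof -
    have "S (\<lambda>x. c *\<^sub>R v x) = L2_norm (lebesgue_on \<Omega>) (\<lambda>x. c *\<^sub>R sym_strain \<T> v x)"
      unfolding S_def
      by (rule L2_norm_cong_AE[OF L2_funD(1)[OF SL[OF broken_H1_scaleR[OF v]]] L2_funD(1)[OF L2_fun_scaleR[OF SL[OF v]]] sym_strain_scaleR[OF m \<Omega>(1,2) v]])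
    then show ?thesis by (simp add: L2_norm_scaleR S_def)
  qed
  have S_add: "S (\<lambda>x. v x + w x) \<le> S v + S w" if v: "v \<in> broken_H1 \<Omega> \<T>" and w: "w \<in> broken_H1 \<Omega> \<T>" for v w
  proof -
    have "S (\<lambda>x. v x + w x) = L2_norm (lebesgue_on \<Omega>) (\<lambda>x. sym_strain \<T> v x + sym_strain \<T> w x)"
      unfolding S_def
      by (rule L2_norm_cong_AE[OF L2_funD(1)[OF SL[OF broken_H1_add[OF m v w]]] L2_funD(1)[OF L2_fun_add[OF SL[OF v] SL[OF w]]] sym_strain_add[OF m \<Omega>(1,2) v w]])
    then show ?thesis using L2_norm_triangle[OF SL[OF v] SL[OF w]] by (simp add: S_def)
  qed
  have j_scale: "j (\<lambda>x. c *\<^sub>R v x) F = \<bar>c\<bar> * j v F" if v: "v \<in> broken_H1 \<Omega> \<T>" and F: "F \<in> mesh_faces \<T>" for c v F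
  proof -
    have "L2_norm (surface_measure F) (jump \<Omega> \<T> Kp Km (\<lambda>x. c *\<^sub>R v x) F) = L2_norm (surface_measure F) (\<lambda>x. c *\<^sub>R jump \<Omega> \<T> Kp Km v F x)"
      by (rule L2_norm_cong_AE[OF L2_funD(1)[OF JL[OF F broken_H1_scaleR[OF v]]] L2_funD(1)[OF L2_fun_scaleR[OF JL[OF F v]]] jump_scaleR[OF m \<Omega>(1,2) s F v]])
    then show ?thesis by (simp add: L2_norm_scaleR j_def)
  qed
  have j_add: "j (\<lambda>x. v x + w x) F \<le> j v F + j w F"
    if v: "v \<in> broken_H1 \<Omega> \<T>" and w: "w \<in> broken_H1 \<Omega> \<T>" and F: "F \<in> mesh_faces \<T>" for v w F
  proof -
    have "L2_norm (surface_measure F) (jump \<Omega> \<T> Kp Km (\<lambda>x. v x + w x) F) =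
      L2_norm (surface_measure F) (\<lambda>x. jump \<Omega> \<T> Kp Km v F x + jump \<Omega> \<T> Kp Km w F x)"
      by (rule L2_norm_cong_AE[OF L2_funD(1)[OF JL[OF F broken_H1_add[OF m v w]]] L2_funD(1)[OF L2_fun_add[OF JL[OF F v] JL[OF F w]]] jump_add[OF m \<Omega>(1,2) s F v w]])
    also have "\<dots> \<le> L2_norm (surface_measure F) (jump \<Omega> \<T> Kp Km v F) + L2_norm (surface_measure F) (jump \<Omega> \<T> Kp Km w F)"
      by (rule L2_norm_triangle[OF JL[OF F v] JL[OF F w]])
    finally show ?thesis
      using diam[OF F] unfolding j_def distrib_left[symmetric] by (intro mult_left_mono) auto
  qed
  have scale: "sym_norm \<Omega> \<T> Kp Km (\<lambda>x. c *\<^sub>R v x) = \<bar>c\<bar> * sym_norm \<Omega> \<T> Kp Km v" if v: "v \<in> broken_H1 \<Omega> \<T>" for c v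
  proof -
    have "J (\<lambda>x. c *\<^sub>R v x) = L2_set (\<lambda>F. \<bar>c\<bar> * j v F) (mesh_faces \<T>)"
      unfolding J_def by (rule L2_set_cong[OF refl j_scale[OF v]])
    then have "J (\<lambda>x. c *\<^sub>R v x) = \<bar>c\<bar> * J v" by (simp add: J_def L2_set_right_distrib)
    then have "(S (\<lambda>x. c *\<^sub>R v x))\<^sup>2 + (J (\<lambda>x. c *\<^sub>R v x))\<^sup>2 = \<bar>c\<bar>\<^sup>2 * ((S v)\<^sup>2 + (J v)\<^sup>2)"
      by (simp only: S_scale[OF v] power_mult_distrib distrib_left)
    then show ?thesis unfolding N by (simp add: real_sqrt_mult)
  qed
  have add: "sym_norm \<Omega> \<T> Kp Km (\<lambda>x. v x + w x) \<le> sym_norm \<Omega> \<T> Kp Km v + sym_norm \<Omega> \<T> Kp Km w"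
    if v: "v \<in> broken_H1 \<Omega> \<T>" and w: "w \<in> broken_H1 \<Omega> \<T>" for v w
  proof -
    have "J (\<lambda>x. v x + w x) \<le> L2_set (\<lambda>F. j v F + j w F) (mesh_faces \<T>)"
      unfolding J_def by (rule L2_set_mono) (use j_add[OF v w] j_nonneg in auto)
    also have "\<dots> \<le> J v + J w" unfolding J_def by (rule L2_set_triangle_ineq)
    finally have "sqrt ((S (\<lambda>x. v x + w x))\<^sup>2 + (J (\<lambda>x. v x + w x))\<^sup>2) \<le> sqrt ((S v + S w)\<^sup>2 + (J v + J w)\<^sup>2)"
      using S_add[OF v w] nonneg by (intro real_sqrt_le_mono add_mono power_mono) auto
    also have "\<dots> \<le> sqrt ((S v)\<^sup>2 + (J v)\<^sup>2) + sqrt ((S w)\<^sup>2 + (J w)\<^sup>2)"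
      by (rule real_sqrt_sum_squares_triangle_ineq)
    finally show ?thesis unfolding N .
  qed
  have definite: "AE x in lebesgue_on \<Omega>. w x = 0" if w: "w \<in> broken_H1 \<Omega> \<T>" and 0: "sym_norm \<Omega> \<T> Kp Km w = 0" for w
  proof (rule broken_H1_definite[OF m \<Omega> s w])
    have "(S w)\<^sup>2 + (J w)\<^sup>2 = 0" using 0 unfolding N by simp
    then have "S w = 0" and J0: "J w = 0" by (simp_all add: sum_power2_eq_zero_iff)
    then show "AE x in lebesgue_on \<Omega>. sym_strain \<T> w x = 0"
      using L2_norm_eq_0_iff[OF SL[OF w]] by (simp add: S_def)
    fix F assume F: "F \<in> mesh_faces \<T>"
    have "j w F = 0" using J0 L2_set_eq_0_iff[OF mesh_faces_finite[OF m]] F by (auto simp: J_def)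
    then show "AE x in surface_measure F. jump \<Omega> \<T> Kp Km w F x = 0"
      using diam[OF F] L2_norm_eq_0_iff[OF JL[OF F w]] by (simp add: j_def)
  qed
  \<comment> \<open>Homogeneity with c = 0 determines the value without inspecting which gradient
    and traces \<open>SOME\<close> selects for the zero field.\<close>
  have zero: "sym_norm \<Omega> \<T> Kp Km (\<lambda>x. 0) = 0"
    using scale[OF zero_broken_H1, of 0] by simp
  have cong: "w \<in> broken_H1 \<Omega> \<T> \<and> sym_norm \<Omega> \<T> Kp Km w = sym_norm \<Omega> \<T> Kp Km v"
    if "v \<in> broken_H1 \<Omega> \<T>" "AE x in lebesgue_on \<Omega>. v x = w x" for v w
    using broken_H1_cong_AE(1)[OF m \<Omega>(1,2) that] sym_norm_cong_AE[OF m \<Omega>(1,2) s that] by blast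
  have null: "sym_norm \<Omega> \<T> Kp Km w = 0" if "w \<in> broken_H1 \<Omega> \<T>" "AE x in lebesgue_on \<Omega>. w x = 0" for w
    using cong[OF that] zero by simp
  show ?thesis
    unfolding norm_on_ae_classes_def
  proof (intro conjI ballI allI impI)
    fix v w c
    assume v: "v \<in> broken_H1 \<Omega> \<T>"
    show "L2_fun (lebesgue_on \<Omega>) (sym_strain \<T> v)" by (rule SL[OF v])
    show "L2_fun (surface_measure F) (jump \<Omega> \<T> Kp Km v F)" if "F \<in> mesh_faces \<T>" for F
      by (rule JL[OF that v])
    show "(\<lambda>x. c *\<^sub>R v x) \<in> broken_H1 \<Omega> \<T>" by (rule broken_H1_scaleR[OF v])
    show "0 \<le> sym_norm \<Omega> \<T> Kp Km v" unfolding N by simp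
    show "sym_norm \<Omega> \<T> Kp Km v = 0 \<longleftrightarrow> (AE x in lebesgue_on \<Omega>. v x = 0)"
      using definite[OF v] null[OF v] by blast
    show "sym_norm \<Omega> \<T> Kp Km (\<lambda>x. c *\<^sub>R v x) = \<bar>c\<bar> * sym_norm \<Omega> \<T> Kp Km v" by (rule scale[OF v])
    {
      assume ae: "AE x in lebesgue_on \<Omega>. v x = w x"
      show "w \<in> broken_H1 \<Omega> \<T>" "sym_norm \<Omega> \<T> Kp Km w = sym_norm \<Omega> \<T> Kp Km v"
        using cong[OF v ae] by simp_all
    }
    assume w: "w \<in> broken_H1 \<Omega> \<T>"
    show "(\<lambda>x. v x + w x) \<in> broken_H1 \<Omega> \<T>" by (rule broken_H1_add[OF m v w])
    show "sym_norm \<Omega> \<T> Kp Km (\<lambda>x. v x + w x) \<le> sym_norm \<Omega> \<T> Kp Km v + sym_norm \<Omega> \<T> Kp Km w"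
      by (rule add[OF v w])
  qed (rule zero_broken_H1)
qed

end
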